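(* There exists an absolute constant $c_6>0$ such that the following holds. Let $K$ be a centered convex body in $\mathbb{R}^n$. If $K$ is in one of the classical positions (isotropic position, minimal surface area position, minimal mean width position, John's position, or Löwner's position), then $$|K|^{\frac{k}{n}}\,\int_{\mathrm{Gr}_{n-k}}\mathrm{as}(K\cap E)\,d\nu_{n-k}(E)\le c_6^k\,\mathrm{as}(K)$$ for every $1\le k\le n-1$.
   Context: $|\cdot|$ denotes volume in the appropriate dimension (the $0$-dimensional volume of a point is $1$), and $\mathrm{Gr}_{m}$ is the Grassmannian of $m$-dimensional linear subspaces of $\mathbb{R}^n$, with Haar probability measure $\nu_m$. A convex body in $\mathbb{R}^n$ is a compact convex set with non-empty interior; it is centered if its barycenter is at the origin. An absolute constant does not depend on $n,k,K$. $\sigma$ is the rotationally invariant probability measure on $S^{n-1}$ and $B_2^n$ is the Euclidean unit ball. The average section functional is $\mathrm{as}(K)=\int_{S^{n-1}}|K\cap\xi^\perp|\,d\sigma(\xi)$; for a linear subspace $E$, $\mathrm{as}(K\cap E)=\int_{S^{n-1}\cap E}|K\cap E\cap\xi^\perp|\,d\sigma_E(\xi)$, where $\sigma_E$ is the rotationally invariant probability measure on $S^{n-1}\cap E$. Classical positions of a centered convex body $K$: (1) isotropic position: $|K|=1$ and there is a constant $L_K>0$ with $\int_K\langle x,\xi\rangle^2dx=L_K^2$ for every $\xi\in S^{n-1}$; (2) minimal surface area position: $S(K)\le S(T(K))$ for every $T\in SL(n)$, where $S$ denotes surface area; (3) minimal mean width position: $w(K)\le w(T(K))$ for every $T\in SL(n)$,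 where $w(K)=\int_{S^{n-1}}h_K(\theta)\,d\sigma(\theta)$ and $h_K(y)=\max\{\langle x,y\rangle:x\in K\}$; (4) John's position: the ellipsoid of maximal volume inscribed in $K$ is a multiple of $B_2^n$; (5) Löwner's position: the ellipsoid of minimal volume containing $K$ is a multiple of $B_2^n$. *)

theory Defs
  imports
    "HOL-Analysis.Analysis"
    "HOL-Probability.Probability"
    "HOL-Library.Poly_Mapping"
    "Jordan_Normal_Form.Determinant"
begin

no_notation scalar_prod (infix "\<bullet>" 70)

text \<open>
  The constant in the theorem must not depend on the dimension, so the dimension has to be
  quantified inside the formula and cannot be a type. Hence all the spaces
  \<open>\<real>\<^sup>n\<close> are realised inside one real inner product space, the finitely
  supported real sequences; \<open>Rn n\<close> is the subspace of those sequences that vanish from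
  index \<open>n\<close> on.
\<close>

instantiation poly_mapping :: (type, real_vector) real_vector
begin

lift_definition scaleR_poly_mapping :: "real \<Rightarrow> ('a \<Rightarrow>\<^sub>0 'b) \<Rightarrow> ('a \<Rightarrow>\<^sub>0 'b)"
  is "\<lambda>r f i. r *\<^sub>R f i"
  by (rule finite_subset[rotated]) auto

instance
  by standard (transfer; simp add: fun_eq_iff scaleR_add_right scaleR_add_left)+

end

instantiation poly_mapping :: (type, real_inner) real_inner
begin

definition inner_poly_mapping :: "('a \<Rightarrow>\<^sub>0 'b) \<Rightarrow> ('a \<Rightarrow>\<^sub>0 'b) \<Rightarrow> real" where
  "inner_poly_mapping x y = (\<Sum>i\<in>Poly_Mapping.keys x. Poly_Mapping.lookup x i \<bullet> Poly_Mapping.lookup y i)"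

definition norm_poly_mapping :: "('a \<Rightarrow>\<^sub>0 'b) \<Rightarrow> real" where
  "norm_poly_mapping x = sqrt (x \<bullet> x)"

definition sgn_poly_mapping :: "('a \<Rightarrow>\<^sub>0 'b) \<Rightarrow> ('a \<Rightarrow>\<^sub>0 'b)" where
  "sgn_poly_mapping x = x /\<^sub>R norm x"

definition dist_poly_mapping :: "('a \<Rightarrow>\<^sub>0 'b) \<Rightarrow> ('a \<Rightarrow>\<^sub>0 'b) \<Rightarrow> real" where
  "dist_poly_mapping x y = norm (x - y)"

definition uniformity_poly_mapping :: "(('a \<Rightarrow>\<^sub>0 'b) \<times> ('a \<Rightarrow>\<^sub>0 'b)) filter" where
  "uniformity_poly_mapping = (INF e\<in>{0<..}. principal {(x, y). dist x y < e})"

definition open_poly_mapping :: "('a \<Rightarrow>\<^sub>0 'b) set \<Rightarrow> bool" where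
  "open_poly_mapping U = (\<forall>x\<in>U. \<forall>\<^sub>F (x', y) in uniformity. x' = x \<longrightarrow> y \<in> U)"

lemma inner_poly_mapping_superset:
  fixes x y :: "'a \<Rightarrow>\<^sub>0 'b"
  assumes "finite A" "Poly_Mapping.keys x \<subseteq> A"
  shows "x \<bullet> y = (\<Sum>i\<in>A. Poly_Mapping.lookup x i \<bullet> Poly_Mapping.lookup y i)"
  unfolding inner_poly_mapping_def
  by (rule sum.mono_neutral_left) (use assms in \<open>auto simp: in_keys_iff\<close>)

instance
proof
  fix r :: real and x y z :: "'a \<Rightarrow>\<^sub>0 'b"
  define A where "A = Poly_Mapping.keys x \<union> Poly_Mapping.keys y \<union> Poly_Mapping.keys z"
  have A: "finite A" "Poly_Mapping.keys x \<subseteq> A" "Poly_Mapping.keys y \<subseteq> A"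
    by (auto simp: A_def)
  have A2: "Poly_Mapping.keys (x + y) \<subseteq> A"
    using Poly_Mapping.keys_add[of x y] A by blast
  have A3: "Poly_Mapping.keys (r *\<^sub>R x) \<subseteq> A"
    using A(2) by (auto simp: in_keys_iff scaleR_poly_mapping.rep_eq)
  show "x \<bullet> y = y \<bullet> x"
    using A by (simp add: inner_poly_mapping_superset inner_commute)
  show "(x + y) \<bullet> z = x \<bullet> z + y \<bullet> z"
    using A A2 by (simp add: inner_poly_mapping_superset lookup_add inner_add_left sum.distrib)
  show "r *\<^sub>R x \<bullet> y = r * (x \<bullet> y)"
    using A A3
    by (simp add: inner_poly_mapping_superset scaleR_poly_mapping.rep_eq sum_distrib_left)
  show "0 \<le> x \<bullet> x"
    by (simp add: inner_poly_mapping_def sum_nonneg)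
  show "x \<bullet> x = 0 \<longleftrightarrow> x = 0"
    by (auto simp: inner_poly_mapping_def sum_nonneg_eq_0_iff in_keys_iff
        intro!: poly_mapping_eqI)
qed (simp_all add: norm_poly_mapping_def sgn_poly_mapping_def dist_poly_mapping_def
    uniformity_poly_mapping_def open_poly_mapping_def)

end

type_synonym pt = "nat \<Rightarrow>\<^sub>0 real"

definition Rn :: "nat \<Rightarrow> pt set" where
  "Rn n = {x. Poly_Mapping.keys x \<subseteq> {..<n}}"

definition unit_vec_at :: "nat \<Rightarrow> pt" where
  "unit_vec_at i = Poly_Mapping.single i 1"

definition hyperplane_perp :: "pt \<Rightarrow> pt set" where
  "hyperplane_perp \<xi> = {x. x \<bullet> \<xi> = 0}"

text \<open>
  Lebesgue measure of a finite-dimensional subspace \<open>E\<close>, in the dimension of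
  \<open>E\<close>, obtained by identifying \<open>E\<close> with a coordinate space by an
  orthonormal basis. By rotation invariance of Lebesgue measure the basis does not matter.
  For \<open>E = {0}\<close> the product over the empty basis is a unit point mass, so a point
  has \<open>0\<close>-dimensional volume \<open>1\<close>.
\<close>

definition onb :: "pt set \<Rightarrow> pt set" where
  "onb E = (SOME B. pairwise Linear_Algebra.orthogonal B \<and> (\<forall>b\<in>B. norm b = 1) \<and> span B = E)"

definition leb :: "pt set \<Rightarrow> pt measure" where
  "leb E = distr (\<Pi>\<^sub>M b\<in>onb E. (lborel :: real measure)) borel (\<lambda>c. \<Sum>b\<in>onb E. c b *\<^sub>R b)"

definition vol :: "pt set \<Rightarrow> pt set \<Rightarrow> real" where
  "vol E A = measure (leb E) A"

text \<open>
  The choice operator below, and the one in \<open>haar_Gr\<close>, selects from a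
  one-element set: the invariant probability measure exists and is unique
  (for \<open>dim E \<ge> 1\<close>, respectively \<open>m \<le> n\<close>).
\<close>

definition rotation_invariant_prob_sphere :: "pt set \<Rightarrow> pt measure \<Rightarrow> bool" where
  "rotation_invariant_prob_sphere E M \<longleftrightarrow>
     prob_space M \<and>
     sets M = sets (restrict_space borel (sphere 0 1 \<inter> E)) \<and>
     (\<forall>U. orthogonal_transformation U \<and> U ` E = E \<longrightarrow> distr M M U = M)"

definition sphere_prob :: "pt set \<Rightarrow> pt measure" where
  "sphere_prob E = (SOME M. rotation_invariant_prob_sphere E M)"

definition Gr :: "nat \<Rightarrow> nat \<Rightarrow> pt set set" where
  "Gr n m = {E. subspace E \<and> E \<subseteq> Rn n \<and> dim E = m}"

text \<open>
  On \<open>Gr n m\<close> this is the usual metric: it equals the operator norm of the difference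
  of the two orthogonal projections.
\<close>

definition gap :: "nat \<Rightarrow> pt set \<Rightarrow> pt set \<Rightarrow> real" where
  "gap n E F = (SUP x\<in>cball 0 1 \<inter> Rn n. \<bar>infdist x E - infdist x F\<bar>)"

definition borel_Gr :: "nat \<Rightarrow> nat \<Rightarrow> pt set measure" where
  "borel_Gr n m = sigma (Gr n m)
     {U. U \<subseteq> Gr n m \<and> (\<forall>E\<in>U. \<exists>r>0. \<forall>F\<in>Gr n m. gap n E F < r \<longrightarrow> F \<in> U)}"

definition rotation_invariant_prob_Gr :: "nat \<Rightarrow> nat \<Rightarrow> pt set measure \<Rightarrow> bool" where
  "rotation_invariant_prob_Gr n m M \<longleftrightarrow>
     prob_space M \<and>
     sets M = sets (borel_Gr n m) \<and>
     (\<forall>U. orthogonal_transformation U \<and> U ` Rn n = Rn n \<longrightarrow> distr M M (\<lambda>E. U ` E) = M)"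

definition haar_Gr :: "nat \<Rightarrow> nat \<Rightarrow> pt set measure" where
  "haar_Gr n m = (SOME M. rotation_invariant_prob_Gr n m M)"

text \<open>
  \<open>avg_section E K\<close> is the average section functional of \<open>K \<inter> E\<close>
  taken inside \<open>E\<close>; for \<open>K \<subseteq> Rn n\<close> the functional of
  \<open>K\<close> itself is \<open>avg_section (Rn n) K\<close>.
\<close>

definition avg_section :: "pt set \<Rightarrow> pt set \<Rightarrow> real" where
  "avg_section E K =
     (\<integral>\<xi>. vol (E \<inter> hyperplane_perp \<xi>) (K \<inter> E \<inter> hyperplane_perp \<xi>) \<partial>sphere_prob E)"

definition convex_body :: "nat \<Rightarrow> pt set \<Rightarrow> bool" where
  "convex_body n K \<longleftrightarrow>
     K \<subseteq> Rn n \<and> convex K \<and> compact K \<and> top_of_set (Rn n) interior_of K \<noteq> {}"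

definition barycenter :: "nat \<Rightarrow> pt set \<Rightarrow> pt" where
  "barycenter n K =
     (\<Sum>i<n. ((LINT x:K|leb (Rn n). Poly_Mapping.lookup x i) / vol (Rn n) K) *\<^sub>R unit_vec_at i)"

definition centered :: "nat \<Rightarrow> pt set \<Rightarrow> bool" where
  "centered n K \<longleftrightarrow> barycenter n K = 0"

text \<open>
  Only the values of \<open>T\<close> on \<open>Rn n\<close> matter; every linear map of
  \<open>Rn n\<close> extends to the ambient space.
\<close>

definition det_Rn :: "nat \<Rightarrow> (pt \<Rightarrow> pt) \<Rightarrow> real" where
  "det_Rn n T = Determinant.det (Matrix.mat n n (\<lambda>(i, j). Poly_Mapping.lookup (T (unit_vec_at j)) i))"

definition SL :: "nat \<Rightarrow> (pt \<Rightarrow> pt) set" where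
  "SL n = {T. linear T \<and> T ` Rn n \<subseteq> Rn n \<and> det_Rn n T = 1}"

definition ball_n :: "nat \<Rightarrow> real \<Rightarrow> pt set" where
  "ball_n n r = cball 0 r \<inter> Rn n"

text \<open>Surface area as Minkowski's derivative of the volume of outer parallel bodies.\<close>

definition surface_area :: "nat \<Rightarrow> pt set \<Rightarrow> real" where
  "surface_area n K =
     Lim (at_right 0) (\<lambda>\<epsilon>. (vol (Rn n) {x + y | x y. x \<in> K \<and> y \<in> ball_n n \<epsilon>} - vol (Rn n) K) / \<epsilon>)"

definition support_fun :: "pt set \<Rightarrow> pt \<Rightarrow> real" where
  "support_fun K y = (SUP x\<in>K. x \<bullet> y)"

definition mean_width :: "nat \<Rightarrow> pt set \<Rightarrow> real" where
  "mean_width n K = (\<integral>\<theta>. support_fun K \<theta> \<partial>sphere_prob (Rn n))"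

definition ellipsoid :: "nat \<Rightarrow> pt set \<Rightarrow> bool" where
  "ellipsoid n A \<longleftrightarrow>
     (\<exists>a T. a \<in> Rn n \<and> linear T \<and> T ` Rn n = Rn n \<and> A = (\<lambda>x. a + T x) ` ball_n n 1)"

definition max_vol_inscribed_ellipsoid :: "nat \<Rightarrow> pt set \<Rightarrow> pt set \<Rightarrow> bool" where
  "max_vol_inscribed_ellipsoid n K A \<longleftrightarrow>
     ellipsoid n A \<and> A \<subseteq> K \<and>
     (\<forall>A'. ellipsoid n A' \<and> A' \<subseteq> K \<longrightarrow> vol (Rn n) A' \<le> vol (Rn n) A)"

definition min_vol_containing_ellipsoid :: "nat \<Rightarrow> pt set \<Rightarrow> pt set \<Rightarrow> bool" where
  "min_vol_containing_ellipsoid n K A \<longleftrightarrow>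
     ellipsoid n A \<and> K \<subseteq> A \<and>
     (\<forall>A'. ellipsoid n A' \<and> K \<subseteq> A' \<longrightarrow> vol (Rn n) A \<le> vol (Rn n) A')"

definition isotropic_position :: "nat \<Rightarrow> pt set \<Rightarrow> bool" where
  "isotropic_position n K \<longleftrightarrow>
     vol (Rn n) K = 1 \<and>
     (\<exists>L>0. \<forall>\<xi>\<in>sphere 0 1 \<inter> Rn n. (LINT x:K|leb (Rn n). (x \<bullet> \<xi>)\<^sup>2) = L\<^sup>2)"

definition min_surface_area_position :: "nat \<Rightarrow> pt set \<Rightarrow> bool" where
  "min_surface_area_position n K \<longleftrightarrow> (\<forall>T\<in>SL n. surface_area n K \<le> surface_area n (T ` K))"

definition min_mean_width_position :: "nat \<Rightarrow> pt set \<Rightarrow> bool" where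
  "min_mean_width_position n K \<longleftrightarrow> (\<forall>T\<in>SL n. mean_width n K \<le> mean_width n (T ` K))"

definition John_position :: "nat \<Rightarrow> pt set \<Rightarrow> bool" where
  "John_position n K \<longleftrightarrow> (\<exists>r>0. max_vol_inscribed_ellipsoid n K (ball_n n r))"

definition Loewner_position :: "nat \<Rightarrow> pt set \<Rightarrow> bool" where
  "Loewner_position n K \<longleftrightarrow> (\<exists>r>0. min_vol_containing_ellipsoid n K (ball_n n r))"

definition classical_position :: "nat \<Rightarrow> pt set \<Rightarrow> bool" where
  "classical_position n K \<longleftrightarrow>
     isotropic_position n K \<or> min_surface_area_position n K \<or> min_mean_width_position n K \<or>
     John_position n K \<or> Loewner_position n K"

end

theory Submission
  imports Defs
begin

text \<open>In polar coordinates a section of a body with radial function \<open>\<rho>\<close> by a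
  \<open>j\<close>-dimensional subspace has the volume of the unit ball times the mean of
  \<open>\<rho> ^ j\<close> over the unit sphere of the subspace. A random unit vector in a
  random hyperplane of a random subspace is uniformly distributed on the large sphere, because
  there is only one rotation invariant probability measure. So both sides of the inequality are, up to volumes of unit balls, moments
  of \<open>\<rho>\<close> over the same sphere.

  The loss \<open>c ^ k\<close> with \<open>k \<ge> 1\<close> leaves room for crude estimates: it suffices that
  \<open>r \<le> \<rho> \<le> 32 ^ n * r\<close> for some \<open>r\<close>. Then the moment of order
  \<open>n - 1\<close> is at least \<open>l ^ (n - 1)\<close>, where \<open>1024 * l\<close> is the
  \<open>L\<^sup>n\<close>-norm of \<open>\<rho>\<close>, and integrating
  \<open>l ^ k * \<rho> ^ (n - 1 - k) \<le> l ^ (n - 1) + \<rho> ^ (n - 1)\<close> gives the claim.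
  In isotropic position this bound on \<open>\<rho>\<close> follows by estimating second moments. In
  the extremal positions, if \<open>K\<close> were much longer in some direction than its width in a
  direction \<open>\<xi>\<close>, then rescaling \<open>K\<close> or the extremal ellipsoid along one direction
  and its complement would give a better competitor.\<close>

section \<open>Linear algebra of finite-dimensional subspaces\<close>

text \<open>The obstacle is the direction of Hoelder's inequality: |K|^(k/n) is a power of the
  L^n-norm of \<rho>, which dominates the L^(n-1)-norm behind as(K), so a reverse inequality is
  needed. A ratio 32^n between the extreme values of \<rho> is affordable because \<rho>^n \<le> max
  \<rho> * \<rho>^(n-1) costs this ratio only once, and the estimate loses just its (n-1)-th root.
  Losses exponential in n being harmless, each extremal position needs a single competitor, and the
  asymmetry of K may be bounded as crudely as 2^(n+1).

  The unit balls contribute another c^k: omega_n^(k/n) * omega_(n-1-k) \<le> 2^k * omega_(n-1), by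
  log-convexity of Gamma.

  All subspaces live in one infinite-dimensional inner product space, which is neither complete nor
  locally compact. Measures on subspaces and spheres are therefore identified through uniqueness
  under translations or rotations. The measures selected by choice in the definitions must also be
  shown to exist: on the Grassmannian, as the law of the span of independent uniform vectors
  conditioned on full rank.\<close>

lemma generate_topology_if_dense:
  fixes S :: "'a::metric_space set"
  assumes "countable S" and dense: "\<And>x e. e > 0 \<Longrightarrow> \<exists>s\<in>S. dist s x < e"
  shows "\<exists>B::'a set set. countable B \<and> open = generate_topology B"
proof -
  define B where "B = (\<lambda>(s, k::nat). ball s (1 / Suc k)) ` (S \<times> UNIV)"
  have "topological_basis B"
  proof (rule topological_basisI)
    show "open U" if "U \<in> B" for U
      using that by (auto simp: B_def)
    fix U x assume U: "open U" "x \<in> (U::'a set)"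
    obtain e where e: "e > 0" "ball x e \<subseteq> U"
      by (rule openE[OF U])
    obtain k where k: "1 / Suc k < e / 2"
      using nat_approx_posE[of "e/2"] e(1) by auto
    obtain s where s: "s \<in> S" "dist s x < 1 / Suc k"
      using dense[of "1 / Suc k"] by auto
    have "ball s (1 / Suc k) \<subseteq> U"
    proof
      fix y assume "y \<in> ball s (1 / Suc k)"
      then have "dist x y < e"
        using s(2) k dist_triangle[of x y s] by (auto simp: dist_commute)
      then show "y \<in> U" using e by auto
    qed
    then show "\<exists>V\<in>B. x \<in> V \<and> V \<subseteq> U"
      using s by (intro bexI[of _ "ball s (1 / Suc k)"]) (auto simp: B_def)
  qed
  moreover have "countable B"
    unfolding B_def using assms(1) by auto
  ultimately show ?thesis
    using topological_basis_imp_subbasis by blast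
qed

section \<open>Second countability of the space of finitely supported sequences\<close>

lemma inner_single_left: "Poly_Mapping.single i a \<bullet> (y :: 'a \<Rightarrow>\<^sub>0 'b::real_inner) = a \<bullet> Poly_Mapping.lookup y i"
  by (subst inner_poly_mapping_superset[of "{i}"]) auto

lemma norm_single: "norm (Poly_Mapping.single i (a::'b::real_inner)) = norm a"
  by (simp add: norm_eq_sqrt_inner inner_single_left)

lemma sum_single_lookup:
  assumes "finite A" "Poly_Mapping.keys x \<subseteq> A"
  shows "(\<Sum>i\<in>A. Poly_Mapping.single i (Poly_Mapping.lookup x i)) = x"
proof (rule poly_mapping_eqI)
  fix k
  have "Poly_Mapping.lookup (\<Sum>i\<in>A. Poly_Mapping.single i (Poly_Mapping.lookup x i)) k
      = (\<Sum>i\<in>A. if i = k then Poly_Mapping.lookup x i else 0)"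
    by (simp add: lookup_sum lookup_single when_def)
  also have "\<dots> = Poly_Mapping.lookup x k"
    using assms by (auto simp: sum.delta in_keys_iff)
  finally show "Poly_Mapping.lookup (\<Sum>i\<in>A. Poly_Mapping.single i (Poly_Mapping.lookup x i)) k
      = Poly_Mapping.lookup x k" .
qed

text \<open>Second countability makes the Borel sets of a product the product sigma-algebra, on
  which measurability of sums and the Fubini arguments rest; it also gives Lindelof covers. The
  dense set consists of finite sums of single entries from a countable dense set of coefficients;
  indexing these sums by lists makes countability immediate.\<close>

instance poly_mapping :: (countable, "{real_inner,second_countable_topology}") second_countable_topology
proof
  obtain D :: "'b set" where D: "countable D" "\<And>X. open X \<Longrightarrow> X \<noteq> {} \<Longrightarrow> \<exists>d\<in>D. d \<in> X"
    using countable_dense_exists by blast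
  define F :: "('a \<times> 'b) list \<Rightarrow> ('a \<Rightarrow>\<^sub>0 'b)"
    where "F xs = sum_list (map (\<lambda>(i, d). Poly_Mapping.single i d) xs)" for xs
  define S where "S = F ` lists (UNIV \<times> D)"
  have "countable S"
    unfolding S_def using D(1) by auto
  moreover have "\<exists>s\<in>S. dist s x < e" if "e > 0" for x e
  proof -
    define n where "n = card (Poly_Mapping.keys x)"
    have "\<exists>d\<in>D. dist d (Poly_Mapping.lookup x i) < e / Suc n" for i
      using D(2)[of "ball (Poly_Mapping.lookup x i) (e / real (Suc n))"] that
      by (simp add: dist_commute not_le)
    then obtain d where d: "\<And>i. d i \<in> D" "\<And>i. dist (d i) (Poly_Mapping.lookup x i) < e / Suc n"
      by metis
    obtain ks where ks: "set ks = Poly_Mapping.keys x" "distinct ks"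
      using finite_distinct_list[of "Poly_Mapping.keys x"] by auto
    define s where "s = F (map (\<lambda>i. (i, d i)) ks)"
    have s: "s = (\<Sum>i\<in>Poly_Mapping.keys x. Poly_Mapping.single i (d i))"
      using ks by (simp add: s_def F_def comp_def sum_list_distinct_conv_sum_set)
    have "s - x = (\<Sum>i\<in>Poly_Mapping.keys x. Poly_Mapping.single i (d i - Poly_Mapping.lookup x i))"
      using sum_single_lookup[of "Poly_Mapping.keys x" x]
      by (simp add: s single_diff sum_subtractf)
    then have "dist s x \<le> (\<Sum>i\<in>Poly_Mapping.keys x. norm (d i - Poly_Mapping.lookup x i))"
      unfolding dist_norm by (metis (no_types, lifting) norm_single norm_sum sum.cong)
    also have "\<dots> \<le> (\<Sum>i\<in>Poly_Mapping.keys x. e / Suc n)"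
      using d(2) by (intro sum_mono) (auto simp: dist_norm less_imp_le)
    also have "\<dots> < e"
      using that by (simp add: n_def field_simps)
    finally have "dist s x < e" .
    moreover have "s \<in> S"
      using d(1) by (auto simp: S_def s_def intro!: imageI)
    ultimately show ?thesis by blast
  qed
  ultimately show "\<exists>B::('a \<Rightarrow>\<^sub>0 'b) set set. countable B \<and> open = generate_topology B"
    by (rule generate_topology_if_dense)
qed

section \<open>Finite orthonormal bases and finite-dimensional subspaces\<close>

definition onbasis :: "'a::real_inner set \<Rightarrow> 'a set \<Rightarrow> bool" where
  "onbasis B E \<longleftrightarrow> finite B \<and> (\<forall>b\<in>B. \<forall>c\<in>B. b \<bullet> c = of_bool (b = c)) \<and> span B = E"

lemma onbasis_finite: "onbasis B E \<Longrightarrow> finite B"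
  and onbasis_span: "onbasis B E \<Longrightarrow> span B = E"
  and onbasis_inner: "onbasis B E \<Longrightarrow> b \<in> B \<Longrightarrow> c \<in> B \<Longrightarrow> b \<bullet> c = of_bool (b = c)"
  by (auto simp: onbasis_def)

lemma onbasis_subset: "onbasis B E \<Longrightarrow> B \<subseteq> E"
  using onbasis_span span_superset by blast

lemma onbasis_subspace: "onbasis B E \<Longrightarrow> subspace E"
  using onbasis_span subspace_span by blast

lemma onbasis_norm: "onbasis B E \<Longrightarrow> b \<in> B \<Longrightarrow> norm b = 1"
  by (simp add: norm_eq_sqrt_inner onbasis_inner)

lemma onbasis_inner_sum:
  assumes "onbasis B E" "b \<in> B"
  shows "(\<Sum>c\<in>B. f c *\<^sub>R c) \<bullet> b = f b"
proof -
  have "(\<Sum>c\<in>B. f c *\<^sub>R c) \<bullet> b = (\<Sum>c\<in>B. if c = b then f c else 0)"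
    unfolding inner_sum_left
    by (intro sum.cong) (use assms in \<open>auto simp: onbasis_inner\<close>)
  then show ?thesis
    using assms by (simp add: onbasis_finite)
qed

lemma onbasis_sum_in: "onbasis B E \<Longrightarrow> (\<Sum>c\<in>B. f c *\<^sub>R c) \<in> E"
proof -
  assume "onbasis B E"
  moreover have "(\<Sum>c\<in>B. f c *\<^sub>R c) \<in> span B"
    by (intro span_sum span_scale span_base)
  ultimately show ?thesis using onbasis_span by blast
qed

lemma onbasis_repr:
  assumes "onbasis B E" "x \<in> E"
  shows "(\<Sum>b\<in>B. (x \<bullet> b) *\<^sub>R b) = x"
proof -
  obtain u where u: "x = (\<Sum>v\<in>B. u v *\<^sub>R v)"
    using assms span_finite[OF onbasis_finite[OF assms(1)]] onbasis_span by blast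
  show ?thesis
    by (subst (2) u, rule sum.cong) (auto simp: u onbasis_inner_sum[OF assms(1)])
qed

lemma onbasis_inner_eq_sum:
  assumes "onbasis B E" "x \<in> E"
  shows "x \<bullet> y = (\<Sum>b\<in>B. (x \<bullet> b) * (y \<bullet> b))"
proof -
  have "x \<bullet> y = (\<Sum>b\<in>B. (x \<bullet> b) *\<^sub>R b) \<bullet> y"
    using onbasis_repr[OF assms] by simp
  also have "\<dots> = (\<Sum>b\<in>B. (x \<bullet> b) * (y \<bullet> b))"
    by (simp add: inner_sum_left inner_commute[of y])
  finally show ?thesis .
qed

lemma onbasis_norm_eq_sum:
  assumes "onbasis B E"
  shows "norm (\<Sum>b\<in>B. f b *\<^sub>R b) = sqrt (\<Sum>b\<in>B. (f b)\<^sup>2)"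
  unfolding norm_eq_sqrt_inner
  by (subst onbasis_inner_eq_sum[OF assms onbasis_sum_in[OF assms]])
     (simp add: onbasis_inner_sum[OF assms] power2_eq_square)

lemma onbasis_independent:
  assumes "onbasis B E"
  shows "independent B"
proof -
  have "pairwise Linear_Algebra.orthogonal B" "0 \<notin> B"
    using assms onbasis_norm[OF assms, of 0]
    by (auto simp: pairwise_def Linear_Algebra.orthogonal_def onbasis_inner)
  then show ?thesis
    by (rule pairwise_orthogonal_independent)
qed

lemma onbasis_card: "onbasis B E \<Longrightarrow> card B = dim E"
  using onbasis_independent onbasis_span dim_span_eq_card_independent by metis

lemma onbasis_empty: "onbasis {} {0}"
  by (simp add: onbasis_def)

text \<open>Gram-Schmidt, one vector of \<open>S\<close> at a time: the vector minus its projection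
  to the span so far either vanishes, and nothing is added, or can be normalised.\<close>

lemma onbasis_extend:
  assumes "finite S" "onbasis C (span C)"
  shows "\<exists>B. C \<subseteq> B \<and> onbasis B (span (C \<union> S))"
  using assms(1)
proof (induction S)
  case empty
  then show ?case using assms(2) by auto
next
  case (insert x S)
  then obtain B where B: "C \<subseteq> B" "onbasis B (span (C \<union> S))" by auto
  define y where "y = x - (\<Sum>b\<in>B. (x \<bullet> b) *\<^sub>R b)"
  have sp: "span B = span (C \<union> S)"
    using B(2) by (rule onbasis_span)
  have xy: "(\<Sum>b\<in>B. (x \<bullet> b) *\<^sub>R b) \<in> span B"
    by (intro span_sum span_scale span_base)
  have span_insert_x: "span (insert x (C \<union> S)) = span (insert x B)"
    using sp by (simp add: span_insert)
  show ?case
  proof (cases "y = 0")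
    case True
    then have "x \<in> span B"
      using xy by (simp add: y_def)
    then have "span (C \<union> insert x S) = span B"
      using span_insert_x by (simp add: span_redundant)
    then show ?thesis
      using B sp by auto
  next
    case False
    define z where "z = y /\<^sub>R norm y"
    have z: "norm z = 1"
      using False by (simp add: z_def)
    have yb: "y \<bullet> b = 0" if "b \<in> B" for b
      using that by (simp add: y_def inner_diff_left onbasis_inner_sum[OF B(2)])
    then have zb: "z \<bullet> b = 0" "b \<bullet> z = 0" if "b \<in> B" for b
      using that by (auto simp: z_def inner_commute)
    have zz: "z \<bullet> z = 1"
      using z by (simp add: norm_eq_1)
    have "z \<notin> B"
      using zb zz by force
    have "span (insert z B) = span (insert x B)"
    proof -
      have x: "x = norm y *\<^sub>R z + (\<Sum>b\<in>B. (x \<bullet> b) *\<^sub>R b)"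
        using False by (simp add: z_def y_def)
      have "x \<in> span (insert z B)"
        by (subst x, intro span_add span_scale span_sum) (auto intro: span_base)
      moreover have "z \<in> span (insert x B)"
        unfolding z_def y_def by (intro span_scale span_diff span_sum) (auto intro: span_base)
      ultimately show ?thesis
        using span_redundant[of x "insert z B"] span_redundant[of z "insert x B"]
        by (simp add: insert_commute)
    qed
    then have "onbasis (insert z B) (span (C \<union> insert x S))"
      using span_insert_x B(2) zb zz \<open>z \<notin> B\<close>
      by (auto simp: onbasis_def)
    then show ?thesis
      using B(1) by (intro exI[of _ "insert z B"]) auto
  qed
qed

text \<open>\<open>dim\<close> alone cannot express finite dimension, since it is 0 both for
  \<open>{0}\<close> and for an infinite-dimensional space.\<close>

definition fdsub :: "'a::real_inner set \<Rightarrow> bool" where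
  "fdsub E \<longleftrightarrow> (\<exists>B. onbasis B E)"

lemma fdsub_subspace: "fdsub E \<Longrightarrow> subspace E"
  by (auto simp: fdsub_def onbasis_subspace)

lemma fdsub_span: "finite S \<Longrightarrow> fdsub (span S)"
  using onbasis_extend[of S "{}"] by (auto simp: fdsub_def onbasis_def)

lemma fdsub_subset:
  assumes "fdsub F" "subspace E" "E \<subseteq> F"
  shows "fdsub E"
proof -
  obtain B where B: "finite B" "span B = F"
    using assms(1) unfolding fdsub_def onbasis_def by metis
  obtain C where C: "C \<subseteq> E" "independent C" "E \<subseteq> span C"
    by (rule basis_exists[of E])
  have "finite C"
    using independent_span_bound[OF B(1) C(2)] subset_trans[OF C(1) assms(3)] B(2) by simp
  moreover have "span C = E"
    using C(3) span_minimal[OF C(1) assms(2)] by blast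
  ultimately show ?thesis
    using fdsub_span[of C] by simp
qed

text \<open>The choice in \<open>onb\<close> does not ask for finiteness; this follows by the
  exchange lemma, an independent set being no larger than a finite spanning set.\<close>

lemma onb_onbasis:
  assumes "fdsub E"
  shows "onbasis (onb E) E"
proof -
  let ?P = "\<lambda>B. pairwise Linear_Algebra.orthogonal B \<and> (\<forall>b\<in>B. norm b = 1) \<and> span B = E"
  obtain C where C: "onbasis C E"
    using assms by (auto simp: fdsub_def)
  then have "?P C"
    by (auto simp: pairwise_def Linear_Algebra.orthogonal_def onbasis_inner onbasis_norm onbasis_span)
  then have P: "?P (onb E)"
    unfolding onb_def by (rule someI)
  then have "independent (onb E)"
    by (intro pairwise_orthogonal_independent) auto
  then have "finite (onb E)"
    using independent_span_bound[of C "onb E"] C P span_superset[of "onb E"]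
    by (auto simp: onbasis_finite onbasis_span)
  moreover have "b \<bullet> c = of_bool (b = c)" if "b \<in> onb E" "c \<in> onb E" for b c
    using P that by (cases "b = c") (simp_all add: pairwise_def Linear_Algebra.orthogonal_def norm_eq_1)
  ultimately show ?thesis
    using P by (simp add: onbasis_def)
qed

lemma fdsub_dim_0_iff: "fdsub E \<Longrightarrow> dim E = 0 \<longleftrightarrow> E = {0}"
proof -
  assume "fdsub E"
  then obtain B where B: "onbasis B E" by (auto simp: fdsub_def)
  have "E = {0}" if "dim E = 0"
    using that onbasis_card[OF B] onbasis_finite[OF B] onbasis_span[OF B] by simp
  then show ?thesis
    using onbasis_card[OF onbasis_empty] by auto
qed

lemma fdsub_ex_unit:
  assumes "fdsub E" "dim E > 0"
  obtains x where "x \<in> E" "norm x = 1"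
proof -
  obtain B where B: "onbasis B E" using assms by (auto simp: fdsub_def)
  then have "B \<noteq> {}"
    using assms(2) onbasis_card[OF B] by auto
  then show thesis
    using onbasis_norm[OF B] onbasis_subset[OF B] that by blast
qed

lemma subspace_hyperplane_perp: "subspace (hyperplane_perp \<xi>)"
  by (simp add: hyperplane_perp_def subspace_def inner_add_left)

text \<open>Provides bases of \<open>E\<close> that contain a prescribed unit vector, so that
  integrals over \<open>E\<close> split into a line and its complement
  (\<open>leb_split\<close>).\<close>

lemma onbasis_insert_perp:
  assumes "onbasis B (E \<inter> hyperplane_perp \<xi>)" "\<xi> \<in> E" "norm \<xi> = 1" "subspace E"
  shows "onbasis (insert \<xi> B) E" "\<xi> \<notin> B"
proof -
  have sub: "B \<subseteq> E \<inter> hyperplane_perp \<xi>"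
    using assms(1) by (rule onbasis_subset)
  then have b: "b \<bullet> \<xi> = 0" "\<xi> \<bullet> b = 0" if "b \<in> B" for b
    using that by (auto simp: hyperplane_perp_def inner_commute)
  have \<xi>: "\<xi> \<bullet> \<xi> = 1"
    using assms(3) by (simp add: norm_eq_1)
  then show n: "\<xi> \<notin> B"
    using b(1) by force
  have "span (insert \<xi> B) = E"
  proof
    show "span (insert \<xi> B) \<subseteq> E"
      using sub assms by (intro span_minimal) auto
    show "E \<subseteq> span (insert \<xi> B)"
    proof
      fix x assume "x \<in> E"
      then have "x - (x \<bullet> \<xi>) *\<^sub>R \<xi> \<in> span B"
        using assms \<xi> unfolding onbasis_span[OF assms(1)]
        by (auto simp: hyperplane_perp_def inner_diff_left subspace_diff subspace_scale)
      then show "x \<in> span (insert \<xi> B)"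
        unfolding span_insert by blast
    qed
  qed
  then show "onbasis (insert \<xi> B) E"
    using assms(1) n b \<xi> by (auto simp: onbasis_def)
qed

lemma fdsub_perp: "fdsub E \<Longrightarrow> fdsub (E \<inter> hyperplane_perp \<xi>)"
  by (rule fdsub_subset) (auto intro: subspace_inter subspace_hyperplane_perp fdsub_subspace)

lemma dim_perp:
  assumes "fdsub E" "\<xi> \<in> E" "norm \<xi> = 1"
  shows "dim E = Suc (dim (E \<inter> hyperplane_perp \<xi>))"
proof -
  obtain B where B: "onbasis B (E \<inter> hyperplane_perp \<xi>)"
    using fdsub_perp[OF assms(1)] by (auto simp: fdsub_def)
  have "onbasis (insert \<xi> B) E" "\<xi> \<notin> B"
    using onbasis_insert_perp[OF B assms(2,3) fdsub_subspace[OF assms(1)]] by auto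
  then show ?thesis
    using B by (metis card_insert_disjoint onbasis_card onbasis_finite)
qed

section \<open>Orthogonal projections, closedness and compactness\<close>

definition proj :: "pt set \<Rightarrow> pt \<Rightarrow> pt" where
  "proj E x = (\<Sum>b\<in>onb E. (x \<bullet> b) *\<^sub>R b)"

lemma linear_proj: "linear (proj E)"
  by (rule linearI)
     (auto simp: proj_def inner_add_left scaleR_add_left sum.distrib scaleR_sum_right)

lemma continuous_on_proj [continuous_intros]: "continuous_on S f \<Longrightarrow> continuous_on S (\<lambda>x. proj E (f x))"
  unfolding proj_def by (intro continuous_intros)

lemma proj_in: "fdsub E \<Longrightarrow> proj E x \<in> E"
  unfolding proj_def by (rule onbasis_sum_in) (rule onb_onbasis)

lemma proj_id: "fdsub E \<Longrightarrow> x \<in> E \<Longrightarrow> proj E x = x"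
  unfolding proj_def by (rule onbasis_repr) (rule onb_onbasis)

lemma proj_inner:
  assumes "fdsub E" "y \<in> E"
  shows "proj E x \<bullet> y = x \<bullet> y"
proof -
  have "proj E x \<bullet> y = (\<Sum>b\<in>onb E. (y \<bullet> b) * (x \<bullet> b))"
    unfolding proj_def inner_sum_left by (rule sum.cong) (simp_all add: inner_commute)
  then show ?thesis
    using onbasis_inner_eq_sum[OF onb_onbasis[OF assms(1)] assms(2), of x] by (simp add: inner_commute)
qed

lemma proj_unique:
  assumes "fdsub E" "z \<in> E" "\<And>y. y \<in> E \<Longrightarrow> z \<bullet> y = x \<bullet> y"
  shows "proj E x = z"
proof -
  have "proj E x - z \<in> E"
    using assms proj_in subspace_diff fdsub_subspace by blast
  then have "(proj E x - z) \<bullet> (proj E x - z) = 0"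
    using assms proj_inner[of E "proj E x - z" x] by (simp add: inner_diff_left)
  then show ?thesis by simp
qed

lemma proj_perp:
  assumes "fdsub E" "\<xi> \<in> E" "norm \<xi> = 1" "x \<in> E"
  shows "proj (E \<inter> hyperplane_perp \<xi>) x = x - (x \<bullet> \<xi>) *\<^sub>R \<xi>"
proof (rule proj_unique)
  show "fdsub (E \<inter> hyperplane_perp \<xi>)" by (rule fdsub_perp) fact
  show "x - (x \<bullet> \<xi>) *\<^sub>R \<xi> \<in> E \<inter> hyperplane_perp \<xi>"
    using assms fdsub_subspace[OF assms(1)]
    by (auto simp: hyperplane_perp_def inner_diff_left subspace_diff subspace_scale norm_eq_1)
qed (auto simp: hyperplane_perp_def inner_diff_left inner_commute[of \<xi>])

lemma norm_proj_le:
  assumes "fdsub E"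
  shows "norm (proj E x) \<le> norm x"
proof -
  have "norm (proj E x) ^ 2 = x \<bullet> proj E x"
    using proj_inner[OF assms proj_in[OF assms], of x x] by (simp add: power2_norm_eq_inner)
  also have "\<dots> \<le> norm x * norm (proj E x)"
    by (rule norm_cauchy_schwarz)
  finally show ?thesis
    by (cases "norm (proj E x) = 0") (auto simp: power2_eq_square)
qed

text \<open>\<open>E\<close> is the fixed-point set of its projection, which is continuous because
  it is a finite sum of inner products.\<close>

lemma fdsub_closed: "fdsub E \<Longrightarrow> closed (E :: pt set)"
proof -
  assume E: "fdsub E"
  have "E = {x. proj E x = x}"
    using proj_id[OF E] proj_in[OF E] by (auto, metis)
  moreover have "closed {x. proj E x = x}"
    by (intro closed_Collect_eq continuous_intros)
  ultimately show "closed E" by simp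
qed

text \<open>Closed bounded sets of the ambient space need not be compact. A ball of a
  finite-dimensional subspace is compact because it is a closed subset of such a Minkowski sum of
  segments, and sums of two compact sets are compact.\<close>

lemma compact_sum_segments:
  fixes B :: "'a::real_normed_vector set"
  assumes "finite B"
  shows "compact {\<Sum>b\<in>B. c b *\<^sub>R b |c. \<forall>b\<in>B. \<bar>c b\<bar> \<le> r}"
  using assms
proof (induction B)
  case empty
  have "{\<Sum>b\<in>{}. c b *\<^sub>R b |c. \<forall>b\<in>{}::'a set. \<bar>c b\<bar> \<le> r} = {0}" by auto
  then show ?case by simp
next
  case (insert x B)
  have "{\<Sum>b\<in>insert x B. c b *\<^sub>R b |c. \<forall>b\<in>insert x B. \<bar>c b\<bar> \<le> r}
      = {y + z |y z. y \<in> (\<lambda>t. t *\<^sub>R x) ` {-r..r} \<and> z \<in> {\<Sum>b\<in>B. c b *\<^sub>R b |c. \<forall>b\<in>B. \<bar>c b\<bar> \<le> r}}"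
    (is "?L = ?R")
  proof
    show "?L \<subseteq> ?R"
    proof clarify
      fix c assume c: "\<forall>b\<in>insert x B. \<bar>c b\<bar> \<le> r"
      then show "\<exists>y z. (\<Sum>b\<in>insert x B. c b *\<^sub>R b) = y + z \<and> y \<in> (\<lambda>t. t *\<^sub>R x) ` {-r..r} \<and>
          z \<in> {\<Sum>b\<in>B. c b *\<^sub>R b |c. \<forall>b\<in>B. \<bar>c b\<bar> \<le> r}"
        using insert.hyps
        by (intro exI[of _ "c x *\<^sub>R x"] exI[of _ "\<Sum>b\<in>B. c b *\<^sub>R b"])
           (auto simp: abs_le_iff intro!: image_eqI[of _ _ "c x"])
    qed
    show "?R \<subseteq> ?L"
    proof clarify
      fix t c assume t: "t \<in> {-r..r}" and c: "\<forall>b\<in>B. \<bar>c b\<bar> \<le> r"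
      have "(\<Sum>b\<in>B. (c(x := t)) b *\<^sub>R b) = (\<Sum>b\<in>B. c b *\<^sub>R b)"
        by (rule sum.cong) (use insert.hyps in auto)
      then have "t *\<^sub>R x + (\<Sum>b\<in>B. c b *\<^sub>R b) = (\<Sum>b\<in>insert x B. (c(x := t)) b *\<^sub>R b)"
        using insert.hyps by simp
      then show "\<exists>c'. t *\<^sub>R x + (\<Sum>b\<in>B. c b *\<^sub>R b) = (\<Sum>b\<in>insert x B. c' b *\<^sub>R b) \<and> (\<forall>b\<in>insert x B. \<bar>c' b\<bar> \<le> r)"
        using t c by (intro exI[of _ "c(x := t)"]) auto
    qed
  qed
  moreover have "compact ?R"
  proof (rule compact_sums)
    show "compact ((\<lambda>t. t *\<^sub>R x) ` {-r..r})"
      by (rule compact_continuous_image) (auto intro!: continuous_intros)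
  qed (rule insert.IH)
  ultimately show ?case by simp
qed

lemma compact_cball_fdsub:
  assumes "fdsub (E :: pt set)"
  shows "compact (cball 0 r \<inter> E)"
proof -
  let ?S = "{\<Sum>b\<in>onb E. c b *\<^sub>R b |c. \<forall>b\<in>onb E. \<bar>c b\<bar> \<le> r}"
  note B = onb_onbasis[OF assms]
  have "cball 0 r \<inter> E \<subseteq> ?S"
  proof
    fix x assume x: "x \<in> cball 0 r \<inter> E"
    have "\<bar>x \<bullet> b\<bar> \<le> r" if "b \<in> onb E" for b
      using Cauchy_Schwarz_ineq2[of x b] x onbasis_norm[OF B that] by simp
    then show "x \<in> ?S"
      using onbasis_repr[OF B, of x] x by (auto intro!: exI[of _ "\<lambda>b. x \<bullet> b"])
  qed
  moreover have "compact ?S"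
    by (rule compact_sum_segments) (rule onbasis_finite[OF B])
  moreover have "closed (cball 0 r \<inter> E)"
    by (rule closed_Int[OF closed_cball fdsub_closed[OF assms]])
  ultimately show ?thesis
    using compact_Int_closed[of ?S "cball 0 r \<inter> E"] by (simp add: inf.absorb2)
qed

section \<open>The coordinate subspaces\<close>

lemma Rn_sum_repr: "x \<in> Rn n \<Longrightarrow> (\<Sum>i<n. Poly_Mapping.lookup x i *\<^sub>R unit_vec_at i) = x"
proof -
  assume "x \<in> Rn n"
  moreover have "Poly_Mapping.lookup x i *\<^sub>R unit_vec_at i = Poly_Mapping.single i (Poly_Mapping.lookup x i)" for i
    by (rule poly_mapping_eqI) (simp add: unit_vec_at_def scaleR_poly_mapping.rep_eq lookup_single when_def)
  ultimately show ?thesis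
    using sum_single_lookup[of "{..<n}" x] by (auto simp: Rn_def)
qed

lemma inner_unit_vec_at: "x \<bullet> unit_vec_at i = Poly_Mapping.lookup x i"
  by (simp add: unit_vec_at_def inner_commute[of x] inner_single_left)

lemma lookup_unit_vec_at: "Poly_Mapping.lookup (unit_vec_at i) j = of_bool (i = j)"
  by (simp add: unit_vec_at_def lookup_single when_def)

lemma subspace_Rn: "subspace (Rn n)"
proof -
  have "Rn n = {x. \<forall>i\<ge>n. Poly_Mapping.lookup x i = 0}"
    by (auto simp: Rn_def in_keys_iff) (meson not_less)
  then show ?thesis
    by (simp add: subspace_def lookup_add scaleR_poly_mapping.rep_eq)
qed

lemma unit_vec_at_in: "i < n \<Longrightarrow> unit_vec_at i \<in> Rn n"
  by (auto simp: Rn_def unit_vec_at_def)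

lemma norm_unit_vec_at: "norm (unit_vec_at i) = 1"
  by (simp add: unit_vec_at_def norm_single)

lemma inj_unit_vec_at: "inj unit_vec_at"
  by (rule injI) (metis lookup_unit_vec_at of_bool_eq_1_iff)

lemma onbasis_Rn: "onbasis (unit_vec_at ` {..<n}) (Rn n)"
proof -
  have "span (unit_vec_at ` {..<n}) = Rn n"
  proof
    show "span (unit_vec_at ` {..<n}) \<subseteq> Rn n"
      by (rule span_minimal) (auto simp: subspace_Rn unit_vec_at_in)
    show "Rn n \<subseteq> span (unit_vec_at ` {..<n})"
    proof
      fix x assume "x \<in> Rn n"
      moreover have "(\<Sum>i<n. Poly_Mapping.lookup x i *\<^sub>R unit_vec_at i) \<in> span (unit_vec_at ` {..<n})"
        by (intro span_sum span_scale span_base) auto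
      ultimately show "x \<in> span (unit_vec_at ` {..<n})"
        by (simp add: Rn_sum_repr)
    qed
  qed
  then show ?thesis
    by (auto simp: onbasis_def inner_unit_vec_at lookup_unit_vec_at inj_eq[OF inj_unit_vec_at])
qed

lemma fdsub_Rn: "fdsub (Rn n)"
  using onbasis_Rn by (auto simp: fdsub_def)

lemma dim_Rn: "dim (Rn n) = n"
  using onbasis_card[OF onbasis_Rn[of n]] by (simp add: card_image inj_on_subset[OF inj_unit_vec_at])

section \<open>Orthogonal transformations\<close>

lemma reflection:
  assumes "subspace E" "x \<in> E" "y \<in> E" "norm x = norm (y :: 'a::real_inner)"
  obtains U where "orthogonal_transformation U" "\<And>z. U (U z) = z" "U ` E = E" "U x = y"
    "\<And>F. subspace F \<Longrightarrow> x \<in> F \<Longrightarrow> y \<in> F \<Longrightarrow> U ` F = F"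
proof -
  \<comment> \<open>Householder reflection in the hyperplane orthogonal to x - y; it exchanges x and
    y because their norms agree. For x = y the division by zero makes \<open>w\<close> vanish and
    \<open>U\<close> the identity. Being an involution, \<open>U\<close> is its own inverse.\<close>
  define w where "w = (x - y) /\<^sub>R norm (x - y)"
  define U where "U z = z - (2 * (z \<bullet> w)) *\<^sub>R w" for z
  have U0: "U = (\<lambda>z. z)" if "x = y"
    using that by (auto simp: U_def w_def)
  have ww: "w \<bullet> w = 1" if "x \<noteq> y"
  proof -
    have "norm w = 1" using that by (simp add: w_def)
    then show ?thesis by (simp only: norm_eq_1)
  qed
  have orth: "orthogonal_transformation U"
  proof (cases "x = y")
    case False
    have "linear U"
      by (rule linearI) (auto simp: U_def inner_add_left algebra_simps)
    moreover have "U v \<bullet> U z = v \<bullet> z" for v z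
      using ww[OF False] by (simp add: U_def inner_diff_left inner_diff_right inner_commute algebra_simps)
    ultimately show ?thesis by (simp add: orthogonal_transformation_def)
  qed (use U0 in simp)
  have UU: "U (U z) = z" for z
  proof (cases "x = y")
    case False
    then show ?thesis
      using ww[OF False] by (simp add: U_def inner_diff_left algebra_simps)
  qed (use U0 in simp)
  have im: "U ` F = F" if "subspace F" "x \<in> F" "y \<in> F" for F
  proof -
    have "w \<in> F"
      using that by (auto simp: w_def intro: subspace_scale subspace_diff)
    then have "U ` F \<subseteq> F"
      using that by (auto simp: U_def intro: subspace_scale subspace_diff)
    moreover have "x \<in> U ` F" if "x \<in> F" for x
      using UU[of x] that \<open>U ` F \<subseteq> F\<close> by (intro image_eqI[of _ _ "U x"]) auto
    ultimately show ?thesis by blast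
  qed
  have Uxy: "U x = y"
  proof (cases "x = y")
    case False
    have "norm (x - y) ^ 2 = 2 * (x \<bullet> x) - 2 * (x \<bullet> y)"
      using assms(4) by (simp add: power2_norm_eq_inner inner_diff_left inner_diff_right inner_commute norm_eq)
    then have "2 * (x \<bullet> (x - y)) = norm (x - y) ^ 2"
      by (simp add: inner_diff_right)
    moreover have "(2 * (x \<bullet> w)) *\<^sub>R w = (2 * (x \<bullet> (x - y)) / (norm (x - y))\<^sup>2) *\<^sub>R (x - y)"
      by (simp only: w_def inner_scaleR_right scaleR_scaleR) (simp add: power2_eq_square field_simps)
    ultimately have "(2 * (x \<bullet> w)) *\<^sub>R w = x - y"
      using False by simp
    then show ?thesis by (simp add: U_def)
  qed (use U0 in simp)
  show thesis
    by (rule that[OF orth UU im[OF assms(1-3)] Uxy im])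
qed

lemma orthogonal_transformation_continuous:
  "orthogonal_transformation (U :: 'a::real_inner \<Rightarrow> 'a) \<Longrightarrow> continuous_on S U"
proof -
  assume U: "orthogonal_transformation U"
  then have "bounded_linear U"
    by (intro bounded_linear_intro[of _ 1])
       (auto simp: orthogonal_transformation linear_add linear_scale)
  then show ?thesis
    by (rule linear_continuous_on)
qed

lemma orthogonal_transformation_measurable:
  "orthogonal_transformation (U :: pt \<Rightarrow> pt) \<Longrightarrow> U \<in> borel_measurable borel"
  by (intro borel_measurable_continuous_onI orthogonal_transformation_continuous)

lemma orthogonal_transformation_inj_real_inner:
  assumes "orthogonal_transformation (U :: 'a::real_inner \<Rightarrow> 'a)"
  shows "inj U"
proof (rule injI)
  fix x y assume "U x = U y"
  then have "norm (x - y) = norm (U x - U y)"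
    using assms by (metis orthogonal_transformation linear_diff)
  then show "x = y"
    using \<open>U x = U y\<close> by simp
qed

lemma onbasis_image:
  assumes "onbasis B E" "orthogonal_transformation (U :: 'a::real_inner \<Rightarrow> 'a)"
  shows "onbasis (U ` B) (U ` E)"
proof -
  have "inj U"
    by (rule orthogonal_transformation_inj_real_inner[OF assms(2)])
  then show ?thesis
    using assms by (auto simp: onbasis_def orthogonal_transformation_def linear_span_image inj_eq)
qed

lemma fdsub_image: "fdsub E \<Longrightarrow> orthogonal_transformation (U :: 'a::real_inner \<Rightarrow> 'a) \<Longrightarrow> fdsub (U ` E)"
  using onbasis_image by (auto simp: fdsub_def)

lemma dim_image_orthogonal:
  assumes "fdsub E" "orthogonal_transformation (U :: 'a::real_inner \<Rightarrow> 'a)"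
  shows "dim (U ` E) = dim E"
proof -
  obtain B where B: "onbasis B E" using assms by (auto simp: fdsub_def)
  have "inj U"
    by (rule orthogonal_transformation_inj_real_inner[OF assms(2)])
  then show ?thesis
    using onbasis_card[OF B] onbasis_card[OF onbasis_image[OF B assms(2)]]
      card_image[OF inj_on_subset[OF \<open>inj U\<close> subset_UNIV], of B] by simp
qed

lemma proj_image:
  assumes "fdsub (E :: pt set)" "orthogonal_transformation U"
  shows "proj (U ` E) (U x) = U (proj E x)"
  by (rule proj_unique)
     (use assms in \<open>auto simp: fdsub_image proj_in proj_inner orthogonal_transformation_def\<close>)

section \<open>Lebesgue measure on subspaces\<close>

lemma unit_ball_vol_neq_0 [simp]: "unit_ball_vol (real n) \<noteq> 0"
  using unit_ball_vol_pos[of "real n"] by linarith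

text \<open>The measure inside \<open>leb\<close> with the basis as a parameter. Once
  \<open>leb_eq_lebB\<close> shows that the basis is irrelevant, each argument may choose a basis
  adapted to it.\<close>

definition lebB :: "pt set \<Rightarrow> pt measure" where
  "lebB B = distr (\<Pi>\<^sub>M b\<in>B. (lborel :: real measure)) borel (\<lambda>c. \<Sum>b\<in>B. c b *\<^sub>R b)"

lemma measurable_sum_scaleR [measurable]:
  "(\<lambda>c. \<Sum>b\<in>B. c b *\<^sub>R (b :: pt)) \<in> borel_measurable (\<Pi>\<^sub>M b\<in>B. (lborel :: real measure))"
proof (intro borel_measurable_sum borel_measurable_scaleR borel_measurable_const)
  fix b assume "b \<in> B"
  then have "(\<lambda>c. c b) \<in> (\<Pi>\<^sub>M b\<in>B. (lborel :: real measure)) \<rightarrow>\<^sub>M lborel"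
    by (rule measurable_component_singleton)
  then show "(\<lambda>c. c b) \<in> borel_measurable (\<Pi>\<^sub>M b\<in>B. (lborel :: real measure))"
    by simp
qed

lemma sets_lebB [simp, measurable_cong]: "sets (lebB B) = sets borel"
  and space_lebB [simp]: "space (lebB B) = UNIV"
  by (simp_all add: lebB_def)

lemma nn_integral_lebB:
  "f \<in> borel_measurable borel \<Longrightarrow>
    (\<integral>\<^sup>+x. f x \<partial>lebB B) = (\<integral>\<^sup>+c. f (\<Sum>b\<in>B. c b *\<^sub>R b) \<partial>(\<Pi>\<^sub>M b\<in>B. (lborel :: real measure)))"
  unfolding lebB_def by (subst nn_integral_distr) auto

lemma nn_integral_lebB_empty:
  assumes [measurable]: "f \<in> borel_measurable borel"
  shows "(\<integral>\<^sup>+x. f x \<partial>lebB {}) = f 0"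
  by (simp add: nn_integral_lebB PiM_empty nn_integral_count_space_finite)

text \<open>Fubini for one basis vector; it drives the inductions over the basis for translations
  and dilations.\<close>

lemma nn_integral_lebB_insert:
  assumes [measurable]: "f \<in> borel_measurable borel" and "finite B" "x \<notin> B"
  shows "(\<integral>\<^sup>+z. f z \<partial>lebB (insert x B)) = (\<integral>\<^sup>+y. (\<integral>\<^sup>+t. f (t *\<^sub>R x + y) \<partial>lborel) \<partial>lebB B)"
proof -
  interpret product_sigma_finite "\<lambda>_. lborel :: real measure" by standard
  have eq: "(\<Sum>b\<in>insert x B. (c(x := t)) b *\<^sub>R b) = t *\<^sub>R x + (\<Sum>b\<in>B. c b *\<^sub>R b)" for c t
  proof -
    have "(\<Sum>b\<in>B. (c(x := t)) b *\<^sub>R b) = (\<Sum>b\<in>B. c b *\<^sub>R b)"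
      by (rule sum.cong) (use assms in auto)
    then show ?thesis using assms by simp
  qed
  have "(\<integral>\<^sup>+z. f z \<partial>lebB (insert x B))
      = (\<integral>\<^sup>+c. f (\<Sum>b\<in>insert x B. c b *\<^sub>R b) \<partial>(\<Pi>\<^sub>M b\<in>insert x B. (lborel :: real measure)))"
    by (rule nn_integral_lebB) fact
  also have "\<dots> = (\<integral>\<^sup>+c. (\<integral>\<^sup>+t. f (\<Sum>b\<in>insert x B. (c(x := t)) b *\<^sub>R b) \<partial>lborel)
      \<partial>(\<Pi>\<^sub>M b\<in>B. (lborel :: real measure)))"
  proof (rule product_nn_integral_insert)
    show "(\<lambda>c. f (\<Sum>b\<in>insert x B. c b *\<^sub>R b))
        \<in> borel_measurable (\<Pi>\<^sub>M b\<in>insert x B. (lborel :: real measure))"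
      by (rule measurable_compose[OF measurable_sum_scaleR assms(1)])
  qed (use assms in auto)
  also have "\<dots> = (\<integral>\<^sup>+c. (\<integral>\<^sup>+t. f (t *\<^sub>R x + (\<Sum>b\<in>B. c b *\<^sub>R b)) \<partial>lborel)
      \<partial>(\<Pi>\<^sub>M b\<in>B. (lborel :: real measure)))"
    by (simp only: eq)
  also have "\<dots> = (\<integral>\<^sup>+y. (\<integral>\<^sup>+t. f (t *\<^sub>R x + y) \<partial>lborel) \<partial>lebB B)"
    by (rule nn_integral_lebB[symmetric]) measurable
  finally show ?thesis .
qed

lemma nn_integral_real_shift:
  fixes f :: "real \<Rightarrow> ennreal"
  assumes [measurable]: "f \<in> borel_measurable borel"
  shows "(\<integral>\<^sup>+t. f (a + t) \<partial>lborel) = (\<integral>\<^sup>+t. f t \<partial>lborel)"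
  using nn_integral_real_affine[of f 1 a] by simp

lemma nn_integral_lebB_translate:
  assumes "finite B" and "f \<in> borel_measurable borel"
  shows "(\<integral>\<^sup>+x. f ((\<Sum>b\<in>B. u b *\<^sub>R b) + x) \<partial>lebB B) = (\<integral>\<^sup>+x. f x \<partial>lebB B)"
  using assms
proof (induction B arbitrary: f)
  case empty
  then show ?case by simp
next
  case (insert x B)
  note [measurable] = insert.prems
  define v where "v = (\<Sum>b\<in>B. u b *\<^sub>R b)"
  have "(\<integral>\<^sup>+z. f ((\<Sum>b\<in>insert x B. u b *\<^sub>R b) + z) \<partial>lebB (insert x B))
      = (\<integral>\<^sup>+y. (\<integral>\<^sup>+t. f ((\<Sum>b\<in>insert x B. u b *\<^sub>R b) + (t *\<^sub>R x + y)) \<partial>lborel) \<partial>lebB B)"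
    by (rule nn_integral_lebB_insert) (use insert.hyps in auto)
  also have "\<dots> = (\<integral>\<^sup>+y. (\<integral>\<^sup>+t. f ((u x + t) *\<^sub>R x + (v + y)) \<partial>lborel) \<partial>lebB B)"
    using insert.hyps by (simp add: v_def scaleR_add_left add_ac)
  also have "\<dots> = (\<integral>\<^sup>+y. (\<integral>\<^sup>+t. f (t *\<^sub>R x + (v + y)) \<partial>lborel) \<partial>lebB B)"
    by (intro nn_integral_cong nn_integral_real_shift) measurable
  also have "\<dots> = (\<integral>\<^sup>+y. (\<integral>\<^sup>+t. f (t *\<^sub>R x + y) \<partial>lborel) \<partial>lebB B)"
    unfolding v_def by (rule insert.IH) measurable
  also have "\<dots> = (\<integral>\<^sup>+z. f z \<partial>lebB (insert x B))"
    by (rule nn_integral_lebB_insert[symmetric]) (use insert.hyps in auto)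
  finally show ?case .
qed

lemma nn_integral_lebB_scale:
  assumes "finite B" and "f \<in> borel_measurable borel" and "c \<noteq> 0"
  shows "(\<integral>\<^sup>+x. f x \<partial>lebB B) = ennreal (\<bar>c\<bar> ^ card B) * (\<integral>\<^sup>+x. f (c *\<^sub>R x) \<partial>lebB B)"
  using assms(1,2)
proof (induction B arbitrary: f)
  case empty
  then show ?case by (simp add: nn_integral_lebB_empty)
next
  case (insert x B)
  note [measurable] = insert.prems
  have "(\<integral>\<^sup>+z. f z \<partial>lebB (insert x B)) = (\<integral>\<^sup>+y. (\<integral>\<^sup>+t. f (t *\<^sub>R x + y) \<partial>lborel) \<partial>lebB B)"
    by (rule nn_integral_lebB_insert) (use insert.hyps in auto)
  also have "\<dots> = ennreal (\<bar>c\<bar> ^ card B) *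
      (\<integral>\<^sup>+y. (\<integral>\<^sup>+t. f (t *\<^sub>R x + c *\<^sub>R y) \<partial>lborel) \<partial>lebB B)"
    by (rule insert.IH) measurable
  also have "(\<lambda>y. \<integral>\<^sup>+t. f (t *\<^sub>R x + c *\<^sub>R y) \<partial>lborel)
      = (\<lambda>y. ennreal \<bar>c\<bar> * (\<integral>\<^sup>+t. f (c *\<^sub>R (t *\<^sub>R x + y)) \<partial>lborel))"
  proof
    fix y
    have "(\<integral>\<^sup>+t. f (t *\<^sub>R x + c *\<^sub>R y) \<partial>lborel)
        = ennreal \<bar>c\<bar> * (\<integral>\<^sup>+t. f ((0 + c * t) *\<^sub>R x + c *\<^sub>R y) \<partial>lborel)"
      by (rule nn_integral_real_affine) (use assms(3) in measurable)
    then show "(\<integral>\<^sup>+t. f (t *\<^sub>R x + c *\<^sub>R y) \<partial>lborel)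
        = ennreal \<bar>c\<bar> * (\<integral>\<^sup>+t. f (c *\<^sub>R (t *\<^sub>R x + y)) \<partial>lborel)"
      by (simp add: scaleR_add_right)
  qed
  also have "(\<integral>\<^sup>+y. ennreal \<bar>c\<bar> * (\<integral>\<^sup>+t. f (c *\<^sub>R (t *\<^sub>R x + y)) \<partial>lborel) \<partial>lebB B)
      = ennreal \<bar>c\<bar> * (\<integral>\<^sup>+y. (\<integral>\<^sup>+t. f (c *\<^sub>R (t *\<^sub>R x + y)) \<partial>lborel) \<partial>lebB B)"
    by (rule nn_integral_cmult) measurable
  also have "(\<integral>\<^sup>+y. (\<integral>\<^sup>+t. f (c *\<^sub>R (t *\<^sub>R x + y)) \<partial>lborel) \<partial>lebB B)
      = (\<integral>\<^sup>+z. f (c *\<^sub>R z) \<partial>lebB (insert x B))"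
    by (rule nn_integral_lebB_insert[symmetric]) (use insert.hyps in auto)
  finally show ?case
    using insert.hyps by (simp add: mult.assoc[symmetric] ennreal_mult'[symmetric] mult.commute)
qed

lemma AE_lebB:
  assumes "finite B"
  shows "AE x in lebB B. x \<in> span B"
proof -
  have "closed (span B)"
    using assms by (intro fdsub_closed fdsub_span)
  then have [measurable]: "span B \<in> sets borel" by simp
  show ?thesis
    unfolding lebB_def
    by (subst AE_distr_iff) (use \<open>span B \<in> sets borel\<close> in \<open>auto intro!: AE_I2 span_sum intro: span_scale[OF span_base]\<close>)
qed

text \<open>In orthonormal coordinates the ball becomes a Euclidean ball of the product space, whose
  volume is known.\<close>

lemma emeasure_lebB_cball:
  assumes "onbasis B E" "r > 0"
  shows "emeasure (lebB B) (cball 0 r) = ennreal (unit_ball_vol (real (card B)) * r ^ card B)"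
proof -
  let ?P = "\<Pi>\<^sub>M b\<in>B. (lborel :: real measure)"
  have "emeasure (lebB B) (cball 0 r) = emeasure ?P ((\<lambda>c. \<Sum>b\<in>B. c b *\<^sub>R b) -` cball 0 r \<inter> space ?P)"
    unfolding lebB_def by (rule emeasure_distr) auto
  also have "(\<lambda>c. \<Sum>b\<in>B. c b *\<^sub>R b) -` cball 0 r \<inter> space ?P
      = {f. sqrt (\<Sum>i\<in>B. (f i)\<^sup>2) \<le> r} \<inter> space ?P"
    by (auto simp: onbasis_norm_eq_sum[OF assms(1)])
  finally show ?thesis
    using emeasure_cball_aux[OF onbasis_finite[OF assms(1)] assms(2)] by simp
qed

lemma sigma_finite_if_cball_finite:
  fixes M :: "'a::real_normed_vector measure"
  assumes "sets M = sets borel" "\<And>r. r > 0 \<Longrightarrow> emeasure M (cball 0 r) < \<infinity>"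
  shows "sigma_finite_measure M"
proof
  let ?A = "range (\<lambda>n::nat. cball (0::'a) (Suc n))"
  have "\<Union>?A = space M"
  proof -
    have "\<exists>n::nat. norm x \<le> Suc n" for x :: 'a
    proof -
      obtain n :: nat where "norm x \<le> n"
        using real_arch_simple by blast
      then show ?thesis by (intro exI[of _ n]) simp
    qed
    then have "\<Union>?A = UNIV"
      by (simp add: set_eq_iff del: of_nat_Suc)
    then show ?thesis
      using sets_eq_imp_space_eq[OF assms(1)] by simp
  qed
  moreover have "\<forall>a\<in>?A. emeasure M a \<noteq> \<infinity>"
    using assms(2) by (simp add: less_top[symmetric] del: of_nat_Suc)
  ultimately show "\<exists>A. countable A \<and> A \<subseteq> sets M \<and> \<Union>A = space M \<and> (\<forall>a\<in>A. emeasure M a \<noteq> \<infinity>)"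
    using assms(1) by (intro exI[of _ ?A]) auto
qed

section \<open>Uniqueness of translation invariant measures on a subspace\<close>

definition translation_invariant_on :: "'a::real_normed_vector set \<Rightarrow> 'a measure \<Rightarrow> bool" where
  "translation_invariant_on E M \<longleftrightarrow> (AE x in M. x \<in> E) \<and>
    (\<forall>f\<in>borel_measurable borel. \<forall>v\<in>E. (\<integral>\<^sup>+x. f (v + x) \<partial>M) = (\<integral>\<^sup>+x. f x \<partial>M))"

text \<open>Both sides of the identity below evaluate
  \<open>\<integral>\<integral> f (x + y) g y dM(x) dN(y)\<close>.\<close>

lemma translation_invariant_exchange:
  fixes M N :: "'a::{real_normed_vector, second_countable_topology} measure"
  assumes M: "sets M = sets borel" "sigma_finite_measure M" "translation_invariant_on E M"
    and N: "sets N = sets borel" "sigma_finite_measure N" "translation_invariant_on E N"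
    and E: "subspace E"
    and f[measurable]: "f \<in> borel_measurable borel" and g[measurable]: "g \<in> borel_measurable borel"
  shows "(\<integral>\<^sup>+x. f x \<partial>M) * (\<integral>\<^sup>+x. g x \<partial>N) = (\<integral>\<^sup>+x. f x \<partial>N) * (\<integral>\<^sup>+x. g (-x) \<partial>M)"
proof -
  note [measurable_cong] = M(1) N(1)
  interpret M: sigma_finite_measure M by fact
  interpret N: sigma_finite_measure N by fact
  interpret pair_sigma_finite M N ..
  have tM: "(\<integral>\<^sup>+x. h (v + x) \<partial>M) = (\<integral>\<^sup>+x. h x \<partial>M)"
    and tN: "(\<integral>\<^sup>+x. h (v + x) \<partial>N) = (\<integral>\<^sup>+x. h x \<partial>N)" if "v \<in> E" "h \<in> borel_measurable borel" for h v
    using M(3) N(3) that by (auto simp: translation_invariant_on_def)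
  have AM: "AE x in M. x \<in> E" and AN: "AE x in N. x \<in> E"
    using M(3) N(3) by (auto simp: translation_invariant_on_def)
  have "(\<integral>\<^sup>+x. f x \<partial>M) * (\<integral>\<^sup>+x. g x \<partial>N) = (\<integral>\<^sup>+y. (\<integral>\<^sup>+x. f x \<partial>M) * g y \<partial>N)"
    by (rule nn_integral_cmult[symmetric]) measurable
  also have "\<dots> = (\<integral>\<^sup>+y. (\<integral>\<^sup>+x. f (y + x) * g y \<partial>M) \<partial>N)"
    using AN by (intro nn_integral_cong_AE) (auto elim!: eventually_mono simp: nn_integral_multc tM)
  also have "\<dots> = (\<integral>\<^sup>+x. (\<integral>\<^sup>+y. f (y + x) * g y \<partial>N) \<partial>M)"
    by (rule Fubini') measurable
  also have "\<dots> = (\<integral>\<^sup>+x. (\<integral>\<^sup>+y. f y * g (y - x) \<partial>N) \<partial>M)"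
  proof (rule nn_integral_cong_AE, use AM in eventually_elim)
    case (elim x)
    have "(\<integral>\<^sup>+y. f (x + y) * g (x + y - x) \<partial>N) = (\<integral>\<^sup>+y. f y * g (y - x) \<partial>N)"
      by (rule tN[OF elim]) measurable
    then show ?case by (simp add: add.commute)
  qed
  also have "\<dots> = (\<integral>\<^sup>+y. (\<integral>\<^sup>+x. f y * g (y - x) \<partial>M) \<partial>N)"
    by (rule Fubini'[symmetric]) measurable
  also have "\<dots> = (\<integral>\<^sup>+y. f y * (\<integral>\<^sup>+x. g (-x) \<partial>M) \<partial>N)"
  proof (rule nn_integral_cong_AE, use AN in eventually_elim)
    case (elim y)
    have "(\<integral>\<^sup>+x. g (y - (y + x)) \<partial>M) = (\<integral>\<^sup>+x. g (y - x) \<partial>M)"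
      by (rule tM[OF elim]) measurable
    then show ?case by (simp add: nn_integral_cmult)
  qed
  also have "\<dots> = (\<integral>\<^sup>+x. f x \<partial>N) * (\<integral>\<^sup>+x. g (-x) \<partial>M)"
    by (rule nn_integral_multc) measurable
  finally show ?thesis .
qed

text \<open>With the indicator of the unit ball as \<open>g\<close>, which is even, the exchange
  identity makes the two measures proportional. The common mass of the ball, neither 0 nor infinite,
  cancels.\<close>

lemma translation_invariant_unique:
  fixes M N :: "'a::{real_normed_vector, second_countable_topology} measure"
  assumes M: "sets M = sets borel" "sigma_finite_measure M" "translation_invariant_on E M"
    and N: "sets N = sets borel" "sigma_finite_measure N" "translation_invariant_on E N"
    and E: "subspace E"
    and ball: "emeasure M (cball 0 1) = emeasure N (cball 0 1)"
      "emeasure N (cball 0 1) \<noteq> 0" "emeasure N (cball 0 1) \<noteq> \<infinity>"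
  shows "M = N"
proof (rule measure_eqI)
  fix A assume A: "A \<in> sets M"
  let ?g = "indicator (cball 0 1) :: 'a \<Rightarrow> ennreal"
  have "(\<integral>\<^sup>+x. indicator A x \<partial>M) * (\<integral>\<^sup>+x. ?g x \<partial>N) = (\<integral>\<^sup>+x. indicator A x \<partial>N) * (\<integral>\<^sup>+x. ?g (-x) \<partial>M)"
  proof (rule translation_invariant_exchange[OF M N E])
    show "(indicator A :: 'a \<Rightarrow> ennreal) \<in> borel_measurable borel"
      using A M(1) by (intro borel_measurable_indicator) simp
    show "?g \<in> borel_measurable borel"
      by (intro borel_measurable_indicator borel_closed closed_cball)
  qed
  also have "(\<lambda>x. ?g (-x)) = ?g"
    by (rule ext) (simp add: indicator_def)
  finally have "emeasure M A * emeasure N (cball 0 1) = emeasure N A * emeasure N (cball 0 1)"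
    using A M(1) N(1) ball by simp
  then show "emeasure M A = emeasure N A"
    using ball by (simp add: mult.commute[of _ "emeasure N (cball 0 1)"] ennreal_mult_cancel_left)
qed (use M N in simp)

lemma lebB_translation_invariant:
  assumes "onbasis B E"
  shows "translation_invariant_on E (lebB B)"
  unfolding translation_invariant_on_def
proof (intro conjI ballI)
  show "AE x in lebB B. x \<in> E"
    using AE_lebB[OF onbasis_finite[OF assms]] onbasis_span[OF assms] by simp
  fix f :: "pt \<Rightarrow> ennreal" and v assume f: "f \<in> borel_measurable borel" and v: "v \<in> E"
  show "(\<integral>\<^sup>+x. f (v + x) \<partial>lebB B) = (\<integral>\<^sup>+x. f x \<partial>lebB B)"
    using nn_integral_lebB_translate[OF onbasis_finite[OF assms] f, of "\<lambda>b. v \<bullet> b"]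
    by (simp add: onbasis_repr[OF assms v])
qed

lemma lebB_sigma_finite: "onbasis B E \<Longrightarrow> sigma_finite_measure (lebB B)"
  by (rule sigma_finite_if_cball_finite) (auto simp: emeasure_lebB_cball)

text \<open>Every orthonormal basis of \<open>E\<close> yields a translation invariant measure on
  \<open>E\<close> with the same mass of the unit ball, hence the same measure.\<close>

lemma leb_eq_lebB:
  assumes "onbasis B E"
  shows "leb E = lebB B"
proof -
  have E: "fdsub E" using assms by (auto simp: fdsub_def)
  note onb = onb_onbasis[OF E]
  have "lebB (onb E) = lebB B"
    by (rule translation_invariant_unique[where E = E])
       (use onb assms in \<open>auto simp: lebB_sigma_finite lebB_translation_invariant onbasis_subspace
          emeasure_lebB_cball onbasis_card\<close>)
  then show ?thesis
    by (simp add: leb_def lebB_def)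
qed

section \<open>Properties of Lebesgue measure on a subspace\<close>

lemma sets_leb [simp, measurable_cong]: "sets (leb E) = sets borel"
  and space_leb [simp]: "space (leb E) = UNIV"
  by (simp_all add: leb_def)

lemma leb_sigma_finite: "fdsub E \<Longrightarrow> sigma_finite_measure (leb E)"
  using leb_eq_lebB lebB_sigma_finite onb_onbasis by metis

lemma leb_translation_invariant: "fdsub E \<Longrightarrow> translation_invariant_on E (leb E)"
  using leb_eq_lebB lebB_translation_invariant onb_onbasis by metis

lemma leb_AE: "fdsub E \<Longrightarrow> AE x in leb E. x \<in> E"
  using leb_translation_invariant by (auto simp: translation_invariant_on_def)

lemma leb_translate:
  "fdsub E \<Longrightarrow> f \<in> borel_measurable borel \<Longrightarrow> v \<in> E \<Longrightarrow>
    (\<integral>\<^sup>+x. f (v + x) \<partial>leb E) = (\<integral>\<^sup>+x. f x \<partial>leb E)"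
  using leb_translation_invariant by (auto simp: translation_invariant_on_def)

lemma leb_scale:
  assumes "fdsub E" "f \<in> borel_measurable borel" "c \<noteq> 0"
  shows "(\<integral>\<^sup>+x. f x \<partial>leb E) = ennreal (\<bar>c\<bar> ^ dim E) * (\<integral>\<^sup>+x. f (c *\<^sub>R x) \<partial>leb E)"
  using nn_integral_lebB_scale[OF onbasis_finite[OF onb_onbasis[OF assms(1)]] assms(2,3)]
  by (simp add: leb_eq_lebB[OF onb_onbasis[OF assms(1)]] onbasis_card[OF onb_onbasis[OF assms(1)]])

lemma leb_cball:
  assumes "fdsub E" "r > 0"
  shows "emeasure (leb E) (cball 0 r) = ennreal (unit_ball_vol (real (dim E)) * r ^ dim E)"
  using emeasure_lebB_cball[OF onb_onbasis[OF assms(1)] assms(2)]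
  by (simp add: leb_eq_lebB[OF onb_onbasis[OF assms(1)]] onbasis_card[OF onb_onbasis[OF assms(1)]])

lemma leb_split:
  assumes "fdsub E" "f \<in> borel_measurable borel" "\<xi> \<in> E" "norm \<xi> = 1"
  shows "(\<integral>\<^sup>+x. f x \<partial>leb E) = (\<integral>\<^sup>+y. (\<integral>\<^sup>+t. f (t *\<^sub>R \<xi> + y) \<partial>lborel) \<partial>leb (E \<inter> hyperplane_perp \<xi>))"
proof -
  note B = onb_onbasis[OF fdsub_perp[OF assms(1), of \<xi>]]
  note * = onbasis_insert_perp[OF B assms(3,4) fdsub_subspace[OF assms(1)]]
  show ?thesis
    unfolding leb_eq_lebB[OF *(1)] leb_eq_lebB[OF B]
    by (rule nn_integral_lebB_insert) (use * B assms in \<open>auto simp: onbasis_finite\<close>)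
qed

lemma leb_trivial: "leb {0} = return borel 0"
proof (rule measure_eqI)
  fix A assume A: "A \<in> sets (leb {0})"
  then have "(\<integral>\<^sup>+x. indicator A x \<partial>leb {0}) = indicator A 0"
    unfolding leb_eq_lebB[OF onbasis_empty] by (intro nn_integral_lebB_empty) auto
  then show "emeasure (leb {0}) A = emeasure (return borel 0) A"
    using A by simp
qed simp

lemma leb_image:
  assumes "fdsub E" "orthogonal_transformation U" "f \<in> borel_measurable borel"
  shows "(\<integral>\<^sup>+x. f x \<partial>leb (U ` E)) = (\<integral>\<^sup>+x. f (U x) \<partial>leb E)"
proof -
  have [measurable]: "U \<in> borel_measurable borel"
    using assms(2) by (rule orthogonal_transformation_measurable)
  have UE: "fdsub (U ` E)"
    using assms by (intro fdsub_image)
  have lin: "linear U" and nrm: "norm (U x) = norm x" for x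
    using assms(2) by (auto simp: orthogonal_transformation)
  let ?M = "distr (leb E) borel U"
  have ball: "emeasure ?M (cball 0 r) = emeasure (leb (U ` E)) (cball 0 r)" if "r > 0" for r
  proof -
    have "emeasure ?M (cball 0 r) = emeasure (leb E) (U -` cball 0 r \<inter> space (leb E))"
      by (rule emeasure_distr) auto
    also have "U -` cball 0 r \<inter> space (leb E) = cball 0 r"
      by (auto simp: nrm)
    finally show ?thesis
      using that assms UE by (simp add: leb_cball dim_image_orthogonal)
  qed
  have "?M = leb (U ` E)"
  proof (rule translation_invariant_unique[where E = "U ` E"])
    show "sigma_finite_measure ?M"
      by (rule sigma_finite_if_cball_finite) (use UE in \<open>auto simp: ball leb_cball\<close>)
    show "translation_invariant_on (U ` E) ?M"
      unfolding translation_invariant_on_def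
    proof (intro conjI ballI)
      have UEm: "U ` E \<in> sets borel"
        using fdsub_closed[OF UE] by simp
      show "AE x in ?M. x \<in> U ` E"
        using leb_AE[OF assms(1)] by (subst AE_distr_iff) (auto elim: eventually_mono simp: UEm)
      fix f :: "pt \<Rightarrow> ennreal" and v assume f[measurable]: "f \<in> borel_measurable borel" and v: "v \<in> U ` E"
      then obtain w where w: "w \<in> E" "v = U w" by auto
      have "(\<integral>\<^sup>+x. f (v + x) \<partial>?M) = (\<integral>\<^sup>+x. f (U (w + x)) \<partial>leb E)"
        by (subst nn_integral_distr) (auto simp: w linear_add[OF lin])
      also have "\<dots> = (\<integral>\<^sup>+x. f (U x) \<partial>leb E)"
        by (rule leb_translate[OF assms(1) _ w(1)]) measurable
      also have "\<dots> = (\<integral>\<^sup>+x. f x \<partial>?M)"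
        by (subst nn_integral_distr) auto
      finally show "(\<integral>\<^sup>+x. f (v + x) \<partial>?M) = (\<integral>\<^sup>+x. f x \<partial>?M)" .
    qed
    show "emeasure ?M (cball 0 1) = emeasure (leb (U ` E)) (cball 0 1)"
      by (rule ball) simp
  qed (use UE in \<open>auto simp: leb_sigma_finite leb_translation_invariant fdsub_subspace leb_cball\<close>)
  then have "(\<integral>\<^sup>+x. f x \<partial>leb (U ` E)) = (\<integral>\<^sup>+x. f x \<partial>?M)" by simp
  then show ?thesis
    using assms(3) by (simp add: nn_integral_distr)
qed

section \<open>Polar coordinates and the invariant measure on the sphere\<close>

lemma measurable_sgn_pt [measurable]: "(sgn :: pt \<Rightarrow> pt) \<in> borel_measurable borel"
  unfolding sgn_div_norm[abs_def] by measurable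

text \<open>Each line parallel to \<xi> meets the hyperplane in a single point, and points are null
  on the line.\<close>

lemma leb_hyperplane_null:
  assumes "fdsub E" "\<xi> \<in> E" "norm \<xi> = 1"
  shows "AE x in leb E. x \<bullet> \<xi> \<noteq> 0"
proof -
  have "(\<integral>\<^sup>+x. indicator {x. x \<bullet> \<xi> = 0} x \<partial>leb E)
      = (\<integral>\<^sup>+y. (\<integral>\<^sup>+t. indicator {x. x \<bullet> \<xi> = 0} (t *\<^sub>R \<xi> + y) \<partial>lborel) \<partial>leb (E \<inter> hyperplane_perp \<xi>))"
    by (rule leb_split) (use assms in auto)
  also have "\<dots> = (\<integral>\<^sup>+y. 0 \<partial>leb (E \<inter> hyperplane_perp \<xi>))"
  proof (rule nn_integral_cong_AE, use leb_AE[OF fdsub_perp[OF assms(1), of \<xi>]] in eventually_elim)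
    case (elim y)
    then have "indicator {x. x \<bullet> \<xi> = 0} (t *\<^sub>R \<xi> + y) = (indicator {0} t :: ennreal)" for t
      using assms(3) by (simp add: hyperplane_perp_def inner_add_left norm_eq_1 indicator_def)
    then show ?case by simp
  qed
  finally have "emeasure (leb E) {x. x \<bullet> \<xi> = 0} = 0" by simp
  then show ?thesis
    by (intro AE_I[of _ _ "{x. x \<bullet> \<xi> = 0}"]) auto
qed

lemma leb_AE_nonzero:
  assumes "fdsub E" "dim E > 0"
  shows "AE x in leb E. x \<noteq> 0"
proof -
  obtain \<xi> where "\<xi> \<in> E" "norm \<xi> = 1"
    using fdsub_ex_unit[OF assms] by blast
  then have "AE x in leb E. x \<bullet> \<xi> \<noteq> 0"
    by (rule leb_hyperplane_null[OF assms(1)])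
  then show ?thesis
    by eventually_elim auto
qed

text \<open>The condition ranges over all nonzero vectors of \<open>E\<close> instead of unit
  vectors only. This forces \<rho> to be homogeneous of degree -1, so that it may be integrated over
  an annulus before any measure on the sphere is at hand.\<close>

definition radial_on :: "pt set \<Rightarrow> pt set \<Rightarrow> (pt \<Rightarrow> real) \<Rightarrow> bool" where
  "radial_on E K \<rho> \<longleftrightarrow> \<rho> \<in> borel_measurable borel \<and> (\<forall>x. 0 \<le> \<rho> x) \<and>
     (\<forall>x\<in>E - {0}. \<forall>t>0. t *\<^sub>R x \<in> K \<longleftrightarrow> t \<le> \<rho> x)"

lemma radial_on_cball: "radial_on E (cball 0 1) (\<lambda>x. 1 / norm x)"
  by (auto simp: radial_on_def field_simps)

lemma radial_on_scale:
  assumes "radial_on E K \<rho>" "x \<in> E" "x \<noteq> 0" "subspace E"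
  shows "\<rho> x = \<rho> (sgn x) / norm x"
proof -
  have iff: "t \<le> \<rho> x \<longleftrightarrow> t \<le> \<rho> (sgn x) / norm x" if "t > 0" for t
  proof -
    have "sgn x \<in> E - {0}"
      using assms by (auto simp: sgn_div_norm subspace_scale)
    then have "(t * norm x) *\<^sub>R sgn x \<in> K \<longleftrightarrow> t * norm x \<le> \<rho> (sgn x)"
      using assms that by (simp add: radial_on_def)
    moreover have "(t * norm x) *\<^sub>R sgn x = t *\<^sub>R x"
      using assms by (simp add: sgn_div_norm)
    ultimately show ?thesis
      using assms that by (simp add: radial_on_def pos_le_divide_eq)
  qed
  have nn: "0 \<le> \<rho> x" "0 \<le> \<rho> (sgn x) / norm x"
    using assms(1) by (auto simp: radial_on_def)
  show ?thesis
  proof (rule antisym)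
    show "\<rho> x \<le> \<rho> (sgn x) / norm x"
      using iff[of "\<rho> x"] nn by (cases "\<rho> x = 0") auto
    show "\<rho> (sgn x) / norm x \<le> \<rho> x"
      using iff[of "\<rho> (sgn x) / norm x"] nn by (cases "\<rho> (sgn x) / norm x = 0") auto
  qed
qed

text \<open>Its logarithmic thickness is 1, so every ray meets it in mass 1 with respect to dt/t; no
  further normalisation is needed in the polar formula.\<close>

definition annulus :: "pt set" where
  "annulus = {x. 1 < norm x \<and> norm x \<le> exp 1}"

lemma annulus_measurable [measurable]: "annulus \<in> sets borel"
  unfolding annulus_def by measurable

lemma nn_integral_log_annulus:
  assumes "x \<noteq> 0"
  shows "(\<integral>\<^sup>+t. indicator {0<..} t * indicator annulus ((1 / t) *\<^sub>R x) * ennreal (1 / t) \<partial>lborel) = 1"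
proof -
  let ?a = "norm x / exp 1"
  have a: "0 < ?a" "?a \<le> norm x"
    using assms by (auto simp: field_simps)
  have m: "(\<lambda>t::real. 1 / t) \<in> borel_measurable borel" by measurable
  have "(\<integral>\<^sup>+t. indicator {0<..} t * indicator annulus ((1 / t) *\<^sub>R x) * ennreal (1 / t) \<partial>lborel)
      = (\<integral>\<^sup>+t. ennreal (1 / t) * indicator {?a..norm x} t \<partial>lborel)"
  \<comment> \<open>The value t = norm x lies in the closed interval but not in the half-open
    annulus condition; it is a null set.\<close>
  proof (rule nn_integral_cong_AE, use AE_lborel_singleton[of "norm x"] in eventually_elim)
    case (elim t)
    have "(0 < t \<and> 1 < norm x / t \<and> norm x / t \<le> exp 1) \<longleftrightarrow> (?a \<le> t \<and> t \<le> norm x)"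
    proof (cases "t > 0")
      case True
      then show ?thesis using elim by (auto simp: field_simps)
    qed (use a in auto)
    then show ?case
      by (auto simp: annulus_def indicator_def)
  qed
  also have "\<dots> = ln (norm x) - ln ?a"
  proof (rule nn_integral_FTC_Icc[OF m, where F = ln])
    fix t assume "t \<in> {?a..norm x}"
    then have "0 < t" using a(1) by simp
    then show "DERIV ln t :> 1 / t" "0 \<le> 1 / t"
      by (auto intro: DERIV_ln_divide)
  qed (rule a)
  also have "\<dots> = 1"
    using assms by (simp add: ln_div)
  finally show ?thesis .
qed

lemma nn_integral_power_Ioc:
  assumes "0 \<le> r" "m > 0"
  shows "(\<integral>\<^sup>+t. indicator {0<..} t * ennreal (t ^ (m - 1)) * indicator {t. t \<le> r} t \<partial>lborel) = ennreal (r ^ m / m)"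
proof -
  have "(\<integral>\<^sup>+t. indicator {0<..} t * ennreal (t ^ (m - 1)) * indicator {t. t \<le> r} t \<partial>lborel)
      = (\<integral>\<^sup>+t. ennreal (t ^ (m - 1)) * indicator {0..r} t \<partial>lborel)"
    by (rule nn_integral_cong_AE, use AE_lborel_singleton[of "0::real"] in eventually_elim)
       (auto simp: indicator_def)
  also have "\<dots> = r ^ m / m - 0 ^ m / m"
    by (rule nn_integral_FTC_Icc) (use assms in \<open>auto intro!: derivative_eq_intros\<close>)
  finally show ?thesis using assms by (simp add: zero_power)
qed

text \<open>The double integral of \<open>1\<^sub>K(x) 1\<^sub>A(x/t) / t\<close> over \<open>x\<close> and \<open>t > 0\<close>, with
  \<open>A\<close> the annulus, is evaluated in both orders, after rescaling \<open>x\<close> by \<open>t\<close> in one of them.\<close>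

lemma emeasure_leb_radial:
  assumes E: "fdsub E" "dim E > 0" and K[measurable]: "K \<in> sets borel" and \<rho>: "radial_on E K \<rho>"
  shows "emeasure (leb E) K = (\<integral>\<^sup>+x. indicator annulus x * ennreal (\<rho> x ^ dim E / dim E) \<partial>leb E)"
proof -
  define m where "m = dim E"
  interpret E: sigma_finite_measure "leb E" by (rule leb_sigma_finite) fact
  interpret pair_sigma_finite "leb E" lborel ..
  have [measurable]: "\<rho> \<in> borel_measurable borel"
    using \<rho> by (simp add: radial_on_def)
  have "emeasure (leb E) K = (\<integral>\<^sup>+x. indicator K x \<partial>leb E)"
    by simp
  also have "\<dots> = (\<integral>\<^sup>+x. (\<integral>\<^sup>+t. indicator K x * (indicator {0<..} t * indicator annulus ((1 / t) *\<^sub>R x) * ennreal (1 / t)) \<partial>lborel) \<partial>leb E)"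
  proof (rule nn_integral_cong_AE, use leb_AE_nonzero[OF E] in eventually_elim)
    case (elim x)
    then show ?case
      by (subst nn_integral_cmult) (simp_all add: nn_integral_log_annulus)
  qed
  also have "\<dots> = (\<integral>\<^sup>+t. (\<integral>\<^sup>+x. indicator K x * (indicator {0<..} t * indicator annulus ((1 / t) *\<^sub>R x) * ennreal (1 / t)) \<partial>leb E) \<partial>lborel)"
    by (rule Fubini'[symmetric]) measurable
  also have "\<dots> = (\<integral>\<^sup>+t. (\<integral>\<^sup>+x. indicator annulus x * (indicator {0<..} t * ennreal (t ^ (m - 1)) * indicator K (t *\<^sub>R x)) \<partial>leb E) \<partial>lborel)"
  proof (rule nn_integral_cong)
    fix t :: real
    show "(\<integral>\<^sup>+x. indicator K x * (indicator {0<..} t * indicator annulus ((1 / t) *\<^sub>R x) * ennreal (1 / t)) \<partial>leb E)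
      = (\<integral>\<^sup>+x. indicator annulus x * (indicator {0<..} t * ennreal (t ^ (m - 1)) * indicator K (t *\<^sub>R x)) \<partial>leb E)"
    proof (cases "t > 0")
      case True
      have tm: "ennreal (t ^ m) * ennreal (1 / t) = ennreal (t ^ (m - 1))"
        using True E(2) by (cases m) (auto simp: ennreal_mult'[symmetric] m_def)
      have "(\<integral>\<^sup>+x. indicator K x * (indicator {0<..} t * indicator annulus ((1 / t) *\<^sub>R x) * ennreal (1 / t)) \<partial>leb E)
        = ennreal (\<bar>t\<bar> ^ m) * (\<integral>\<^sup>+x. indicator K (t *\<^sub>R x) * (indicator {0<..} t * indicator annulus ((1 / t) *\<^sub>R (t *\<^sub>R x)) * ennreal (1 / t)) \<partial>leb E)"
        unfolding m_def by (rule leb_scale) (use E True in auto)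
      also have "\<dots> = (\<integral>\<^sup>+x. ennreal (\<bar>t\<bar> ^ m) * (indicator K (t *\<^sub>R x) * (indicator {0<..} t * indicator annulus ((1 / t) *\<^sub>R (t *\<^sub>R x)) * ennreal (1 / t))) \<partial>leb E)"
        by (rule nn_integral_cmult[symmetric]) measurable
      also have "\<dots> = (\<integral>\<^sup>+x. indicator annulus x * (indicator {0<..} t * ennreal (t ^ (m - 1)) * indicator K (t *\<^sub>R x)) \<partial>leb E)"
        using True tm by (intro nn_integral_cong) (auto simp: indicator_def)
      finally show ?thesis .
    qed simp
  qed
  also have "\<dots> = (\<integral>\<^sup>+x. (\<integral>\<^sup>+t. indicator annulus x * (indicator {0<..} t * ennreal (t ^ (m - 1)) * indicator K (t *\<^sub>R x)) \<partial>lborel) \<partial>leb E)"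
    by (rule Fubini') measurable
  also have "\<dots> = (\<integral>\<^sup>+x. indicator annulus x * ennreal (\<rho> x ^ m / m) \<partial>leb E)"
  proof (rule nn_integral_cong_AE, use leb_AE_nonzero[OF E] leb_AE[OF E(1)] in eventually_elim)
    case (elim x)
    have "(\<integral>\<^sup>+t. indicator annulus x * (indicator {0<..} t * ennreal (t ^ (m - 1)) * indicator K (t *\<^sub>R x)) \<partial>lborel)
        = indicator annulus x * (\<integral>\<^sup>+t. indicator {0<..} t * ennreal (t ^ (m - 1)) * indicator K (t *\<^sub>R x) \<partial>lborel)"
      by (rule nn_integral_cmult) measurable
    also have "(\<integral>\<^sup>+t. indicator {0<..} t * ennreal (t ^ (m - 1)) * indicator K (t *\<^sub>R x) \<partial>lborel)
        = (\<integral>\<^sup>+t. indicator {0<..} t * ennreal (t ^ (m - 1)) * indicator {t. t \<le> \<rho> x} t \<partial>lborel)"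
      using \<rho> elim by (intro nn_integral_cong) (auto simp: indicator_def radial_on_def)
    also have "\<dots> = ennreal (\<rho> x ^ m / m)"
      by (rule nn_integral_power_Ioc) (use \<rho> E(2) in \<open>auto simp: radial_on_def m_def\<close>)
    finally show ?case .
  qed
  finally show ?thesis by (simp add: m_def)
qed

section \<open>Uniqueness of the rotation invariant probability on a sphere\<close>

definition rot_inv :: "pt set \<Rightarrow> pt measure \<Rightarrow> bool" where
  "rot_inv E M \<longleftrightarrow> prob_space M \<and> sets M = sets borel \<and> (AE x in M. x \<in> sphere 0 1 \<inter> E) \<and>
     (\<forall>U. orthogonal_transformation U \<and> U ` E = E \<longrightarrow> distr M borel U = M)"

text \<open>The reflection exchanging the two centres preserves the measure and carries one ball to
  the other.\<close>

lemma rot_inv_ball_eq: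
  assumes M: "rot_inv E M" and E: "subspace E" and "x \<in> sphere 0 1 \<inter> E" "y \<in> sphere 0 1 \<inter> E"
  shows "emeasure M (ball x \<delta>) = emeasure M (ball y \<delta>)"
proof -
  obtain U where U: "orthogonal_transformation U" "\<And>z. U (U z) = z" "U ` E = E" "U x = y"
    by (rule reflection[OF E, of x y]) (use assms(3,4) in auto)
  have s: "sets M = sets borel" using M by (simp add: rot_inv_def)
  note [measurable_cong] = s
  have [measurable]: "U \<in> borel_measurable borel"
    by (rule orthogonal_transformation_measurable) fact
  have pre: "U -` ball y \<delta> = ball x \<delta>"
  proof -
    have "dist y (U z) = dist x z" for z
    proof -
      have "norm (U (x - z)) = norm (x - z)"
        using U(1) by (simp add: orthogonal_transformation)
      moreover have "U (x - z) = y - U z"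
        using U(1,4) by (simp add: orthogonal_transformation linear_diff)
      ultimately have "norm (x - z) = norm (y - U z)" by simp
      then show ?thesis by (simp add: dist_norm)
    qed
    then show ?thesis by auto
  qed
  have "emeasure M (ball y \<delta>) = emeasure (distr M borel U) (ball y \<delta>)"
    using M U by (simp add: rot_inv_def)
  also have "\<dots> = emeasure M (U -` ball y \<delta> \<inter> space M)"
    by (rule emeasure_distr) measurable
  also have "\<dots> = emeasure M (ball x \<delta>)"
    using sets_eq_imp_space_eq[OF s] by (simp add: pre)
  finally show ?thesis by simp
qed

text \<open>If one such ball were null, all of them would be, and by Lindelof countably many cover
  the sphere, which carries the whole mass.\<close>

lemma rot_inv_ball_pos:
  assumes M: "rot_inv E M" and E: "subspace E" and x: "x \<in> sphere 0 1 \<inter> E" and "\<delta> > 0"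
  shows "emeasure M (ball x \<delta>) > 0"
proof (rule ccontr)
  have s: "sets M = sets borel" using M by (simp add: rot_inv_def)
  assume "\<not> ?thesis"
  then have null: "ball y \<delta> \<in> null_sets M" if "y \<in> sphere 0 1 \<inter> E" for y
    using rot_inv_ball_eq[OF M E x that] s by (auto simp: null_sets_def)
  obtain F where F: "F \<subseteq> (\<lambda>y. ball y \<delta>) ` (sphere 0 1 \<inter> E)" "countable F"
    "\<Union>F = \<Union>((\<lambda>y. ball y \<delta>) ` (sphere 0 1 \<inter> E))"
    using Lindelof[of "(\<lambda>y. ball y \<delta>) ` (sphere 0 1 \<inter> E)"] by auto
  have "\<Union>F \<in> null_sets M"
  proof -
    have "(\<Union>A\<in>F. A) \<in> null_sets M"
      by (rule null_sets_UN'[OF F(2)]) (use F(1) null in blast)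
    then show ?thesis by simp
  qed
  then have "AE y in M. y \<notin> \<Union>F"
    by (rule AE_not_in)
  moreover have "AE y in M. y \<in> \<Union>F"
  proof -
    have "AE y in M. y \<in> sphere 0 1 \<inter> E" using M by (simp add: rot_inv_def)
    then show ?thesis
      by eventually_elim (use \<open>\<delta> > 0\<close> in \<open>unfold F(3), force\<close>)
  qed
  ultimately have "AE y in M. False"
    by eventually_elim simp
  then show False
    using M prob_space.AE_False unfolding rot_inv_def by blast
qed

text \<open>Christensen's argument for uniformly distributed measures: around a point of the open
  set, the fraction of a small ball lying in the set becomes 1. Averaging this fraction over
  \<open>M\<close> and applying Fatou bounds \<open>M\<close> of the set by double integrals over
  close pairs, and by Fubini each of these is at most \<open>N\<close> of the set. Used in both
  directions it gives equality on open sets.\<close>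

lemma rot_inv_open_le:
  assumes M: "rot_inv E M" and N: "rot_inv E N" and E: "subspace E" and "open G"
    and e: "e \<in> sphere 0 1 \<inter> E"
  shows "emeasure M G \<le> emeasure N G"
proof -
  have [measurable_cong]: "sets M = sets borel" "sets N = sets borel"
    using M N by (auto simp: rot_inv_def)
  have spc: "space M = UNIV" "space N = UNIV"
    using M N sets_eq_imp_space_eq[of M borel] sets_eq_imp_space_eq[of N borel] by (auto simp: rot_inv_def)
  have [measurable]: "G \<in> sets borel" using \<open>open G\<close> by simp
  have AM: "AE y in M. y \<in> sphere 0 1 \<inter> E" and AN: "AE y in N. y \<in> sphere 0 1 \<inter> E"
    using M N by (auto simp: rot_inv_def)
  interpret M: prob_space M using M by (simp add: rot_inv_def)
  interpret N: prob_space N using N by (simp add: rot_inv_def)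
  interpret pair_sigma_finite M N ..
  define k h where "k \<delta> = emeasure N (ball e \<delta>)" and "h \<delta> = emeasure M (ball e \<delta>)" for \<delta>
  have ballM: "(\<integral>\<^sup>+x. indicator {z. dist (fst z) (snd z) < \<delta>} (x, y) \<partial>M) = h \<delta>"
    if "y \<in> sphere 0 1 \<inter> E" for y \<delta>
  proof -
    have "(\<integral>\<^sup>+x. indicator {z. dist (fst z) (snd z) < \<delta>} (x, y) \<partial>M) = (\<integral>\<^sup>+x. indicator (ball y \<delta>) x \<partial>M)"
      by (intro nn_integral_cong) (simp add: indicator_def dist_commute)
    then show ?thesis
      using rot_inv_ball_eq[OF M E e that] by (simp add: h_def)
  qed
  have ballN: "(\<integral>\<^sup>+y. indicator {z. dist (fst z) (snd z) < \<delta>} (x, y) \<partial>N) = k \<delta>"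
    if "x \<in> sphere 0 1 \<inter> E" for x \<delta>
  proof -
    have "(\<integral>\<^sup>+y. indicator {z. dist (fst z) (snd z) < \<delta>} (x, y) \<partial>N) = (\<integral>\<^sup>+y. indicator (ball x \<delta>) y \<partial>N)"
      by (intro nn_integral_cong) (simp add: indicator_def)
    then show ?thesis
      using rot_inv_ball_eq[OF N E e that] by (simp add: k_def)
  qed
  have D[measurable]: "{z::pt\<times>pt. dist (fst z) (snd z) < \<delta>} \<in> sets (borel \<Otimes>\<^sub>M borel)" for \<delta>
    unfolding borel_prod by (intro borel_open open_Collect_less continuous_intros)
  \<comment> \<open>Both numbers are the product mass of the pairs at distance less than \<delta>,
    computed in the two orders; this uses that both measures have total mass 1.\<close>
  have hk: "h \<delta> = k \<delta>" for \<delta>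
  proof -
    have "h \<delta> = (\<integral>\<^sup>+y. h \<delta> \<partial>N)" by (simp add: N.emeasure_space_1)
    also have "\<dots> = (\<integral>\<^sup>+y. (\<integral>\<^sup>+x. indicator {z. dist (fst z) (snd z) < \<delta>} (x, y) \<partial>M) \<partial>N)"
      by (rule nn_integral_cong_AE, use AN in eventually_elim) (simp only: ballM)
    also have "\<dots> = (\<integral>\<^sup>+x. (\<integral>\<^sup>+y. indicator {z. dist (fst z) (snd z) < \<delta>} (x, y) \<partial>N) \<partial>M)"
      by (rule Fubini') measurable
    also have "\<dots> = (\<integral>\<^sup>+x. k \<delta> \<partial>M)"
      by (rule nn_integral_cong_AE, use AM in eventually_elim) (simp only: ballN)
    also have "\<dots> = k \<delta>" by (simp add: M.emeasure_space_1)
    finally show ?thesis .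
  qed
  have k: "k \<delta> > 0" "k \<delta> < \<infinity>" if "\<delta> > 0" for \<delta>
    using rot_inv_ball_pos[OF N E e that] N.emeasure_finite[of "ball e \<delta>"]
    by (simp_all add: k_def less_top[symmetric])
  define d where "d i = 1 / real (Suc i)" for i
  have d: "d i > 0" for i by (simp add: d_def)
  \<comment> \<open>For x in \<open>G\<close> this is the proportion, with respect to
    \<open>N\<close>, of the ball of radius \<open>d i\<close> around x that lies in
    \<open>G\<close>; it equals 1 once the ball is contained in \<open>G\<close>.\<close>
  define u where "u i x = (1 / k (d i)) * (\<integral>\<^sup>+y. indicator G x * indicator G y *
      indicator {z. dist (fst z) (snd z) < d i} (x, y) \<partial>N)" for i x
  have [measurable]: "u i \<in> borel_measurable M" for i
    unfolding u_def by measurable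
  have lim: "indicator G x \<le> liminf (\<lambda>i. u i x)" if x: "x \<in> sphere 0 1 \<inter> E" for x
  proof (cases "x \<in> G")
    case True
    then obtain r where r: "r > 0" "ball x r \<subseteq> G"
      using \<open>open G\<close> by (auto elim: openE)
    have "d \<longlonglongrightarrow> 0"
      unfolding d_def using LIMSEQ_inverse_real_of_nat by (simp add: inverse_eq_divide)
    then have "\<forall>\<^sub>F i in sequentially. d i < r"
      using r(1) by (rule order_tendstoD)
    then have "\<forall>\<^sub>F i in sequentially. 1 \<le> u i x"
    proof eventually_elim
      case (elim i)
      have "(\<integral>\<^sup>+y. indicator G x * indicator G y * indicator {z. dist (fst z) (snd z) < d i} (x, y) \<partial>N)
          = (\<integral>\<^sup>+y. indicator {z. dist (fst z) (snd z) < d i} (x, y) \<partial>N)"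
        by (intro nn_integral_cong) (use True r(2) elim in \<open>auto simp: indicator_def subset_iff\<close>)
      then have "u i x = (1 / k (d i)) * k (d i)"
        by (simp add: u_def ballN[OF x])
      also have "\<dots> = 1"
        using k[OF d[of i]] by (simp add: ennreal_divide_times ennreal_divide_self)
      finally show ?case by simp
    qed
    then have "1 \<le> liminf (\<lambda>i. u i x)"
      by (rule Liminf_bounded)
    then show ?thesis using True by simp
  qed simp
  have "emeasure M G = (\<integral>\<^sup>+x. indicator G x \<partial>M)"
    by simp
  also have "\<dots> \<le> (\<integral>\<^sup>+x. liminf (\<lambda>i. u i x) \<partial>M)"
    by (rule nn_integral_mono_AE, use AM in eventually_elim) (rule lim)
  also have "\<dots> \<le> liminf (\<lambda>i. \<integral>\<^sup>+x. u i x \<partial>M)"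
    by (rule nn_integral_liminf) measurable
  also have "\<dots> \<le> liminf (\<lambda>i. emeasure N G)"
  proof (intro Liminf_mono always_eventually allI)
    fix i
    have "(\<integral>\<^sup>+x. u i x \<partial>M) = (1 / k (d i)) * (\<integral>\<^sup>+x. (\<integral>\<^sup>+y. indicator G x * indicator G y *
      indicator {z. dist (fst z) (snd z) < d i} (x, y) \<partial>N) \<partial>M)"
      unfolding u_def by (rule nn_integral_cmult) measurable
    also have "(\<integral>\<^sup>+x. (\<integral>\<^sup>+y. indicator G x * indicator G y * indicator {z. dist (fst z) (snd z) < d i} (x, y) \<partial>N) \<partial>M)
       = (\<integral>\<^sup>+y. (\<integral>\<^sup>+x. indicator G x * indicator G y * indicator {z. dist (fst z) (snd z) < d i} (x, y) \<partial>M) \<partial>N)"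
      by (rule Fubini'[symmetric]) measurable
    also have "\<dots> \<le> (\<integral>\<^sup>+y. indicator G y * (\<integral>\<^sup>+x. indicator {z. dist (fst z) (snd z) < d i} (x, y) \<partial>M) \<partial>N)"
    proof (rule nn_integral_mono)
      fix y
      have "(\<integral>\<^sup>+x. indicator G x * indicator G y * indicator {z. dist (fst z) (snd z) < d i} (x, y) \<partial>M)
        \<le> (\<integral>\<^sup>+x. indicator G y * indicator {z. dist (fst z) (snd z) < d i} (x, y) \<partial>M)"
        by (rule nn_integral_mono) (auto simp: indicator_def)
      also have "\<dots> = indicator G y * (\<integral>\<^sup>+x. indicator {z. dist (fst z) (snd z) < d i} (x, y) \<partial>M)"
        by (rule nn_integral_cmult) measurable
      finally show "(\<integral>\<^sup>+x. indicator G x * indicator G y * indicator {z. dist (fst z) (snd z) < d i} (x, y) \<partial>M)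
        \<le> indicator G y * (\<integral>\<^sup>+x. indicator {z. dist (fst z) (snd z) < d i} (x, y) \<partial>M)" .
    qed
    also have "\<dots> = (\<integral>\<^sup>+y. indicator G y * k (d i) \<partial>N)"
      by (rule nn_integral_cong_AE, use AN in eventually_elim) (simp only: ballM hk)
    also have "\<dots> = emeasure N G * k (d i)"
      by (subst nn_integral_multc) auto
    finally have "(\<integral>\<^sup>+x. u i x \<partial>M) \<le> (1 / k (d i)) * (emeasure N G * k (d i))"
      by (simp add: mult_left_mono)
    also have "\<dots> = ((1 / k (d i)) * k (d i)) * emeasure N G"
      by (simp add: mult_ac)
    also have "\<dots> = emeasure N G"
      using k[OF d[of i]] by (simp add: ennreal_divide_times ennreal_divide_self)
    finally show "(\<integral>\<^sup>+x. u i x \<partial>M) \<le> emeasure N G" .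
  qed
  also have "\<dots> = emeasure N G"
    by (rule Liminf_const) simp
  finally show ?thesis .
qed

lemma rot_inv_unique:
  assumes M: "rot_inv E M" and N: "rot_inv E N" and E: "subspace E"
  shows "M = N"
proof -
  interpret M: prob_space M using M by (simp add: rot_inv_def)
  have "AE x in M. x \<in> sphere 0 1 \<inter> E" using M by (simp add: rot_inv_def)
  then obtain e where e: "e \<in> sphere 0 1 \<inter> E"
    using M.AE_False by (metis (mono_tags, lifting) AE_mp AE_I2)
  have eq: "emeasure M G = emeasure N G" if "open G" for G
    using rot_inv_open_le[OF M N E that e] rot_inv_open_le[OF N M E that e] by simp
  show ?thesis
  proof (rule measure_eqI_generator_eq[where E = "{S. open S}" and \<Omega> = UNIV and A = "\<lambda>_. UNIV"])
    show "sets M = sigma_sets UNIV {S. open S}" "sets N = sigma_sets UNIV {S. open S}"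
      using M N by (auto simp: rot_inv_def borel_def)
    show "Int_stable {S::pt set. open S}"
      by (auto simp: Int_stable_def)
    show "emeasure M UNIV \<noteq> \<infinity>" using M.emeasure_finite[of UNIV] by simp
  qed (auto simp: eq)
qed

section \<open>The uniform probability on the sphere as a radial image of Lebesgue measure\<close>

lemma sphere_Int_borel:
  assumes "fdsub (E :: pt set)"
  shows "sphere 0 1 \<inter> E \<in> sets borel"
proof -
  have "{x :: pt. norm x = 1} \<in> sets borel" by measurable
  moreover have "sphere (0::pt) 1 = {x. norm x = 1}" by auto
  ultimately show ?thesis
    using fdsub_closed[OF assms] by auto
qed

text \<open>The polar formula for the unit ball, whose radial function is 1 / norm x, evaluates the
  integral: it is the surface area of the unit sphere of \<open>E\<close>.\<close>

lemma annulus_mass: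
  assumes E: "fdsub E" "dim E > 0"
  shows "(\<integral>\<^sup>+x. indicator annulus x * ennreal ((1 / norm x) ^ dim E) \<partial>leb E) = ennreal (dim E * unit_ball_vol (dim E))"
proof -
  have "ennreal (unit_ball_vol (dim E)) = emeasure (leb E) (cball 0 1)"
    using leb_cball[OF E(1), of 1] by simp
  also have "\<dots> = (\<integral>\<^sup>+x. indicator annulus x * ennreal ((1 / norm x) ^ dim E / dim E) \<partial>leb E)"
    by (rule emeasure_leb_radial[OF E _ radial_on_cball]) simp
  finally have "ennreal (dim E) * ennreal (unit_ball_vol (dim E))
      = ennreal (dim E) * (\<integral>\<^sup>+x. indicator annulus x * ennreal ((1 / norm x) ^ dim E / dim E) \<partial>leb E)"
    by simp
  also have "\<dots> = (\<integral>\<^sup>+x. ennreal (dim E) * (indicator annulus x * ennreal ((1 / norm x) ^ dim E / dim E)) \<partial>leb E)"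
    by (rule nn_integral_cmult[symmetric]) measurable
  also have "\<dots> = (\<integral>\<^sup>+x. indicator annulus x * ennreal ((1 / norm x) ^ dim E) \<partial>leb E)"
    by (intro nn_integral_cong) (use E(2) in \<open>auto simp: indicator_def ennreal_mult'[symmetric]\<close>)
  finally show ?thesis
    by (simp add: ennreal_mult')
qed

text \<open>The power of the norm makes the weighted Lebesgue measure invariant under dilations,
  which matches the homogeneity of radial functions, and the divisor is the surface area of the unit
  sphere. Spreading the mass over an annulus is necessary because the sphere itself is a Lebesgue
  null set.\<close>

definition sphere_weight :: "pt set \<Rightarrow> pt \<Rightarrow> ennreal" where
  "sphere_weight E x = indicator annulus x * ennreal ((1 / norm x) ^ dim E / (dim E * unit_ball_vol (dim E)))"

definition usphere :: "pt set \<Rightarrow> pt measure" where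
  "usphere E = distr (density (leb E) (sphere_weight E)) borel sgn"

lemma sphere_weight_measurable [measurable]: "sphere_weight E \<in> borel_measurable borel"
  unfolding sphere_weight_def[abs_def] by measurable

lemma sets_usphere [simp, measurable_cong]: "sets (usphere E) = sets borel"
  and space_usphere [simp]: "space (usphere E) = UNIV"
  by (simp_all add: usphere_def)

lemma nn_integral_usphere:
  assumes [measurable]: "f \<in> borel_measurable borel"
  shows "(\<integral>\<^sup>+x. f x \<partial>usphere E) = (\<integral>\<^sup>+x. sphere_weight E x * f (sgn x) \<partial>leb E)"
  unfolding usphere_def by (subst nn_integral_distr) (auto simp: nn_integral_density)

lemma prob_space_usphere:
  assumes E: "fdsub E" "dim E > 0"
  shows "prob_space (usphere E)"
proof
  let ?c = "dim E * unit_ball_vol (dim E)"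
  have c: "?c > 0" using E(2) by simp
  have "emeasure (usphere E) (space (usphere E)) = (\<integral>\<^sup>+x. 1 \<partial>usphere E)"
    by simp
  also have "\<dots> = (\<integral>\<^sup>+x. sphere_weight E x \<partial>leb E)"
    by (subst nn_integral_usphere) auto
  also have "\<dots> = (\<integral>\<^sup>+x. (indicator annulus x * ennreal ((1 / norm x) ^ dim E)) * ennreal (1 / ?c) \<partial>leb E)"
    using E(2) by (intro nn_integral_cong) (auto simp: sphere_weight_def indicator_def ennreal_mult'[symmetric])
  also have "\<dots> = ennreal ?c * ennreal (1 / ?c)"
    by (subst nn_integral_multc) (auto simp: annulus_mass[OF E])
  also have "\<dots> = ennreal (?c * (1 / ?c))"
    using c by (subst ennreal_mult) auto
  also have "?c * (1 / ?c) = 1"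
    using c by (metis less_irrefl nonzero_mult_div_cancel_left times_divide_eq_right mult.right_neutral)
  also have "ennreal 1 = 1" by simp
  finally show "emeasure (usphere E) (space (usphere E)) = 1" .
qed

lemma AE_usphere_iff:
  assumes [measurable]: "Measurable.pred borel P"
    and "AE x in leb E. P (sgn x)"
  shows "AE x in usphere E. P x"
proof -
  have P[measurable]: "{x. P x} \<in> sets borel" by measurable
  have "AE x in density (leb E) (sphere_weight E). P (sgn x)"
    using assms(2) by (subst AE_density) (auto elim: eventually_mono)
  then show ?thesis
    unfolding usphere_def by (subst AE_distr_iff) auto
qed

lemma AE_usphere_hyperplane:
  assumes E: "fdsub E" and \<xi>: "\<xi> \<in> E" "norm \<xi> = 1"
  shows "AE x in usphere E. x \<bullet> \<xi> \<noteq> 0"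
proof (rule AE_usphere_iff)
  show "AE x in leb E. sgn x \<bullet> \<xi> \<noteq> 0"
    using leb_hyperplane_null[OF E \<xi>]
    by eventually_elim (auto simp: sgn_div_norm)
qed measurable

lemma AE_usphere_sphere:
  assumes E: "fdsub E" "dim E > 0"
  shows "AE x in usphere E. x \<in> sphere 0 1 \<inter> E"
proof (rule AE_usphere_iff)
  have "sphere 0 1 \<inter> E \<in> sets borel" by (rule sphere_Int_borel[OF E(1)])
  then show "Measurable.pred borel (\<lambda>x. x \<in> sphere 0 1 \<inter> E)"
    by (rule pred_sets2) simp
  show "AE x in leb E. sgn x \<in> sphere 0 1 \<inter> E"
    using leb_AE_nonzero[OF E] leb_AE[OF E(1)]
    by eventually_elim (auto simp: norm_sgn sgn_div_norm subspace_scale[OF fdsub_subspace[OF E(1)]])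
qed

lemma rot_inv_usphere:
  assumes E: "fdsub E" "dim E > 0"
  shows "rot_inv E (usphere E)"
  unfolding rot_inv_def
proof (intro conjI allI impI)
  fix U :: "pt \<Rightarrow> pt" assume U: "orthogonal_transformation U \<and> U ` E = E"
  have [measurable]: "U \<in> borel_measurable borel"
    using U orthogonal_transformation_measurable by blast
  have nrm: "norm (U x) = norm x" and sg: "sgn (U x) = U (sgn x)" for x
  proof -
    show "norm (U x) = norm x" using U by (simp add: orthogonal_transformation)
    then show "sgn (U x) = U (sgn x)"
      using U by (simp add: sgn_div_norm orthogonal_transformation linear_scale)
  qed
  show "distr (usphere E) borel U = usphere E"
  proof (rule measure_eqI)
    fix A assume "A \<in> sets (distr (usphere E) borel U)"
    then have A[measurable]: "A \<in> sets borel" by simp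
    have "emeasure (distr (usphere E) borel U) A = (\<integral>\<^sup>+x. indicator A x \<partial>distr (usphere E) borel U)"
      by simp
    also have "\<dots> = (\<integral>\<^sup>+x. indicator A (U x) \<partial>usphere E)"
      by (rule nn_integral_distr) measurable
    also have "\<dots> = (\<integral>\<^sup>+x. sphere_weight E x * indicator A (U (sgn x)) \<partial>leb E)"
      by (rule nn_integral_usphere) measurable
    also have "\<dots> = (\<integral>\<^sup>+x. sphere_weight E (U x) * indicator A (sgn (U x)) \<partial>leb E)"
      by (simp add: sg sphere_weight_def annulus_def nrm indicator_def)
    also have "\<dots> = (\<integral>\<^sup>+x. sphere_weight E x * indicator A (sgn x) \<partial>leb (U ` E))"
      by (rule leb_image[symmetric]) (use U E in auto)
    also have "\<dots> = (\<integral>\<^sup>+x. sphere_weight E x * indicator A (sgn x) \<partial>leb E)"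
      using U by simp
    also have "\<dots> = (\<integral>\<^sup>+x. indicator A x \<partial>usphere E)"
      by (rule nn_integral_usphere[symmetric]) measurable
    finally show "emeasure (distr (usphere E) borel U) A = emeasure (usphere E) A"
      by simp
  qed simp
qed (use prob_space_usphere[OF E] AE_usphere_sphere[OF E] in auto)

lemma rot_inv_eq_usphere:
  assumes "fdsub E" "dim E > 0" "rot_inv E M"
  shows "M = usphere E"
  using rot_inv_unique[OF assms(3) rot_inv_usphere[OF assms(1,2)] fdsub_subspace[OF assms(1)]] .

text \<open>Homogeneity of \<rho> replaces its value at x by that at \<open>sgn x\<close>, which
  turns the integral over the annulus into one over the sphere.\<close>

lemma emeasure_eq_usphere:
  assumes E: "fdsub E" "dim E > 0" and K: "K \<in> sets borel" and \<rho>: "radial_on E K \<rho>"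
  shows "emeasure (leb E) K = ennreal (unit_ball_vol (dim E)) * (\<integral>\<^sup>+x. ennreal (\<rho> x ^ dim E) \<partial>usphere E)"
proof -
  let ?w = "unit_ball_vol (dim E)"
  have [measurable]: "\<rho> \<in> borel_measurable borel" and nn: "0 \<le> \<rho> x" for x
    using \<rho> by (auto simp: radial_on_def)
  have "ennreal ?w * (\<integral>\<^sup>+x. ennreal (\<rho> x ^ dim E) \<partial>usphere E)
      = ennreal ?w * (\<integral>\<^sup>+x. sphere_weight E x * ennreal (\<rho> (sgn x) ^ dim E) \<partial>leb E)"
    by (subst nn_integral_usphere) auto
  also have "\<dots> = (\<integral>\<^sup>+x. ennreal ?w * (sphere_weight E x * ennreal (\<rho> (sgn x) ^ dim E)) \<partial>leb E)"
    by (rule nn_integral_cmult[symmetric]) measurable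
  also have "\<dots> = (\<integral>\<^sup>+x. indicator annulus x * ennreal (\<rho> x ^ dim E / dim E) \<partial>leb E)"
  proof (rule nn_integral_cong_AE, use leb_AE_nonzero[OF E] leb_AE[OF E(1)] in eventually_elim)
    case (elim x)
    then have "\<rho> x = \<rho> (sgn x) / norm x"
      using radial_on_scale[OF \<rho>] fdsub_subspace[OF E(1)] by auto
    then have eq: "?w * ((1 / norm x) ^ dim E / (dim E * ?w) * \<rho> (sgn x) ^ dim E) = \<rho> x ^ dim E / dim E"
      by (simp add: power_divide)
    have "ennreal ?w * (ennreal ((1 / norm x) ^ dim E / (dim E * ?w)) * ennreal (\<rho> (sgn x) ^ dim E))
        = ennreal (?w * ((1 / norm x) ^ dim E / (dim E * ?w) * \<rho> (sgn x) ^ dim E))"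
      using nn[of "sgn x"] by (simp only: ennreal_mult'[symmetric] ennreal_mult''[symmetric] zero_le_power unit_ball_vol_nonneg of_nat_0_le_iff)
    then show ?case
      unfolding eq by (simp add: sphere_weight_def indicator_def)
  qed
  also have "\<dots> = emeasure (leb E) K"
    using emeasure_leb_radial[OF E K \<rho>] by simp
  finally show ?thesis by simp
qed

text \<open>Every rotation of \<open>F\<close> extends to a rotation of \<open>E\<close> that fixes
  the complement of \<open>F\<close>, and projecting intertwines the two; the law of the normalised
  projection is thus rotation invariant. In this way means over spheres of varying subspaces become
  integrals against one fixed measure, as Fubini requires.\<close>

lemma rot_inv_proj:
  assumes E: "fdsub E" "dim E > 0" and F: "subspace F" "F \<subseteq> E" "dim F > 0"
  shows "distr (usphere E) borel (\<lambda>x. sgn (proj F x)) = usphere F"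
proof (rule rot_inv_eq_usphere)
  show F': "fdsub F" by (rule fdsub_subset[OF E(1) F(1,2)])
  show "dim F > 0" by fact
  have pm[measurable]: "proj F \<in> borel_measurable borel"
    by (intro borel_measurable_continuous_onI continuous_on_proj continuous_on_id)
  interpret E: prob_space "usphere E" by (rule prob_space_usphere[OF E])
  obtain \<xi> where \<xi>: "\<xi> \<in> F" "norm \<xi> = 1"
    using fdsub_ex_unit[OF F' F(3)] by blast
  let ?M = "distr (usphere E) borel (\<lambda>x. sgn (proj F x))"
  have Sb: "sphere 0 1 \<inter> F \<in> sets borel"
    by (rule sphere_Int_borel) fact
  show "rot_inv F ?M"
    unfolding rot_inv_def
  proof (intro conjI allI impI)
    show "prob_space ?M" by (rule E.prob_space_distr) measurable
    have "AE x in usphere E. x \<bullet> \<xi> \<noteq> 0"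
      by (rule AE_usphere_hyperplane) (use E F \<xi> in auto)
    then have "AE x in usphere E. sgn (proj F x) \<in> sphere 0 1 \<inter> F"
    proof eventually_elim
      case (elim x)
      then have "proj F x \<noteq> 0"
        using proj_inner[OF F' \<xi>(1), of x] by auto
      then show ?case
        using proj_in[OF F'] F(1) by (auto simp: norm_sgn sgn_div_norm subspace_scale)
    qed
    then show "AE x in ?M. x \<in> sphere 0 1 \<inter> F"
      using Sb by (subst AE_distr_iff) (simp_all del: Int_iff mem_sphere mem_sphere_0)
    fix V :: "pt \<Rightarrow> pt" assume V: "orthogonal_transformation V \<and> V ` F = F"
    then have linV: "linear V" and nV: "\<And>x. norm (V x) = norm x"
      by (auto simp: orthogonal_transformation)
    \<comment> \<open>The extension of \<open>V\<close>: it acts as \<open>V\<close> on the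
      component in \<open>F\<close> and as the identity on the orthogonal component.\<close>
    define W where "W x = V (proj F x) + (x - proj F x)" for x
    have linW: "linear W"
      by (rule linearI)
         (auto simp: W_def linear_add[OF linV] linear_add[OF linear_proj] linear_scale[OF linV]
            linear_scale[OF linear_proj] algebra_simps)
    have perp: "(x - proj F x) \<bullet> y = 0" if "y \<in> F" for x y
      using proj_inner[OF F' that] by (simp add: inner_diff_left)
    have VF: "V (proj F x) \<in> F" for x
      using V proj_in[OF F'] by blast
    have pW: "proj F (W x) = V (proj F x)" for x
    proof (rule proj_unique[OF F' VF])
      fix y assume "y \<in> F"
      then show "V (proj F x) \<bullet> y = W x \<bullet> y"
        by (simp add: W_def inner_add_left perp)
    qed
    have "norm (W x) = norm x" for x
    proof -
      have "norm (W x) ^ 2 = norm (V (proj F x)) ^ 2 + norm (x - proj F x) ^ 2"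
        unfolding W_def using perp[OF VF, of x x]
        by (simp add: power2_norm_eq_inner inner_add_left inner_add_right inner_commute)
      also have "\<dots> = norm (proj F x + (x - proj F x)) ^ 2"
        using perp[OF proj_in[OF F'], of x x]
        by (simp add: nV power2_norm_eq_inner inner_diff_left inner_diff_right inner_commute)
      finally show ?thesis by simp
    qed
    then have orthW: "orthogonal_transformation W"
      using linW by (simp add: orthogonal_transformation)
    have "W ` E = E"
    proof
      show "W ` E \<subseteq> E"
        using VF proj_in[OF F'] F(2) fdsub_subspace[OF E(1)]
        by (auto simp: W_def intro!: subspace_add subspace_diff)
      show "E \<subseteq> W ` E"
      proof
        fix y assume y: "y \<in> E"
        obtain g where g: "g \<in> F" "V g = proj F y"
          using V proj_in[OF F', of y] by (metis imageE)
        define x where "x = g + (y - proj F y)"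
        have "proj F x = g"
        proof (rule proj_unique[OF F' g(1)])
          fix z assume "z \<in> F"
          then show "g \<bullet> z = x \<bullet> z" by (simp add: x_def inner_add_left perp)
        qed
        then have "W x = y" by (simp add: W_def g(2)) (simp add: x_def)
        moreover have "x \<in> E"
          unfolding x_def using g(1) y proj_in[OF F', of y] F(2) fdsub_subspace[OF E(1)]
          by (intro subspace_add subspace_diff) auto
        ultimately show "y \<in> W ` E" by blast
      qed
    qed
    then have inv: "distr (usphere E) borel W = usphere E"
      using rot_inv_usphere[OF E] orthW by (simp add: rot_inv_def)
    have [measurable]: "V \<in> borel_measurable borel" "W \<in> borel_measurable borel"
      using V orthW orthogonal_transformation_measurable by auto
    have "distr ?M borel V = distr (usphere E) borel (\<lambda>x. V (sgn (proj F x)))"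
      by (subst distr_distr) (auto simp: comp_def)
    also have "(\<lambda>x. V (sgn (proj F x))) = (\<lambda>x. sgn (proj F (W x)))"
      by (simp add: pW sgn_div_norm nV linear_scale[OF linV])
    also have "distr (usphere E) borel (\<lambda>x. sgn (proj F (W x)))
        = distr (distr (usphere E) borel W) borel (\<lambda>x. sgn (proj F x))"
      by (subst distr_distr) (auto simp: comp_def)
    also have "\<dots> = ?M" by (simp add: inv)
    finally show "distr ?M borel V = ?M" .
  qed simp
qed

text \<open>\<open>usphere E\<close> lives on the whole space, whereas the definition asks for a
  measure on the sphere as a space of its own. Restricting it to the sphere produces a witness for
  the choice; the properties used later are those of the defining predicate.\<close>

lemma sphere_prob_rotation_invariant:
  assumes E: "fdsub E" "dim E > 0"
  shows "rotation_invariant_prob_sphere E (sphere_prob E)"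
  unfolding sphere_prob_def
proof (rule someI)
  let ?S = "sphere 0 1 \<inter> E"
  have Sb[measurable]: "?S \<in> sets borel"
    by (rule sphere_Int_borel) fact
  interpret E: prob_space "usphere E" by (rule prob_space_usphere[OF E])
  have AE: "AE x in usphere E. x \<in> ?S" by (rule AE_usphere_sphere[OF E])
  let ?M = "restrict_space (usphere E) ?S"
  have spM: "space ?M = ?S" by (simp add: space_restrict_space)
  show "rotation_invariant_prob_sphere E ?M"
    unfolding rotation_invariant_prob_sphere_def
  proof (intro conjI allI impI)
    show "prob_space ?M"
    proof
      have "emeasure (usphere E) ?S = 1"
        using AE by (intro E.emeasure_eq_1_AE) auto
      then show "emeasure ?M (space ?M) = 1"
        by (simp add: spM emeasure_restrict_space)
    qed
    show sM: "sets ?M = sets (restrict_space borel ?S)"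
      by (rule sets_restrict_space_cong) simp
    fix U :: "pt \<Rightarrow> pt" assume U: "orthogonal_transformation U \<and> U ` E = E"
    have [measurable]: "U \<in> borel_measurable borel"
      using U orthogonal_transformation_measurable by blast
    have US: "U x \<in> ?S" if "x \<in> ?S" for x
      using U that by (auto simp: orthogonal_transformation)
    have Um: "U \<in> ?M \<rightarrow>\<^sub>M ?M"
      by (rule measurable_restrict_space3) (use US in \<open>auto simp: usphere_def\<close>)
    show "distr ?M ?M U = ?M"
    proof (rule measure_eqI)
      fix A assume "A \<in> sets (distr ?M ?M U)"
      then have A: "A \<in> sets ?M" by simp
      then have A': "A \<in> sets borel" "A \<subseteq> ?S"
        by (auto simp: sets_restrict_space_iff)
      have "emeasure (distr ?M ?M U) A = emeasure ?M (U -` A \<inter> ?S)"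
        using Um A by (simp add: emeasure_distr spM)
      also have "\<dots> = emeasure (usphere E) (U -` A \<inter> ?S)"
        by (rule emeasure_restrict_space) auto
      also have "\<dots> = emeasure (usphere E) (U -` A)"
        by (rule emeasure_eq_AE) (use AE A'(1) measurable_sets[of U borel borel A] in \<open>auto elim: eventually_mono\<close>)
      also have "\<dots> = emeasure (distr (usphere E) borel U) A"
        using A'(1) by (subst emeasure_distr) auto
      also have "\<dots> = emeasure (usphere E) A"
        using rot_inv_usphere[OF E] U by (simp add: rot_inv_def)
      also have "\<dots> = emeasure ?M A"
        using A'(2) by (subst emeasure_restrict_space) auto
      finally show "emeasure (distr ?M ?M U) A = emeasure ?M A" .
    qed simp
  qed
qed

section \<open>Sections of convex bodies in terms of the radial function\<close>

text \<open>The two radii keep \<rho> between positive bounds. Their ratio is what the position of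
  the body contributes to the final estimate.\<close>

definition cbody :: "nat \<Rightarrow> real \<Rightarrow> real \<Rightarrow> pt set \<Rightarrow> bool" where
  "cbody n r R K \<longleftrightarrow> 0 < r \<and> compact K \<and> convex K \<and> ball_n n r \<subseteq> K \<and> K \<subseteq> ball_n n R"

text \<open>At 0 the set under the supremum is unbounded once K contains the origin. The value 0
  keeps \<open>radial K (sgn x)\<close> bounded everywhere, also where \<open>sgn\<close>
  vanishes.\<close>

definition radial :: "pt set \<Rightarrow> pt \<Rightarrow> real" where
  "radial K x = (if x = 0 then 0 else Sup {t. 0 \<le> t \<and> t *\<^sub>R x \<in> K})"

context
  fixes n r R K
  assumes K: "cbody n r R K"
begin

lemma cbody_closed: "closed K"
  using K by (auto simp: cbody_def compact_imp_closed)

lemma cbody_borel [measurable]: "K \<in> sets borel"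
  using cbody_closed by simp

lemma cbody_zero: "0 \<in> K"
  using K subspace_0[OF subspace_Rn] by (auto simp: cbody_def ball_n_def)

lemma cbody_scale:
  assumes "x \<in> K" "0 \<le> t" "t \<le> 1"
  shows "t *\<^sub>R x \<in> K"
proof -
  have "t *\<^sub>R x + (1 - t) *\<^sub>R 0 \<in> K"
    using K assms cbody_zero by (intro convexD) (auto simp: cbody_def)
  then show ?thesis by simp
qed

lemma cbody_R: "0 \<le> R"
  using K cbody_zero by (auto simp: cbody_def ball_n_def)

lemma radial_le_iff:
  assumes "x \<noteq> 0" "0 < t"
  shows "t *\<^sub>R x \<in> K \<longleftrightarrow> t \<le> radial K x"
proof -
  let ?S = "{t. 0 \<le> t \<and> t *\<^sub>R x \<in> K}"
  have "t \<le> R / norm x" if "t \<in> ?S" for t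
    using that K assms(1) by (auto simp: cbody_def ball_n_def pos_le_divide_eq)
  then have bdd: "bdd_above ?S" by (rule bdd_aboveI)
  have "closed ?S"
    using closed_Int[OF closed_atLeast[of 0] closed_vimage[OF cbody_closed, of "\<lambda>t. t *\<^sub>R x"]]
    by (simp add: vimage_def Int_def continuous_intros)
  moreover have "0 \<in> ?S" using cbody_zero by simp
  ultimately have S: "Sup ?S \<in> ?S"
    using bdd closed_contains_Sup[of ?S] by blast
  show ?thesis
  proof
    assume "t *\<^sub>R x \<in> K"
    then show "t \<le> radial K x"
      using assms bdd by (auto simp: radial_def intro!: cSup_upper)
  next
    assume t: "t \<le> radial K x"
    define s where "s = Sup ?S"
    have s: "s *\<^sub>R x \<in> K" "t \<le> s"
      using S t assms by (auto simp: radial_def s_def)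
    have "(t / s) *\<^sub>R (s *\<^sub>R x) \<in> K"
      by (rule cbody_scale[OF s(1)]) (use s assms in auto)
    with s have "(t / s) *\<^sub>R (s *\<^sub>R x) \<in> K" "t \<le> s" by auto
    then show "t *\<^sub>R x \<in> K"
      using s assms by simp
  qed
qed

lemma radial_nonneg: "0 \<le> radial K x"
proof (cases "x = 0")
  case False
  have "0 \<in> {t. 0 \<le> t \<and> t *\<^sub>R x \<in> K}" using cbody_zero by simp
  moreover have "t \<le> R / norm x" if "t \<in> {t. 0 \<le> t \<and> t *\<^sub>R x \<in> K}" for t
    using that K False by (auto simp: cbody_def ball_n_def pos_le_divide_eq)
  then have "bdd_above {t. 0 \<le> t \<and> t *\<^sub>R x \<in> K}" by (rule bdd_aboveI)
  ultimately show ?thesis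
    using False by (auto simp: radial_def intro: cSup_upper)
qed (simp add: radial_def)

text \<open>For a > 0 the set where \<open>radial K\<close> is at least a is the preimage of the
  closed set K under dilation by a, without the origin.\<close>

lemma radial_measurable [measurable]: "radial K \<in> borel_measurable borel"
proof (rule borel_measurableI_ge)
  fix a :: real
  show "{x \<in> space borel. a \<le> radial K x} \<in> sets borel"
  proof (cases "a > 0")
    case True
    have "{x \<in> space borel. a \<le> radial K x} = - {0} \<inter> (\<lambda>x. a *\<^sub>R x) -` K"
      using True radial_le_iff[of _ a] by (auto simp: radial_def)
    moreover have "(\<lambda>x. a *\<^sub>R x) -` K \<in> sets borel"
      using closed_vimage[OF cbody_closed, of "\<lambda>x. a *\<^sub>R x"]
      by (simp add: continuous_intros)
    ultimately show ?thesis by auto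
  next
    case False
    then have "{x \<in> space borel. a \<le> radial K x} = UNIV"
      using radial_nonneg by (auto intro: order_trans[of a 0])
    then show ?thesis by simp
  qed
qed

lemma radial_on_radial: "radial_on E K (radial K)"
  unfolding radial_on_def using radial_le_iff radial_nonneg by auto

lemma radial_le: "x \<noteq> 0 \<Longrightarrow> radial K x \<le> R / norm x"
proof (rule ccontr)
  assume x: "x \<noteq> 0" and "\<not> radial K x \<le> R / norm x"
  then have c: "R / norm x < radial K x" by simp
  have p: "0 < radial K x"
    using x c cbody_R by (smt (verit, best) divide_nonneg_nonneg norm_ge_zero)
  then have "radial K x *\<^sub>R x \<in> K" using radial_le_iff[OF x] by simp
  then have "radial K x * norm x \<le> R"
    using K p by (auto simp: cbody_def ball_n_def)
  then show False using c x by (simp add: pos_divide_less_eq)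
qed

lemma radial_sgn_le: "radial K (sgn x) \<le> R"
  using radial_le[of "sgn x"] cbody_R by (cases "x = 0") (auto simp: radial_def norm_sgn)

lemma radial_ge:
  assumes "x \<in> Rn n" "x \<noteq> 0"
  shows "r / norm x \<le> radial K x"
proof -
  have "(r / norm x) *\<^sub>R x \<in> ball_n n r"
    using assms K by (auto simp: ball_n_def cbody_def intro!: subspace_scale[OF subspace_Rn])
  then have "(r / norm x) *\<^sub>R x \<in> K"
    using K by (auto simp: cbody_def)
  then show ?thesis
    using radial_le_iff[of x "r / norm x"] assms K by (auto simp: cbody_def)
qed

lemma integral_radial_sgn:
  assumes "prob_space M" and [measurable]: "f \<in> borel_measurable M"
  shows "integrable M (\<lambda>x. radial K (sgn (f x)) ^ j)"
proof -
  interpret prob_space M by fact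
  have "norm (radial K (sgn (f x)) ^ j) \<le> R ^ j" for x
    using radial_sgn_le[of "f x"] radial_nonneg[of "sgn (f x)"] by (simp add: power_mono)
  then show ?thesis
    by (intro integrable_const_bound[of _ "R ^ j"] AE_I2) auto
qed

definition radial_moment :: "nat \<Rightarrow> real" where
  "radial_moment j = (\<integral>x. radial K x ^ j \<partial>usphere (Rn n))"

lemma integrable_radial:
  assumes "fdsub E" "dim E > 0"
  shows "integrable (usphere E) (\<lambda>x. radial K x ^ j)"
proof -
  interpret prob_space "usphere E" by (rule prob_space_usphere[OF assms])
  have "AE x in usphere E. norm (radial K x ^ j) \<le> R ^ j"
    using AE_usphere_sphere[OF assms]
  proof eventually_elim
    case (elim x)
    then have "norm x = 1" "x \<noteq> 0" by auto
    then have "radial K x \<le> R"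
      using radial_le[of x] by simp
    then show ?case
      using radial_nonneg[of x] by (simp add: power_mono)
  qed
  then show ?thesis
    by (intro integrable_const_bound) auto
qed

lemma measure_leb_cbody:
  assumes E: "fdsub E" "dim E > 0"
  shows "measure (leb E) K = unit_ball_vol (dim E) * (\<integral>x. radial K x ^ dim E \<partial>usphere E)"
    and "emeasure (leb E) K < \<infinity>"
proof -
  have nn: "(\<integral>\<^sup>+x. ennreal (radial K x ^ dim E) \<partial>usphere E) = ennreal (\<integral>x. radial K x ^ dim E \<partial>usphere E)"
    by (rule nn_integral_eq_integral) (auto simp: integrable_radial[OF E] radial_nonneg)
  have int_nn: "0 \<le> (\<integral>x. radial K x ^ dim E \<partial>usphere E)"
    by (rule integral_nonneg_AE) (auto simp: radial_nonneg)
  have "emeasure (leb E) K = ennreal (unit_ball_vol (dim E)) * (\<integral>\<^sup>+x. ennreal (radial K x ^ dim E) \<partial>usphere E)"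
    by (rule emeasure_eq_usphere[OF E cbody_borel radial_on_radial])
  also have "\<dots> = ennreal (unit_ball_vol (dim E) * (\<integral>x. radial K x ^ dim E \<partial>usphere E))"
    unfolding nn by (rule ennreal_mult[symmetric]) (use int_nn in auto)
  finally have e: "emeasure (leb E) K = ennreal (unit_ball_vol (dim E) * (\<integral>x. radial K x ^ dim E \<partial>usphere E))" .
  then show "emeasure (leb E) K < \<infinity>" by simp
  show "measure (leb E) K = unit_ball_vol (dim E) * (\<integral>x. radial K x ^ dim E \<partial>usphere E)"
    using e int_nn by (simp add: measure_def)
qed

lemma vol_Int:
  assumes "fdsub E" "A \<in> sets borel"
  shows "vol E (A \<inter> E) = measure (leb E) A"
  unfolding vol_def measure_def
  by (subst emeasure_eq_AE[of "A \<inter> E" A])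
     (use leb_AE[OF assms(1)] fdsub_closed[OF assms(1)] assms(2) in \<open>auto elim: eventually_mono\<close>)

lemma vol_cbody:
  assumes "n > 0"
  shows "vol (Rn n) K = unit_ball_vol n * radial_moment n"
  using measure_leb_cbody(1)[OF fdsub_Rn, of n] assms by (simp add: vol_def dim_Rn radial_moment_def)

end

text \<open>A rotation applied after \<open>f\<close> can be pushed through \<open>f\<close>, where
  it acts on both arguments and preserves the product measure; so the law of \<open>f\<close> is
  invariant and hence uniform. It is applied with \<open>M\<close> the law of a random normal
  direction and the law of a random subspace.\<close>

lemma distr_pair_rot_inv:
  assumes E: "fdsub E" "dim E > 0" and M: "prob_space M"
    and f[measurable]: "f \<in> borel_measurable (M \<Otimes>\<^sub>M usphere E)"
    and AE: "\<And>\<xi>. \<xi> \<in> space M \<Longrightarrow> AE x in usphere E. f (\<xi>, x) \<in> sphere 0 1 \<inter> E"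
    and inv: "\<And>U. orthogonal_transformation U \<Longrightarrow> U ` E = E \<Longrightarrow>
      \<exists>V \<in> M \<rightarrow>\<^sub>M M. distr M M V = M \<and> (\<forall>\<xi>\<in>space M. \<forall>x\<in>sphere 0 1 \<inter> E. U (f (\<xi>, x)) = f (V \<xi>, U x))"
  shows "distr (M \<Otimes>\<^sub>M usphere E) borel f = usphere E"
proof (rule rot_inv_eq_usphere[OF E])
  interpret E: prob_space "usphere E" by (rule prob_space_usphere[OF E])
  interpret M: prob_space M by fact
  interpret P: pair_prob_space M "usphere E" ..
  have Sb: "sphere 0 1 \<inter> E \<in> sets borel" by (rule sphere_Int_borel[OF E(1)])
  show "rot_inv E (distr (M \<Otimes>\<^sub>M usphere E) borel f)"
    unfolding rot_inv_def
  proof (intro conjI allI impI)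
    show "prob_space (distr (M \<Otimes>\<^sub>M usphere E) borel f)"
      by (rule P.prob_space_distr) measurable
    have "AE z in M \<Otimes>\<^sub>M usphere E. f z \<in> sphere 0 1 \<inter> E"
    proof (rule P.AE_pair_measure)
      show "{z \<in> space (M \<Otimes>\<^sub>M usphere E). f z \<in> sphere 0 1 \<inter> E} \<in> sets (M \<Otimes>\<^sub>M usphere E)"
        using measurable_sets[OF f Sb] by (simp add: vimage_def Int_def conj_commute)
      show "AE x in M. AE y in usphere E. f (x, y) \<in> sphere 0 1 \<inter> E"
        by (rule AE_I2) (rule AE)
    qed
    then show "AE x in distr (M \<Otimes>\<^sub>M usphere E) borel f. x \<in> sphere 0 1 \<inter> E"
      using Sb by (subst AE_distr_iff) (simp_all del: Int_iff mem_sphere mem_sphere_0)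
    fix U :: "pt \<Rightarrow> pt" assume U: "orthogonal_transformation U \<and> U ` E = E"
    then obtain V where V: "V \<in> M \<rightarrow>\<^sub>M M" "distr M M V = M"
      "\<And>\<xi> x. \<xi> \<in> space M \<Longrightarrow> x \<in> sphere 0 1 \<inter> E \<Longrightarrow> U (f (\<xi>, x)) = f (V \<xi>, U x)"
      using inv[of U] by blast
    note [measurable] = V(1)
    have [measurable]: "U \<in> borel_measurable borel"
      using U orthogonal_transformation_measurable by blast
    have Um: "U \<in> usphere E \<rightarrow>\<^sub>M usphere E" by measurable
    have dU: "distr (usphere E) (usphere E) U = usphere E"
    proof -
      have "distr (usphere E) (usphere E) U = distr (usphere E) borel U"
        by (rule distr_cong) auto
      then show ?thesis
        using rot_inv_usphere[OF E] U by (simp add: rot_inv_def)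
    qed
    have pair: "distr (M \<Otimes>\<^sub>M usphere E) (M \<Otimes>\<^sub>M usphere E) (\<lambda>(\<xi>, x). (V \<xi>, U x)) = M \<Otimes>\<^sub>M usphere E"
      using pair_measure_distr[OF V(1) Um] by (simp add: V(2) dU E.sigma_finite_measure_axioms)
    have "distr (distr (M \<Otimes>\<^sub>M usphere E) borel f) borel U = distr (M \<Otimes>\<^sub>M usphere E) borel (\<lambda>z. U (f z))"
      by (subst distr_distr) (auto simp: comp_def)
    also have "\<dots> = distr (M \<Otimes>\<^sub>M usphere E) borel (\<lambda>z. f (V (fst z), U (snd z)))"
    proof (rule distr_cong_AE)
      show "AE z in M \<Otimes>\<^sub>M usphere E. U (f z) = f (V (fst z), U (snd z))"
      proof (rule P.AE_pair_measure)
        show "AE x in M. AE y in usphere E. U (f (x, y)) = f (V (fst (x, y)), U (snd (x, y)))"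
        proof (rule AE_I2)
          fix \<xi> assume "\<xi> \<in> space M"
          then have "\<And>y. y \<in> sphere 0 1 \<inter> E \<Longrightarrow> U (f (\<xi>, y)) = f (V (fst (\<xi>, y)), U (snd (\<xi>, y)))"
            using V(3) by simp
          with AE_usphere_sphere[OF E]
          show "AE y in usphere E. U (f (\<xi>, y)) = f (V (fst (\<xi>, y)), U (snd (\<xi>, y)))"
            by (rule eventually_mono)
        qed
      qed measurable
    qed measurable
    also have "\<dots> = distr (distr (M \<Otimes>\<^sub>M usphere E) (M \<Otimes>\<^sub>M usphere E) (\<lambda>(\<xi>, x). (V \<xi>, U x))) borel f"
      by (subst distr_distr) (auto simp: comp_def case_prod_beta)
    also have "\<dots> = distr (M \<Otimes>\<^sub>M usphere E) borel f"
      by (simp add: pair)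
    finally show "distr (distr (M \<Otimes>\<^sub>M usphere E) borel f) borel U = distr (M \<Otimes>\<^sub>M usphere E) borel f" .
  qed simp
qed

lemma sphere_prob_space_prob:
  assumes "fdsub E" "dim E > 0"
  shows "prob_space (sphere_prob E)" "space (sphere_prob E) = sphere 0 1 \<inter> E"
    "sets (sphere_prob E) = sets (restrict_space borel (sphere 0 1 \<inter> E))"
  using sphere_prob_rotation_invariant[OF assms]
    sets_eq_imp_space_eq[of "sphere_prob E" "restrict_space borel (sphere 0 1 \<inter> E)"]
  by (auto simp: rotation_invariant_prob_sphere_def space_restrict_space)

text \<open>A uniform vector made orthogonal to an independent uniform direction and normalised is
  uniform again, because the operation commutes with rotations. Dimension at least 2 guarantees that
  the difference is almost surely nonzero.\<close>

lemma distr_pair_perp: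
  assumes E: "fdsub E" "dim E \<ge> 2"
  shows "distr (sphere_prob E \<Otimes>\<^sub>M usphere E) borel (\<lambda>(\<xi>, x). sgn (x - (x \<bullet> \<xi>) *\<^sub>R \<xi>)) = usphere E"
proof -
  have E0: "dim E > 0" using E by simp
  note sp = sphere_prob_space_prob[OF E(1) E0]
  have idm[measurable]: "(\<lambda>x. x) \<in> sphere_prob E \<rightarrow>\<^sub>M borel"
    unfolding measurable_cong_sets[OF sp(3) refl] by (rule measurable_restrict_space1) simp
  have fst[measurable]: "(\<lambda>z. fst z) \<in> sphere_prob E \<Otimes>\<^sub>M usphere E \<rightarrow>\<^sub>M borel"
    by (rule measurable_compose[OF measurable_fst idm])
  show ?thesis
  proof (rule distr_pair_rot_inv[OF E(1) E0 sp(1)])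
    show "(\<lambda>(\<xi>, x). sgn (x - (x \<bullet> \<xi>) *\<^sub>R \<xi>)) \<in> borel_measurable (sphere_prob E \<Otimes>\<^sub>M usphere E)"
      unfolding case_prod_beta by measurable
  next
    fix \<xi> assume "\<xi> \<in> space (sphere_prob E)"
    then have \<xi>: "\<xi> \<in> E" "norm \<xi> = 1" by (auto simp: sp)
    have F: "fdsub (E \<inter> hyperplane_perp \<xi>)" "dim (E \<inter> hyperplane_perp \<xi>) > 0"
      using dim_perp[OF E(1) \<xi>] E by (auto intro: fdsub_perp)
    obtain \<eta> where \<eta>: "\<eta> \<in> E \<inter> hyperplane_perp \<xi>" "norm \<eta> = 1"
      by (rule fdsub_ex_unit[OF F])
    have "AE x in usphere E. x \<bullet> \<eta> \<noteq> 0"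
      by (rule AE_usphere_hyperplane) (use E \<eta> in auto)
    then have "AE x in usphere E. sgn (x - (x \<bullet> \<xi>) *\<^sub>R \<xi>) \<in> sphere 0 1 \<inter> E"
      using AE_usphere_sphere[OF E(1) E0]
    proof eventually_elim
      case (elim x)
      have "(x - (x \<bullet> \<xi>) *\<^sub>R \<xi>) \<bullet> \<eta> = x \<bullet> \<eta>"
        using \<eta> by (simp add: hyperplane_perp_def inner_diff_left inner_commute[of \<xi>])
      then have "x - (x \<bullet> \<xi>) *\<^sub>R \<xi> \<noteq> 0" using elim by auto
      then show ?case
        using elim \<xi> fdsub_subspace[OF E(1)]
        by (auto simp: norm_sgn sgn_div_norm subspace_scale subspace_diff)
    qed
    then show "AE x in usphere E. (case (\<xi>, x) of (\<xi>, x) \<Rightarrow> sgn (x - (x \<bullet> \<xi>) *\<^sub>R \<xi>)) \<in> sphere 0 1 \<inter> E"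
      by simp
  next
    fix U :: "pt \<Rightarrow> pt" assume U: "orthogonal_transformation U" "U ` E = E"
    have "distr (sphere_prob E) (sphere_prob E) U = sphere_prob E"
      using sphere_prob_rotation_invariant[OF E(1) E0] U by (simp add: rotation_invariant_prob_sphere_def)
    moreover have "U \<in> sphere_prob E \<rightarrow>\<^sub>M sphere_prob E"
      unfolding measurable_cong_sets[OF sp(3) sp(3)]
      by (rule measurable_restrict_space3)
         (use U orthogonal_transformation_measurable in \<open>auto simp: orthogonal_transformation\<close>)
    moreover have "U (sgn (x - (x \<bullet> \<xi>) *\<^sub>R \<xi>)) = sgn (U x - (U x \<bullet> U \<xi>) *\<^sub>R U \<xi>)" for x \<xi>
    proof -
      have "linear U" "\<And>x. norm (U x) = norm x" "\<And>x y. U x \<bullet> U y = x \<bullet> y"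
        using U(1) orthogonal_transformation[of U] by (auto simp: orthogonal_transformation_def)
      moreover have "U x - (U x \<bullet> U \<xi>) *\<^sub>R U \<xi> = U (x - (x \<bullet> \<xi>) *\<^sub>R \<xi>)"
        using calculation by (simp add: linear_diff linear_scale)
      ultimately show ?thesis
        by (simp add: sgn_div_norm linear_scale)
    qed
    ultimately show "\<exists>V\<in>sphere_prob E \<rightarrow>\<^sub>M sphere_prob E. distr (sphere_prob E) (sphere_prob E) V = sphere_prob E \<and>
        (\<forall>\<xi>\<in>space (sphere_prob E). \<forall>x\<in>sphere 0 1 \<inter> E.
          U (case (\<xi>, x) of (\<xi>, x) \<Rightarrow> sgn (x - (x \<bullet> \<xi>) *\<^sub>R \<xi>)) =
          (case (V \<xi>, U x) of (\<xi>, x) \<Rightarrow> sgn (x - (x \<bullet> \<xi>) *\<^sub>R \<xi>)))"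
      by (intro bexI[of _ U]) auto
  qed
qed

text \<open>The section orthogonal to \<xi> is a mean of a power of \<rho> over the sphere of the
  section; \<open>rot_inv_proj\<close> rewrites it as a mean over the sphere of \<open>E\<close>.
  After Fubini the direction \<xi> disappears by \<open>distr_pair_perp\<close>.\<close>

lemma avg_section_eq:
  assumes K: "cbody n r R K" and E: "subspace E" "E \<subseteq> Rn n" "dim E > 0"
  shows "avg_section E K = unit_ball_vol (dim E - 1) * (\<integral>x. radial K x ^ (dim E - 1) \<partial>usphere E)"
proof -
  have fE: "fdsub E" by (rule fdsub_subset[OF fdsub_Rn E(1,2)])
  note sp = sphere_prob_space_prob[OF fE E(3)]
  interpret S: prob_space "sphere_prob E" by (rule sp)
  interpret E: prob_space "usphere E" by (rule prob_space_usphere[OF fE E(3)])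
  interpret P: pair_prob_space "sphere_prob E" "usphere E" ..
  have [measurable]: "K \<in> sets borel" "radial K \<in> borel_measurable borel"
    using cbody_borel[OF K] radial_measurable[OF K] by auto
  have dimF: "dim (E \<inter> hyperplane_perp \<xi>) = dim E - 1" "fdsub (E \<inter> hyperplane_perp \<xi>)"
    if "\<xi> \<in> space (sphere_prob E)" for \<xi>
    using that dim_perp[OF fE, of \<xi>] fdsub_perp[OF fE] by (auto simp: sp)
  have vol: "vol (E \<inter> hyperplane_perp \<xi>) (K \<inter> E \<inter> hyperplane_perp \<xi>) = measure (leb (E \<inter> hyperplane_perp \<xi>)) K"
    if "\<xi> \<in> space (sphere_prob E)" for \<xi>
    using vol_Int[OF K dimF(2)[OF that], of K] by (simp add: Int_assoc)
  show ?thesis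
  proof (cases "dim E \<ge> 2")
    \<comment> \<open>In dimension 1 every section is the origin alone, of 0-dimensional volume 1;
      the right-hand side is the volume of the 0-dimensional ball times the moment of order 0, also
      1.\<close>
    case False
    then have d: "dim E = 1" using E(3) by linarith
    have "vol (E \<inter> hyperplane_perp \<xi>) (K \<inter> E \<inter> hyperplane_perp \<xi>) = 1"
      if \<xi>: "\<xi> \<in> space (sphere_prob E)" for \<xi>
    proof -
      have "E \<inter> hyperplane_perp \<xi> = {0}"
        using dimF[OF \<xi>] d fdsub_dim_0_iff by auto
      then show ?thesis
        unfolding vol[OF \<xi>] using cbody_zero[OF K] by (simp add: leb_trivial measure_def)
    qed
    then have "avg_section E K = (\<integral>\<xi>. 1 \<partial>sphere_prob E)"
      unfolding avg_section_def by (rule Bochner_Integration.integral_cong[OF refl])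
    also have "\<dots> = 1" by (simp add: S.prob_space)
    finally show ?thesis
      using d E.prob_space by simp
  next
    case True
    let ?m = "dim E - 1"
    let ?f = "\<lambda>z :: pt \<times> pt. sgn (snd z - (snd z \<bullet> fst z) *\<^sub>R fst z)"
    have idm[measurable]: "(\<lambda>x. x) \<in> sphere_prob E \<rightarrow>\<^sub>M borel"
      unfolding measurable_cong_sets[OF sp(3) refl] by (rule measurable_restrict_space1) simp
    have fst[measurable]: "(\<lambda>z. fst z) \<in> sphere_prob E \<Otimes>\<^sub>M usphere E \<rightarrow>\<^sub>M borel"
      by (rule measurable_compose[OF measurable_fst idm])
    have fm[measurable]: "?f \<in> borel_measurable (sphere_prob E \<Otimes>\<^sub>M usphere E)" by measurable
    have vol': "vol (E \<inter> hyperplane_perp \<xi>) (K \<inter> E \<inter> hyperplane_perp \<xi>)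
        = (\<integral>x. unit_ball_vol ?m * radial K (?f (\<xi>, x)) ^ ?m \<partial>usphere E)"
      if \<xi>: "\<xi> \<in> space (sphere_prob E)" for \<xi>
    proof -
      let ?F = "E \<inter> hyperplane_perp \<xi>"
      have \<xi>': "\<xi> \<in> E" "norm \<xi> = 1" using \<xi> by (auto simp: sp)
      have pF: "proj ?F \<in> borel_measurable borel"
        by (intro borel_measurable_continuous_onI continuous_on_proj continuous_on_id)
      have F: "dim ?F > 0" using dimF(1)[OF \<xi>] True by simp
      have "vol ?F (K \<inter> E \<inter> hyperplane_perp \<xi>) = unit_ball_vol ?m * (\<integral>x. radial K x ^ ?m \<partial>usphere ?F)"
        unfolding vol[OF \<xi>] using measure_leb_cbody(1)[OF K dimF(2)[OF \<xi>] F] dimF(1)[OF \<xi>] by simp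
      also have "usphere ?F = distr (usphere E) borel (\<lambda>x. sgn (proj ?F x))"
        by (rule rot_inv_proj[symmetric, OF fE E(3)]) (use dimF[OF \<xi>] F in \<open>auto simp: fdsub_subspace\<close>)
      also have "(\<integral>x. radial K x ^ ?m \<partial>\<dots>) = (\<integral>x. radial K (sgn (proj ?F x)) ^ ?m \<partial>usphere E)"
      proof (rule integral_distr)
        show "(\<lambda>x. sgn (proj ?F x)) \<in> usphere E \<rightarrow>\<^sub>M borel"
          unfolding measurable_cong_sets[OF sets_usphere refl]
          by (rule measurable_compose[OF pF measurable_sgn_pt])
      qed measurable
      also have "\<dots> = (\<integral>x. radial K (?f (\<xi>, x)) ^ ?m \<partial>usphere E)"
      proof (rule integral_cong_AE)
        show "AE x in usphere E. radial K (sgn (proj ?F x)) ^ ?m = radial K (?f (\<xi>, x)) ^ ?m"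
          using AE_usphere_sphere[OF fE E(3)]
          by eventually_elim (simp add: proj_perp[OF fE \<xi>'])
        show "(\<lambda>x. radial K (sgn (proj ?F x)) ^ ?m) \<in> borel_measurable (usphere E)"
          unfolding measurable_cong_sets[OF sets_usphere refl]
          by (intro borel_measurable_power measurable_compose[OF measurable_compose[OF pF measurable_sgn_pt]]) measurable
        have "(\<lambda>x. x - (x \<bullet> \<xi>) *\<^sub>R \<xi>) \<in> borel_measurable borel"
          by (intro borel_measurable_continuous_onI continuous_intros)
        then have "(\<lambda>x. ?f (\<xi>, x)) \<in> borel_measurable (usphere E)"
          unfolding fst_conv snd_conv measurable_cong_sets[OF sets_usphere refl]
          by (rule measurable_compose[OF _ measurable_sgn_pt])
        then show "(\<lambda>x. radial K (?f (\<xi>, x)) ^ ?m) \<in> borel_measurable (usphere E)"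
          by (intro borel_measurable_power measurable_compose[OF _ radial_measurable[OF K]])
      qed
      finally show ?thesis by simp
    qed
    have int: "integrable (sphere_prob E \<Otimes>\<^sub>M usphere E) (\<lambda>z. unit_ball_vol ?m * radial K (?f z) ^ ?m)"
      by (intro integrable_mult_right integral_radial_sgn[OF K])
         (auto intro: P.prob_space_axioms)
    have "avg_section E K = (\<integral>\<xi>. (\<integral>x. unit_ball_vol ?m * radial K (?f (\<xi>, x)) ^ ?m \<partial>usphere E) \<partial>sphere_prob E)"
      unfolding avg_section_def by (rule Bochner_Integration.integral_cong[OF refl vol'])
    also have "\<dots> = (\<integral>z. unit_ball_vol ?m * radial K (?f z) ^ ?m \<partial>(sphere_prob E \<Otimes>\<^sub>M usphere E))"
      by (rule P.integral_fst'[OF int])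
    also have "\<dots> = unit_ball_vol ?m * (\<integral>z. radial K (?f z) ^ ?m \<partial>(sphere_prob E \<Otimes>\<^sub>M usphere E))"
      by simp
    also have "(\<integral>z. radial K (?f z) ^ ?m \<partial>(sphere_prob E \<Otimes>\<^sub>M usphere E))
        = (\<integral>x. radial K x ^ ?m \<partial>distr (sphere_prob E \<Otimes>\<^sub>M usphere E) borel ?f)"
      by (rule integral_distr[symmetric]) measurable
    also have "distr (sphere_prob E \<Otimes>\<^sub>M usphere E) borel ?f = usphere E"
      using distr_pair_perp[OF fE True] by (simp add: case_prod_beta')
    finally show ?thesis .
  qed
qed

lemma avg_section_Rn:
  assumes "cbody n r R K" "n > 0"
  shows "avg_section (Rn n) K = unit_ball_vol (n - 1) * radial_moment n K (n - 1)"
  using avg_section_eq[OF assms(1) subspace_Rn] assms(2) by (simp add: dim_Rn radial_moment_def[OF assms(1)])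

section \<open>The invariant measure on the Grassmannian\<close>

lemma Gr_fdsub: "E \<in> Gr n m \<Longrightarrow> fdsub E"
  using fdsub_subset[OF fdsub_Rn] by (auto simp: Gr_def)

lemma infdist_fdsub:
  assumes "fdsub E"
  shows "infdist x E = norm (x - proj E x)"
proof (rule antisym)
  show "infdist x E \<le> norm (x - proj E x)"
    using infdist_le[OF proj_in[OF assms], of x x] by (simp add: dist_norm)
  show "norm (x - proj E x) \<le> infdist x E"
  proof -
    have "norm (x - proj E x) \<le> dist x y" if y: "y \<in> E" for y
    proof -
      have "(x - proj E x) \<bullet> (proj E x - y) = 0"
        using proj_inner[OF assms, of "proj E x - y" x] y proj_in[OF assms] fdsub_subspace[OF assms]
        by (simp add: inner_diff_left subspace_diff)
      then have "norm (x - y) ^ 2 = norm (x - proj E x) ^ 2 + norm (proj E x - y) ^ 2"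
        using norm_add_Pythagorean[of "x - proj E x" "proj E x - y"]
        by (simp add: Linear_Algebra.orthogonal_def)
      then have "norm (x - proj E x) ^ 2 \<le> norm (x - y) ^ 2" by simp
      then show ?thesis
        unfolding dist_norm by (rule power2_le_imp_le) simp
    qed
    moreover have "E \<noteq> {}" using proj_in[OF assms] by auto
    ultimately show ?thesis
      by (simp add: infdist_notempty cINF_greatest)
  qed
qed

lemma gap_ge:
  assumes "E \<in> Gr n m" "F \<in> Gr n m" "x \<in> cball 0 1 \<inter> Rn n"
  shows "\<bar>infdist x E - infdist x F\<bar> \<le> gap n E F"
  unfolding gap_def
proof (rule cSUP_upper[OF assms(3)], rule bdd_aboveI2)
  fix y assume y: "y \<in> cball 0 1 \<inter> Rn n"
  have "infdist y G \<le> 1" if "G \<in> Gr n m" for G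
    using infdist_le[of 0 G y] that y subspace_0[of G] by (auto simp: Gr_def)
  then have "0 \<le> infdist y E \<and> infdist y E \<le> 1" "0 \<le> infdist y F \<and> infdist y F \<le> 1"
    using assms by (auto simp: infdist_nonneg)
  then show "\<bar>infdist y E - infdist y F\<bar> \<le> 1" by linarith
qed

lemma gap_proj_le:
  assumes E: "E \<in> Gr n m" and F: "F \<in> Gr n m" and y: "y \<in> E"
  shows "norm (y - proj F y) \<le> gap n E F * norm y"
proof (cases "y = 0")
  case True
  then show ?thesis by (simp add: linear_0[OF linear_proj])
next
  case False
  note fE = Gr_fdsub[OF E] and fF = Gr_fdsub[OF F]
  have s: "sgn y \<in> E" "sgn y \<in> Rn n"
    using y E by (auto simp: sgn_div_norm subspace_scale Gr_def)
  have "norm (sgn y - proj F (sgn y)) = \<bar>infdist (sgn y) E - infdist (sgn y) F\<bar>"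
    using s by (simp add: infdist_fdsub fE fF proj_id)
  also have "\<dots> \<le> gap n E F"
    by (rule gap_ge[OF E F]) (use s False in \<open>auto simp: norm_sgn\<close>)
  finally have g: "norm (sgn y - proj F (sgn y)) \<le> gap n E F" .
  have "y - proj F y = norm y *\<^sub>R (sgn y - proj F (sgn y))"
    using False by (simp add: sgn_div_norm linear_scale[OF linear_proj] scaleR_diff_right)
  then have "norm (y - proj F y) = norm y * norm (sgn y - proj F (sgn y))" by simp
  then show ?thesis
    using mult_left_mono[OF g norm_ge_zero[of y]] by (simp add: mult.commute)
qed

lemma gap_commute: "gap n E F = gap n F E"
  unfolding gap_def by (simp add: abs_minus_commute)

text \<open>Splitting x into its component \<open>u\<close> in \<open>E\<close> and the rest, the
  first part is moved by at most the gap, and the projection of the rest to \<open>F\<close> is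
  estimated by duality. The factor 2 is harmless, since only continuity of the projection in the
  subspace is drawn from it.\<close>

lemma norm_proj_diff_le:
  assumes E: "E \<in> Gr n m" and F: "F \<in> Gr n m"
  shows "norm (proj E x - proj F x) \<le> 2 * gap n E F * norm x"
proof -
  note fE = Gr_fdsub[OF E] and fF = Gr_fdsub[OF F]
  have g0: "0 \<le> gap n E F"
    using gap_ge[OF E F, of 0] subspace_0[OF subspace_Rn] by force
  define u where "u = proj E x"
  define f where "f = proj F (x - u)"
  have u: "u \<in> E" "norm u \<le> norm x" by (auto simp: u_def proj_in fE norm_proj_le)
  have fF': "f \<in> F" by (simp add: f_def proj_in fF)
  have f: "norm f \<le> gap n E F * norm x"
  proof -
    have "norm f ^ 2 = f \<bullet> f" by (simp add: power2_norm_eq_inner)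
    also have "\<dots> = (x - u) \<bullet> f"
      unfolding f_def by (rule proj_inner[OF fF]) (use fF' in \<open>simp add: f_def\<close>)
    \<comment> \<open>x - u is orthogonal to \<open>E\<close>, so the component of \<open>f\<close>
      in \<open>E\<close> may be subtracted; what remains is small because \<open>f\<close> lies in
      \<open>F\<close>.\<close>
    also have "\<dots> = (x - u) \<bullet> (f - proj E f)"
      using proj_inner[OF fE proj_in[OF fE], of x f] by (simp add: u_def inner_diff_left inner_diff_right)
    also have "\<dots> \<le> norm (x - u) * norm (f - proj E f)"
      by (rule norm_cauchy_schwarz)
    also have "\<dots> \<le> norm x * (gap n E F * norm f)"
    proof (rule mult_mono)
      have "norm (x - u) ^ 2 + norm u ^ 2 = norm x ^ 2"
        using proj_inner[OF fE u(1), of x]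
        by (simp add: u_def power2_norm_eq_inner inner_diff_left inner_diff_right inner_commute)
      then have "norm (x - u) ^ 2 \<le> norm x ^ 2" using zero_le_power2[of "norm u"] by linarith
      then show "norm (x - u) \<le> norm x" by (rule power2_le_imp_le) simp
      show "norm (f - proj E f) \<le> gap n E F * norm f"
        using gap_proj_le[OF F E fF'] by (simp add: gap_commute)
    qed auto
    finally have "norm f * norm f \<le> norm f * (gap n E F * norm x)"
      by (simp add: power2_eq_square mult_ac)
    then show ?thesis
      using g0 by (cases "norm f = 0") (auto simp: mult_le_cancel_left)
  qed
  have "proj E x - proj F x = (u - proj F u) - f"
    by (simp add: f_def u_def linear_diff[OF linear_proj])
  then have "norm (proj E x - proj F x) \<le> norm (u - proj F u) + norm f"
    by (simp add: norm_triangle_ineq4)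
  also have "\<dots> \<le> gap n E F * norm x + gap n E F * norm x"
    using gap_proj_le[OF E F u(1)] f mult_left_mono[OF u(2) g0] by linarith
  finally show ?thesis by (simp add: mult_ac)
qed

definition gap_open :: "nat \<Rightarrow> nat \<Rightarrow> pt set set \<Rightarrow> bool" where
  "gap_open n m W \<longleftrightarrow> W \<subseteq> Gr n m \<and> (\<forall>E\<in>W. \<exists>r>0. \<forall>F\<in>Gr n m. gap n E F < r \<longrightarrow> F \<in> W)"

lemma borel_Gr_eq: "borel_Gr n m = sigma (Gr n m) {W. gap_open n m W}"
  by (simp add: borel_Gr_def gap_open_def)

lemma space_borel_Gr: "space (borel_Gr n m) = Gr n m"
  unfolding borel_Gr_eq by (rule space_measure_of) (auto simp: gap_open_def)

lemma gap_open_in_sets: "gap_open n m W \<Longrightarrow> W \<in> sets (borel_Gr n m)"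
  unfolding borel_Gr_eq by (subst sets_measure_of) (auto simp: gap_open_def)

lemma measurable_into_Gr:
  assumes "\<And>x. x \<in> space M \<Longrightarrow> f x \<in> Gr n m"
    and "\<And>W. gap_open n m W \<Longrightarrow> f -` W \<inter> space M \<in> sets M"
  shows "f \<in> M \<rightarrow>\<^sub>M borel_Gr n m"
  unfolding borel_Gr_eq by (rule measurable_measure_of) (use assms in \<open>auto simp: gap_open_def\<close>)

text \<open>The projection of a fixed vector is continuous in the gap, so preimages of open sets are
  generators of the sigma-algebra. This is how functions of a random subspace become
  measurable.\<close>

lemma proj_measurable_Gr: "(\<lambda>E. proj E x) \<in> borel_Gr n m \<rightarrow>\<^sub>M borel"
proof (rule borel_measurableI)
  fix U :: "pt set" assume "open U"
  have "gap_open n m {E \<in> Gr n m. proj E x \<in> U}"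
    unfolding gap_open_def
  proof (intro conjI ballI)
    fix E assume E: "E \<in> {E \<in> Gr n m. proj E x \<in> U}"
    then obtain e where e: "e > 0" "ball (proj E x) e \<subseteq> U"
      using \<open>open U\<close> by (auto elim: openE)
    show "\<exists>r>0. \<forall>F\<in>Gr n m. gap n E F < r \<longrightarrow> F \<in> {E \<in> Gr n m. proj E x \<in> U}"
    proof (intro exI[of _ "e / (2 * norm x + 1)"] conjI ballI impI)
      have p: "2 * norm x + 1 > 0" using norm_ge_zero[of x] by linarith
      then show "0 < e / (2 * norm x + 1)" using e(1) by simp
      fix F assume F: "F \<in> Gr n m" and g: "gap n E F < e / (2 * norm x + 1)"
      have g0: "0 \<le> gap n E F"
        using gap_ge[of E n m F 0] E F subspace_0[OF subspace_Rn] by force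
      have "norm (proj E x - proj F x) \<le> 2 * gap n E F * norm x"
        using norm_proj_diff_le E F by blast
      also have "\<dots> \<le> gap n E F * (2 * norm x + 1)"
        using g0 by (simp add: algebra_simps)
      also have "\<dots> < e" using g p by (simp add: pos_less_divide_eq)
      finally have "proj F x \<in> ball (proj E x) e" by (simp add: dist_norm)
      then show "F \<in> {E \<in> Gr n m. proj E x \<in> U}" using e F by auto
    qed
  qed auto
  then show "(\<lambda>E. proj E x) -` U \<inter> space (borel_Gr n m) \<in> sets (borel_Gr n m)"
    using gap_open_in_sets by (simp add: space_borel_Gr vimage_def Int_def conj_commute)
qed

lemma image_Gr:
  assumes "orthogonal_transformation U" "U ` Rn n = Rn n" "E \<in> Gr n m"
  shows "U ` E \<in> Gr n m"
  using assms Gr_fdsub[OF assms(3)] dim_image_orthogonal[of E U] fdsub_subspace[OF fdsub_image[of E U]]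
  by (auto simp: Gr_def)

lemma gap_image:
  assumes "orthogonal_transformation U" "U ` Rn n = Rn n" "E \<in> Gr n m" "F \<in> Gr n m"
  shows "gap n (U ` E) (U ` F) = gap n E F"
proof -
  have nrm: "norm (U x) = norm x" and lin: "linear U" for x
    using assms(1) by (auto simp: orthogonal_transformation)
  have inf: "infdist (U x) (U ` G) = infdist x G" if "G \<in> Gr n m" for x G
    using Gr_fdsub[OF that] assms(1)
    by (simp add: infdist_fdsub fdsub_image proj_image linear_diff[OF lin, symmetric] nrm)
  have "cball 0 1 \<inter> Rn n = U ` (cball 0 1 \<inter> Rn n)"
  proof
    show "U ` (cball 0 1 \<inter> Rn n) \<subseteq> cball 0 1 \<inter> Rn n"
      using assms(2) nrm by auto
    show "cball 0 1 \<inter> Rn n \<subseteq> U ` (cball 0 1 \<inter> Rn n)"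
    proof
      fix y assume y: "y \<in> cball 0 1 \<inter> Rn n"
      then obtain x where "x \<in> Rn n" "y = U x" using assms(2) by blast
      then show "y \<in> U ` (cball 0 1 \<inter> Rn n)" using y nrm by auto
    qed
  qed
  then have "gap n (U ` E) (U ` F) = (SUP x\<in>U ` (cball 0 1 \<inter> Rn n). \<bar>infdist x (U ` E) - infdist x (U ` F)\<bar>)"
    by (simp add: gap_def)
  also have "\<dots> = gap n E F"
    unfolding gap_def image_image using inf assms(3,4) by simp
  finally show ?thesis .
qed

lemma image_measurable_Gr:
  assumes U: "orthogonal_transformation U" "U ` Rn n = Rn n"
  shows "(\<lambda>E. U ` E) \<in> borel_Gr n m \<rightarrow>\<^sub>M borel_Gr n m"
proof (rule measurable_into_Gr)
  fix W assume W: "gap_open n m W"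
  have "gap_open n m {E \<in> Gr n m. U ` E \<in> W}"
    unfolding gap_open_def
  proof (intro conjI ballI)
    fix E assume "E \<in> {E \<in> Gr n m. U ` E \<in> W}"
    then have E: "E \<in> Gr n m" "U ` E \<in> W" by auto
    then obtain r where r: "r > 0" "\<And>F. F \<in> Gr n m \<Longrightarrow> gap n (U ` E) F < r \<Longrightarrow> F \<in> W"
      using W unfolding gap_open_def by blast
    show "\<exists>r>0. \<forall>F\<in>Gr n m. gap n E F < r \<longrightarrow> F \<in> {E \<in> Gr n m. U ` E \<in> W}"
    proof (intro exI[of _ r] conjI ballI impI)
      fix F assume F: "F \<in> Gr n m" "gap n E F < r"
      then have "U ` F \<in> W"
        using gap_image[OF U E(1) F(1)] image_Gr[OF U F(1)] by (intro r(2)) auto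
      then show "F \<in> {E \<in> Gr n m. U ` E \<in> W}" using F by simp
    qed (rule r(1))
  qed auto
  then show "(\<lambda>E. U ` E) -` W \<inter> space (borel_Gr n m) \<in> sets (borel_Gr n m)"
    using gap_open_in_sets by (simp add: space_borel_Gr vimage_def Int_def conj_commute)
qed (use U image_Gr in \<open>auto simp: space_borel_Gr\<close>)

section \<open>Continuity of the span of a tuple of vectors\<close>

lemma dim_span_tuple_le: "finite I \<Longrightarrow> dim (span (x ` I)) \<le> card (I :: 'i set)"
  using dim_le_card[of "span (x ` I)" "x ` I"] card_image_le[of I x] by simp

lemma span_tuple_repr:
  assumes "finite I" "inj_on x I" "v \<in> span (x ` I)"
  obtains a where "v = (\<Sum>i\<in>I. a i *\<^sub>R x i)"
proof -
  obtain u where "v = (\<Sum>w\<in>x ` I. u w *\<^sub>R w)"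
    using assms(1,3) span_finite[of "x ` I"] by auto
  then have "v = (\<Sum>i\<in>I. u (x i) *\<^sub>R x i)"
    using assms(2) by (simp add: sum.reindex)
  then show thesis by (rule that)
qed

text \<open>A vector \<open>y\<close> dual to \<open>x j\<close> gives the bound \<open>\<bar>a j\<bar> \<le> norm y * norm v\<close>
  on the coordinates of \<open>v\<close>.\<close>

lemma coordinate_bound:
  fixes x :: "nat \<Rightarrow> pt"
  assumes "dim (span (x ` {..<m})) = m"
  obtains C where "C > 0" "inj_on x {..<m}"
    "\<And>a j. j < m \<Longrightarrow> \<bar>a j\<bar> \<le> C * norm (\<Sum>i<m. a i *\<^sub>R x i)"
proof -
  have notin: "x j \<notin> span (x ` ({..<m} - {j}))" if "j < m" for j
  proof
    assume j: "x j \<in> span (x ` ({..<m} - {j}))"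
    have "x ` {..<m} = insert (x j) (x ` ({..<m} - {j}))" using that by auto
    then have "span (x ` {..<m}) = span (x ` ({..<m} - {j}))"
      using span_redundant[OF j] by simp
    then have "m \<le> card ({..<m} - {j})"
      using dim_span_tuple_le[of "{..<m} - {j}" x] assms by simp
    then show False using that by simp
  qed
  have inj: "inj_on x {..<m}"
  proof (rule inj_onI, rule ccontr)
    fix i j assume ij: "i \<in> {..<m}" "j \<in> {..<m}" "x i = x j" "i \<noteq> j"
    then have "x j \<in> span (x ` ({..<m} - {j}))"
      by (intro span_base) (auto intro!: image_eqI[of _ _ i])
    then show False using notin ij by auto
  qed
  have "\<exists>y. \<forall>i<m. x i \<bullet> y = of_bool (i = j)" if "j < m" for j
  proof -
    let ?S = "span (x ` ({..<m} - {j}))"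
    have fS: "fdsub ?S" by (rule fdsub_span) simp
    define z where "z = x j - proj ?S (x j)"
    have "z \<noteq> 0"
      using notin[OF that] proj_in[OF fS, of "x j"] by (auto simp: z_def)
    have zi: "w \<bullet> z = 0" if "w \<in> ?S" for w
      using proj_inner[OF fS that, of "x j"] by (simp add: z_def inner_diff_right inner_commute)
    have "x j \<bullet> z = z \<bullet> z"
      using zi[OF proj_in[OF fS, of "x j"]] by (simp add: z_def inner_diff_left)
    then have "\<forall>i<m. x i \<bullet> (z /\<^sub>R (z \<bullet> z)) = of_bool (i = j)"
      using \<open>z \<noteq> 0\<close> by (auto intro!: zi span_base)
    then show ?thesis by blast
  qed
  then obtain y where y: "\<And>i j. j < m \<Longrightarrow> i < m \<Longrightarrow> x i \<bullet> y j = of_bool (i = j)"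
    by metis
  define C where "C = 1 + (\<Sum>j<m. norm (y j))"
  have "\<bar>a j\<bar> \<le> C * norm (\<Sum>i<m. a i *\<^sub>R x i)" if "j < m" for a j
  proof -
    have "(\<Sum>i<m. a i *\<^sub>R x i) \<bullet> y j = (\<Sum>i<m. if i = j then a i else 0)"
      unfolding inner_sum_left by (rule sum.cong) (use y that in auto)
    also have "\<dots> = a j" using that by simp
    finally have "\<bar>a j\<bar> \<le> norm (\<Sum>i<m. a i *\<^sub>R x i) * norm (y j)"
      using Cauchy_Schwarz_ineq2[of "\<Sum>i<m. a i *\<^sub>R x i" "y j"] by simp
    also have "\<dots> \<le> norm (\<Sum>i<m. a i *\<^sub>R x i) * C"
    proof (rule mult_left_mono)
      have "norm (y j) \<le> (\<Sum>j<m. norm (y j))"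
        using that by (intro member_le_sum) auto
      then show "norm (y j) \<le> C" by (simp add: C_def)
    qed simp
    finally show ?thesis by (simp add: mult.commute)
  qed
  moreover have "C > 0"
    unfolding C_def using sum_nonneg[of "{..<m}" "\<lambda>j. norm (y j)"] by simp
  ultimately show thesis using inj that by blast
qed

text \<open>Converse of \<open>coordinate_bound\<close>. Stated as an inequality, linear
  independence survives small perturbations.\<close>

lemma dim_span_tuple_eq:
  fixes z :: "nat \<Rightarrow> pt"
  assumes "\<And>a j. j < m \<Longrightarrow> \<bar>a j\<bar> \<le> C * norm (\<Sum>i<m. a i *\<^sub>R z i)"
  shows "dim (span (z ` {..<m})) = m" "inj_on z {..<m}"
proof -
  show inj: "inj_on z {..<m}"
  proof (rule inj_onI, rule ccontr)
    fix i j assume ij: "i \<in> {..<m}" "j \<in> {..<m}" "z i = z j" "i \<noteq> j"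
    define a where "a k = (if k = i then 1 else if k = j then -1 else (0::real))" for k
    have "(\<Sum>k<m. a k *\<^sub>R z k) = (\<Sum>k\<in>{i, j}. a k *\<^sub>R z k)"
      by (rule sum.mono_neutral_right) (use ij in \<open>auto simp: a_def\<close>)
    also have "\<dots> = 0" using ij by (simp add: a_def)
    finally show False
      using assms[of i a] ij by (simp add: a_def)
  qed
  have "independent (z ` {..<m})"
  proof (rule independent_if_scalars_zero)
    fix f v assume "(\<Sum>x\<in>z ` {..<m}. f x *\<^sub>R x) = 0" "v \<in> z ` {..<m}"
    then obtain j where j: "j < m" "v = z j" and "(\<Sum>i<m. f (z i) *\<^sub>R z i) = 0"
      using inj by (auto simp: sum.reindex)
    then show "f v = 0"
      using assms[of j "\<lambda>i. f (z i)"] by simp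
  qed simp
  then show "dim (span (z ` {..<m})) = m"
    using dim_span_eq_card_independent[OF \<open>independent (z ` {..<m})\<close>] card_image[OF inj] by simp
qed

text \<open>Full rank is an open condition and the span depends continuously on the tuple: the
  coordinates of v are at most C * norm v, so moving each generator by less than \<eta> moves v by
  at most m * C * \<eta> * norm v.\<close>

lemma span_perturbation:
  fixes x :: "nat \<Rightarrow> pt"
  assumes x: "\<And>i. i < m \<Longrightarrow> x i \<in> Rn n" "dim (span (x ` {..<m})) = m" and "\<epsilon> > 0"
  obtains \<eta> where "\<eta> > 0" "\<And>z. (\<And>i. i < m \<Longrightarrow> z i \<in> Rn n \<and> dist (z i) (x i) < \<eta>) \<Longrightarrow>
     span (z ` {..<m}) \<in> Gr n m \<and> gap n (span (x ` {..<m})) (span (z ` {..<m})) < \<epsilon>"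
proof -
  obtain C where C: "C > 0" "inj_on x {..<m}"
    and bd: "\<And>a j. j < m \<Longrightarrow> \<bar>a j\<bar> \<le> C * norm (\<Sum>i<m. a i *\<^sub>R x i)"
    using coordinate_bound[OF x(2)] by blast
  \<comment> \<open>The bound 1/2 keeps the perturbed tuple independent, with the constant doubled;
    \<epsilon>/4 makes the resulting gap bound 2 * \<delta> smaller than \<epsilon>.\<close>
  define \<delta> where "\<delta> = min (1/2) (\<epsilon> / 4)"
  have \<delta>: "0 < \<delta>" "\<delta> \<le> 1/2" "2 * \<delta> < \<epsilon>" using \<open>\<epsilon> > 0\<close> by (auto simp: \<delta>_def min_def)
  \<comment> \<open>Adding 1 to the denominator covers m = 0.\<close>
  define \<eta> where "\<eta> = \<delta> / (real m * C + 1)"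
  have p: "real m * C + 1 > 0" using mult_nonneg_nonneg[of "real m" C] C(1) by linarith
  then have \<eta>: "\<eta> > 0" using \<delta> by (simp add: \<eta>_def)
  have "\<eta> * (real m * C) \<le> \<delta>"
  proof -
    have "\<eta> * (real m * C) \<le> \<eta> * (real m * C + 1)" using \<eta> by simp
    also have "\<dots> = \<delta>" using p by (simp add: \<eta>_def)
    finally show ?thesis .
  qed
  note \<eta>C = this
  show thesis
  proof (rule that[OF \<eta>])
    fix z assume z: "\<And>i. i < m \<Longrightarrow> z i \<in> Rn n \<and> dist (z i) (x i) < \<eta>"
    let ?E = "span (x ` {..<m})" and ?F = "span (z ` {..<m})"
    have near: "norm ((\<Sum>i<m. a i *\<^sub>R z i) - (\<Sum>i<m. a i *\<^sub>R x i)) \<le> \<delta> * norm (\<Sum>i<m. a i *\<^sub>R x i)" for a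
    proof -
      let ?v = "\<Sum>i<m. a i *\<^sub>R x i"
      have "norm ((\<Sum>i<m. a i *\<^sub>R z i) - ?v) = norm (\<Sum>i<m. a i *\<^sub>R (z i - x i))"
        by (simp add: sum_subtractf scaleR_diff_right)
      also have "\<dots> \<le> (\<Sum>i<m. norm (a i *\<^sub>R (z i - x i)))" by (rule norm_sum)
      also have "\<dots> \<le> (\<Sum>i<m. (C * norm ?v) * \<eta>)"
      proof (rule sum_mono)
        fix i assume "i \<in> {..<m}"
        then have "norm (a i *\<^sub>R (z i - x i)) = \<bar>a i\<bar> * dist (z i) (x i)" by (simp add: dist_norm)
        also have "\<dots> \<le> (C * norm ?v) * \<eta>"
          using bd[of i a] z[of i] \<open>i \<in> {..<m}\<close> C(1) by (intro mult_mono) auto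
        finally show "norm (a i *\<^sub>R (z i - x i)) \<le> (C * norm ?v) * \<eta>" .
      qed
      also have "\<dots> = (\<eta> * (real m * C)) * norm ?v" by simp
      also have "\<dots> \<le> \<delta> * norm ?v" by (rule mult_right_mono[OF \<eta>C]) simp
      finally show ?thesis .
    qed
    have half: "norm (\<Sum>i<m. a i *\<^sub>R x i) \<le> 2 * norm (\<Sum>i<m. a i *\<^sub>R z i)" for a
    proof -
      let ?v = "\<Sum>i<m. a i *\<^sub>R x i" and ?w = "\<Sum>i<m. a i *\<^sub>R z i"
      have "norm ?v \<le> norm ?w + norm (?w - ?v)"
        using norm_triangle_ineq4[of ?w "?w - ?v"] by simp
      moreover have "\<delta> * norm ?v \<le> (1/2) * norm ?v"
        by (rule mult_right_mono[OF \<delta>(2)]) simp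
      ultimately show ?thesis using near[of a] by linarith
    qed
    have bd': "\<bar>a j\<bar> \<le> (2 * C) * norm (\<Sum>i<m. a i *\<^sub>R z i)" if "j < m" for a j
      using bd[OF that, of a] mult_left_mono[OF half[of a], of C] C(1) by linarith
    note dz = dim_span_tuple_eq[where m = m and z = z and C = "2 * C", OF bd']
    have F: "?F \<in> Gr n m"
      using z dz(1) span_minimal[of "z ` {..<m}" "Rn n"] by (auto simp: Gr_def subspace_Rn)
    have E: "?E \<in> Gr n m"
      using x span_minimal[of "x ` {..<m}" "Rn n"] by (auto simp: Gr_def subspace_Rn)
    have EF: "infdist v ?F \<le> 2 * \<delta> * norm v" if v: "v \<in> ?E" for v
    proof -
      obtain a where a: "v = (\<Sum>i<m. a i *\<^sub>R x i)"
        by (rule span_tuple_repr[OF _ C(2) v]) auto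
      have "infdist v ?F \<le> dist v (\<Sum>i<m. a i *\<^sub>R z i)"
        by (intro infdist_le span_sum span_scale span_base) auto
      also have "\<dots> \<le> \<delta> * norm v" using near[of a] by (simp add: a dist_norm norm_minus_commute)
      also have "\<dots> \<le> 2 * \<delta> * norm v" using \<delta>(1) by simp
      finally show ?thesis .
    qed
    have FE: "infdist w ?E \<le> 2 * \<delta> * norm w" if w: "w \<in> ?F" for w
    proof -
      obtain a where a: "w = (\<Sum>i<m. a i *\<^sub>R z i)"
        by (rule span_tuple_repr[OF _ dz(2) w]) auto
      have "infdist w ?E \<le> dist w (\<Sum>i<m. a i *\<^sub>R x i)"
        by (intro infdist_le span_sum span_scale span_base) auto
      also have "\<dots> \<le> \<delta> * norm (\<Sum>i<m. a i *\<^sub>R x i)" using near[of a] by (simp add: a dist_norm)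
      also have "\<dots> \<le> \<delta> * (2 * norm w)" unfolding a by (rule mult_left_mono[OF half]) (use \<delta> in simp)
      finally show ?thesis by simp
    qed
    have comp: "infdist p G \<le> infdist p H + 2 * \<delta>"
      if p: "norm p \<le> 1" and H: "fdsub H" and HG: "\<And>v. v \<in> H \<Longrightarrow> infdist v G \<le> 2 * \<delta> * norm v" for p :: pt and G H
    proof -
      have "infdist p G \<le> infdist (proj H p) G + dist p (proj H p)"
        by (rule infdist_triangle)
      also have "infdist (proj H p) G \<le> 2 * \<delta> * norm (proj H p)"
        by (rule HG[OF proj_in[OF H]])
      also have "\<dots> \<le> 2 * \<delta> * 1"
        using norm_proj_le[OF H, of p] p \<delta>(1) by (intro mult_left_mono) auto
      finally show ?thesis by (simp add: infdist_fdsub[OF H] dist_norm)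
    qed
    have "gap n ?E ?F \<le> 2 * \<delta>"
      unfolding gap_def
    proof (rule cSUP_least)
      show "cball 0 1 \<inter> Rn n \<noteq> {}" using subspace_0[OF subspace_Rn] by force
      fix p assume "p \<in> cball 0 1 \<inter> Rn n"
      then have "norm p \<le> 1" by simp
      then show "\<bar>infdist p ?E - infdist p ?F\<bar> \<le> 2 * \<delta>"
        using comp[of p ?E ?F] comp[of p ?F ?E] EF FE Gr_fdsub[OF E] Gr_fdsub[OF F]
        by (auto simp: abs_le_iff)
    qed
    then show "?F \<in> Gr n m \<and> gap n ?E ?F < \<epsilon>"
      using F \<delta> by simp
  qed
qed

text \<open>The measure is the law of the span of m independent uniform vectors, conditioned on the
  event \<open>D\<close> that the span has dimension m. Conditioning requires only that
  \<open>D\<close> has positive probability, which holds near the coordinate vectors. Both the law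
  of the vectors and the event are rotation invariant. The product has countably many factors, so
  that its sigma-algebra is the Borel one on sequences; m coordinates are used.\<close>

lemma ex_rotation_invariant_prob_Gr:
  assumes "m \<le> n" "n > 0"
  shows "\<exists>M. rotation_invariant_prob_Gr n m M"
proof -
  let ?u = "usphere (Rn n)"
  have dn: "dim (Rn n) > 0" using assms(2) by (simp add: dim_Rn)
  interpret u: prob_space ?u by (rule prob_space_usphere[OF fdsub_Rn dn])
  interpret product_prob_space "\<lambda>_::nat. ?u" UNIV ..
  define P where "P = (\<Pi>\<^sub>M i\<in>(UNIV::nat set). ?u)"
  have P: "prob_space P" unfolding P_def by (rule P.prob_space_axioms)
  have sP: "sets P = sets borel" and spP: "space P = UNIV"
  proof -
    have "sets P = sets (\<Pi>\<^sub>M i\<in>(UNIV::nat set). (borel :: pt measure))"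
      unfolding P_def by (rule sets_PiM_cong) auto
    then show "sets P = sets borel" by (simp add: sets_PiM_equal_borel)
    then show "space P = UNIV" using sets_eq_imp_space_eq by fastforce
  qed
  \<comment> \<open>The sampled vectors lie in \<open>Rn n\<close> only almost surely; projecting
    them puts every span into \<open>Rn n\<close>, so the openness arguments need no exceptional
    set.\<close>
  define S where "S x = span ((\<lambda>i. proj (Rn n) (x i)) ` {..<m})" for x :: "nat \<Rightarrow> pt"
  define D where "D = {x. dim (S x) = m}"
  have prn: "proj (Rn n) v \<in> Rn n" for v by (rule proj_in[OF fdsub_Rn])
  have SGr: "S x \<in> Gr n m" if "x \<in> D" for x
    using that span_minimal[of "(\<lambda>i. proj (Rn n) (x i)) ` {..<m}" "Rn n"] prn
    by (auto simp: D_def S_def Gr_def subspace_Rn)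
  have opn: "open {x \<in> D. S x \<in> W}" if W: "gap_open n m W" for W
  proof (subst open_subopen, rule ballI)
    fix x assume "x \<in> {x \<in> D. S x \<in> W}"
    then have x: "x \<in> D" "S x \<in> W" by auto
    then obtain \<epsilon> where \<epsilon>: "\<epsilon> > 0" "\<And>F. F \<in> Gr n m \<Longrightarrow> gap n (S x) F < \<epsilon> \<Longrightarrow> F \<in> W"
      using W unfolding gap_open_def by metis
    have xm: "dim (span ((\<lambda>i. proj (Rn n) (x i)) ` {..<m})) = m"
      using x(1) by (simp add: D_def S_def)
    obtain \<eta> where \<eta>: "\<eta> > 0" "\<And>z. (\<And>i. i < m \<Longrightarrow> z i \<in> Rn n \<and> dist (z i) (proj (Rn n) (x i)) < \<eta>) \<Longrightarrow>
       span (z ` {..<m}) \<in> Gr n m \<and> gap n (S x) (span (z ` {..<m})) < \<epsilon>"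
      unfolding S_def
      by (rule span_perturbation[where x = "\<lambda>i. proj (Rn n) (x i)" and m = m, OF prn xm \<epsilon>(1)]) blast+
    let ?U = "\<Inter>i\<in>{..<m}. (\<lambda>z. z i) -` ball (x i) \<eta>"
    have "open ?U"
      by (intro open_INT ballI open_vimage open_ball) (auto intro: continuous_on_product_coordinates)
    moreover have "x \<in> ?U" using \<eta>(1) by simp
    moreover have "?U \<subseteq> {x \<in> D. S x \<in> W}"
    proof
      fix z assume z: "z \<in> ?U"
      have "dist (proj (Rn n) (z i)) (proj (Rn n) (x i)) < \<eta>" if "i < m" for i
        using z that norm_proj_le[OF fdsub_Rn, of n "z i - x i"]
        by (auto simp: dist_norm linear_diff[OF linear_proj] norm_minus_commute intro: le_less_trans)
      then have "S z \<in> Gr n m \<and> gap n (S x) (S z) < \<epsilon>"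
        unfolding S_def[of z] using \<eta>(2)[of "\<lambda>i. proj (Rn n) (z i)"] prn by simp
      then show "z \<in> {x \<in> D. S x \<in> W}"
        using \<epsilon>(2) by (auto simp: D_def Gr_def)
    qed
    ultimately show "\<exists>T. open T \<and> x \<in> T \<and> T \<subseteq> {x \<in> D. S x \<in> W}" by blast
  qed
  have "gap_open n m (Gr n m)" by (auto simp: gap_open_def intro: exI[of _ 1])
  moreover have "{x \<in> D. S x \<in> Gr n m} = D" using SGr by auto
  ultimately have oD: "open D" using opn[of "Gr n m"] by simp
  then have D: "D \<in> sets P" by (simp add: sP)
  have Dpos: "emeasure P D > 0"
  proof -
    let ?x = "\<lambda>i. unit_vec_at i"
    have "span (?x ` {..<m}) = Rn m" by (rule onbasis_span[OF onbasis_Rn])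
    moreover have "Rn m \<subseteq> Rn n" using assms(1) by (auto simp: Rn_def)
    ultimately have "?x ` {..<m} \<subseteq> Rn n" "dim (span (?x ` {..<m})) = m"
      using span_superset[of "?x ` {..<m}"] dim_Rn[of m] by auto
    then have ui: "\<And>i. i < m \<Longrightarrow> ?x i \<in> Rn n" "dim (span (?x ` {..<m})) = m" by auto
    obtain \<eta> where \<eta>: "\<eta> > 0" "\<And>z. (\<And>i. i < m \<Longrightarrow> z i \<in> Rn n \<and> dist (z i) (?x i) < \<eta>) \<Longrightarrow>
       span (z ` {..<m}) \<in> Gr n m \<and> gap n (span (?x ` {..<m})) (span (z ` {..<m})) < 1"
      by (rule span_perturbation[where x = unit_vec_at and m = m and n = n and \<epsilon> = 1])
         (use ui in \<open>(simp; fail) | blast\<close>)+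
    \<comment> \<open>The event that the first m vectors are close to the coordinate vectors. By
      independence its probability is a product of masses of balls centred on the sphere, all
      positive.\<close>
    let ?B = "{z\<in>space (\<Pi>\<^sub>M i\<in>(UNIV::nat set). ?u). \<forall>i\<in>{..<m}. z i \<in> ball (?x i) \<eta>}"
    have "emeasure P ?B = (\<Prod>i\<in>{..<m}. emeasure ?u (ball (?x i) \<eta>))"
      unfolding P_def by (rule emeasure_PiM_Collect) auto
    also have "\<dots> > 0"
    proof -
      have pos: "emeasure ?u (ball (?x i) \<eta>) > 0" if "i < m" for i
        using that assms(1) \<eta>(1)
        by (intro rot_inv_ball_pos[OF rot_inv_usphere[OF fdsub_Rn dn] subspace_Rn])
           (auto simp: norm_unit_vec_at unit_vec_at_in)
      have "\<And>i. i < m \<Longrightarrow> emeasure ?u (ball (?x i) \<eta>) \<noteq> 0"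
        by (rule less_imp_neq[OF pos, THEN not_sym])
      then have "(\<Prod>i\<in>{..<m}. emeasure ?u (ball (?x i) \<eta>)) \<noteq> 0" by simp
      then show ?thesis by (simp add: zero_less_iff_neq_zero)
    qed
    finally have "0 < emeasure P ?B" .
    also have "emeasure P ?B \<le> emeasure P D"
    proof (rule emeasure_mono[OF _ D])
      show "?B \<subseteq> D"
      proof
        fix z assume z: "z \<in> ?B"
        have "dist (proj (Rn n) (z i)) (?x i) < \<eta>" if i: "i < m" for i
        proof -
          have "?x i \<in> Rn n" using i assms(1) by (intro unit_vec_at_in) simp
          then have "dist (proj (Rn n) (z i)) (?x i) = norm (proj (Rn n) (z i - ?x i))"
            by (simp add: dist_norm linear_diff[OF linear_proj] proj_id[OF fdsub_Rn])
          also have "\<dots> \<le> norm (z i - ?x i)" by (rule norm_proj_le[OF fdsub_Rn])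
          also have "\<dots> < \<eta>" using z i by (auto simp: dist_norm norm_minus_commute)
          finally show ?thesis .
        qed
        then have "S z \<in> Gr n m"
          unfolding S_def using \<eta>(2)[of "\<lambda>i. proj (Rn n) (z i)"] prn by simp
        then show "z \<in> D" by (simp add: D_def Gr_def)
      qed
    qed
    finally show ?thesis .
  qed
  interpret PP: prob_space P by fact
  have Dfin: "emeasure P D < \<infinity>" using PP.emeasure_finite[of D] by (simp add: less_top[symmetric])
  define Q where "Q = uniform_measure P D"
  have Q: "prob_space Q"
    unfolding Q_def using Dpos Dfin by (intro prob_space_uniform_measure) auto
  have sQ: "sets Q = sets borel" and spQ: "space Q = UNIV" by (simp_all add: Q_def sP spP)
  define E0 where "E0 = Rn m"
  have E0: "E0 \<in> Gr n m"
    using assms(1) by (auto simp: E0_def Gr_def subspace_Rn dim_Rn) (auto simp: Rn_def)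
  \<comment> \<open>Outside \<open>D\<close>, a null set for \<open>Q\<close>, the value is an
    arbitrary fixed subspace, so that the map is defined everywhere.\<close>
  define S' where "S' x = (if x \<in> D then S x else E0)" for x
  have S'm: "S' \<in> Q \<rightarrow>\<^sub>M borel_Gr n m"
  proof (rule measurable_into_Gr)
    fix W assume W: "gap_open n m W"
    have "S' -` W \<inter> space Q = {x \<in> D. S x \<in> W} \<union> (if E0 \<in> W then - D else {})"
      by (auto simp: S'_def spQ split: if_splits)
    then show "S' -` W \<inter> space Q \<in> sets Q"
      using opn[OF W] oD by (auto simp: sQ)
  qed (auto simp: S'_def SGr E0)
  let ?M = "distr Q (borel_Gr n m) S'"
  have "rotation_invariant_prob_Gr n m ?M"
    unfolding rotation_invariant_prob_Gr_def
  proof (intro conjI allI impI)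
    show "prob_space ?M" by (rule prob_space.prob_space_distr[OF Q S'm])
    fix U :: "pt \<Rightarrow> pt" assume U: "orthogonal_transformation U \<and> U ` Rn n = Rn n"
    then have lin: "linear U" by (simp add: orthogonal_transformation)
    define \<tau> where "\<tau> x i = U (x i)" for x :: "nat \<Rightarrow> pt" and i
    have Ub: "U \<in> borel_measurable borel" using U orthogonal_transformation_measurable by blast
    then have Um: "U \<in> ?u \<rightarrow>\<^sub>M ?u" by measurable
    have \<tau>m: "\<tau> \<in> P \<rightarrow>\<^sub>M P"
      unfolding P_def \<tau>_def[abs_def]
    proof (rule measurable_PiM_single')
      fix i :: nat
      have "(\<lambda>x. x i) \<in> (\<Pi>\<^sub>M i\<in>(UNIV::nat set). ?u) \<rightarrow>\<^sub>M ?u"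
        by (rule measurable_component_singleton) simp
      then show "(\<lambda>x. U (x i)) \<in> (\<Pi>\<^sub>M i\<in>(UNIV::nat set). ?u) \<rightarrow>\<^sub>M ?u"
        by (rule measurable_compose[OF _ Um])
    qed (simp add: space_PiM)
    have \<tau>P: "distr P P \<tau> = P"
      unfolding P_def
    proof (rule PiM_eq)
      fix J :: "nat set" and F assume J: "finite J" and F: "\<And>j. j \<in> J \<Longrightarrow> F j \<in> sets ?u"
      let ?PP = "\<Pi>\<^sub>M i\<in>(UNIV::nat set). ?u"
      have em: "prod_emb UNIV (\<lambda>_. ?u) J (Pi\<^sub>E J F) = {x \<in> space ?PP. \<forall>i\<in>J. x i \<in> F i}" for F
        by (auto simp: prod_emb_def space_PiM PiE_iff)
      have "emeasure (distr ?PP ?PP \<tau>) (prod_emb UNIV (\<lambda>_. ?u) J (Pi\<^sub>E J F))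
          = emeasure ?PP (\<tau> -` prod_emb UNIV (\<lambda>_. ?u) J (Pi\<^sub>E J F) \<inter> space ?PP)"
        by (rule emeasure_distr) (use \<tau>m J F in \<open>auto simp: P_def intro!: sets_PiM_I\<close>)
      also have "\<tau> -` prod_emb UNIV (\<lambda>_. ?u) J (Pi\<^sub>E J F) \<inter> space ?PP
          = {x \<in> space ?PP. \<forall>i\<in>J. x i \<in> U -` F i}"
        unfolding em by (auto simp: \<tau>_def space_PiM)
      also have "emeasure ?PP \<dots> = (\<Prod>i\<in>J. emeasure ?u (U -` F i))"
        by (rule emeasure_PiM_Collect)
           (use J F measurable_sets[OF Ub] in \<open>auto\<close>)
      also have "\<dots> = (\<Prod>i\<in>J. emeasure ?u (F i))"
      proof (rule prod.cong[OF refl])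
        fix i assume "i \<in> J"
        then have "F i \<in> sets borel" using F by simp
        moreover have "U \<in> ?u \<rightarrow>\<^sub>M borel"
          unfolding measurable_cong_sets[OF sets_usphere refl] by (rule Ub)
        ultimately have "emeasure (distr ?u borel U) (F i) = emeasure ?u (U -` F i)"
          using emeasure_distr[of U ?u borel "F i"] by simp
        then show "emeasure ?u (U -` F i) = emeasure ?u (F i)"
          using rot_inv_usphere[OF fdsub_Rn dn] U by (simp add: rot_inv_def)
      qed
      finally show "emeasure (distr ?PP ?PP \<tau>) (prod_emb UNIV (\<lambda>_. ?u) J (Pi\<^sub>E J F))
          = (\<Prod>j\<in>J. emeasure ?u (F j))" .
    qed simp
    have S\<tau>: "S (\<tau> x) = U ` S x" for x
    proof -
      have "proj (Rn n) (U v) = U (proj (Rn n) v)" for v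
        using proj_image[OF fdsub_Rn, of U n v] U by simp
      then have "S (\<tau> x) = span (U ` (\<lambda>i. proj (Rn n) (x i)) ` {..<m})"
        by (simp add: S_def \<tau>_def image_image)
      then show ?thesis
        by (simp add: linear_span_image[OF lin] S_def)
    qed
    have D\<tau>: "\<tau> x \<in> D \<longleftrightarrow> x \<in> D" for x
    proof -
      have "fdsub (S x)" unfolding S_def by (rule fdsub_span) simp
      then show ?thesis
        using U dim_image_orthogonal[of "S x" U] by (simp add: D_def S\<tau>)
    qed
    note imU = image_measurable_Gr[of U n m]
    show "distr ?M ?M (\<lambda>E. U ` E) = ?M"
    proof (rule measure_eqI)
      fix A assume "A \<in> sets (distr ?M ?M (\<lambda>E. U ` E))"
      then have A: "A \<in> sets (borel_Gr n m)" by simp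
      have Sm: "S' -` A \<in> sets P" if "A \<in> sets (borel_Gr n m)" for A
        using measurable_sets[OF S'm that] by (simp add: spQ sQ sP)
      have val: "emeasure ?M A = emeasure P (D \<inter> S' -` A) / emeasure P D"
        if "A \<in> sets (borel_Gr n m)" for A
        using Sm[OF that] S'm that D by (simp add: emeasure_distr spQ) (simp add: Q_def)
      let ?A = "(\<lambda>E. U ` E) -` A \<inter> Gr n m"
      have A2: "?A \<in> sets (borel_Gr n m)"
        using measurable_sets[OF imU A] U by (simp add: space_borel_Gr)
      have "emeasure (distr ?M ?M (\<lambda>E. U ` E)) A = emeasure ?M ((\<lambda>E. U ` E) -` A \<inter> space ?M)"
        using imU U A by (intro emeasure_distr) auto
      also have "\<dots> = emeasure P (D \<inter> S' -` ?A) / emeasure P D"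
        using val[OF A2] by (simp add: space_borel_Gr)
      also have "D \<inter> S' -` ?A = \<tau> -` (D \<inter> S' -` A) \<inter> space P"
        using SGr by (auto simp: S'_def S\<tau> D\<tau> spP)
      also have "emeasure P \<dots> = emeasure (distr P P \<tau>) (D \<inter> S' -` A)"
        using \<tau>m D Sm[OF A] by (subst emeasure_distr) auto
      also have "\<dots> / emeasure P D = emeasure ?M A"
        unfolding \<tau>P val[OF A] ..
      finally show "emeasure (distr ?M ?M (\<lambda>E. U ` E)) A = emeasure ?M A" .
    qed simp
  qed simp
  then show ?thesis ..
qed

lemma haar_Gr_rotation_invariant:
  "m \<le> n \<Longrightarrow> n > 0 \<Longrightarrow> rotation_invariant_prob_Gr n m (haar_Gr n m)"
  unfolding haar_Gr_def by (rule someI_ex) (rule ex_rotation_invariant_prob_Gr)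

text \<open>A uniform vector of a random subspace is uniform on the sphere of \<open>Rn n\<close>,
  by the same invariance principle as for hyperplanes. The Grassmannian average thus reduces to a
  moment of \<rho> over one sphere.\<close>

lemma integral_haar_Gr_avg_section:
  assumes K: "cbody n r R K" and m: "1 \<le> m" "m \<le> n"
  shows "(\<integral>E. avg_section E K \<partial>haar_Gr n m) = unit_ball_vol (m - 1) * radial_moment n K (m - 1)"
proof -
  let ?u = "usphere (Rn n)"
  let ?\<nu> = "haar_Gr n m"
  have dn: "dim (Rn n) > 0" using m by (simp add: dim_Rn)
  have inv: "rotation_invariant_prob_Gr n m ?\<nu>"
    by (rule haar_Gr_rotation_invariant) (use m in auto)
  then have s\<nu>: "sets ?\<nu> = sets (borel_Gr n m)" and p\<nu>: "prob_space ?\<nu>"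
    by (auto simp: rotation_invariant_prob_Gr_def)
  have sp\<nu>: "space ?\<nu> = Gr n m"
    using sets_eq_imp_space_eq[OF s\<nu>] by (simp add: space_borel_Gr)
  interpret \<nu>: prob_space ?\<nu> by fact
  interpret u: prob_space ?u by (rule prob_space_usphere[OF fdsub_Rn dn])
  interpret P: pair_prob_space ?\<nu> ?u ..
  \<comment> \<open>On \<open>Rn n\<close> this is the normalised projection of x to E. Expanding x
    in coordinates separates the two variables: E enters only through the projections of the
    coordinate vectors, which gives joint measurability.\<close>
  let ?f = "\<lambda>z :: pt set \<times> pt. sgn (\<Sum>i<n. (snd z \<bullet> unit_vec_at i) *\<^sub>R proj (fst z) (unit_vec_at i))"
  have f_eq: "?f (E, x) = sgn (proj E x)" if "x \<in> Rn n" for E x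
  proof -
    have "proj E x = proj E (\<Sum>i<n. Poly_Mapping.lookup x i *\<^sub>R unit_vec_at i)"
      using Rn_sum_repr[OF that] by simp
    then show ?thesis
      by (simp add: linear_sum[OF linear_proj] linear_scale[OF linear_proj] inner_unit_vec_at)
  qed
  have pm: "(\<lambda>z. proj (fst z) y) \<in> borel_measurable (?\<nu> \<Otimes>\<^sub>M ?u)" for y
  proof (rule measurable_compose[OF measurable_fst])
    show "(\<lambda>E. proj E y) \<in> ?\<nu> \<rightarrow>\<^sub>M borel"
      unfolding measurable_cong_sets[OF s\<nu> refl] by (rule proj_measurable_Gr)
  qed
  have fm: "?f \<in> borel_measurable (?\<nu> \<Otimes>\<^sub>M ?u)"
    by (rule measurable_compose[OF _ measurable_sgn_pt], intro borel_measurable_sum borel_measurable_scaleR pm)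
       measurable
  have law: "distr (?\<nu> \<Otimes>\<^sub>M ?u) borel ?f = ?u"
  proof (rule distr_pair_rot_inv[OF fdsub_Rn dn p\<nu> fm])
    fix E assume "E \<in> space ?\<nu>"
    then have E: "E \<in> Gr n m" by (simp add: sp\<nu>)
    then have E': "subspace E" "E \<subseteq> Rn n" "dim E > 0" using m by (auto simp: Gr_def)
    obtain \<xi> where \<xi>: "\<xi> \<in> E" "norm \<xi> = 1"
      by (rule fdsub_ex_unit[OF Gr_fdsub[OF E] E'(3)])
    have "AE x in ?u. x \<bullet> \<xi> \<noteq> 0"
      by (rule AE_usphere_hyperplane[OF fdsub_Rn]) (use \<xi> E' in auto)
    then show "AE x in ?u. ?f (E, x) \<in> sphere 0 1 \<inter> Rn n"
      using AE_usphere_sphere[OF fdsub_Rn dn]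
    proof eventually_elim
      case (elim x)
      have "proj E x \<noteq> 0"
        using proj_inner[OF Gr_fdsub[OF E] \<xi>(1), of x] elim by auto
      moreover have "proj E x \<in> Rn n"
        using proj_in[OF Gr_fdsub[OF E]] E' by auto
      moreover have "?f (E, x) = sgn (proj E x)"
        using elim by (intro f_eq) simp
      ultimately show ?case
        by (auto simp: norm_sgn) (auto simp: sgn_div_norm subspace_scale[OF subspace_Rn])
    qed
  next
    fix U :: "pt \<Rightarrow> pt" assume U: "orthogonal_transformation U" "U ` Rn n = Rn n"
    then have lin: "linear U" and nrm: "\<And>x. norm (U x) = norm x" by (auto simp: orthogonal_transformation)
    have "distr ?\<nu> ?\<nu> (\<lambda>E. U ` E) = ?\<nu>"
      using inv U by (simp add: rotation_invariant_prob_Gr_def)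
    moreover have "(\<lambda>E. U ` E) \<in> ?\<nu> \<rightarrow>\<^sub>M ?\<nu>"
      unfolding measurable_cong_sets[OF s\<nu> s\<nu>] by (rule image_measurable_Gr[OF U])
    moreover have "U (?f (E, x)) = ?f (U ` E, U x)" if "E \<in> space ?\<nu>" "x \<in> sphere 0 1 \<inter> Rn n" for E x
    proof -
      have x: "x \<in> Rn n" "U x \<in> Rn n" using that U by auto
      have fE: "fdsub E" using that by (auto simp: sp\<nu> intro: Gr_fdsub)
      have "U (sgn (proj E x)) = sgn (U (proj E x))"
        by (simp add: sgn_div_norm nrm linear_scale[OF lin])
      then show ?thesis
        unfolding f_eq[OF x(1)] f_eq[OF x(2)] proj_image[OF fE U(1)] .
    qed
    ultimately show "\<exists>V\<in>?\<nu> \<rightarrow>\<^sub>M ?\<nu>. distr ?\<nu> ?\<nu> V = ?\<nu> \<and>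
        (\<forall>E\<in>space ?\<nu>. \<forall>x\<in>sphere 0 1 \<inter> Rn n. U (?f (E, x)) = ?f (V E, U x))"
      by blast
  qed
  note rm = radial_measurable[OF K]
  let ?g = "\<lambda>z. unit_ball_vol (m - 1) * radial K (?f z) ^ (m - 1)"
  have int: "integrable (?\<nu> \<Otimes>\<^sub>M ?u) ?g"
  proof (rule integrable_mult_right, rule integral_radial_sgn[OF K P.prob_space_axioms])
    show "(\<lambda>z. \<Sum>i<n. (snd z \<bullet> unit_vec_at i) *\<^sub>R proj (fst z) (unit_vec_at i)) \<in> borel_measurable (?\<nu> \<Otimes>\<^sub>M ?u)"
      by (intro borel_measurable_sum borel_measurable_scaleR pm) measurable
  qed
  have avg: "avg_section E K = (\<integral>x. ?g (E, x) \<partial>?u)" if "E \<in> space ?\<nu>" for E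
  proof -
    have E: "E \<in> Gr n m" using that by (simp add: sp\<nu>)
    then have E': "subspace E" "E \<subseteq> Rn n" "dim E = m" by (auto simp: Gr_def)
    have pE: "(\<lambda>x. sgn (proj E x)) \<in> borel_measurable ?u"
      unfolding measurable_cong_sets[OF sets_usphere refl]
      by (intro measurable_compose[OF _ measurable_sgn_pt] borel_measurable_continuous_onI continuous_on_proj continuous_on_id)
    have "avg_section E K = unit_ball_vol (m - 1) * (\<integral>x. radial K x ^ (m - 1) \<partial>usphere E)"
      using avg_section_eq[OF K E'(1,2)] m E'(3) by simp
    also have "usphere E = distr ?u borel (\<lambda>x. sgn (proj E x))"
      by (rule rot_inv_proj[symmetric, OF fdsub_Rn dn]) (use E' m in auto)
    also have "(\<integral>x. radial K x ^ (m - 1) \<partial>\<dots>) = (\<integral>x. radial K (sgn (proj E x)) ^ (m - 1) \<partial>?u)"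
      by (rule integral_distr[OF pE]) (intro borel_measurable_power rm)
    also have "\<dots> = (\<integral>x. radial K (?f (E, x)) ^ (m - 1) \<partial>?u)"
    proof (rule integral_cong_AE)
      show "AE x in ?u. radial K (sgn (proj E x)) ^ (m - 1) = radial K (?f (E, x)) ^ (m - 1)"
        using AE_usphere_sphere[OF fdsub_Rn dn]
      proof eventually_elim
        case (elim x)
        then have "?f (E, x) = sgn (proj E x)" by (intro f_eq) simp
        then show ?case by (simp only:)
      qed
      show "(\<lambda>x. radial K (sgn (proj E x)) ^ (m - 1)) \<in> borel_measurable ?u"
        by (intro borel_measurable_power measurable_compose[OF pE rm])
      have "(\<lambda>x. ?f (E, x)) \<in> borel_measurable ?u"
        by (rule measurable_compose[OF measurable_Pair1'[OF that] fm])
      then show "(\<lambda>x. radial K (?f (E, x)) ^ (m - 1)) \<in> borel_measurable ?u"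
        by (intro borel_measurable_power measurable_compose[OF _ rm])
    qed
    finally show ?thesis by simp
  qed
  have "(\<integral>E. avg_section E K \<partial>?\<nu>) = (\<integral>E. (\<integral>x. ?g (E, x) \<partial>?u) \<partial>?\<nu>)"
    by (rule Bochner_Integration.integral_cong[OF refl avg])
  also have "\<dots> = (\<integral>z. ?g z \<partial>(?\<nu> \<Otimes>\<^sub>M ?u))"
    by (rule P.integral_fst'[OF int])
  also have "\<dots> = unit_ball_vol (m - 1) * (\<integral>z. radial K (?f z) ^ (m - 1) \<partial>(?\<nu> \<Otimes>\<^sub>M ?u))"
    by simp
  also have "(\<integral>z. radial K (?f z) ^ (m - 1) \<partial>(?\<nu> \<Otimes>\<^sub>M ?u))
      = (\<integral>x. radial K x ^ (m - 1) \<partial>distr (?\<nu> \<Otimes>\<^sub>M ?u) borel ?f)"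
    by (rule integral_distr[OF fm, symmetric]) (intro borel_measurable_power rm)
  finally show ?thesis
    unfolding law by (simp add: radial_moment_def[OF K])
qed

section \<open>Centered convex bodies\<close>

definition diag_map :: "pt \<Rightarrow> real \<Rightarrow> real \<Rightarrow> pt \<Rightarrow> pt" where
  "diag_map \<xi> s \<tau> x = \<tau> *\<^sub>R x + ((s - \<tau>) * (x \<bullet> \<xi>)) *\<^sub>R \<xi>"

lemma linear_diag_map: "linear (diag_map \<xi> s \<tau>)"
  by (rule linearI) (auto simp: diag_map_def inner_add_left algebra_simps)

lemma continuous_diag_map [continuous_intros]:
  "continuous_on A f \<Longrightarrow> continuous_on A (\<lambda>x. diag_map \<xi> s \<tau> (f x))"
  unfolding diag_map_def by (intro continuous_intros)

lemma diag_map_measurable [measurable]: "diag_map \<xi> s \<tau> \<in> borel_measurable borel"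
  by (intro borel_measurable_continuous_onI continuous_intros)

lemma diag_map_in: "subspace E \<Longrightarrow> \<xi> \<in> E \<Longrightarrow> x \<in> E \<Longrightarrow> diag_map \<xi> s \<tau> x \<in> E"
  by (auto simp: diag_map_def intro!: subspace_add subspace_scale)

lemma diag_map_comp:
  assumes "norm \<xi> = 1"
  shows "diag_map \<xi> s \<tau> (diag_map \<xi> s' \<tau>' x) = diag_map \<xi> (s * s') (\<tau> * \<tau>') x"
proof -
  have "\<xi> \<bullet> \<xi> = 1" using assms by (simp add: norm_eq_1)
  then show ?thesis
    by (simp add: diag_map_def inner_add_left scaleR_add_right[symmetric] scaleR_add_left[symmetric])
       (simp add: algebra_simps)
qed

lemma diag_map_id: "diag_map \<xi> 1 1 x = x"
  by (simp add: diag_map_def)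

lemma diag_map_inverse:
  assumes "norm \<xi> = 1" "s \<noteq> 0" "\<tau> \<noteq> 0"
  shows "diag_map \<xi> s \<tau> (diag_map \<xi> (1 / s) (1 / \<tau>) x) = x"
    "diag_map \<xi> (1 / s) (1 / \<tau>) (diag_map \<xi> s \<tau> x) = x"
  using assms by (simp_all add: diag_map_comp diag_map_id)

lemma diag_map_image_Rn:
  assumes "norm \<xi> = 1" "s \<noteq> 0" "\<tau> \<noteq> 0" "subspace E" "\<xi> \<in> E"
  shows "diag_map \<xi> s \<tau> ` E = E"
proof
  show "diag_map \<xi> s \<tau> ` E \<subseteq> E" using diag_map_in assms by blast
  show "E \<subseteq> diag_map \<xi> s \<tau> ` E"
  proof
    fix x assume "x \<in> E"
    then have "diag_map \<xi> (1 / s) (1 / \<tau>) x \<in> E" using diag_map_in assms by blast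
    then show "x \<in> diag_map \<xi> s \<tau> ` E"
      using diag_map_inverse(1)[OF assms(1-3), of x] by (metis image_eqI)
  qed
qed

lemma diag_map_image_eq:
  assumes "norm \<xi> = 1" "s \<noteq> 0" "\<tau> \<noteq> 0"
  shows "diag_map \<xi> s \<tau> ` A = diag_map \<xi> (1 / s) (1 / \<tau>) -` A"
proof -
  have "x \<in> diag_map \<xi> s \<tau> ` A" if "diag_map \<xi> (1 / s) (1 / \<tau>) x \<in> A" for x
    using that diag_map_inverse(1)[OF assms, of x] by (metis image_eqI)
  then show ?thesis using diag_map_inverse(2)[OF assms] by auto
qed

lemma norm_diag_map:
  assumes "norm \<xi> = 1"
  shows "norm (diag_map \<xi> s \<tau> x) ^ 2 = s\<^sup>2 * (x \<bullet> \<xi>)\<^sup>2 + \<tau>\<^sup>2 * (norm x ^ 2 - (x \<bullet> \<xi>)\<^sup>2)"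
proof -
  have "\<xi> \<bullet> \<xi> = 1" using assms by (simp add: norm_eq_1)
  then show ?thesis
    by (simp add: diag_map_def power2_norm_eq_inner inner_add_left inner_add_right inner_commute)
       (simp add: power2_eq_square algebra_simps)
qed

lemma inner_sq_le: "norm \<xi> = 1 \<Longrightarrow> (x \<bullet> \<xi>)\<^sup>2 \<le> norm (x::pt) ^ 2"
  using Cauchy_Schwarz_ineq2[of x \<xi>] by (metis abs_le_square_iff abs_norm_cancel mult.right_neutral)

text \<open>After splitting off the line of \<xi>, the map scales the line by \<open>s\<close> and
  the complement by \<tau>; the two changes of variables give the Jacobian.\<close>

lemma nn_integral_diag_map:
  assumes E: "fdsub E" "\<xi> \<in> E" "norm \<xi> = 1" and s: "s > 0" "\<tau> > 0"
    and f[measurable]: "f \<in> borel_measurable borel"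
  shows "(\<integral>\<^sup>+x. f x \<partial>leb E) = ennreal (s * \<tau> ^ (dim E - 1)) * (\<integral>\<^sup>+x. f (diag_map \<xi> s \<tau> x) \<partial>leb E)"
proof -
  let ?F = "E \<inter> hyperplane_perp \<xi>"
  have F: "fdsub ?F" by (rule fdsub_perp[OF E(1)])
  have d: "dim ?F = dim E - 1" using dim_perp[OF E] by simp
  have \<xi>\<xi>: "\<xi> \<bullet> \<xi> = 1" using E(3) by (simp add: norm_eq_1)
  have "(\<integral>\<^sup>+x. f x \<partial>leb E) = (\<integral>\<^sup>+y. (\<integral>\<^sup>+t. f (t *\<^sub>R \<xi> + y) \<partial>lborel) \<partial>leb ?F)"
    by (rule leb_split[OF E(1) f E(2,3)])
  also have "\<dots> = ennreal (\<tau> ^ (dim E - 1)) * (\<integral>\<^sup>+y. (\<integral>\<^sup>+t. f (t *\<^sub>R \<xi> + \<tau> *\<^sub>R y) \<partial>lborel) \<partial>leb ?F)"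
    using leb_scale[OF F, of "\<lambda>y. \<integral>\<^sup>+t. f (t *\<^sub>R \<xi> + y) \<partial>lborel" \<tau>] s d by simp
  also have "(\<integral>\<^sup>+y. (\<integral>\<^sup>+t. f (t *\<^sub>R \<xi> + \<tau> *\<^sub>R y) \<partial>lborel) \<partial>leb ?F)
      = (\<integral>\<^sup>+y. ennreal s * (\<integral>\<^sup>+t. f (diag_map \<xi> s \<tau> (t *\<^sub>R \<xi> + y)) \<partial>lborel) \<partial>leb ?F)"
  proof (rule nn_integral_cong_AE, use leb_AE[OF F] in eventually_elim)
    case (elim y)
    then have "y \<bullet> \<xi> = 0" by (simp add: hyperplane_perp_def)
    then have "diag_map \<xi> s \<tau> (t *\<^sub>R \<xi> + y) = (0 + s * t) *\<^sub>R \<xi> + \<tau> *\<^sub>R y" for t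
      using \<xi>\<xi> by (simp add: diag_map_def inner_add_left algebra_simps)
    then show ?case
      using nn_integral_real_affine[of "\<lambda>t. f (t *\<^sub>R \<xi> + \<tau> *\<^sub>R y)" s 0] s by simp
  qed
  also have "\<dots> = ennreal s * (\<integral>\<^sup>+y. (\<integral>\<^sup>+t. f (diag_map \<xi> s \<tau> (t *\<^sub>R \<xi> + y)) \<partial>lborel) \<partial>leb ?F)"
    by (rule nn_integral_cmult) measurable
  also have "(\<integral>\<^sup>+y. (\<integral>\<^sup>+t. f (diag_map \<xi> s \<tau> (t *\<^sub>R \<xi> + y)) \<partial>lborel) \<partial>leb ?F)
      = (\<integral>\<^sup>+x. f (diag_map \<xi> s \<tau> x) \<partial>leb E)"
    by (rule leb_split[OF E(1) _ E(2,3), symmetric]) measurable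
  finally show ?thesis
    using s by (simp add: mult.assoc[symmetric] ennreal_mult'[symmetric] mult.commute)
qed

lemma diag_map_image_borel:
  assumes "norm \<xi> = 1" "s \<noteq> 0" "\<tau> \<noteq> 0" "A \<in> sets borel"
  shows "diag_map \<xi> s \<tau> ` A \<in> sets borel"
  unfolding diag_map_image_eq[OF assms(1-3)]
  using measurable_sets[OF diag_map_measurable[of \<xi> "1/s" "1/\<tau>"] assms(4)] by simp

lemma emeasure_diag_map:
  assumes E: "fdsub E" "\<xi> \<in> E" "norm \<xi> = 1" and s: "s > 0" "\<tau> > 0" and A: "A \<in> sets borel"
  shows "emeasure (leb E) (diag_map \<xi> s \<tau> ` A) = ennreal (s * \<tau> ^ (dim E - 1)) * emeasure (leb E) A"
proof -
  have TA: "diag_map \<xi> s \<tau> ` A \<in> sets borel"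
    by (rule diag_map_image_borel) (use E s A in auto)
  have "indicator (diag_map \<xi> s \<tau> ` A) (diag_map \<xi> s \<tau> x) = (indicator A x :: ennreal)" for x
    using diag_map_inverse(2)[OF E(3), of s \<tau> x] s
    by (auto simp: diag_map_image_eq[OF E(3), of s \<tau>] indicator_def)
  then show ?thesis
    using nn_integral_diag_map[OF E s, of "indicator (diag_map \<xi> s \<tau> ` A)"] TA A by simp
qed

section \<open>Determinants of these maps\<close>

lemma det_Rn_comp:
  assumes S: "linear S" and T: "T ` Rn n \<subseteq> Rn n"
  shows "det_Rn n (\<lambda>x. S (T x)) = det_Rn n S * det_Rn n T"
proof -
  let ?M = "\<lambda>T. Matrix.mat n n (\<lambda>(i, j). Poly_Mapping.lookup (T (unit_vec_at j)) i) :: real Matrix.mat"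
  have "?M (\<lambda>x. S (T x)) = ?M S * ?M T"
  proof (rule eq_matI)
    fix i j assume ij: "i < dim_row (?M S * ?M T)" "j < dim_col (?M S * ?M T)"
    then have i: "i < n" and j: "j < n" by auto
    have "T (unit_vec_at j) \<in> Rn n" using T unit_vec_at_in[OF j] by blast
    then have "S (T (unit_vec_at j)) = S (\<Sum>k<n. Poly_Mapping.lookup (T (unit_vec_at j)) k *\<^sub>R unit_vec_at k)"
      by (simp add: Rn_sum_repr)
    also have "\<dots> = (\<Sum>k<n. Poly_Mapping.lookup (T (unit_vec_at j)) k *\<^sub>R S (unit_vec_at k))"
      by (simp add: linear_sum[OF S] linear_scale[OF S])
    finally have "Poly_Mapping.lookup (S (T (unit_vec_at j))) i
        = (\<Sum>k<n. Poly_Mapping.lookup (S (unit_vec_at k)) i * Poly_Mapping.lookup (T (unit_vec_at j)) k)"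
      by (simp add: lookup_sum scaleR_poly_mapping.rep_eq mult.commute)
    then show "?M (\<lambda>x. S (T x)) $$ (i, j) = (?M S * ?M T) $$ (i, j)"
      using i j by (simp add: scalar_prod_def lessThan_atLeast0)
  qed auto
  then show ?thesis
    unfolding det_Rn_def by (simp add: det_mult[of _ n])
qed

lemma det_Rn_id: "det_Rn n (\<lambda>x. x) = 1"
proof -
  have "Matrix.mat n n (\<lambda>(i, j). Poly_Mapping.lookup (unit_vec_at j) i) = (1\<^sub>m n :: real Matrix.mat)"
    by (rule eq_matI) (auto simp: lookup_unit_vec_at)
  then show ?thesis by (simp add: det_Rn_def)
qed

lemma det_Rn_diag_coord:
  assumes "n > 0"
  shows "det_Rn n (diag_map (unit_vec_at 0) s \<tau>) = s * \<tau> ^ (n - 1)"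
proof -
  let ?A = "Matrix.mat n n (\<lambda>(i, j). Poly_Mapping.lookup (diag_map (unit_vec_at 0) s \<tau> (unit_vec_at j)) i) :: real Matrix.mat"
  have ent: "Poly_Mapping.lookup (diag_map (unit_vec_at 0) s \<tau> (unit_vec_at j)) i
      = (if i = j then if i = 0 then s else \<tau> else 0)" for i j
    by (auto simp: diag_map_def lookup_add scaleR_poly_mapping.rep_eq lookup_unit_vec_at inner_unit_vec_at)
  have "det_Rn n (diag_map (unit_vec_at 0) s \<tau>) = prod_list (diag_mat ?A)"
    unfolding det_Rn_def by (rule det_upper_triangular[of _ n]) (auto simp: ent)
  also have "\<dots> = (\<Prod>i<n. if i = 0 then s else \<tau>)"
    by (simp add: prod_list_diag_prod ent lessThan_atLeast0)
  also have "\<dots> = s * \<tau> ^ (n - 1)"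
    using assms by (subst prod.remove[of _ 0]) (auto simp: card_Diff_singleton)
  finally show ?thesis .
qed

text \<open>A reflection taking the first coordinate vector to \<open>\<xi>\<close> conjugates the map into a
  diagonal one; being an involution, it does not affect the determinant.\<close>

lemma det_Rn_diag_map:
  assumes "\<xi> \<in> Rn n" "norm \<xi> = 1"
  shows "det_Rn n (diag_map \<xi> s \<tau>) = s * \<tau> ^ (n - 1)"
proof -
  have n: "n > 0"
    using assms by (cases "n = 0") (auto simp: Rn_def)
  obtain U where U: "orthogonal_transformation U" "\<And>z. U (U z) = z" "U ` Rn n = Rn n" "U (unit_vec_at 0) = \<xi>"
    by (rule reflection[OF subspace_Rn unit_vec_at_in[OF n] assms(1)])
       (use assms in \<open>auto simp: norm_unit_vec_at\<close>)
  have lin: "linear U" and inn: "\<And>x y. U x \<bullet> U y = x \<bullet> y"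
    using U(1) by (auto simp: orthogonal_transformation_def)
  let ?D = "diag_map (unit_vec_at 0) s \<tau>"
  have eq: "diag_map \<xi> s \<tau> = (\<lambda>x. U (?D (U x)))"
  proof
    fix x
    have "U x \<bullet> unit_vec_at 0 = x \<bullet> \<xi>" using inn[of x "U (unit_vec_at 0)"] U(2,4) inn by metis
    then show "diag_map \<xi> s \<tau> x = U (?D (U x))"
      using U(2,4) by (simp add: diag_map_def linear_add[OF lin] linear_scale[OF lin])
  qed
  have D: "?D ` Rn n \<subseteq> Rn n"
    using diag_map_in[OF subspace_Rn unit_vec_at_in[OF n]] by blast
  have "det_Rn n U * det_Rn n U = det_Rn n (\<lambda>x. U (U x))"
    by (rule det_Rn_comp[symmetric, OF lin]) (use U in auto)
  also have "\<dots> = 1" by (simp add: U(2) det_Rn_id)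
  finally have UU: "det_Rn n U * det_Rn n U = 1" .
  have "det_Rn n (diag_map \<xi> s \<tau>) = det_Rn n U * det_Rn n (\<lambda>x. ?D (U x))"
    unfolding eq by (rule det_Rn_comp[OF lin]) (use U D in auto)
  also have "det_Rn n (\<lambda>x. ?D (U x)) = det_Rn n ?D * det_Rn n U"
    by (rule det_Rn_comp[OF linear_diag_map]) (use U in auto)
  finally show ?thesis
    using UU by (simp add: det_Rn_diag_coord[OF n])
qed

lemma diag_map_SL:
  assumes "\<xi> \<in> Rn n" "norm \<xi> = 1" "s * \<tau> ^ (n - 1) = 1"
  shows "diag_map \<xi> s \<tau> \<in> SL n"
  using assms diag_map_in[OF subspace_Rn assms(1)]
  by (auto simp: SL_def linear_diag_map det_Rn_diag_map)

section \<open>Lower bounds of the support function and inscribed balls\<close>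

lemma norm_diff_scaleR_sq:
  "norm (w - t *\<^sub>R v) ^ 2 = norm w ^ 2 - 2 * t * (v \<bullet> w) + t\<^sup>2 * norm (v :: 'a::real_inner) ^ 2"
  by (simp add: power2_norm_eq_inner inner_diff_left inner_diff_right inner_commute)
     (simp add: power2_eq_square algebra_simps)

text \<open>If x is outside K and p is its nearest point in K, the hyperplane through p orthogonal
  to x - p supports K. In that direction the support function is then smaller than norm x, hence
  smaller than r.\<close>

lemma separation_ball:
  assumes "compact K" "convex K" "K \<subseteq> Rn n" "K \<noteq> {}"
    and h: "\<And>\<xi>. \<xi> \<in> Rn n \<Longrightarrow> norm \<xi> = 1 \<Longrightarrow> r \<le> support_fun K \<xi>"
  shows "ball_n n r \<subseteq> K"
proof
  fix x assume "x \<in> ball_n n r"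
  then have x: "norm x \<le> r" "x \<in> Rn n" by (auto simp: ball_n_def)
  obtain p where p: "p \<in> K" "\<And>y. y \<in> K \<Longrightarrow> dist x p \<le> dist x y"
  proof -
    have "continuous_on K (\<lambda>y. dist x y)" by (intro continuous_intros)
    from continuous_attains_inf[OF assms(1,4) this] show thesis using that by blast
  qed
  show "x \<in> K"
  proof (rule ccontr)
    assume "x \<notin> K"
    then have ne: "x \<noteq> p" using p by auto
    define w where "w = x - p"
    have w: "w \<noteq> 0" "w \<in> Rn n" using ne x p(1) assms(3) subspace_diff[OF subspace_Rn] by (auto simp: w_def)
    have le: "(y - p) \<bullet> w \<le> 0" if y: "y \<in> K" for y
    proof (rule ccontr)
      assume "\<not> (y - p) \<bullet> w \<le> 0"
      then have c: "(y - p) \<bullet> w > 0" by simp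
      then have yp: "norm (y - p) > 0" by auto
      \<comment> \<open>The minimiser of the distance from x to the line through p and y, truncated
        to stay on the segment inside K; at this parameter the distance would drop below the
        minimum.\<close>
      define t where "t = min 1 ((y - p) \<bullet> w / norm (y - p) ^ 2)"
      have t: "0 < t" "t \<le> 1" using c yp by (auto simp: t_def)
      have "(1 - t) *\<^sub>R p + t *\<^sub>R y \<in> K"
        using t p(1) y assms(2) by (intro convexD) auto
      then have "norm w \<le> norm (w - t *\<^sub>R (y - p))"
        using p(2)[of "(1 - t) *\<^sub>R p + t *\<^sub>R y"] by (simp add: w_def dist_norm algebra_simps)
      then have "norm w ^ 2 \<le> norm (w - t *\<^sub>R (y - p)) ^ 2" by (intro power_mono) auto
      also have "\<dots> = norm w ^ 2 - 2 * t * ((y - p) \<bullet> w) + t\<^sup>2 * norm (y - p) ^ 2"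
        by (rule norm_diff_scaleR_sq)
      finally have "2 * ((y - p) \<bullet> w) * t \<le> t * norm (y - p) ^ 2 * t"
        by (simp add: power2_eq_square mult_ac)
      then have "2 * ((y - p) \<bullet> w) \<le> t * norm (y - p) ^ 2" using t(1) by (simp add: mult_le_cancel_right)
      also have "\<dots> \<le> (y - p) \<bullet> w"
        using yp by (simp add: t_def min_def pos_le_divide_eq)
      finally show False using c by simp
    qed
    have "support_fun K (sgn w) \<le> p \<bullet> sgn w"
      unfolding support_fun_def
    proof (rule cSUP_least[OF assms(4)])
      fix y assume "y \<in> K"
      then show "y \<bullet> sgn w \<le> p \<bullet> sgn w"
        using le[of y] by (simp add: sgn_div_norm inner_diff_left divide_right_mono mult_left_mono)
    qed
    also have "p \<bullet> sgn w = x \<bullet> sgn w - norm w"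
    proof -
      have "w \<bullet> sgn w = norm w"
        using w by (simp add: sgn_div_norm power2_norm_eq_inner[symmetric] power2_eq_square)
      then show ?thesis by (simp add: w_def inner_diff_left)
    qed
    also have "\<dots> < x \<bullet> sgn w" using w by simp
    also have "\<dots> \<le> norm x" using norm_cauchy_schwarz[of x "sgn w"] w by (simp add: norm_sgn)
    finally have "support_fun K (sgn w) < r" using x by simp
    moreover have "r \<le> support_fun K (sgn w)"
      by (rule h) (use w in \<open>auto simp: sgn_div_norm subspace_scale[OF subspace_Rn]\<close>)
    ultimately show False by simp
  qed
qed

section \<open>Bodies with barycenter at the origin\<close>

locale centered_body =
  fixes n :: nat and K :: "pt set"
  assumes body: "convex_body n K" and centered: "centered n K" and n: "n > 0"
begin

abbreviation "h \<equiv> support_fun K"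

lemma K: "K \<subseteq> Rn n" "convex K" "compact K" "closed K"
  using body by (auto simp: convex_body_def compact_imp_closed)

lemma K_bounded: "\<exists>R>0. K \<subseteq> cball 0 R"
  using compact_imp_bounded[OF K(3)] by (auto simp: bounded_pos)

lemma K_borel [measurable]: "K \<in> sets borel"
  using K(4) by simp

lemma interior_pt: obtains c \<delta> where "c \<in> K" "\<delta> > 0" "\<And>y. y \<in> Rn n \<Longrightarrow> norm (y - c) \<le> \<delta> \<Longrightarrow> y \<in> K"
proof -
  obtain c T where T: "openin (top_of_set (Rn n)) T" "c \<in> T" "T \<subseteq> K"
    using body by (auto simp: convex_body_def interior_of_def)
  then obtain e where e: "e > 0" "ball c e \<inter> Rn n \<subseteq> T"
    using openin_contains_ball[of "Rn n" T] by blast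
  show thesis
  proof (rule that[of c "e / 2"])
    fix y assume "y \<in> Rn n" "norm (y - c) \<le> e / 2"
    then have "y \<in> ball c e \<inter> Rn n" using e by (auto simp: dist_norm norm_minus_commute)
    then show "y \<in> K" using e T by auto
  qed (use T e in auto)
qed

lemma K_ne: "K \<noteq> {}"
  using interior_pt by blast

lemma h_ge: "x \<in> K \<Longrightarrow> x \<bullet> \<xi> \<le> h \<xi>"
  unfolding support_fun_def
  by (rule cSUP_upper, assumption, rule bounded_imp_bdd_above, rule compact_imp_bounded,
      rule compact_continuous_image[OF _ K(3)]) (intro continuous_intros)

lemma h_attained: obtains x where "x \<in> K" "x \<bullet> \<xi> = h \<xi>"
proof -
  obtain x where x: "x \<in> K" "\<And>y. y \<in> K \<Longrightarrow> y \<bullet> \<xi> \<le> x \<bullet> \<xi>"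
  proof -
    have "continuous_on K (\<lambda>y. y \<bullet> \<xi>)" by (intro continuous_intros)
    from continuous_attains_sup[OF K(3) K_ne this] show thesis using that by blast
  qed
  then have "h \<xi> \<le> x \<bullet> \<xi>"
    unfolding support_fun_def by (intro cSUP_least[OF K_ne])
  then show thesis using that h_ge[OF x(1), of \<xi>] x(1) by force
qed

definition V :: real where "V = vol (Rn n) K"

lemma V: "emeasure (leb (Rn n)) K = ennreal V" "V > 0"
proof -
  obtain R where R: "R > 0" "K \<subseteq> cball 0 R"
    using K_bounded by blast
  have "emeasure (leb (Rn n)) K \<le> emeasure (leb (Rn n)) (cball 0 R)"
    by (rule emeasure_mono[OF R(2)]) simp
  also have "\<dots> < \<infinity>" using leb_cball[OF fdsub_Rn R(1), of n] by simp
  finally have fin: "emeasure (leb (Rn n)) K < \<infinity>" .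
  then show e: "emeasure (leb (Rn n)) K = ennreal V"
    unfolding V_def vol_def by (intro emeasure_eq_ennreal_measure) auto
  obtain c \<delta> where c: "c \<in> K" "\<delta> > 0" "\<And>y. y \<in> Rn n \<Longrightarrow> norm (y - c) \<le> \<delta> \<Longrightarrow> y \<in> K"
    using interior_pt by blast
  have "0 < emeasure (leb (Rn n)) (cball 0 \<delta>)"
    using leb_cball[OF fdsub_Rn c(2), of n] c(2) by simp
  also have "\<dots> = (\<integral>\<^sup>+x. indicator (cball c \<delta>) (c + x) \<partial>leb (Rn n))"
  proof -
    have "indicator (cball c \<delta>) (c + x) = (indicator (cball 0 \<delta>) x :: ennreal)" for x
      by (simp add: indicator_def dist_norm)
    then show ?thesis by simp
  qed
  also have "\<dots> = (\<integral>\<^sup>+x. indicator (cball c \<delta>) x \<partial>leb (Rn n))"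
    by (rule leb_translate[OF fdsub_Rn]) (use c K in \<open>auto intro!: borel_measurable_indicator\<close>)
  also have "\<dots> \<le> (\<integral>\<^sup>+x. indicator K x \<partial>leb (Rn n))"
    by (rule nn_integral_mono_AE, use leb_AE[OF fdsub_Rn, of n] in eventually_elim)
       (use c(3) in \<open>auto simp: indicator_def dist_norm norm_minus_commute\<close>)
  finally have "0 < ennreal V" by (simp add: e)
  then show "V > 0" by simp
qed

definition \<mu> :: "pt measure" where
  "\<mu> = density (leb (Rn n)) (\<lambda>x. ennreal (indicator K x / V))"

lemma sets_\<mu> [simp, measurable_cong]: "sets \<mu> = sets borel" and space_\<mu> [simp]: "space \<mu> = UNIV"
  by (simp_all add: \<mu>_def)

lemma nn_integral_\<mu>:
  "f \<in> borel_measurable borel \<Longrightarrow> (\<integral>\<^sup>+x. f x \<partial>\<mu>) = (\<integral>\<^sup>+x. ennreal (indicator K x / V) * f x \<partial>leb (Rn n))"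
  unfolding \<mu>_def by (rule nn_integral_density) auto

lemma integral_\<mu>:
  fixes f :: "pt \<Rightarrow> real"
  assumes "f \<in> borel_measurable borel"
  shows "(\<integral>x. f x \<partial>\<mu>) = (LINT x:K|leb (Rn n). f x) / V"
proof -
  have "(\<integral>x. f x \<partial>\<mu>) = (\<integral>x. (indicator K x / V) *\<^sub>R f x \<partial>leb (Rn n))"
    unfolding \<mu>_def by (rule integral_density) (use assms V in auto)
  then show ?thesis
    by (simp add: set_lebesgue_integral_def)
qed

lemma prob_\<mu>: "prob_space \<mu>"
proof
  have "(\<integral>\<^sup>+x. 1 \<partial>\<mu>) = (\<integral>\<^sup>+x. indicator K x * ennreal (1 / V) \<partial>leb (Rn n))"
    by (subst nn_integral_\<mu>) (auto intro!: nn_integral_cong simp: indicator_def)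
  also have "\<dots> = ennreal V * ennreal (1 / V)"
    by (subst nn_integral_multc) (auto simp: V(1))
  also have "\<dots> = 1" using V(2) by (simp add: ennreal_mult'[symmetric])
  finally show "emeasure \<mu> (space \<mu>) = 1" by simp
qed

lemma AE_\<mu>: "AE x in \<mu>. x \<in> K"
  unfolding \<mu>_def by (subst AE_density) (auto intro!: AE_I2 simp: indicator_def split: if_splits)

lemma integrable_\<mu>:
  assumes "continuous_on UNIV (f :: pt \<Rightarrow> real)"
  shows "integrable \<mu> f"
proof -
  interpret prob_space \<mu> by (rule prob_\<mu>)
  obtain B where "\<And>x. x \<in> K \<Longrightarrow> norm (f x) \<le> B"
    using compact_imp_bounded[OF compact_continuous_image[OF continuous_on_subset[OF assms] K(3)]]
    by (auto simp: bounded_iff)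
  moreover have "f \<in> borel_measurable \<mu>"
    unfolding measurable_cong_sets[OF sets_\<mu> refl] by (rule borel_measurable_continuous_onI[OF assms])
  ultimately show ?thesis
    by (intro integrable_const_bound[of _ B] eventually_mono[OF AE_\<mu>]) auto
qed

lemma integral_\<mu>_inner:
  assumes "\<xi> \<in> Rn n"
  shows "(\<integral>x. x \<bullet> \<xi> \<partial>\<mu>) = 0"
proof -
  have i: "(\<integral>x. Poly_Mapping.lookup x i \<partial>\<mu>) = 0" "integrable \<mu> (\<lambda>x. Poly_Mapping.lookup x i)" if "i < n" for i
  proof -
    have cont: "continuous_on UNIV (\<lambda>x::pt. Poly_Mapping.lookup x i)"
      unfolding inner_unit_vec_at[symmetric] by (intro continuous_intros)
    then show "integrable \<mu> (\<lambda>x. Poly_Mapping.lookup x i)" by (rule integrable_\<mu>)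
    have "0 = Poly_Mapping.lookup (barycenter n K) i"
      using centered by (simp add: centered_def)
    also have "\<dots> = (\<Sum>j<n. ((LINT x:K|leb (Rn n). Poly_Mapping.lookup x j) / V) * of_bool (j = i))"
      by (simp add: barycenter_def lookup_sum scaleR_poly_mapping.rep_eq lookup_unit_vec_at V_def)
    also have "\<dots> = (LINT x:K|leb (Rn n). Poly_Mapping.lookup x i) / V"
      using that by (simp add: of_bool_def if_distrib cong: if_cong)
    also have "\<dots> = (\<integral>x. Poly_Mapping.lookup x i \<partial>\<mu>)"
      by (rule integral_\<mu>[symmetric]) (rule borel_measurable_continuous_onI[OF cont])
    finally show "(\<integral>x. Poly_Mapping.lookup x i \<partial>\<mu>) = 0" by simp
  qed
  have "x \<bullet> \<xi> = (\<Sum>i<n. Poly_Mapping.lookup \<xi> i * Poly_Mapping.lookup x i)" for x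
    using Rn_sum_repr[OF assms] by (metis (no_types, lifting) inner_scaleR_right inner_sum_right inner_unit_vec_at sum.cong)
  then have "(\<integral>x. x \<bullet> \<xi> \<partial>\<mu>) = (\<Sum>i<n. Poly_Mapping.lookup \<xi> i * (\<integral>x. Poly_Mapping.lookup x i \<partial>\<mu>))"
    using i(2) by simp
  then show ?thesis using i(1) by simp
qed

text \<open>K contains its copy shrunk by 1/2 towards a point of K, whose volume is 2^(-n) times
  that of K. The mean over the copy is therefore at most 2^n times the mean over K. Applied to a
  support point or to a long vector, it converts a single extreme point into information about
  means.\<close>

lemma half_contraction:
  assumes c: "c \<in> K" and f[measurable]: "f \<in> borel_measurable borel"
  shows "(\<integral>\<^sup>+x. f ((1/2) *\<^sub>R c + (1/2) *\<^sub>R x) \<partial>\<mu>) \<le> ennreal (2 ^ n) * (\<integral>\<^sup>+x. f x \<partial>\<mu>)"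
proof -
  let ?g = "\<lambda>x. ennreal (indicator K x / V) * f x"
  let ?T = "\<lambda>x. (1/2) *\<^sub>R c + (1/2) *\<^sub>R x"
  have cR: "(1/2) *\<^sub>R c \<in> Rn n" using c K(1) subspace_scale[OF subspace_Rn] by blast
  have "(\<integral>\<^sup>+x. f x \<partial>\<mu>) = (\<integral>\<^sup>+x. ?g x \<partial>leb (Rn n))"
    by (rule nn_integral_\<mu>) measurable
  also have "\<dots> = (\<integral>\<^sup>+x. ?g ((1/2) *\<^sub>R c + x) \<partial>leb (Rn n))"
    by (rule leb_translate[OF fdsub_Rn _ cR, symmetric]) measurable
  also have "\<dots> = ennreal (\<bar>1/2\<bar> ^ dim (Rn n)) * (\<integral>\<^sup>+x. ?g (?T x) \<partial>leb (Rn n))"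
    by (rule leb_scale[OF fdsub_Rn]) auto
  finally have eq: "(\<integral>\<^sup>+x. f x \<partial>\<mu>) = ennreal ((1/2) ^ n) * (\<integral>\<^sup>+x. ?g (?T x) \<partial>leb (Rn n))"
    by (simp add: dim_Rn)
  have "(\<integral>\<^sup>+x. f (?T x) \<partial>\<mu>) = (\<integral>\<^sup>+x. ennreal (indicator K x / V) * f (?T x) \<partial>leb (Rn n))"
    by (rule nn_integral_\<mu>) measurable
  also have "\<dots> \<le> (\<integral>\<^sup>+x. ?g (?T x) \<partial>leb (Rn n))"
  proof (rule nn_integral_mono)
    fix x
    have "?T x \<in> K" if "x \<in> K"
      using K(2) c that by (intro convexD) auto
    then show "ennreal (indicator K x / V) * f (?T x) \<le> ?g (?T x)"
      by (cases "x \<in> K") auto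
  qed
  also have "\<dots> = ennreal (2 ^ n * (1/2) ^ n) * (\<integral>\<^sup>+x. ?g (?T x) \<partial>leb (Rn n))"
    by (simp add: power_mult_distrib[symmetric])
  also have "\<dots> = ennreal (2 ^ n) * (\<integral>\<^sup>+x. f x \<partial>\<mu>)"
    unfolding eq by (simp add: ennreal_mult mult.assoc)
  finally show ?thesis .
qed

lemma half_contraction_real:
  assumes c: "c \<in> K" and f: "continuous_on UNIV (f :: pt \<Rightarrow> real)" and nn: "\<And>x. 0 \<le> f x"
  shows "(\<integral>x. f ((1/2) *\<^sub>R c + (1/2) *\<^sub>R x) \<partial>\<mu>) \<le> 2 ^ n * (\<integral>x. f x \<partial>\<mu>)"
proof -
  let ?T = "\<lambda>x. (1/2) *\<^sub>R c + (1/2) *\<^sub>R x"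
  have i: "integrable \<mu> f" by (rule integrable_\<mu>[OF f])
  have iT: "integrable \<mu> (\<lambda>x. f (?T x))"
    by (intro integrable_\<mu> continuous_on_compose2[OF f] continuous_intros) auto
  have "ennreal (\<integral>x. f (?T x) \<partial>\<mu>) = (\<integral>\<^sup>+x. ennreal (f (?T x)) \<partial>\<mu>)"
    by (rule nn_integral_eq_integral[symmetric, OF iT]) (simp add: nn)
  also have "\<dots> \<le> ennreal (2 ^ n) * (\<integral>\<^sup>+x. ennreal (f x) \<partial>\<mu>)"
    by (rule half_contraction[OF c]) (use borel_measurable_continuous_onI[OF f] in simp)
  also have "\<dots> = ennreal (2 ^ n) * ennreal (\<integral>x. f x \<partial>\<mu>)"
    using nn_integral_eq_integral[OF i] nn by simp
  also have "\<dots> = ennreal (2 ^ n * (\<integral>x. f x \<partial>\<mu>))"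
    by (rule ennreal_mult[symmetric]) (simp_all add: nn)
  finally show ?thesis
    by (rule ennreal_le_iff[THEN iffD1, rotated]) (simp add: nn)
qed

lemma h_nonneg: "\<xi> \<in> Rn n \<Longrightarrow> 0 \<le> h \<xi>"
proof -
  assume \<xi>: "\<xi> \<in> Rn n"
  interpret prob_space \<mu> by (rule prob_\<mu>)
  have "(\<integral>x. x \<bullet> \<xi> \<partial>\<mu>) \<le> (\<integral>x. h \<xi> \<partial>\<mu>)"
    by (rule integral_mono_AE, rule integrable_\<mu>)
       (use eventually_mono[OF AE_\<mu> h_ge] in \<open>auto intro!: continuous_intros\<close>)
  then show ?thesis using integral_\<mu>_inner[OF \<xi>] prob_space by simp
qed

text \<open>A weak form of Minkowski's inequality for the asymmetry of a centered body: the positive part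
  of a linear functional is integrated over the copy of \<open>K\<close> shrunk towards a support point.\<close>

lemma h_le_opposite:
  assumes \<xi>: "\<xi> \<in> Rn n"
  shows "h \<xi> \<le> 2 ^ (n + 1) * h (-\<xi>)"
proof -
  interpret prob_space \<mu> by (rule prob_\<mu>)
  have \<xi>': "-\<xi> \<in> Rn n" using \<xi> subspace_neg[OF subspace_Rn] by blast
  obtain c where c: "c \<in> K" "c \<bullet> \<xi> = h \<xi>" using h_attained by blast
  have cont: "continuous_on UNIV (\<lambda>x. max 0 (x \<bullet> \<xi>))" "continuous_on UNIV (\<lambda>x. max 0 (-(x \<bullet> \<xi>)))"
    "continuous_on UNIV (\<lambda>x. x \<bullet> \<xi>)" "continuous_on UNIV (\<lambda>x. (1/2) * h \<xi> + (1/2) * (x \<bullet> \<xi>))"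
    "continuous_on UNIV (\<lambda>x. max 0 (((1/2) *\<^sub>R c + (1/2) *\<^sub>R x) \<bullet> \<xi>))"
    by (intro continuous_intros)+
  have "(1/2) * h \<xi> = (\<integral>x. (1/2) * h \<xi> + (1/2) * (x \<bullet> \<xi>) \<partial>\<mu>)"
    using integral_\<mu>_inner[OF \<xi>] integrable_\<mu>[OF cont(3)] prob_space by simp
  also have "\<dots> \<le> (\<integral>x. max 0 (((1/2) *\<^sub>R c + (1/2) *\<^sub>R x) \<bullet> \<xi>) \<partial>\<mu>)"
    by (rule integral_mono[OF integrable_\<mu>[OF cont(4)] integrable_\<mu>[OF cont(5)]])
       (simp add: inner_add_left c(2))
  also have "\<dots> \<le> 2 ^ n * (\<integral>x. max 0 (x \<bullet> \<xi>) \<partial>\<mu>)"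
    by (rule half_contraction_real[OF c(1) cont(1)]) simp
  \<comment> \<open>The barycenter condition enters here: the functional has mean 0, so its positive
    and negative parts have equal means.\<close>
  also have "(\<integral>x. max 0 (x \<bullet> \<xi>) \<partial>\<mu>) = (\<integral>x. max 0 (-(x \<bullet> \<xi>)) + x \<bullet> \<xi> \<partial>\<mu>)"
    by (intro Bochner_Integration.integral_cong) auto
  also have "\<dots> = (\<integral>x. max 0 (-(x \<bullet> \<xi>)) \<partial>\<mu>)"
    using integral_\<mu>_inner[OF \<xi>] by (simp add: integrable_\<mu>[OF cont(2)] integrable_\<mu>[OF cont(3)])
  also have "\<dots> \<le> (\<integral>x. h (-\<xi>) \<partial>\<mu>)"
  proof (rule integral_mono_AE[OF integrable_\<mu>[OF cont(2)]])
    show "AE x in \<mu>. max 0 (-(x \<bullet> \<xi>)) \<le> h (-\<xi>)"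
      using AE_\<mu> by eventually_elim (use h_ge[of _ "-\<xi>"] h_nonneg[OF \<xi>'] in auto)
  qed simp
  also have "\<dots> = h (-\<xi>)" using prob_space by simp
  finally show ?thesis by simp
qed

text \<open>A ball of radius \<delta> around an interior point makes h \<xi> or h (-\<xi>) at least
  \<delta>, and the bound on the asymmetry transfers this to both. The radii obtained are only
  qualitative; those depending on the position come from \<open>classical_cbody\<close>.\<close>

lemma cbody_K: obtains r R where "cbody n r R K"
proof -
  obtain c \<delta> where c: "c \<in> K" "\<delta> > 0" "\<And>y. y \<in> Rn n \<Longrightarrow> norm (y - c) \<le> \<delta> \<Longrightarrow> y \<in> K"
    using interior_pt by blast
  obtain R where R: "R > 0 \<and> K \<subseteq> cball 0 R"
    using K_bounded by (rule exE)
  define r where "r = \<delta> / 2 ^ (n + 1)"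
  have "r \<le> h \<xi>" if \<xi>: "\<xi> \<in> Rn n" "norm \<xi> = 1" for \<xi>
  proof -
    have cR: "c \<in> Rn n" "\<delta> *\<^sub>R \<xi> \<in> Rn n"
      using c(1) K(1) \<xi>(1) subspace_scale[OF subspace_Rn] by auto
    have "c + \<delta> *\<^sub>R \<xi> \<in> K"
      by (rule c(3), rule subspace_add[OF subspace_Rn cR]) (use \<xi>(2) c(2) in simp)
    moreover have "c - \<delta> *\<^sub>R \<xi> \<in> K"
      by (rule c(3), rule subspace_diff[OF subspace_Rn cR]) (use \<xi>(2) c(2) in simp)
    ultimately have in_K: "c + \<delta> *\<^sub>R \<xi> \<in> K" "c - \<delta> *\<^sub>R \<xi> \<in> K" by simp_all
    from h_ge[OF in_K(1), of \<xi>] h_ge[OF in_K(2), of "-\<xi>"]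
    have "c \<bullet> \<xi> + \<delta> \<le> h \<xi>" "\<delta> - c \<bullet> \<xi> \<le> h (-\<xi>)"
      using \<xi>(2) by (simp_all add: inner_add_left inner_diff_left norm_eq_1)
    moreover have "h (-\<xi>) \<le> 2 ^ (n + 1) * h \<xi>"
      using h_le_opposite[of "-\<xi>"] \<xi>(1) subspace_neg[OF subspace_Rn] by simp
    moreover have "h \<xi> \<le> 2 ^ (n + 1) * h \<xi>"
      using mult_right_mono[OF one_le_power[of "2::real" "n + 1"] h_nonneg[OF \<xi>(1)]] by simp
    ultimately have "\<delta> \<le> 2 ^ (n + 1) * h \<xi>"
      by (cases "c \<bullet> \<xi> \<ge> 0") linarith+
    then show ?thesis by (simp add: r_def pos_divide_le_eq mult.commute)
  qed
  then have "ball_n n r \<subseteq> K" by (rule separation_ball[OF K(3,2,1) K_ne])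
  then have "cbody n r R K"
    using c(2) K(1-3) R by (simp add: cbody_def r_def ball_n_def)
  then show thesis by (rule that)
qed

end

section \<open>Classical positions\<close>

text \<open>The base 32 is 2^5: the largest exponent met in the classical positions is 3 * n + 2,
  which is at most 5 * n for n \<ge> 1.\<close>

lemma pow2_le_32: "m \<le> 5 * n \<Longrightarrow> (2::real) ^ m \<le> 32 ^ n"
proof -
  assume "m \<le> 5 * n"
  then have "(2::real) ^ m \<le> 2 ^ (5 * n)" by (rule power_increasing) simp
  then show ?thesis by (simp add: power_mult)
qed

section \<open>Volumes of balls and ellipsoids, continuity of support functions\<close>

lemma emeasure_translate:
  assumes "fdsub E" "v \<in> E" "A \<in> sets borel"
  shows "emeasure (leb E) ((\<lambda>x. v + x) ` A) = emeasure (leb E) A"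
proof -
  have im: "(\<lambda>x. v + x) ` A = (\<lambda>x. -v + x) -` A"
    by (auto simp: image_iff intro!: bexI[of _ "_ - v"])
  have "(\<lambda>x. -v + x) \<in> borel_measurable borel"
    by (intro borel_measurable_continuous_onI continuous_intros)
  then have m: "(\<lambda>x. v + x) ` A \<in> sets borel"
    unfolding im by (rule measurable_sets_borel[OF _ assms(3)])
  have "(\<integral>\<^sup>+x. indicator ((\<lambda>x. v + x) ` A) (v + x) \<partial>leb E) = (\<integral>\<^sup>+x. indicator ((\<lambda>x. v + x) ` A) x \<partial>leb E)"
    by (rule leb_translate) (use assms m in auto)
  moreover have "indicator ((\<lambda>x. v + x) ` A) (v + x) = (indicator A x :: ennreal)" for x
    by (auto simp: indicator_def)
  ultimately show ?thesis using m assms(3) by simp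
qed

lemma ball_n_borel: "ball_n n r \<in> sets borel"
  unfolding ball_n_def by (intro borel_closed closed_Int closed_cball fdsub_closed fdsub_Rn)

lemma emeasure_ball_n:
  "r > 0 \<Longrightarrow> emeasure (leb (Rn n)) (ball_n n r) = ennreal (unit_ball_vol n * r ^ n)"
proof -
  assume "r > 0"
  have "emeasure (leb (Rn n)) (ball_n n r) = emeasure (leb (Rn n)) (cball 0 r)"
    unfolding ball_n_def
    by (rule emeasure_eq_AE) (use leb_AE[OF fdsub_Rn, of n] fdsub_closed[OF fdsub_Rn, of n] in \<open>auto elim: eventually_mono\<close>)
  then show ?thesis using leb_cball[OF fdsub_Rn \<open>r > 0\<close>, of n] by (simp add: dim_Rn)
qed

lemma vol_ball_n: "r > 0 \<Longrightarrow> vol (Rn n) (ball_n n r) = unit_ball_vol n * r ^ n"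
  by (simp add: vol_def measure_def emeasure_ball_n)

lemma ellipsoid_diag:
  assumes "a \<in> Rn n" "\<xi> \<in> Rn n" "norm \<xi> = 1" "s > 0" "\<tau> > 0"
  shows "ellipsoid n ((\<lambda>x. a + diag_map \<xi> s \<tau> x) ` ball_n n 1)"
    "vol (Rn n) ((\<lambda>x. a + diag_map \<xi> s \<tau> x) ` ball_n n 1) = s * \<tau> ^ (n - 1) * unit_ball_vol n"
proof -
  show "ellipsoid n ((\<lambda>x. a + diag_map \<xi> s \<tau> x) ` ball_n n 1)"
    unfolding ellipsoid_def using assms diag_map_image_Rn[OF assms(3) _ _ subspace_Rn assms(2), of s \<tau>]
    by (intro exI[of _ a] exI[of _ "diag_map \<xi> s \<tau>"]) (auto simp: linear_diag_map)
  have "(\<lambda>x. a + diag_map \<xi> s \<tau> x) ` ball_n n 1 = (\<lambda>x. a + x) ` diag_map \<xi> s \<tau> ` ball_n n 1"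
    by (simp add: image_image)
  then have "emeasure (leb (Rn n)) ((\<lambda>x. a + diag_map \<xi> s \<tau> x) ` ball_n n 1)
      = emeasure (leb (Rn n)) (diag_map \<xi> s \<tau> ` ball_n n 1)"
    using emeasure_translate[OF fdsub_Rn assms(1)] diag_map_image_borel[OF assms(3) _ _ ball_n_borel, of s \<tau>] assms
    by simp
  also have "\<dots> = ennreal (s * \<tau> ^ (n - 1)) * ennreal (unit_ball_vol n)"
    using emeasure_diag_map[OF fdsub_Rn assms(2-5) ball_n_borel, of n 1] emeasure_ball_n[of 1 n]
    by (simp add: dim_Rn)
  also have "\<dots> = ennreal (s * \<tau> ^ (n - 1) * unit_ball_vol n)"
    by (rule ennreal_mult[symmetric]) (use assms in auto)
  finally show "vol (Rn n) ((\<lambda>x. a + diag_map \<xi> s \<tau> x) ` ball_n n 1) = s * \<tau> ^ (n - 1) * unit_ball_vol n"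
    using assms by (simp add: vol_def measure_def)
qed

lemma support_fun_continuous:
  assumes "compact A" "A \<noteq> {}"
  shows "continuous_on UNIV (support_fun A)"
proof -
  obtain R where R: "R > 0" "\<And>x. x \<in> A \<Longrightarrow> norm x \<le> R"
    using compact_imp_bounded[OF assms(1)] by (auto simp: bounded_pos)
  have bdd: "bdd_above ((\<lambda>x. x \<bullet> \<theta>) ` A)" for \<theta>
    by (rule bounded_imp_bdd_above[OF compact_imp_bounded[OF compact_continuous_image[OF _ assms(1)]]])
       (intro continuous_intros)
  have le: "support_fun A \<theta> - support_fun A \<theta>' \<le> R * norm (\<theta> - \<theta>')" for \<theta> \<theta>'
  proof -
    have "support_fun A \<theta> \<le> support_fun A \<theta>' + R * norm (\<theta> - \<theta>')"
      unfolding support_fun_def[of A \<theta>]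
    proof (rule cSUP_least[OF assms(2)])
      fix x assume x: "x \<in> A"
      have "x \<bullet> \<theta> = x \<bullet> \<theta>' + x \<bullet> (\<theta> - \<theta>')" by (simp add: inner_diff_right)
      also have "x \<bullet> \<theta>' \<le> support_fun A \<theta>'"
        unfolding support_fun_def by (rule cSUP_upper[OF x bdd])
      also have "x \<bullet> (\<theta> - \<theta>') \<le> norm x * norm (\<theta> - \<theta>')" by (rule norm_cauchy_schwarz)
      also have "\<dots> \<le> R * norm (\<theta> - \<theta>')" by (rule mult_right_mono[OF R(2)[OF x]]) simp
      finally show "x \<bullet> \<theta> \<le> support_fun A \<theta>' + R * norm (\<theta> - \<theta>')" by simp
    qed
    then show ?thesis by simp
  qed
  have "dist (support_fun A \<theta>) (support_fun A \<theta>') \<le> R * dist \<theta> \<theta>'" for \<theta> \<theta>'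
    using le[of \<theta> \<theta>'] le[of \<theta>' \<theta>] by (simp add: dist_norm abs_le_iff norm_minus_commute)
  then have "R-lipschitz_on UNIV (support_fun A)"
    using R(1) by (intro lipschitz_onI) auto
  then show ?thesis by (rule lipschitz_on_continuous_on)
qed

section \<open>Integration over the unit sphere of the coordinate space\<close>

context
  fixes n :: nat
  assumes n: "n > 0"
begin

interpretation sphere: prob_space "sphere_prob (Rn n)"
  by (rule sphere_prob_space_prob(1)[OF fdsub_Rn]) (simp add: dim_Rn n)

lemma space_sphere_Rn: "space (sphere_prob (Rn n)) = sphere 0 1 \<inter> Rn n"
  by (rule sphere_prob_space_prob(2)[OF fdsub_Rn]) (simp add: dim_Rn n)

lemma measurable_sphere_Rn: "f \<in> borel \<rightarrow>\<^sub>M M \<Longrightarrow> f \<in> sphere_prob (Rn n) \<rightarrow>\<^sub>M M"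
  using sphere_prob_space_prob(3)[OF fdsub_Rn, of n] n
  by (subst measurable_cong_sets[OF _ refl, of _ "restrict_space borel (sphere 0 1 \<inter> Rn n)"])
     (auto simp: dim_Rn intro: measurable_restrict_space1)

lemma integrable_sphere_Rn:
  assumes "continuous_on UNIV (f :: pt \<Rightarrow> real)"
  shows "integrable (sphere_prob (Rn n)) f"
proof -
  have "compact (cball 0 1 \<inter> Rn n)" by (rule compact_cball_fdsub[OF fdsub_Rn])
  then obtain B where B: "\<And>x. x \<in> cball 0 1 \<inter> Rn n \<Longrightarrow> norm (f x) \<le> B"
    using compact_imp_bounded[OF compact_continuous_image[OF continuous_on_subset[OF assms]]]
    unfolding bounded_iff by (metis image_eqI subset_UNIV)
  show ?thesis
    by (rule sphere.integrable_const_bound[of _ B])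
       (use B in \<open>auto intro!: AE_I2 measurable_sphere_Rn borel_measurable_continuous_onI[OF assms] simp: space_sphere_Rn\<close>)
qed

lemma integral_sphere_Rn_rotate:
  assumes U: "orthogonal_transformation U" "U ` Rn n = Rn n" and f: "f \<in> borel_measurable borel"
  shows "(\<integral>x. f (U x) \<partial>sphere_prob (Rn n)) = (\<integral>x. (f x :: real) \<partial>sphere_prob (Rn n))"
proof -
  let ?P = "sphere_prob (Rn n)"
  have "distr ?P ?P U = ?P"
    using sphere_prob_rotation_invariant[OF fdsub_Rn, of n] n U
    by (simp add: dim_Rn rotation_invariant_prob_sphere_def)
  moreover have s: "sets ?P = sets (restrict_space borel (sphere 0 1 \<inter> Rn n))"
    by (rule sphere_prob_space_prob(3)[OF fdsub_Rn]) (simp add: dim_Rn n)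
  have "U \<in> ?P \<rightarrow>\<^sub>M ?P"
    unfolding measurable_cong_sets[OF s s]
    by (rule measurable_restrict_space3)
       (use U orthogonal_transformation_measurable in \<open>auto simp: orthogonal_transformation\<close>)
  ultimately show ?thesis
    using integral_distr[of U ?P ?P f] measurable_sphere_Rn[OF f] by simp
qed

text \<open>By symmetry all unit vectors give the same value, and over an orthonormal basis the
  squares add up to 1.\<close>

lemma integral_sphere_inner_sq:
  assumes u: "u \<in> Rn n" "norm u = 1"
  shows "(\<integral>x. (x \<bullet> u)\<^sup>2 \<partial>sphere_prob (Rn n)) = 1 / n"
proof -
  let ?P = "sphere_prob (Rn n)"
  have cont: "continuous_on UNIV (\<lambda>x::pt. (x \<bullet> v)\<^sup>2)" for v by (intro continuous_intros)
  have eq: "(\<integral>x. (x \<bullet> unit_vec_at i)\<^sup>2 \<partial>?P) = (\<integral>x. (x \<bullet> u)\<^sup>2 \<partial>?P)" if i: "i < n" for i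
  proof -
    obtain U where U: "orthogonal_transformation U" "\<And>z. U (U z) = z" "U ` Rn n = Rn n" "U u = unit_vec_at i"
      by (rule reflection[OF subspace_Rn u(1) unit_vec_at_in[OF i]])
         (use u in \<open>auto simp: norm_unit_vec_at\<close>)
    have "U x \<bullet> unit_vec_at i = x \<bullet> u" for x
      using U(1,4) by (metis orthogonal_transformation_def)
    then show ?thesis
      using integral_sphere_Rn_rotate[OF U(1,3) borel_measurable_continuous_onI[OF cont], of "unit_vec_at i"] by simp
  qed
  have "1 = (\<integral>x. (\<Sum>i<n. (x \<bullet> unit_vec_at i)\<^sup>2) \<partial>?P)"
  proof -
    have "(\<Sum>i<n. (x \<bullet> unit_vec_at i)\<^sup>2) = 1" if "x \<in> space ?P" for x
    proof -
      have x: "x \<in> Rn n" "x \<bullet> x = 1" using that by (auto simp: space_sphere_Rn norm_eq_1)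
      then show ?thesis
        using onbasis_inner_eq_sum[OF onbasis_Rn x(1), of x]
        by (simp add: sum.reindex inj_on_subset[OF inj_unit_vec_at] power2_eq_square)
    qed
    then have "(\<integral>x. (\<Sum>i<n. (x \<bullet> unit_vec_at i)\<^sup>2) \<partial>?P) = (\<integral>x. 1 \<partial>?P)"
      by (rule Bochner_Integration.integral_cong[OF refl])
    then show ?thesis by (simp add: sphere.prob_space)
  qed
  also have "\<dots> = (\<Sum>i<n. (\<integral>x. (x \<bullet> unit_vec_at i)\<^sup>2 \<partial>?P))"
    by (rule Bochner_Integration.integral_sum) (rule integrable_sphere_Rn[OF cont])
  also have "\<dots> = n * (\<integral>x. (x \<bullet> u)\<^sup>2 \<partial>?P)"
    by (simp add: eq)
  finally show ?thesis using n by (simp add: field_simps)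
qed

end

section \<open>Isotropic, Loewner, John and minimal mean width positions\<close>

context centered_body
begin

text \<open>The second moment is the same in every direction. In the direction \<eta> it is bounded
  above by the extent of K, in the direction of x it is bounded below by the copy of K shrunk
  towards x; comparing the two bounds norm x by h \<eta>.\<close>

lemma isotropic_bound:
  assumes iso: "isotropic_position n K" and x: "x \<in> K" and \<eta>: "\<eta> \<in> Rn n" "norm \<eta> = 1"
  shows "norm x \<le> 32 ^ n * h \<eta>"
proof (cases "x = 0")
  case True
  then show ?thesis using h_nonneg[OF \<eta>(1)] by simp
next
  case False
  interpret prob_space \<mu> by (rule prob_\<mu>)
  obtain L where L: "L > 0" "\<And>\<xi>. \<xi> \<in> sphere 0 1 \<inter> Rn n \<Longrightarrow> (LINT x:K|leb (Rn n). (x \<bullet> \<xi>)\<^sup>2) = L\<^sup>2"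
    and V1: "V = 1"
    using iso by (auto simp: isotropic_position_def V_def)
  have ct: "continuous_on UNIV (\<lambda>x::pt. x \<bullet> \<xi>)" "continuous_on UNIV (\<lambda>x::pt. (x \<bullet> \<xi>)\<^sup>2)" for \<xi>
    by (intro continuous_intros)+
  note it = integrable_\<mu>[OF ct(1)] integrable_\<mu>[OF ct(2)]
  have E: "(\<integral>x. (x \<bullet> \<xi>)\<^sup>2 \<partial>\<mu>) = L\<^sup>2" if "\<xi> \<in> Rn n" "norm \<xi> = 1" for \<xi>
    using that L(2)[of \<xi>] integral_\<mu>[OF borel_measurable_continuous_onI[OF ct(2)]] V1 by simp
  \<comment> \<open>Both factors are nonnegative on K. Since the linear term integrates to 0, the
    mean of the product is h \<eta> * h (-\<eta>) minus the second moment.\<close>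
  have "0 \<le> (\<integral>x. (h \<eta> - x \<bullet> \<eta>) * (x \<bullet> \<eta> + h (-\<eta>)) \<partial>\<mu>)"
  proof (rule integral_nonneg_AE)
    show "AE x in \<mu>. 0 \<le> (h \<eta> - x \<bullet> \<eta>) * (x \<bullet> \<eta> + h (-\<eta>))"
      using AE_\<mu>
    proof eventually_elim
      case (elim x)
      then show ?case using h_ge[of x \<eta>] h_ge[of x "-\<eta>"] by (intro mult_nonneg_nonneg) auto
    qed
  qed
  also have "\<dots> = (\<integral>x. h \<eta> * h (-\<eta>) + (h \<eta> - h (-\<eta>)) * (x \<bullet> \<eta>) - (x \<bullet> \<eta>)\<^sup>2 \<partial>\<mu>)"
    by (intro Bochner_Integration.integral_cong) (auto simp: power2_eq_square algebra_simps)
  also have "\<dots> = h \<eta> * h (-\<eta>) - L\<^sup>2"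
    using it[of \<eta>] E[OF \<eta>] integral_\<mu>_inner[OF \<eta>(1)] prob_space by simp
  finally have "L\<^sup>2 \<le> h \<eta> * h (-\<eta>)" by simp
  also have "\<dots> \<le> h \<eta> * (2 ^ (n + 1) * h \<eta>)"
    using h_le_opposite[of "-\<eta>"] \<eta> subspace_neg[OF subspace_Rn] h_nonneg[OF \<eta>(1)]
    by (intro mult_left_mono) auto
  finally have L2: "L\<^sup>2 \<le> 2 ^ (n + 1) * (h \<eta>)\<^sup>2" by (simp add: power2_eq_square mult_ac)
  define \<xi> where "\<xi> = sgn x"
  have \<xi>: "\<xi> \<in> Rn n" "norm \<xi> = 1"
    using False x K(1) by (auto simp: \<xi>_def norm_sgn) (auto simp: sgn_div_norm intro: subspace_scale[OF subspace_Rn])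
  have x\<xi>: "x \<bullet> \<xi> = norm x"
    using False by (simp add: \<xi>_def sgn_div_norm power2_norm_eq_inner[symmetric] power2_eq_square)
  \<comment> \<open>The term with L completes the second moment of the shrunk copy, whose barycenter
    is x / 2; the mixed term has mean 0.\<close>
  have "(norm x)\<^sup>2 / 4 \<le> (norm x)\<^sup>2 / 4 + L\<^sup>2 / 4" by simp
  also have "\<dots> = (\<integral>y. (norm x)\<^sup>2 / 4 + (norm x / 2) * (y \<bullet> \<xi>) + (1/4) * (y \<bullet> \<xi>)\<^sup>2 \<partial>\<mu>)"
    using it[of \<xi>] E[OF \<xi>] integral_\<mu>_inner[OF \<xi>(1)] prob_space by simp
  also have "\<dots> = (\<integral>y. (((1/2) *\<^sub>R x + (1/2) *\<^sub>R y) \<bullet> \<xi>)\<^sup>2 \<partial>\<mu>)"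
    by (intro Bochner_Integration.integral_cong)
       (auto simp: inner_add_left x\<xi> power2_eq_square algebra_simps)
  also have "\<dots> \<le> 2 ^ n * (\<integral>y. (y \<bullet> \<xi>)\<^sup>2 \<partial>\<mu>)"
    by (rule half_contraction_real[OF x ct(2)]) simp
  also have "\<dots> \<le> 2 ^ n * (2 ^ (n + 1) * (h \<eta>)\<^sup>2)"
    using L2 by (simp add: E[OF \<xi>])
  finally have "(norm x)\<^sup>2 / 4 \<le> 2 ^ n * (2 ^ (n + 1) * (h \<eta>)\<^sup>2)" .
  moreover have "(2::real) ^ (2 * n + 3) = 4 * (2 ^ n * 2 ^ (n + 1))"
  proof -
    have "2 * n + 3 = 2 + (n + (n + 1))" by simp
    then show ?thesis by (simp only: power_add power2_eq_square)
  qed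
  ultimately have "(norm x)\<^sup>2 \<le> 2 ^ (2 * n + 3) * (h \<eta>)\<^sup>2"
    by (simp only: mult.assoc)
  also have "\<dots> \<le> (32 ^ n)\<^sup>2 * (h \<eta>)\<^sup>2"
  proof (rule mult_right_mono)
    show "2 ^ (2 * n + 3) \<le> (32 ^ n :: real)\<^sup>2"
      using pow2_le_32[of "2 * n + 3" "2 * n"] n by (simp add: power_mult[symmetric] mult.commute)
  qed simp
  finally have "(norm x)\<^sup>2 \<le> (32 ^ n * h \<eta>)\<^sup>2" by (simp add: power_mult_distrib)
  then show ?thesis
    by (rule power2_le_imp_le) (simp add: h_nonneg \<eta>)
qed

lemma h_pos:
  assumes "\<eta> \<in> Rn n" "norm \<eta> = 1"
  shows "0 < h \<eta>"
proof -
  obtain r R where c: "cbody n r R K" by (rule cbody_K)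
  then have r: "r > 0" by (simp add: cbody_def)
  have "r *\<^sub>R \<eta> \<in> K"
    using c assms subspace_scale[OF subspace_Rn assms(1)] by (auto simp: cbody_def ball_n_def)
  then have "(r *\<^sub>R \<eta>) \<bullet> \<eta> \<le> h \<eta>" by (rule h_ge)
  then show ?thesis using r assms(2) by (simp add: norm_eq_1)
qed

lemma abs_inner_le:
  assumes "x \<in> K" "\<eta> \<in> Rn n" "norm \<eta> = 1"
  shows "\<bar>x \<bullet> \<eta>\<bar> \<le> 2 ^ (n + 1) * h \<eta>"
proof -
  have "h \<eta> \<le> 2 ^ (n + 1) * h \<eta>"
    using mult_right_mono[OF one_le_power[of "2::real" "n + 1"] h_nonneg[OF assms(2)]] by simp
  moreover have "h (-\<eta>) \<le> 2 ^ (n + 1) * h \<eta>"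
    using h_le_opposite[of "-\<eta>"] assms(2) subspace_neg[OF subspace_Rn] by simp
  ultimately show ?thesis
    using h_ge[OF assms(1), of \<eta>] h_ge[OF assms(1), of "-\<eta>"] by (simp add: abs_le_iff)
qed

text \<open>If K is thin in the direction \<eta>, it lies in the intersection of a slab with the
  minimal ball, hence in a flat ellipsoid. Minimality of the volume of the ball then bounds its
  radius, and so norm x, by the thickness of the slab.\<close>

lemma Loewner_bound:
  assumes loe: "Loewner_position n K" and x: "x \<in> K" and \<eta>: "\<eta> \<in> Rn n" "norm \<eta> = 1"
  shows "norm x \<le> 32 ^ n * h \<eta>"
proof -
  obtain r where r: "r > 0" and m: "min_vol_containing_ellipsoid n K (ball_n n r)"
    using loe by (auto simp: Loewner_position_def)
  define \<delta> where "\<delta> = 2 ^ (n + 1) * h \<eta>"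
  have \<delta>: "\<delta> > 0" using h_pos[OF \<eta>] by (simp add: \<delta>_def)
  \<comment> \<open>The factor sqrt 2 on both semi-axes lets each of the constraints, slab and ball,
    contribute at most 1/2 to the squared norm.\<close>
  let ?T = "diag_map \<eta> (sqrt 2 * \<delta>) (sqrt 2 * r)"
  have pos: "sqrt 2 * \<delta> > 0" "sqrt 2 * r > 0" using \<delta> r by auto
  let ?A = "(\<lambda>x. 0 + ?T x) ` ball_n n 1"
  have KA: "K \<subseteq> ?A"
  proof
    fix y assume y: "y \<in> K"
    let ?z = "diag_map \<eta> (1 / (sqrt 2 * \<delta>)) (1 / (sqrt 2 * r)) y"
    have "norm y \<le> r"
      using y m by (auto simp: min_vol_containing_ellipsoid_def ball_n_def)
    have "norm ?z ^ 2 = (1 / (sqrt 2 * \<delta>))\<^sup>2 * (y \<bullet> \<eta>)\<^sup>2 + (1 / (sqrt 2 * r))\<^sup>2 * (norm y ^ 2 - (y \<bullet> \<eta>)\<^sup>2)"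
      by (rule norm_diag_map[OF \<eta>(2)])
    also have "\<dots> \<le> (1 / (sqrt 2 * \<delta>))\<^sup>2 * \<delta>\<^sup>2 + (1 / (sqrt 2 * r))\<^sup>2 * r\<^sup>2"
    proof (intro add_mono mult_left_mono)
      show "(y \<bullet> \<eta>)\<^sup>2 \<le> \<delta>\<^sup>2"
        using abs_inner_le[OF y \<eta>] by (simp add: \<delta>_def abs_le_square_iff[symmetric])
      show "norm y ^ 2 - (y \<bullet> \<eta>)\<^sup>2 \<le> r\<^sup>2"
        using power_mono[OF \<open>norm y \<le> r\<close> norm_ge_zero, of 2] zero_le_power2[of "y \<bullet> \<eta>"] by linarith
    qed auto
    also have "\<dots> = 1" using \<delta> r by (simp add: power_divide power_mult_distrib)
    finally have "norm ?z \<le> 1" by (simp add: abs_square_le_1)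
    moreover have "?z \<in> Rn n" using y K(1) \<eta> diag_map_in[OF subspace_Rn] by blast
    moreover have "y = 0 + ?T ?z" using diag_map_inverse(1)[OF \<eta>(2), of "sqrt 2 * \<delta>" "sqrt 2 * r" y] \<delta> r by simp
    ultimately show "y \<in> ?A" by (auto simp: ball_n_def)
  qed
  have "vol (Rn n) (ball_n n r) \<le> vol (Rn n) ?A"
    using m KA ellipsoid_diag(1)[OF subspace_0[OF subspace_Rn] \<eta> pos]
    by (auto simp: min_vol_containing_ellipsoid_def)
  then have "unit_ball_vol n * r ^ n \<le> unit_ball_vol n * (sqrt 2 * \<delta> * (sqrt 2 * r) ^ (n - 1))"
    unfolding vol_ball_n[OF r] ellipsoid_diag(2)[OF subspace_0[OF subspace_Rn] \<eta> pos] by (simp add: mult_ac)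
  then have "r ^ n \<le> sqrt 2 * \<delta> * (sqrt 2 * r) ^ (n - 1)"
    by (rule mult_left_le_imp_le) simp
  also have "\<dots> = (sqrt 2 ^ n * \<delta>) * r ^ (n - 1)"
    using n by (cases n) (auto simp: power_mult_distrib)
  finally have "r * r ^ (n - 1) \<le> (sqrt 2 ^ n * \<delta>) * r ^ (n - 1)"
    using n by (cases n) auto
  then have "r \<le> sqrt 2 ^ n * \<delta>" using r by simp
  also have "\<dots> \<le> 2 ^ n * \<delta>"
    using \<delta> by (intro mult_right_mono power_mono) (auto intro: real_le_lsqrt)
  also have "\<dots> = 2 ^ (n + (n + 1)) * h \<eta>" by (simp add: \<delta>_def power_add)
  also have "\<dots> \<le> 32 ^ n * h \<eta>"
    using n h_nonneg[OF \<eta>(1)] by (intro mult_right_mono pow2_le_32) auto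
  finally show ?thesis
    using x m by (auto simp: min_vol_containing_ellipsoid_def ball_n_def)
qed

text \<open>The convex hull of x and the maximal inscribed ball contains an ellipsoid elongated in
  the direction of x. Comparing its volume with that of the ball bounds norm x by a multiple of r,
  and r is at most h \<eta>.\<close>

lemma John_bound:
  assumes john: "John_position n K" and x: "x \<in> K" and \<eta>: "\<eta> \<in> Rn n" "norm \<eta> = 1"
  shows "norm x \<le> 32 ^ n * h \<eta>"
proof (cases "x = 0")
  case True
  then show ?thesis using h_nonneg[OF \<eta>(1)] by simp
next
  case False
  obtain r where r: "r > 0" and m: "max_vol_inscribed_ellipsoid n K (ball_n n r)"
    using john by (auto simp: John_position_def)
  then have rK: "ball_n n r \<subseteq> K" by (simp add: max_vol_inscribed_ellipsoid_def)
  have "r *\<^sub>R \<eta> \<in> K"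
    using rK r \<eta> subspace_scale[OF subspace_Rn \<eta>(1)] by (auto simp: ball_n_def)
  then have "(r *\<^sub>R \<eta>) \<bullet> \<eta> \<le> h \<eta>" by (rule h_ge)
  then have rh: "r \<le> h \<eta>" using \<eta>(2) by (simp add: norm_eq_1)
  define \<xi> where "\<xi> = sgn x"
  have \<xi>: "\<xi> \<in> Rn n" "norm \<xi> = 1"
    using False x K(1) by (auto simp: \<xi>_def norm_sgn) (auto simp: sgn_div_norm intro: subspace_scale[OF subspace_Rn])
  have x\<xi>: "x = norm x *\<^sub>R \<xi>" using False by (simp add: \<xi>_def sgn_div_norm)
  have \<xi>\<xi>: "\<xi> \<bullet> \<xi> = 1" using \<xi>(2) by (simp add: norm_eq_1)
  \<comment> \<open>The ellipsoid has centre x/4, semi-axis norm x / 4 along x and r/2 across it: it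
    reaches from the origin to x/2, and there the hull still has at least half the thickness of the
    ball.\<close>
  define s where "s = norm x / 4"
  have s: "s > 0" "r / 2 > 0" using False r by (auto simp: s_def)
  have cR: "s *\<^sub>R \<xi> \<in> Rn n" by (rule subspace_scale[OF subspace_Rn \<xi>(1)])
  let ?A = "(\<lambda>y. s *\<^sub>R \<xi> + diag_map \<xi> s (r / 2) y) ` ball_n n 1"
  have AK: "?A \<subseteq> K"
  proof
    fix p assume "p \<in> ?A"
    then obtain y where y: "y \<in> Rn n" "norm y \<le> 1" and p: "p = s *\<^sub>R \<xi> + diag_map \<xi> s (r / 2) y"
      by (auto simp: ball_n_def)
    define \<alpha> where "\<alpha> = y \<bullet> \<xi>"
    define w where "w = y - \<alpha> *\<^sub>R \<xi>"
    have \<alpha>: "\<bar>\<alpha>\<bar> \<le> 1" using Cauchy_Schwarz_ineq2[of y \<xi>] y \<xi> by (simp add: \<alpha>_def)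
    have wR: "w \<in> Rn n"
      unfolding w_def using y \<xi> by (intro subspace_diff[OF subspace_Rn] subspace_scale[OF subspace_Rn]) auto
    have "norm w ^ 2 = norm y ^ 2 - \<alpha>\<^sup>2"
      by (simp add: w_def \<alpha>_def power2_norm_eq_inner inner_diff_left inner_diff_right inner_commute \<xi>\<xi>)
         (simp add: power2_eq_square)
    then have "norm w ^ 2 \<le> 1 ^ 2"
      using power_mono[OF y(2) norm_ge_zero, of 2] zero_le_power2[of \<alpha>] by linarith
    then have nw: "norm w \<le> 1" by (rule power2_le_imp_le) simp
    \<comment> \<open>The weight of x in the convex combination, read off from the component along
      \<xi>. As it is at most 1/2, the remaining weight is at least 1/2, which keeps
      \<open>u\<close> in the ball of radius r.\<close>
    define l where "l = (1 + \<alpha>) / 4"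
    have l: "0 \<le> l" "l \<le> 1/2" using \<alpha> by (auto simp: l_def abs_le_iff)
    define u where "u = (r / (2 * (1 - l))) *\<^sub>R w"
    have "norm u = r * norm w / (2 * (1 - l))" using r l by (simp add: u_def)
    also have "\<dots> \<le> r * 1 / 1"
      using r l nw by (intro frac_le mult_mono) auto
    finally have "u \<in> ball_n n r"
      using subspace_scale[OF subspace_Rn wR] by (simp add: ball_n_def u_def)
    then have uK: "u \<in> K" using rK by blast
    have "l *\<^sub>R x + (1 - l) *\<^sub>R u \<in> K"
      using K(2) x uK l by (intro convexD) auto
    moreover have "l *\<^sub>R x + (1 - l) *\<^sub>R u = p"
    proof -
      have "(1 - l) *\<^sub>R u = (r / 2) *\<^sub>R w" using l by (simp add: u_def field_simps)
      moreover have "l *\<^sub>R x = (s * (1 + \<alpha>)) *\<^sub>R \<xi>"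
        by (subst x\<xi>) (simp add: l_def s_def field_simps)
      moreover have "p = (s * (1 + \<alpha>)) *\<^sub>R \<xi> + (r / 2) *\<^sub>R w"
        by (simp add: p diag_map_def w_def \<alpha>_def algebra_simps)
      ultimately show ?thesis by simp
    qed
    ultimately show "p \<in> K" by simp
  qed
  have "vol (Rn n) ?A \<le> vol (Rn n) (ball_n n r)"
    using m AK ellipsoid_diag(1)[OF cR \<xi> s] by (auto simp: max_vol_inscribed_ellipsoid_def)
  then have "unit_ball_vol n * (s * (r / 2) ^ (n - 1)) \<le> unit_ball_vol n * r ^ n"
    unfolding vol_ball_n[OF r] ellipsoid_diag(2)[OF cR \<xi> s] by (simp add: mult_ac)
  then have "s * (r / 2) ^ (n - 1) \<le> r ^ n"
    by (rule mult_left_le_imp_le) simp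
  also have "r ^ n = (r * 2 ^ (n - 1)) * (r / 2) ^ (n - 1)"
    using n by (cases n) (auto simp: power_divide)
  finally have "s \<le> r * 2 ^ (n - 1)" using r by simp
  also have "\<dots> \<le> h \<eta> * 2 ^ (n - 1)" using rh by simp
  finally have "norm x \<le> 2 ^ (n - 1 + 2) * h \<eta>"
    by (simp add: s_def power_add mult_ac)
  also have "\<dots> \<le> 32 ^ n * h \<eta>"
    using n h_nonneg[OF \<eta>(1)] by (intro mult_right_mono pow2_le_32) auto
  finally show ?thesis .
qed

text \<open>The competitor halves K on the complement of \<eta> and stretches it along \<eta> as the
  determinant demands. This halves the mean width up to a term controlled by h \<eta>, so minimality
  bounds the mean width by that term, while a long vector x forces a large mean width.\<close>

lemma mean_width_bound:
  assumes mw: "min_mean_width_position n K" and x: "x \<in> K" and \<eta>: "\<eta> \<in> Rn n" "norm \<eta> = 1"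
  shows "norm x \<le> 32 ^ n * h \<eta>"
proof (cases "x = 0")
  case True
  then show ?thesis using h_nonneg[OF \<eta>(1)] by simp
next
  case False
  let ?P = "sphere_prob (Rn n)"
  interpret P: prob_space ?P
    by (rule sphere_prob_space_prob(1)[OF fdsub_Rn]) (simp add: dim_Rn n)
  note hc = support_fun_continuous[OF K(3) K_ne]
  have hc': "continuous_on UNIV (\<lambda>\<theta>. h (-\<theta>))"
    by (rule continuous_on_compose2[OF hc]) (auto intro!: continuous_intros)
  define w where "w = mean_width n K"
  define \<xi> where "\<xi> = sgn x"
  have \<xi>: "\<xi> \<in> Rn n" "norm \<xi> = 1"
    using False x K(1) by (auto simp: \<xi>_def norm_sgn) (auto simp: sgn_div_norm intro: subspace_scale[OF subspace_Rn])
  have x\<xi>: "x = norm x *\<^sub>R \<xi>" using False by (simp add: \<xi>_def sgn_div_norm)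
  have sp: "\<theta> \<in> Rn n" "norm \<theta> = 1" if "\<theta> \<in> space ?P" for \<theta>
    using that by (auto simp: space_sphere_Rn[OF n])
  have neg: "orthogonal_transformation (\<lambda>\<theta>::pt. -\<theta>)" "(\<lambda>\<theta>. -\<theta>) ` Rn n = Rn n"
  proof -
    show "orthogonal_transformation (\<lambda>\<theta>::pt. -\<theta>)"
      by (simp add: orthogonal_transformation_def linear_iff)
    show "(\<lambda>\<theta>. -\<theta>) ` Rn n = Rn n"
      using subspace_neg[OF subspace_Rn] by (force intro!: image_eqI[of _ _ "- _"])
  qed
  have wneg: "(\<integral>\<theta>. h (-\<theta>) \<partial>?P) = w"
    using integral_sphere_Rn_rotate[OF n neg borel_measurable_continuous_onI[OF hc]]
    by (simp add: w_def mean_width_def)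
  have "norm x * (1 / n) = norm x * (\<integral>\<theta>. (\<theta> \<bullet> \<xi>)\<^sup>2 \<partial>?P)"
    using integral_sphere_inner_sq[OF n \<xi>] by simp
  also have "\<dots> = (\<integral>\<theta>. norm x * (\<theta> \<bullet> \<xi>)\<^sup>2 \<partial>?P)" by simp
  also have "\<dots> \<le> (\<integral>\<theta>. h \<theta> + h (-\<theta>) \<partial>?P)"
  proof (rule integral_mono)
    show "integrable ?P (\<lambda>\<theta>. norm x * (\<theta> \<bullet> \<xi>)\<^sup>2)" "integrable ?P (\<lambda>\<theta>. h \<theta> + h (-\<theta>))"
      by (intro integrable_sphere_Rn[OF n] continuous_intros hc hc')+
    fix \<theta> assume "\<theta> \<in> space ?P"
    note \<theta> = sp[OF this]
    \<comment> \<open>The square is used in place of the absolute value because its mean over the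
      sphere is exactly 1/n by symmetry.\<close>
    have "(\<theta> \<bullet> \<xi>)\<^sup>2 \<le> \<bar>\<theta> \<bullet> \<xi>\<bar>"
      using Cauchy_Schwarz_ineq2[of \<theta> \<xi>] \<theta>(2) \<xi>(2) mult_left_le[of "\<bar>\<theta> \<bullet> \<xi>\<bar>" "\<bar>\<theta> \<bullet> \<xi>\<bar>"]
      by (simp add: power2_eq_square abs_mult[symmetric])
    then have "norm x * (\<theta> \<bullet> \<xi>)\<^sup>2 \<le> norm x * \<bar>\<theta> \<bullet> \<xi>\<bar>" by (rule mult_left_mono) simp
    also have "\<dots> = \<bar>x \<bullet> \<theta>\<bar>"
      using arg_cong[OF x\<xi>, of "\<lambda>v. v \<bullet> \<theta>"] by (simp add: abs_mult inner_commute)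
    also have "\<dots> \<le> h \<theta> + h (-\<theta>)"
      using h_ge[OF x, of \<theta>] h_ge[OF x, of "-\<theta>"] h_nonneg[OF \<theta>(1)] h_nonneg[of "-\<theta>"]
        subspace_neg[OF subspace_Rn \<theta>(1)] by (simp add: abs_le_iff)
    finally show "norm x * (\<theta> \<bullet> \<xi>)\<^sup>2 \<le> h \<theta> + h (-\<theta>)" .
  qed
  also have "\<dots> = 2 * w"
    using wneg integrable_sphere_Rn[OF n hc] integrable_sphere_Rn[OF n hc'] by (simp add: w_def mean_width_def)
  finally have xw: "norm x \<le> 2 * n * w" using n by (simp add: field_simps)
  define r where "r = 2 ^ (n + 1) * h \<eta>"
  have r0: "r \<ge> 0" using h_nonneg[OF \<eta>(1)] by (simp add: r_def)
  \<comment> \<open>Compensates the factor 1/2 in the n - 1 directions orthogonal to \<eta>, so that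
    the determinant is 1.\<close>
  define s :: real where "s = 2 ^ (n - 1)"
  have s: "s \<ge> 1" by (simp add: s_def)
  let ?T = "diag_map \<eta> s (1/2)"
  have "s * (1/2) ^ (n - 1) = 1" by (simp add: s_def power_one_over)
  then have "?T \<in> SL n" by (rule diag_map_SL[OF \<eta>])
  then have "w \<le> mean_width n (?T ` K)"
    using mw by (simp add: min_mean_width_position_def w_def)
  also have "\<dots> = (\<integral>\<theta>. support_fun (?T ` K) \<theta> \<partial>?P)" by (simp add: mean_width_def)
  also have "\<dots> \<le> (\<integral>\<theta>. (1/2) * h \<theta> + s * r \<partial>?P)"
  proof (rule integral_mono)
    have "compact (?T ` K)"
      by (rule compact_continuous_image[OF _ K(3)]) (intro continuous_intros)
    then show "integrable ?P (support_fun (?T ` K))"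
      using K_ne by (intro integrable_sphere_Rn[OF n] support_fun_continuous) auto
    show "integrable ?P (\<lambda>\<theta>. (1/2) * h \<theta> + s * r)"
      by (intro integrable_sphere_Rn[OF n] continuous_intros hc)
    fix \<theta> assume "\<theta> \<in> space ?P"
    note \<theta> = sp[OF this]
    show "support_fun (?T ` K) \<theta> \<le> (1/2) * h \<theta> + s * r"
      unfolding support_fun_def[of "?T ` K"]
    proof (rule cSUP_least)
      fix z assume "z \<in> ?T ` K"
      then obtain y where y: "y \<in> K" "z = ?T y" by auto
      have "z \<bullet> \<theta> = (1/2) * (y \<bullet> \<theta>) + (s - 1/2) * ((y \<bullet> \<eta>) * (\<eta> \<bullet> \<theta>))"
        by (simp add: y diag_map_def inner_add_left)
      also have "\<dots> \<le> (1/2) * h \<theta> + s * (r * 1)"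
      proof (rule add_mono)
        have "(y \<bullet> \<eta>) * (\<eta> \<bullet> \<theta>) \<le> \<bar>y \<bullet> \<eta>\<bar> * \<bar>\<eta> \<bullet> \<theta>\<bar>" by (simp add: abs_mult[symmetric])
        also have "\<dots> \<le> r * 1"
          using abs_inner_le[OF y(1) \<eta>] Cauchy_Schwarz_ineq2[of \<eta> \<theta>] \<eta>(2) \<theta>(2) r0
          by (intro mult_mono) (auto simp: r_def)
        finally have yr: "(y \<bullet> \<eta>) * (\<eta> \<bullet> \<theta>) \<le> r * 1" .
        have "(s - 1/2) * ((y \<bullet> \<eta>) * (\<eta> \<bullet> \<theta>)) \<le> (s - 1/2) * (r * 1)"
          by (rule mult_left_mono[OF yr]) (use s in simp)
        also have "\<dots> \<le> s * (r * 1)" using r0 by (intro mult_right_mono) auto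
        finally show "(s - 1/2) * ((y \<bullet> \<eta>) * (\<eta> \<bullet> \<theta>)) \<le> s * (r * 1)" .
        show "(1/2) * (y \<bullet> \<theta>) \<le> (1/2) * h \<theta>" using h_ge[OF y(1), of \<theta>] by simp
      qed
      finally show "z \<bullet> \<theta> \<le> (1/2) * h \<theta> + s * r" by simp
    qed (use K_ne in auto)
  qed
  also have "\<dots> = (1/2) * w + s * r"
    using integrable_sphere_Rn[OF n hc] P.prob_space by (simp add: w_def mean_width_def)
  finally have "w \<le> 2 * (s * r)" by simp
  then have "norm x \<le> 2 * n * (2 * (s * r))"
    by (intro order_trans[OF xw] mult_left_mono) auto
  also have "\<dots> = n * (2 ^ (n + 1 + (n + 1)) * h \<eta>)"
    using n by (cases n) (simp_all add: s_def r_def power_add)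
  \<comment> \<open>The dimension factor from the mean of the square is absorbed
    exponentially.\<close>
  also have "\<dots> \<le> 2 ^ n * (2 ^ (n + 1 + (n + 1)) * h \<eta>)"
    using h_nonneg[OF \<eta>(1)] of_nat_less_two_power[of n, where ?'a = real] by (intro mult_right_mono) auto
  also have "\<dots> = 2 ^ (n + (n + 1 + (n + 1))) * h \<eta>" by (simp add: power_add)
  also have "\<dots> \<le> 32 ^ n * h \<eta>"
    using n h_nonneg[OF \<eta>(1)] by (intro mult_right_mono pow2_le_32) auto
  finally show ?thesis .
qed

end

section \<open>Surface area\<close>

definition parallel_body :: "nat \<Rightarrow> pt set \<Rightarrow> real \<Rightarrow> pt set" where
  "parallel_body n A \<epsilon> = {x + y | x y. x \<in> A \<and> y \<in> ball_n n \<epsilon>}"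

lemma compact_ball_n: "compact (ball_n n r)" and convex_ball_n: "convex (ball_n n r)"
  unfolding ball_n_def
  by (rule compact_cball_fdsub[OF fdsub_Rn])
     (rule convex_Int[OF convex_cball subspace_imp_convex[OF subspace_Rn]])

lemma convex_sum_sets:
  assumes "convex A" "convex B"
  shows "convex {x + y | x y. x \<in> A \<and> y \<in> B}"
proof (rule convexI)
  fix p q and u v :: real
  assume p: "p \<in> {x + y | x y. x \<in> A \<and> y \<in> B}" and q: "q \<in> {x + y | x y. x \<in> A \<and> y \<in> B}"
    and uv: "0 \<le> u" "0 \<le> v" "u + v = 1"
  obtain x y where xy: "p = x + y" "x \<in> A" "y \<in> B" using p by auto
  obtain x' y' where xy': "q = x' + y'" "x' \<in> A" "y' \<in> B" using q by auto
  have "u *\<^sub>R p + v *\<^sub>R q = (u *\<^sub>R x + v *\<^sub>R x') + (u *\<^sub>R y + v *\<^sub>R y')"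
    by (simp add: xy xy' algebra_simps)
  moreover have "u *\<^sub>R x + v *\<^sub>R x' \<in> A" "u *\<^sub>R y + v *\<^sub>R y' \<in> B"
    using assms xy xy' uv by (auto intro: convexD)
  ultimately show "u *\<^sub>R p + v *\<^sub>R q \<in> {x + y | x y. x \<in> A \<and> y \<in> B}" by blast
qed

lemma cbody_parallel:
  assumes A: "cbody n r R A" and "0 \<le> \<epsilon>"
  shows "cbody n r (R + \<epsilon>) (parallel_body n A \<epsilon>)"
proof -
  have A': "compact A" "convex A" "ball_n n r \<subseteq> A" "A \<subseteq> ball_n n R" "0 < r"
    using A by (auto simp: cbody_def)
  have "compact (parallel_body n A \<epsilon>)"
    unfolding parallel_body_def by (rule compact_sums[OF A'(1) compact_ball_n])
  moreover have "convex (parallel_body n A \<epsilon>)"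
    unfolding parallel_body_def by (rule convex_sum_sets[OF A'(2) convex_ball_n])
  moreover have "A \<subseteq> parallel_body n A \<epsilon>"
  proof
    fix x assume "x \<in> A"
    moreover have "0 \<in> ball_n n \<epsilon>" using assms(2) subspace_0[OF subspace_Rn] by (simp add: ball_n_def)
    ultimately have "\<exists>x' y. x = x' + y \<and> x' \<in> A \<and> y \<in> ball_n n \<epsilon>"
      by (intro exI[of _ x] exI[of _ 0]) simp
    then show "x \<in> parallel_body n A \<epsilon>" by (simp add: parallel_body_def)
  qed
  moreover have "parallel_body n A \<epsilon> \<subseteq> ball_n n (R + \<epsilon>)"
  proof
    fix z assume "z \<in> parallel_body n A \<epsilon>"
    then obtain x y where z: "z = x + y" "x \<in> A" "y \<in> ball_n n \<epsilon>" by (auto simp: parallel_body_def)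
    then have "norm x \<le> R" "x \<in> Rn n" "norm y \<le> \<epsilon>" "y \<in> Rn n" using A'(4) by (auto simp: ball_n_def)
    then show "z \<in> ball_n n (R + \<epsilon>)"
      using norm_triangle_ineq[of x y] subspace_add[OF subspace_Rn] by (auto simp: ball_n_def z)
  qed
  ultimately show ?thesis using A' by (auto simp: cbody_def)
qed

lemma parallel_0: "parallel_body n A 0 = A"
  using subspace_0[OF subspace_Rn] by (auto simp: parallel_body_def ball_n_def)

text \<open>The ball of radius \<epsilon> lies in (\<epsilon>/r) A since A contains the ball of
  radius r, and A + (\<epsilon>/r) A = (1 + \<epsilon>/r) A by convexity.\<close>

lemma parallel_subset_scale:
  assumes A: "cbody n r R A" and "0 \<le> \<epsilon>"
  shows "parallel_body n A \<epsilon> \<subseteq> (\<lambda>x. (1 + \<epsilon> / r) *\<^sub>R x) ` A"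
proof
  fix z assume "z \<in> parallel_body n A \<epsilon>"
  then obtain x y where z: "z = x + y" "x \<in> A" "y \<in> ball_n n \<epsilon>" by (auto simp: parallel_body_def)
  have r: "r > 0" "convex A" "ball_n n r \<subseteq> A" using A by (auto simp: cbody_def)
  define l where "l = 1 / (1 + \<epsilon> / r)"
  have p: "1 + \<epsilon> / r > 0" using assms(2) r by (simp add: add_pos_nonneg)
  have l: "0 < l" "l \<le> 1" "1 - l = (\<epsilon> / r) * l" using p assms(2) r by (auto simp: l_def field_simps)
  show "z \<in> (\<lambda>x. (1 + \<epsilon> / r) *\<^sub>R x) ` A"
  proof (cases "\<epsilon> = 0")
    case True
    then have "z = x" using z by (auto simp: ball_n_def)
    then show ?thesis using z True by auto
  next
    case False
    then have e: "\<epsilon> > 0" using assms(2) by simp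
    have "(r / \<epsilon>) *\<^sub>R y \<in> ball_n n r"
      using z(3) e r(1) subspace_scale[OF subspace_Rn] by (auto simp: ball_n_def field_simps)
    then have "(r / \<epsilon>) *\<^sub>R y \<in> A" using r by blast
    then have "l *\<^sub>R x + (1 - l) *\<^sub>R ((r / \<epsilon>) *\<^sub>R y) \<in> A"
      using r(2) z(2) l by (intro convexD) auto
    moreover have "l *\<^sub>R x + (1 - l) *\<^sub>R ((r / \<epsilon>) *\<^sub>R y) = l *\<^sub>R z"
      using e r(1) by (simp add: l(3) z algebra_simps)
    ultimately have "l *\<^sub>R z \<in> A" by simp
    then show ?thesis
      using p by (intro image_eqI[of _ _ "l *\<^sub>R z"]) (auto simp: l_def)
  qed
qed

section \<open>Radial functions of parallel bodies and existence of the surface area\<close>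

context
  fixes n r R A
  assumes A: "cbody n r R A" and n: "n > 0"
begin

abbreviation "\<rho> \<epsilon> \<equiv> radial (parallel_body n A \<epsilon>)"

lemma radial_parallel_mem:
  assumes "x \<in> Rn n" "x \<noteq> 0" "0 \<le> \<epsilon>"
  shows "\<rho> \<epsilon> x > 0" "\<rho> \<epsilon> x *\<^sub>R x \<in> parallel_body n A \<epsilon>"
proof -
  note c = cbody_parallel[OF A assms(3)]
  have "r / norm x > 0" using A assms by (simp add: cbody_def)
  then show "\<rho> \<epsilon> x > 0" using radial_ge[OF c assms(1,2)] by linarith
  then show "\<rho> \<epsilon> x *\<^sub>R x \<in> parallel_body n A \<epsilon>"
    using radial_le_iff[OF c assms(2)] by simp
qed

text \<open>A convex combination of a point of A and a point of the \<epsilon>-parallel body lies in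
  the correspondingly smaller parallel body, so the radial function is concave in \<epsilon> and its
  difference quotients from 0 decrease.\<close>

lemma radial_parallel_concave:
  assumes x: "x \<in> Rn n" "x \<noteq> 0" and d: "0 < \<delta>" "\<delta> \<le> \<epsilon>"
  shows "(\<rho> \<epsilon> x - \<rho> 0 x) / \<epsilon> \<le> (\<rho> \<delta> x - \<rho> 0 x) / \<delta>"
proof -
  define l where "l = \<delta> / \<epsilon>"
  have l: "0 \<le> l" "l \<le> 1" using d by (auto simp: l_def)
  have cv: "convex A" using A by (simp add: cbody_def)
  have 0: "\<rho> 0 x > 0" "\<rho> 0 x *\<^sub>R x \<in> A"
    using radial_parallel_mem[OF x, of 0] by (simp_all add: parallel_0)
  have e: "\<rho> \<epsilon> x > 0" "\<rho> \<epsilon> x *\<^sub>R x \<in> parallel_body n A \<epsilon>"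
    using radial_parallel_mem[OF x, of \<epsilon>] d by simp_all
  then obtain a y where ay: "\<rho> \<epsilon> x *\<^sub>R x = a + y" "a \<in> A" "y \<in> ball_n n \<epsilon>"
    by (auto simp: parallel_body_def)
  let ?t = "(1 - l) * \<rho> 0 x + l * \<rho> \<epsilon> x"
  have "?t *\<^sub>R x = ((1 - l) *\<^sub>R (\<rho> 0 x *\<^sub>R x) + l *\<^sub>R a) + l *\<^sub>R y"
    using ay(1) by (simp add: scaleR_add_left scaleR_add_right[symmetric] add.assoc flip: scaleR_scaleR)
  moreover have "(1 - l) *\<^sub>R (\<rho> 0 x *\<^sub>R x) + l *\<^sub>R a \<in> A"
    using cv 0(2) ay(2) l by (intro convexD) auto
  moreover have "l *\<^sub>R y \<in> ball_n n \<delta>"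
    using ay(3) d subspace_scale[OF subspace_Rn] by (auto simp: ball_n_def l_def field_simps)
  ultimately have "?t *\<^sub>R x \<in> parallel_body n A \<delta>"
    unfolding parallel_body_def by blast
  moreover have "?t > 0"
    using 0(1) e(1) l by (cases "l = 0") (auto intro: add_nonneg_pos)
  ultimately have "?t \<le> \<rho> \<delta> x"
    using radial_le_iff[OF cbody_parallel[OF A] x(2)] d by auto
  then have "l * (\<rho> \<epsilon> x - \<rho> 0 x) \<le> \<rho> \<delta> x - \<rho> 0 x" by (simp add: algebra_simps)
  then show ?thesis using d by (simp add: l_def field_simps)
qed

lemma radial_parallel_bounds:
  assumes x: "x \<in> Rn n" "x \<noteq> 0" and e: "0 \<le> \<epsilon>"
  shows "\<rho> 0 x \<le> \<rho> \<epsilon> x" "\<rho> \<epsilon> x \<le> (1 + \<epsilon> / r) * \<rho> 0 x"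
proof -
  have r: "r > 0" using A by (simp add: cbody_def)
  have p: "1 + \<epsilon> / r > 0" using e r by (simp add: add_pos_nonneg)
  note 0 = radial_parallel_mem[OF x, of 0] and m = radial_parallel_mem[OF x e]
  have "\<rho> 0 x *\<^sub>R x + 0 \<in> parallel_body n A \<epsilon>"
    unfolding parallel_body_def
    using 0(2) e subspace_0[OF subspace_Rn] by (intro CollectI exI conjI refl) (auto simp: parallel_0 ball_n_def)
  then show "\<rho> 0 x \<le> \<rho> \<epsilon> x"
    using radial_le_iff[OF cbody_parallel[OF A e] x(2)] 0(1) by simp
  obtain a where a: "a \<in> A" "\<rho> \<epsilon> x *\<^sub>R x = (1 + \<epsilon> / r) *\<^sub>R a"
    using parallel_subset_scale[OF A e] m(2) by blast
  have "(\<rho> \<epsilon> x / (1 + \<epsilon> / r)) *\<^sub>R x = (1 / (1 + \<epsilon> / r)) *\<^sub>R (\<rho> \<epsilon> x *\<^sub>R x)" by simp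
  also have "\<dots> = a" unfolding a(2) using p by simp
  finally have "(\<rho> \<epsilon> x / (1 + \<epsilon> / r)) *\<^sub>R x \<in> parallel_body n A 0"
    using a(1) by (simp add: parallel_0)
  then have "\<rho> \<epsilon> x / (1 + \<epsilon> / r) \<le> \<rho> 0 x"
    using radial_le_iff[OF cbody_parallel[OF A order_refl] x(2)] m(1) p by simp
  then show "\<rho> \<epsilon> x \<le> (1 + \<epsilon> / r) * \<rho> 0 x"
    using p by (simp add: pos_divide_le_eq mult.commute)
qed

text \<open>The mean value bounds for the power function, with the derivative at the smaller and at
  the larger point.\<close>

lemma power_diff_bounds:
  fixes x y :: real
  assumes "0 \<le> y" "y \<le> x"
  shows "real k * y ^ (k - 1) * (x - y) \<le> x ^ k - y ^ k" "x ^ k - y ^ k \<le> real k * x ^ (k - 1) * (x - y)"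
proof (induction k)
  case (Suc k)
  have eq: "x ^ Suc k - y ^ Suc k = x * (x ^ k - y ^ k) + y ^ k * (x - y)"
    "x ^ Suc k - y ^ Suc k = y * (x ^ k - y ^ k) + x ^ k * (x - y)"
    by (simp_all add: algebra_simps)
  have pm: "y ^ k \<le> x ^ k" using assms by (rule power_mono[rotated])
  {
    case 1
    have "real k * y ^ k * (x - y) \<le> y * (x ^ k - y ^ k)"
      using mult_left_mono[OF Suc.IH(1) assms(1)] by (cases k) (simp_all add: mult_ac)
    moreover have "y ^ k * (x - y) \<le> x ^ k * (x - y)" using pm assms by (intro mult_right_mono) auto
    ultimately show ?case unfolding eq(2) by (simp add: algebra_simps)
  next
    case 2
    have "x * (x ^ k - y ^ k) \<le> real k * x ^ k * (x - y)"
      using mult_left_mono[OF Suc.IH(2), of x] assms by (cases k) (simp_all add: mult_ac)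
    moreover have "y ^ k * (x - y) \<le> x ^ k * (x - y)" using pm assms by (intro mult_right_mono) auto
    ultimately show ?case unfolding eq(1) by (simp add: algebra_simps)
  }
qed simp_all

text \<open>The difference quotient of the volume is squeezed between the integral of
  \<open>n * \<rho> ^ (n - 1)\<close> times the difference quotient of the radial function, which is monotone,
  and a multiple of it tending to it.\<close>

lemma surface_area_tendsto:
  "((\<lambda>\<epsilon>. (vol (Rn n) (parallel_body n A \<epsilon>) - vol (Rn n) A) / \<epsilon>) \<longlongrightarrow> surface_area n A) (at_right 0)"
proof -
  let ?u = "usphere (Rn n)"
  have dn: "dim (Rn n) > 0" using n by (simp add: dim_Rn)
  interpret u: prob_space ?u by (rule prob_space_usphere[OF fdsub_Rn dn])
  have r: "r > 0" using A by (simp add: cbody_def)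
  have pos: "AE x in ?u. x \<in> Rn n \<and> x \<noteq> 0"
    using AE_usphere_sphere[OF fdsub_Rn dn] by eventually_elim auto
  have vol: "vol (Rn n) (parallel_body n A \<epsilon>) = unit_ball_vol n * (\<integral>x. \<rho> \<epsilon> x ^ n \<partial>?u)" if "0 \<le> \<epsilon>" for \<epsilon>
    using vol_cbody[OF cbody_parallel[OF A that] n] radial_moment_def[OF cbody_parallel[OF A that]] by simp
  have int: "integrable ?u (\<lambda>x. \<rho> \<epsilon> x ^ k)" if "0 \<le> \<epsilon>" for \<epsilon> k
    by (rule integrable_radial[OF cbody_parallel[OF A that] fdsub_Rn dn])
  define f where "f \<epsilon> x = n * \<rho> 0 x ^ (n - 1) * ((\<rho> \<epsilon> x - \<rho> 0 x) / \<epsilon>)" for \<epsilon> x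
  have [measurable]: "\<rho> \<epsilon> \<in> borel_measurable borel" if "0 \<le> \<epsilon>" for \<epsilon>
    by (rule radial_measurable[OF cbody_parallel[OF A that]])
  have fm: "f \<epsilon> \<in> borel_measurable ?u" if "0 \<le> \<epsilon>" for \<epsilon>
    unfolding f_def using that by measurable
  have f0: "0 \<le> f \<epsilon> x" "f \<epsilon> x \<le> n / r * \<rho> 0 x ^ n" if "x \<in> Rn n \<and> x \<noteq> 0" "0 < \<epsilon>" for \<epsilon> x
  proof -
    have x: "x \<in> Rn n" "x \<noteq> 0" using that by auto
    have e: "0 \<le> \<epsilon>" using that by simp
    note b = radial_parallel_bounds[OF x e]
    have p0: "\<rho> 0 x > 0" using radial_parallel_mem[OF x, of 0] by simp
    show "0 \<le> f \<epsilon> x" using b(1) p0 that(2) by (simp add: f_def)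
    have "\<rho> \<epsilon> x - \<rho> 0 x \<le> (\<epsilon> / r) * \<rho> 0 x" using b(2) by (simp add: algebra_simps)
    then have "(\<rho> \<epsilon> x - \<rho> 0 x) / \<epsilon> \<le> \<rho> 0 x / r"
      using that(2) by (simp add: pos_divide_le_eq mult.commute)
    then have "f \<epsilon> x \<le> n * \<rho> 0 x ^ (n - 1) * (\<rho> 0 x / r)"
      unfolding f_def using p0 by (intro mult_left_mono) auto
    also have "\<dots> = n / r * \<rho> 0 x ^ n" using n by (cases n) auto
    finally show "f \<epsilon> x \<le> n / r * \<rho> 0 x ^ n" .
  qed
  have fi: "integrable ?u (f \<epsilon>)" if "0 < \<epsilon>" for \<epsilon>
  proof (rule Bochner_Integration.integrable_bound)
    show "integrable ?u (\<lambda>x. n / r * \<rho> 0 x ^ n)"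
      by (rule integrable_mult_right) (rule int, simp)
    show "f \<epsilon> \<in> borel_measurable ?u" using fm that by simp
    show "AE x in ?u. norm (f \<epsilon> x) \<le> norm (n / r * \<rho> 0 x ^ n)"
      using pos
    proof eventually_elim
      case (elim x)
      then show ?case using f0[OF elim that] unfolding real_norm_def by linarith
    qed
  qed
  define g where "g \<epsilon> = unit_ball_vol n * (\<integral>x. f \<epsilon> x \<partial>?u)" for \<epsilon>
  define B where "B = unit_ball_vol n * (\<integral>x. n / r * \<rho> 0 x ^ n \<partial>?u)"
  have gB: "g \<epsilon> \<le> B" if "0 < \<epsilon>" for \<epsilon>
    unfolding g_def B_def
  proof (rule mult_left_mono, rule integral_mono_AE[OF fi[OF that]])
    show "integrable ?u (\<lambda>x. n / r * \<rho> 0 x ^ n)" by (rule integrable_mult_right) (rule int, simp)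
    show "AE x in ?u. f \<epsilon> x \<le> n / r * \<rho> 0 x ^ n"
      using pos by eventually_elim (rule f0(2)[OF _ that])
  qed simp
  have gmono: "g \<epsilon> \<le> g \<delta>" if "0 < \<delta>" "\<delta> \<le> \<epsilon>" for \<delta> \<epsilon>
    unfolding g_def
  proof (rule mult_left_mono, rule integral_mono_AE[OF fi fi])
    show "AE x in ?u. f \<epsilon> x \<le> f \<delta> x"
      using pos
    proof eventually_elim
      case (elim x)
      then show ?case
        unfolding f_def using that radial_parallel_concave[of x \<delta> \<epsilon>] radial_parallel_mem(1)[of x 0]
        by (intro mult_left_mono) auto
    qed
  qed (use that in auto)
  \<comment> \<open>The quotient integral decreases in \<epsilon> and is bounded, so its limit from
    the right at 0 is its supremum.\<close>
  define L where "L = Sup (g ` {0<..})"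
  have bdd: "bdd_above (g ` {0<..})" using gB by (auto intro!: bdd_aboveI2)
  have gL: "(g \<longlongrightarrow> L) (at_right 0)"
  proof (rule increasing_tendsto)
    show "\<forall>\<^sub>F \<epsilon> in at_right 0. g \<epsilon> \<le> L"
      unfolding eventually_at_right_field L_def
      by (intro exI[of _ 1]) (auto intro!: cSUP_upper bdd)
    fix y assume "y < L"
    then obtain \<epsilon> where e: "\<epsilon> > 0" "y < g \<epsilon>"
      unfolding L_def using less_cSUP_iff[OF _ bdd] by auto
    show "\<forall>\<^sub>F x in at_right 0. y < g x"
      unfolding eventually_at_right_field
      by (intro exI[of _ \<epsilon>]) (use e gmono in \<open>force intro: less_le_trans\<close>)
  qed
  let ?D = "\<lambda>\<epsilon>. (vol (Rn n) (parallel_body n A \<epsilon>) - vol (Rn n) A) / \<epsilon>"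
  have D: "?D \<epsilon> = unit_ball_vol n * (\<integral>x. (\<rho> \<epsilon> x ^ n - \<rho> 0 x ^ n) / \<epsilon> \<partial>?u)" if "0 < \<epsilon>" for \<epsilon>
    using that vol[of \<epsilon>] vol[of 0] int[of \<epsilon> n] int[of 0 n]
    by (simp add: parallel_0 right_diff_distrib diff_divide_distrib)
  have Di: "integrable ?u (\<lambda>x. (\<rho> \<epsilon> x ^ n - \<rho> 0 x ^ n) / \<epsilon>)" if "0 < \<epsilon>" for \<epsilon>
    using int[of \<epsilon> n] int[of 0 n] that by simp
  have lower: "g \<epsilon> \<le> ?D \<epsilon>" if "0 < \<epsilon>" for \<epsilon>
    unfolding g_def D[OF that]
  proof (rule mult_left_mono, rule integral_mono_AE[OF fi[OF that] Di[OF that]])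
    show "AE x in ?u. f \<epsilon> x \<le> (\<rho> \<epsilon> x ^ n - \<rho> 0 x ^ n) / \<epsilon>"
      using pos
    proof eventually_elim
      case (elim x)
      then have "real n * \<rho> 0 x ^ (n - 1) * (\<rho> \<epsilon> x - \<rho> 0 x) \<le> \<rho> \<epsilon> x ^ n - \<rho> 0 x ^ n"
        using radial_parallel_bounds(1)[of x \<epsilon>] radial_parallel_mem(1)[of x 0] that
        by (intro power_diff_bounds) auto
      then show ?case using that unfolding f_def by (simp add: divide_right_mono)
    qed
  qed simp
  have upper: "?D \<epsilon> \<le> (1 + \<epsilon> / r) ^ (n - 1) * g \<epsilon>" if "0 < \<epsilon>" for \<epsilon>
  proof -
    have "(\<integral>x. (\<rho> \<epsilon> x ^ n - \<rho> 0 x ^ n) / \<epsilon> \<partial>?u) \<le> (\<integral>x. (1 + \<epsilon> / r) ^ (n - 1) * f \<epsilon> x \<partial>?u)"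
    proof (rule integral_mono_AE[OF Di[OF that]])
      show "integrable ?u (\<lambda>x. (1 + \<epsilon> / r) ^ (n - 1) * f \<epsilon> x)"
        by (rule integrable_mult_right) (rule fi[OF that])
      show "AE x in ?u. (\<rho> \<epsilon> x ^ n - \<rho> 0 x ^ n) / \<epsilon> \<le> (1 + \<epsilon> / r) ^ (n - 1) * f \<epsilon> x"
        using pos
      proof eventually_elim
        case (elim x)
        then have x: "x \<in> Rn n" "x \<noteq> 0" and e: "0 \<le> \<epsilon>" using that by auto
        note b = radial_parallel_bounds[OF x e] and p0 = radial_parallel_mem(1)[OF x order_refl]
        have "\<rho> \<epsilon> x ^ n - \<rho> 0 x ^ n \<le> real n * \<rho> \<epsilon> x ^ (n - 1) * (\<rho> \<epsilon> x - \<rho> 0 x)"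
          using b p0 by (intro power_diff_bounds) auto
        also have "\<dots> \<le> real n * ((1 + \<epsilon> / r) * \<rho> 0 x) ^ (n - 1) * (\<rho> \<epsilon> x - \<rho> 0 x)"
          using b p0 by (intro mult_right_mono mult_left_mono power_mono) auto
        finally show ?case
          using that by (simp add: f_def power_mult_distrib divide_right_mono mult_ac)
      qed
    qed
    then have "unit_ball_vol n * (\<integral>x. (\<rho> \<epsilon> x ^ n - \<rho> 0 x ^ n) / \<epsilon> \<partial>?u)
        \<le> unit_ball_vol n * (\<integral>x. (1 + \<epsilon> / r) ^ (n - 1) * f \<epsilon> x \<partial>?u)"
      by (rule mult_left_mono) simp
    then show ?thesis unfolding D[OF that] by (simp add: g_def mult_ac)
  qed
  have "((\<lambda>\<epsilon>. (1 + \<epsilon> / r) ^ (n - 1) * g \<epsilon>) \<longlongrightarrow> (1 + 0 / r) ^ (n - 1) * L) (at_right 0)"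
    by (intro tendsto_intros gL) (use r in simp)
  then have "((\<lambda>\<epsilon>. (1 + \<epsilon> / r) ^ (n - 1) * g \<epsilon>) \<longlongrightarrow> L) (at_right 0)" by simp
  moreover have "\<forall>\<^sub>F \<epsilon> in at_right 0. g \<epsilon> \<le> ?D \<epsilon>" "\<forall>\<^sub>F \<epsilon> in at_right 0. ?D \<epsilon> \<le> (1 + \<epsilon> / r) ^ (n - 1) * g \<epsilon>"
    unfolding eventually_at_right_field by (intro exI[of _ 1]; use lower upper in simp)+
  ultimately have "(?D \<longlongrightarrow> L) (at_right 0)"
    using gL by (intro tendsto_sandwich[of g ?D])
  moreover from this have "surface_area n A = L"
    unfolding surface_area_def parallel_body_def[symmetric] by (intro tendsto_Lim) auto
  ultimately show ?thesis by simp
qed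

end

section \<open>Fibres in one direction and thickening by a segment\<close>

definition thicken :: "pt set \<Rightarrow> pt \<Rightarrow> real \<Rightarrow> pt set" where
  "thicken A \<xi> t = {x + y | x y. x \<in> A \<and> y \<in> (\<lambda>u. u *\<^sub>R \<xi>) ` {-t..t}}"

lemma compact_thicken: "compact A \<Longrightarrow> compact (thicken A \<xi> t)"
  unfolding thicken_def by (intro compact_sums compact_continuous_image continuous_intros) auto

lemma fiber_interval:
  fixes A :: "pt set"
  assumes A: "compact A" "convex A" and \<xi>: "norm \<xi> = 1" and ne: "{u. u *\<^sub>R \<xi> + y \<in> A} \<noteq> {}"
  obtains a b where "a \<le> b" "{u. u *\<^sub>R \<xi> + y \<in> A} = {a..b}"
proof -
  let ?S = "{u. u *\<^sub>R \<xi> + y \<in> A}"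
  have "closed ?S"
    using closed_vimage[OF compact_imp_closed[OF A(1)], of "\<lambda>u. u *\<^sub>R \<xi> + y"]
    by (simp add: vimage_def continuous_intros)
  moreover have "bounded ?S"
  proof -
    obtain B where B: "\<And>x. x \<in> A \<Longrightarrow> norm x \<le> B"
      using compact_imp_bounded[OF A(1)] by (auto simp: bounded_iff)
    have "norm u \<le> B + norm y" if "u \<in> ?S" for u
    proof -
      have "norm u = norm (u *\<^sub>R \<xi>)" using \<xi> by simp
      also have "\<dots> \<le> norm (u *\<^sub>R \<xi> + y) + norm y"
        using norm_triangle_ineq4[of "u *\<^sub>R \<xi> + y" y] by simp
      also have "norm (u *\<^sub>R \<xi> + y) \<le> B" using that by (intro B) simp
      finally show ?thesis by simp
    qed
    then show ?thesis unfolding bounded_iff by blast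
  qed
  ultimately have "compact ?S" by (simp add: compact_eq_bounded_closed)
  moreover have "convex ?S"
  proof (rule convexI)
    fix u v and p q :: real
    assume uv: "u \<in> ?S" "v \<in> ?S" "0 \<le> p" "0 \<le> q" "p + q = 1"
    have "p *\<^sub>R (u *\<^sub>R \<xi> + y) + q *\<^sub>R (v *\<^sub>R \<xi> + y) \<in> A"
      using A(2) uv by (intro convexD) auto
    moreover have "p *\<^sub>R (u *\<^sub>R \<xi> + y) + q *\<^sub>R (v *\<^sub>R \<xi> + y) = (p *\<^sub>R u + q *\<^sub>R v) *\<^sub>R \<xi> + (p + q) *\<^sub>R y"
      by (simp add: algebra_simps)
    ultimately show "p *\<^sub>R u + q *\<^sub>R v \<in> ?S" using uv(5) by simp
  qed
  ultimately obtain a b where "?S = {a..b}"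
    using connected_compact_interval_1[of ?S] convex_connected by blast
  moreover from this ne have "a \<le> b" by auto
  ultimately show thesis using that by blast
qed

lemma emeasure_leb_fibers:
  assumes "fdsub E" "\<xi> \<in> E" "norm \<xi> = 1" "A \<in> sets borel"
  shows "emeasure (leb E) A = (\<integral>\<^sup>+y. emeasure lborel {u. u *\<^sub>R \<xi> + y \<in> A} \<partial>leb (E \<inter> hyperplane_perp \<xi>))"
proof -
  have m: "{u. u *\<^sub>R \<xi> + y \<in> A} \<in> sets borel" for y
  proof -
    have "(\<lambda>u::real. u *\<^sub>R \<xi> + y) \<in> borel_measurable borel"
      by (intro borel_measurable_continuous_onI continuous_intros)
    from measurable_sets_borel[OF this assms(4)] show ?thesis by (simp add: vimage_def)
  qed
  have "emeasure (leb E) A = (\<integral>\<^sup>+x. indicator A x \<partial>leb E)" using assms(4) by simp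
  also have "\<dots> = (\<integral>\<^sup>+y. (\<integral>\<^sup>+t. indicator A (t *\<^sub>R \<xi> + y) \<partial>lborel) \<partial>leb (E \<inter> hyperplane_perp \<xi>))"
    by (rule leb_split) (use assms in auto)
  also have "\<dots> = (\<integral>\<^sup>+y. (\<integral>\<^sup>+t. indicator {u. u *\<^sub>R \<xi> + y \<in> A} t \<partial>lborel) \<partial>leb (E \<inter> hyperplane_perp \<xi>))"
    by (simp add: indicator_def)
  finally show ?thesis using m by simp
qed

lemma mem_proj_iff_fiber:
  assumes E: "fdsub E" "\<xi> \<in> E" "norm \<xi> = 1" and A: "A \<subseteq> E" and y: "y \<in> E \<inter> hyperplane_perp \<xi>"
  shows "y \<in> proj (E \<inter> hyperplane_perp \<xi>) ` A \<longleftrightarrow> {u. u *\<^sub>R \<xi> + y \<in> A} \<noteq> {}"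
proof
  assume "y \<in> proj (E \<inter> hyperplane_perp \<xi>) ` A"
  then obtain x where x: "x \<in> A" "y = proj (E \<inter> hyperplane_perp \<xi>) x" by auto
  then have "y = x - (x \<bullet> \<xi>) *\<^sub>R \<xi>" using proj_perp[OF E] A by blast
  then have "(x \<bullet> \<xi>) *\<^sub>R \<xi> + y \<in> A" using x by simp
  then show "{u. u *\<^sub>R \<xi> + y \<in> A} \<noteq> {}" by blast
next
  assume "{u. u *\<^sub>R \<xi> + y \<in> A} \<noteq> {}"
  then obtain u where u: "u *\<^sub>R \<xi> + y \<in> A" by blast
  then have "proj (E \<inter> hyperplane_perp \<xi>) (u *\<^sub>R \<xi> + y) = u *\<^sub>R \<xi> + y - ((u *\<^sub>R \<xi> + y) \<bullet> \<xi>) *\<^sub>R \<xi>"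
    using proj_perp[OF E] A by blast
  also have "\<dots> = y"
    using y E(3) by (simp add: hyperplane_perp_def inner_add_left norm_eq_1)
  finally show "y \<in> proj (E \<inter> hyperplane_perp \<xi>) ` A" using u by (metis image_eqI)
qed

lemma compact_proj: "compact A \<Longrightarrow> compact (proj E ` A)"
  by (rule compact_continuous_image) (auto intro!: continuous_intros)

lemma compact_borel: "compact A \<Longrightarrow> (A :: pt set) \<in> sets borel"
  by (rule borel_closed) (rule compact_imp_closed)

text \<open>By convexity every nonempty fibre parallel to \<xi> is an interval, which grows by
  exactly 2 * t; empty fibres stay empty. Integrating over the projection gives a formula exact in
  t, unlike for general parallel bodies.\<close>

lemma emeasure_thicken:
  assumes E: "fdsub E" "\<xi> \<in> E" "norm \<xi> = 1" and A: "compact A" "convex A" "A \<subseteq> E" and t: "0 \<le> t"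
  shows "emeasure (leb E) (thicken A \<xi> t)
    = emeasure (leb E) A + ennreal (2 * t) * emeasure (leb (E \<inter> hyperplane_perp \<xi>)) (proj (E \<inter> hyperplane_perp \<xi>) ` A)"
proof -
  let ?F = "E \<inter> hyperplane_perp \<xi>"
  let ?PA = "proj ?F ` A"
  have PA: "?PA \<in> sets borel" by (rule compact_borel[OF compact_proj[OF A(1)]])
  have bA: "A \<in> sets borel" by (rule compact_borel[OF A(1)])
  have fib: "emeasure lborel {u. u *\<^sub>R \<xi> + y \<in> thicken A \<xi> t}
      = emeasure lborel {u. u *\<^sub>R \<xi> + y \<in> A} + ennreal (2 * t) * indicator ?PA y" if y: "y \<in> ?F" for y
  proof -
    have eq: "{u. u *\<^sub>R \<xi> + y \<in> thicken A \<xi> t} = {u + v | u v. u *\<^sub>R \<xi> + y \<in> A \<and> \<bar>v\<bar> \<le> t}"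
    proof (intro Set.set_eqI iffI)
      fix u assume "u \<in> {u. u *\<^sub>R \<xi> + y \<in> thicken A \<xi> t}"
      then obtain x v where x: "u *\<^sub>R \<xi> + y = x + v *\<^sub>R \<xi>" "x \<in> A" "\<bar>v\<bar> \<le> t"
        by (auto simp: thicken_def abs_le_iff)
      have "(u - v) *\<^sub>R \<xi> + y = (u *\<^sub>R \<xi> + y) - v *\<^sub>R \<xi>" by (simp add: algebra_simps)
      then have "(u - v) *\<^sub>R \<xi> + y \<in> A" using x by simp
      then show "u \<in> {u + v | u v. u *\<^sub>R \<xi> + y \<in> A \<and> \<bar>v\<bar> \<le> t}"
        using x(3) by (intro CollectI exI[of _ "u - v"] exI[of _ v]) simp
    next
      fix w assume "w \<in> {u + v | u v. u *\<^sub>R \<xi> + y \<in> A \<and> \<bar>v\<bar> \<le> t}"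
      then obtain u v where uv: "w = u + v" "u *\<^sub>R \<xi> + y \<in> A" "\<bar>v\<bar> \<le> t" by auto
      then have "w *\<^sub>R \<xi> + y = (u *\<^sub>R \<xi> + y) + v *\<^sub>R \<xi>" "v *\<^sub>R \<xi> \<in> (\<lambda>u. u *\<^sub>R \<xi>) ` {-t..t}"
        by (auto simp: algebra_simps abs_le_iff)
      then show "w \<in> {u. u *\<^sub>R \<xi> + y \<in> thicken A \<xi> t}"
        unfolding thicken_def using uv(2) by blast
    qed
    show ?thesis
    proof (cases "{u. u *\<^sub>R \<xi> + y \<in> A} = {}")
      case True
      then have "{u + v | u v. u *\<^sub>R \<xi> + y \<in> A \<and> \<bar>v\<bar> \<le> t} = {}" by blast
      moreover have "y \<notin> ?PA" using mem_proj_iff_fiber[OF E A(3) y] True by simp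
      ultimately show ?thesis using True unfolding eq by simp
    next
      case False
      then obtain a b where ab: "a \<le> b" "{u. u *\<^sub>R \<xi> + y \<in> A} = {a..b}"
        using fiber_interval[OF A(1,2) E(3)] by metis
      have m: "u *\<^sub>R \<xi> + y \<in> A \<longleftrightarrow> a \<le> u \<and> u \<le> b" for u using ab(2) by (simp add: set_eq_iff)
      have "{u + v | u v. u *\<^sub>R \<xi> + y \<in> A \<and> \<bar>v\<bar> \<le> t} = {a - t..b + t}"
      proof (intro Set.set_eqI iffI)
        fix w assume w: "w \<in> {a - t..b + t}"
        \<comment> \<open>The point of the interval closest to w.\<close>
        define u where "u = max a (min b w)"
        have "a \<le> u \<and> u \<le> b" "\<bar>w - u\<bar> \<le> t" using w ab(1) t by (auto simp: u_def)
        then show "w \<in> {u + v | u v. u *\<^sub>R \<xi> + y \<in> A \<and> \<bar>v\<bar> \<le> t}"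
          unfolding m by (intro CollectI exI[of _ u] exI[of _ "w - u"]) simp
      qed (auto simp: m)
      moreover have "y \<in> ?PA" using mem_proj_iff_fiber[OF E A(3) y] False by simp
      moreover have "ennreal (b + t - (a - t)) = ennreal (b - a) + ennreal (2 * t)"
        using ab(1) t by (simp add: ennreal_plus[symmetric] del: ennreal_plus)
      ultimately show ?thesis using ab t unfolding eq by simp
    qed
  qed
  have "emeasure (leb E) (thicken A \<xi> t) = (\<integral>\<^sup>+y. emeasure lborel {u. u *\<^sub>R \<xi> + y \<in> thicken A \<xi> t} \<partial>leb ?F)"
    by (rule emeasure_leb_fibers[OF E compact_borel[OF compact_thicken[OF A(1)]]])
  also have "\<dots> = (\<integral>\<^sup>+y. emeasure lborel {u. u *\<^sub>R \<xi> + y \<in> A} + ennreal (2 * t) * indicator ?PA y \<partial>leb ?F)"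
    by (rule nn_integral_cong_AE, use leb_AE[OF fdsub_perp[OF E(1)]] in eventually_elim) (rule fib)
  also have "\<dots> = (\<integral>\<^sup>+y. emeasure lborel {u. u *\<^sub>R \<xi> + y \<in> A} \<partial>leb ?F) + (\<integral>\<^sup>+y. ennreal (2 * t) * indicator ?PA y \<partial>leb ?F)"
  proof (rule nn_integral_add)
    have "(\<lambda>y. \<integral>\<^sup>+u. indicator A (u *\<^sub>R \<xi> + y) \<partial>lborel) \<in> borel_measurable (leb ?F)"
      using bA by measurable
    moreover have "(\<integral>\<^sup>+u. indicator A (u *\<^sub>R \<xi> + y) \<partial>lborel) = emeasure lborel {u. u *\<^sub>R \<xi> + y \<in> A}" for y
    proof -
      have "(\<lambda>u::real. u *\<^sub>R \<xi> + y) \<in> borel_measurable borel"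
        by (intro borel_measurable_continuous_onI continuous_intros)
      from measurable_sets_borel[OF this bA] have "{u. u *\<^sub>R \<xi> + y \<in> A} \<in> sets lborel" by (simp add: vimage_def)
      then have "(\<integral>\<^sup>+u. indicator {u. u *\<^sub>R \<xi> + y \<in> A} u \<partial>lborel) = emeasure lborel {u. u *\<^sub>R \<xi> + y \<in> A}" by simp
      then show ?thesis by (simp add: indicator_def)
    qed
    ultimately show "(\<lambda>y. emeasure lborel {u. u *\<^sub>R \<xi> + y \<in> A}) \<in> borel_measurable (leb ?F)" by simp
  qed (use PA in measurable)
  also have "\<dots> = emeasure (leb E) A + ennreal (2 * t) * emeasure (leb ?F) ?PA"
    using emeasure_leb_fibers[OF E bA] PA by (simp add: nn_integral_cmult)
  finally show ?thesis .
qed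

lemma emeasure_leb_scale:
  assumes "fdsub E" "c > 0" "A \<in> sets borel"
  shows "emeasure (leb E) ((\<lambda>x. c *\<^sub>R x) ` A) = ennreal (c ^ dim E) * emeasure (leb E) A"
proof -
  have im: "(\<lambda>x. c *\<^sub>R x) ` A = (\<lambda>x. (1 / c) *\<^sub>R x) -` A"
    using assms(2) by (auto intro!: image_eqI[of _ _ "(1 / c) *\<^sub>R _"])
  have "(\<lambda>x::pt. (1 / c) *\<^sub>R x) \<in> borel_measurable borel"
    by (intro borel_measurable_continuous_onI continuous_intros)
  then have m: "(\<lambda>x. c *\<^sub>R x) ` A \<in> sets borel"
    unfolding im by (rule measurable_sets_borel[OF _ assms(3)])
  have "indicator ((\<lambda>x. c *\<^sub>R x) ` A) (c *\<^sub>R x) = (indicator A x :: ennreal)" for x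
    using assms(2) by (auto simp: indicator_def)
  then show ?thesis
    using leb_scale[OF assms(1), of "indicator ((\<lambda>x. c *\<^sub>R x) ` A)" c] assms m by simp
qed

lemma leb_bounded_finite:
  assumes "fdsub E" "bounded A"
  shows "emeasure (leb E) A < \<infinity>"
proof -
  obtain R where R: "R > 0" "\<And>x. x \<in> A \<Longrightarrow> norm x \<le> R" using assms(2) by (auto simp: bounded_pos)
  have "emeasure (leb E) A \<le> emeasure (leb E) (cball 0 R)"
    by (rule emeasure_mono) (use R in auto)
  also have "\<dots> < \<infinity>" using leb_cball[OF assms(1) R(1)] by simp
  finally show ?thesis .
qed

lemma norm_diag_map_le:
  assumes "norm \<xi> = 1" "s > 0" "\<tau> > 0"
  shows "norm (diag_map \<xi> s \<tau> x) \<le> max s \<tau> * norm x"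
proof (rule power2_le_imp_le)
  have "(norm (diag_map \<xi> s \<tau> x))\<^sup>2 = s\<^sup>2 * (x \<bullet> \<xi>)\<^sup>2 + \<tau>\<^sup>2 * (norm x ^ 2 - (x \<bullet> \<xi>)\<^sup>2)"
    by (rule norm_diag_map[OF assms(1)])
  also have "\<dots> \<le> (max s \<tau>)\<^sup>2 * (x \<bullet> \<xi>)\<^sup>2 + (max s \<tau>)\<^sup>2 * (norm x ^ 2 - (x \<bullet> \<xi>)\<^sup>2)"
    using assms inner_sq_le[OF assms(1), of x] by (intro add_mono mult_right_mono power_mono) auto
  also have "\<dots> = (max s \<tau> * norm x)\<^sup>2" by (simp add: power_mult_distrib algebra_simps)
  finally show "(norm (diag_map \<xi> s \<tau> x))\<^sup>2 \<le> (max s \<tau> * norm x)\<^sup>2" .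
qed (use assms in \<open>auto simp: max_def\<close>)

text \<open>Gives the image radii of its own, so that its surface area is known to be a genuine
  limit.\<close>

lemma cbody_diag_map:
  assumes A: "cbody n r R A" and \<xi>: "\<xi> \<in> Rn n" "norm \<xi> = 1" and s: "s > 0" "\<tau> > 0"
  shows "cbody n (r / max (1 / s) (1 / \<tau>)) (max s \<tau> * R) (diag_map \<xi> s \<tau> ` A)"
proof -
  let ?T = "diag_map \<xi> s \<tau>"
  have A': "compact A" "convex A" "ball_n n r \<subseteq> A" "A \<subseteq> ball_n n R" "0 < r"
    using A by (auto simp: cbody_def)
  have mx: "max (1 / s) (1 / \<tau>) > 0" using s by (simp add: less_max_iff_disj)
  have "compact (?T ` A)"
    by (rule compact_continuous_image[OF _ A'(1)]) (intro continuous_intros)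
  moreover have "convex (?T ` A)" by (rule convex_linear_image[OF linear_diag_map A'(2)])
  moreover have "ball_n n (r / max (1 / s) (1 / \<tau>)) \<subseteq> ?T ` A"
  proof
    fix y assume y: "y \<in> ball_n n (r / max (1 / s) (1 / \<tau>))"
    let ?x = "diag_map \<xi> (1 / s) (1 / \<tau>) y"
    have "norm ?x \<le> max (1 / s) (1 / \<tau>) * norm y"
      by (rule norm_diag_map_le[OF \<xi>(2)]) (use s in auto)
    also have "\<dots> \<le> max (1 / s) (1 / \<tau>) * (r / max (1 / s) (1 / \<tau>))"
      using y mx by (intro mult_left_mono) (auto simp: ball_n_def)
    also have "\<dots> = r" using mx by simp
    finally have "?x \<in> ball_n n r"
      using y diag_map_in[OF subspace_Rn \<xi>(1)] by (auto simp: ball_n_def)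
    then have "?x \<in> A" using A'(3) by blast
    moreover have "y = ?T ?x" using diag_map_inverse(1)[OF \<xi>(2), of s \<tau> y] s by simp
    ultimately show "y \<in> ?T ` A" by blast
  qed
  moreover have "?T ` A \<subseteq> ball_n n (max s \<tau> * R)"
  proof (rule image_subsetI)
    fix x assume "x \<in> A"
    then have x: "norm x \<le> R" "x \<in> Rn n" using A'(4) by (auto simp: ball_n_def)
    have "norm (?T x) \<le> max s \<tau> * norm x" by (rule norm_diag_map_le[OF \<xi>(2) s])
    also have "\<dots> \<le> max s \<tau> * R" by (rule mult_left_mono[OF x(1)]) (use s in \<open>auto simp: max_def\<close>)
    finally show "?T x \<in> ball_n n (max s \<tau> * R)"
      using x diag_map_in[OF subspace_Rn \<xi>(1)] by (auto simp: ball_n_def)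
  qed
  ultimately show ?thesis using A'(5) mx by (auto simp: cbody_def)
qed

section \<open>Volumes of projections onto hyperplanes\<close>

definition shadow :: "nat \<Rightarrow> pt \<Rightarrow> pt set \<Rightarrow> real" where
  "shadow n \<xi> A = measure (leb (Rn n \<inter> hyperplane_perp \<xi>)) (proj (Rn n \<inter> hyperplane_perp \<xi>) ` A)"

lemma emeasure_shadow:
  assumes "compact A"
  shows "emeasure (leb (Rn n \<inter> hyperplane_perp \<xi>)) (proj (Rn n \<inter> hyperplane_perp \<xi>) ` A) = ennreal (shadow n \<xi> A)"
  unfolding shadow_def
  using leb_bounded_finite[OF fdsub_perp[OF fdsub_Rn] compact_imp_bounded[OF compact_proj[OF assms]]]
  by (intro emeasure_eq_ennreal_measure) (simp add: less_top)

lemma emeasure_vol: "bounded A \<Longrightarrow> emeasure (leb (Rn n)) A = ennreal (vol (Rn n) A)"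
  unfolding vol_def using leb_bounded_finite[OF fdsub_Rn, of A n]
  by (intro emeasure_eq_ennreal_measure) auto

lemma vol_nonneg: "0 \<le> vol E A" and shadow_nonneg: "0 \<le> shadow n \<xi> A"
  by (simp_all add: vol_def shadow_def)

lemma vol_mono: "bounded B \<Longrightarrow> A \<subseteq> B \<Longrightarrow> B \<in> sets borel \<Longrightarrow> vol (Rn n) A \<le> vol (Rn n) B"
  using emeasure_mono[of A B "leb (Rn n)"] emeasure_vol[of A n] emeasure_vol[of B n]
    bounded_subset[of B A] vol_nonneg[of "Rn n" B]
  by (simp add: ennreal_le_iff)

lemma vol_thicken:
  assumes A: "compact A" "convex A" "A \<subseteq> Rn n" and \<xi>: "\<xi> \<in> Rn n" "norm \<xi> = 1" and t: "0 \<le> t"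
  shows "vol (Rn n) (thicken A \<xi> t) = vol (Rn n) A + 2 * t * shadow n \<xi> A"
proof -
  have "ennreal (vol (Rn n) (thicken A \<xi> t)) = ennreal (vol (Rn n) A) + ennreal (2 * t) * ennreal (shadow n \<xi> A)"
    using emeasure_thicken[OF fdsub_Rn \<xi> A t] emeasure_vol[OF compact_imp_bounded[OF A(1)], of n]
      emeasure_vol[OF compact_imp_bounded[OF compact_thicken[OF A(1)]], of n \<xi> t] emeasure_shadow[OF A(1), of n \<xi>]
    by simp
  also have "\<dots> = ennreal (vol (Rn n) A + 2 * t * shadow n \<xi> A)"
    using t vol_nonneg shadow_nonneg by (simp add: ennreal_mult'[symmetric] ennreal_plus[symmetric] del: ennreal_plus)
  finally show ?thesis
    using t vol_nonneg shadow_nonneg by (subst (asm) ennreal_inj) auto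
qed

section \<open>Comparing surface area and volume with the shadow in one direction\<close>

context
  fixes n r R A \<xi>
  assumes A: "cbody n r R A" and n: "n > 0" and \<xi>: "\<xi> \<in> Rn n" "norm \<xi> = 1"
begin

lemma A': "compact A" "convex A" "A \<subseteq> Rn n" "r > 0"
  using A by (auto simp: cbody_def ball_n_def)

text \<open>The \<epsilon>-parallel body contains the thickening by a segment of half-length
  \<epsilon>, whose volume grows at the exact rate 2 * shadow.\<close>

lemma surface_area_ge_shadow: "2 * shadow n \<xi> A \<le> surface_area n A"
proof (rule tendsto_lowerbound[OF surface_area_tendsto[OF A n]])
  show "\<forall>\<^sub>F \<epsilon> in at_right 0. 2 * shadow n \<xi> A \<le> (vol (Rn n) (parallel_body n A \<epsilon>) - vol (Rn n) A) / \<epsilon>"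
    unfolding eventually_at_right_field
  proof (intro exI[of _ 1] conjI allI impI)
    fix \<epsilon> :: real assume e: "0 < \<epsilon>"
    have c: "compact (parallel_body n A \<epsilon>)" using cbody_parallel[OF A, of \<epsilon>] e by (simp add: cbody_def)
    have "(\<lambda>u. u *\<^sub>R \<xi>) ` {-\<epsilon>..\<epsilon>} \<subseteq> ball_n n \<epsilon>"
      using \<xi> subspace_scale[OF subspace_Rn \<xi>(1)] by (auto simp: ball_n_def abs_le_iff)
    then have "thicken A \<xi> \<epsilon> \<subseteq> parallel_body n A \<epsilon>"
      unfolding thicken_def parallel_body_def by blast
    then have "vol (Rn n) (thicken A \<xi> \<epsilon>) \<le> vol (Rn n) (parallel_body n A \<epsilon>)"
      by (rule vol_mono[OF compact_imp_bounded[OF c] _ compact_borel[OF c]])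
    then have "2 * \<epsilon> * shadow n \<xi> A \<le> vol (Rn n) (parallel_body n A \<epsilon>) - vol (Rn n) A"
      using vol_thicken[OF A'(1-3) \<xi>, of \<epsilon>] e by simp
    then show "2 * shadow n \<xi> A \<le> (vol (Rn n) (parallel_body n A \<epsilon>) - vol (Rn n) A) / \<epsilon>"
      using e by (simp add: pos_le_divide_eq mult_ac)
  qed simp
qed simp

text \<open>Projection commutes with dilation, so the inclusion of the parallel body in a dilate of
  A passes to the shadows, which have dimension n - 1.\<close>

lemma shadow_parallel_le:
  assumes "0 \<le> \<epsilon>"
  shows "shadow n \<xi> (parallel_body n A \<epsilon>) \<le> (1 + \<epsilon> / r) ^ (n - 1) * shadow n \<xi> A"
proof -
  let ?F = "Rn n \<inter> hyperplane_perp \<xi>"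
  let ?c = "1 + \<epsilon> / r"
  have c: "?c > 0" using assms A'(4) by (simp add: add_pos_nonneg)
  have F: "fdsub ?F" "dim ?F = n - 1"
    using fdsub_perp[OF fdsub_Rn] dim_perp[OF fdsub_Rn \<xi>] by (auto simp: dim_Rn)
  have PA: "proj ?F ` A \<in> sets borel" by (rule compact_borel[OF compact_proj[OF A'(1)]])
  have "compact (parallel_body n A \<epsilon>)" using cbody_parallel[OF A assms] by (simp add: cbody_def)
  then have "ennreal (shadow n \<xi> (parallel_body n A \<epsilon>)) = emeasure (leb ?F) (proj ?F ` parallel_body n A \<epsilon>)"
    by (simp add: emeasure_shadow)
  also have "\<dots> \<le> emeasure (leb ?F) ((\<lambda>x. ?c *\<^sub>R x) ` proj ?F ` A)"
  proof (rule emeasure_mono)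
    have "proj ?F ` parallel_body n A \<epsilon> \<subseteq> proj ?F ` (\<lambda>x. ?c *\<^sub>R x) ` A"
      by (rule image_mono[OF parallel_subset_scale[OF A assms]])
    then show "proj ?F ` parallel_body n A \<epsilon> \<subseteq> (\<lambda>x. ?c *\<^sub>R x) ` proj ?F ` A"
      by (simp add: image_image linear_scale[OF linear_proj])
    have "compact ((\<lambda>x. ?c *\<^sub>R x) ` proj ?F ` A)"
      by (rule compact_scaling[OF compact_proj[OF A'(1)]])
    then show "(\<lambda>x. ?c *\<^sub>R x) ` proj ?F ` A \<in> sets (leb ?F)" by (simp add: compact_borel)
  qed
  also have "\<dots> = ennreal (?c ^ (n - 1)) * ennreal (shadow n \<xi> A)"
    using emeasure_leb_scale[OF F(1) c PA] F(2) emeasure_shadow[OF A'(1)] by simp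
  also have "\<dots> = ennreal (?c ^ (n - 1) * shadow n \<xi> A)"
    using c by (intro ennreal_mult[symmetric]) (auto simp: shadow_nonneg)
  finally show ?thesis
    using c shadow_nonneg by (subst (asm) ennreal_le_iff) auto
qed

text \<open>The preimage of the \<epsilon>-ball lies in the sum of an (\<epsilon>/\<tau>)-ball and a
  segment of half-length \<epsilon>/s along \<xi>. As the map preserves volume, the growth of the
  image is at most that of A under the ball, giving the surface area over \<tau>, plus that under
  the segment, giving the shadow.\<close>

lemma surface_area_diag_le:
  assumes s: "s > 0" "\<tau> > 0" "s * \<tau> ^ (n - 1) = 1"
  shows "surface_area n (diag_map \<xi> s \<tau> ` A) \<le> surface_area n A / \<tau> + 2 / s * shadow n \<xi> A"
proof -
  let ?T = "diag_map \<xi> s \<tau>"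
  note TA = cbody_diag_map[OF A \<xi> s(1,2)]
  let ?D = "\<lambda>A \<epsilon>. (vol (Rn n) (parallel_body n A \<epsilon>) - vol (Rn n) A) / \<epsilon>"
  have vT: "vol (Rn n) (?T ` B) = vol (Rn n) B" if "B \<in> sets borel" for B
    using emeasure_diag_map[OF fdsub_Rn \<xi> s(1,2) that] s(3) by (simp add: vol_def measure_def dim_Rn)
  have bound: "?D (?T ` A) \<epsilon> \<le> ?D A (1 / \<tau> * \<epsilon>) / \<tau> + 2 / s * ((1 + \<epsilon> / \<tau> / r) ^ (n - 1) * shadow n \<xi> A)"
    if e: "0 < \<epsilon>" for \<epsilon>
  proof -
    let ?B = "parallel_body n A (\<epsilon> / \<tau>)"
    have et: "0 \<le> \<epsilon> / \<tau>" using e s by simp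
    have B: "compact ?B" "convex ?B" "?B \<subseteq> Rn n"
      using cbody_parallel[OF A et] by (auto simp: cbody_def ball_n_def)
    have Th: "compact (thicken ?B \<xi> (\<epsilon> / s))" by (rule compact_thicken[OF B(1)])
    have TTh: "compact (?T ` thicken ?B \<xi> (\<epsilon> / s))"
      by (rule compact_continuous_image[OF _ Th]) (intro continuous_intros)
    have "parallel_body n (?T ` A) \<epsilon> \<subseteq> ?T ` thicken ?B \<xi> (\<epsilon> / s)"
    proof
      fix z assume "z \<in> parallel_body n (?T ` A) \<epsilon>"
      then obtain a b where z: "z = ?T a + b" "a \<in> A" "b \<in> ball_n n \<epsilon>" by (auto simp: parallel_body_def)
      have b: "norm b \<le> \<epsilon>" "b \<in> Rn n" using z(3) by (auto simp: ball_n_def)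
      \<comment> \<open>The preimage of b is split into its part orthogonal to \<xi>, absorbed by
        the ball, and its part along \<xi>, absorbed by the segment.\<close>
      define y where "y = (1 / \<tau>) *\<^sub>R (b - (b \<bullet> \<xi>) *\<^sub>R \<xi>)"
      define v where "v = (b \<bullet> \<xi>) / s"
      have "norm (b - (b \<bullet> \<xi>) *\<^sub>R \<xi>) ^ 2 \<le> norm b ^ 2"
        using \<xi>(2) by (simp add: norm_diff_scaleR_sq inner_commute) (simp add: power2_eq_square)
      then have "norm (b - (b \<bullet> \<xi>) *\<^sub>R \<xi>) \<le> norm b" by (rule power2_le_imp_le) simp
      then have "norm y \<le> \<epsilon> / \<tau>" using b(1) s by (simp add: y_def divide_right_mono)
      moreover have "y \<in> Rn n"
        unfolding y_def using b \<xi> by (intro subspace_scale[OF subspace_Rn] subspace_diff[OF subspace_Rn]) auto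
      ultimately have "a + y \<in> ?B"
        unfolding parallel_body_def using z(2) by (auto simp: ball_n_def)
      moreover have "\<bar>v\<bar> \<le> \<epsilon> / s"
        using Cauchy_Schwarz_ineq2[of b \<xi>] b(1) \<xi>(2) s by (simp add: v_def abs_divide divide_right_mono)
      ultimately have "(a + y) + v *\<^sub>R \<xi> \<in> thicken ?B \<xi> (\<epsilon> / s)"
        unfolding thicken_def by (intro CollectI exI conjI refl imageI) (auto simp: abs_le_iff)
      moreover have "?T ((a + y) + v *\<^sub>R \<xi>) = z"
      proof -
        have \<xi>\<xi>: "\<xi> \<bullet> \<xi> = 1" using \<xi>(2) by (simp add: norm_eq_1)
        have "y \<bullet> \<xi> = 0" by (simp add: y_def inner_diff_left \<xi>\<xi>)
        then have "?T y = b - (b \<bullet> \<xi>) *\<^sub>R \<xi>" using s by (simp add: diag_map_def) (simp add: y_def)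
        moreover have "?T (v *\<^sub>R \<xi>) = (b \<bullet> \<xi>) *\<^sub>R \<xi>"
          using s by (simp add: diag_map_def \<xi>\<xi> scaleR_add_left[symmetric] v_def) (simp add: field_simps)
        ultimately show ?thesis
          by (simp add: z linear_add[OF linear_diag_map])
      qed
      ultimately show "z \<in> ?T ` thicken ?B \<xi> (\<epsilon> / s)" by (metis image_eqI)
    qed
    then have "vol (Rn n) (parallel_body n (?T ` A) \<epsilon>) \<le> vol (Rn n) (?T ` thicken ?B \<xi> (\<epsilon> / s))"
      by (rule vol_mono[OF compact_imp_bounded[OF TTh] _ compact_borel[OF TTh]])
    also have "\<dots> = vol (Rn n) ?B + 2 * (\<epsilon> / s) * shadow n \<xi> ?B"
      using vT[OF compact_borel[OF Th]] vol_thicken[OF B \<xi>, of "\<epsilon> / s"] e s by simp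
    also have "\<dots> \<le> vol (Rn n) ?B + 2 * (\<epsilon> / s) * ((1 + \<epsilon> / \<tau> / r) ^ (n - 1) * shadow n \<xi> A)"
      using shadow_parallel_le[OF et] e s by (intro add_left_mono mult_left_mono) auto
    finally have "?D (?T ` A) \<epsilon> \<le> (vol (Rn n) ?B - vol (Rn n) A + 2 * (\<epsilon> / s) * ((1 + \<epsilon> / \<tau> / r) ^ (n - 1) * shadow n \<xi> A)) / \<epsilon>"
      using vT[OF compact_borel[OF A'(1)]] e by (intro divide_right_mono) auto
    also have "\<dots> = ?D A (1 / \<tau> * \<epsilon>) / \<tau> + 2 / s * ((1 + \<epsilon> / \<tau> / r) ^ (n - 1) * shadow n \<xi> A)"
      using e s by (simp add: add_divide_distrib)
    finally show ?thesis .
  qed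
  \<comment> \<open>The quotient of A runs along \<epsilon>/\<tau>, which also tends to 0 from the
    right.\<close>
  have lim: "((\<lambda>\<epsilon>. ?D A (1 / \<tau> * \<epsilon>)) \<longlongrightarrow> surface_area n A) (at_right 0)"
  proof (rule filterlim_compose[OF surface_area_tendsto[OF A n]])
    show "filterlim ((*) (1 / \<tau>)) (at_right 0) (at_right 0)"
      using filtermap_times_pos_at_right[of "1 / \<tau>" 0] s by (simp add: filterlim_def)
  qed
  have "((\<lambda>\<epsilon>. ?D A (1 / \<tau> * \<epsilon>) / \<tau> + 2 / s * ((1 + \<epsilon> / \<tau> / r) ^ (n - 1) * shadow n \<xi> A))
      \<longlongrightarrow> surface_area n A / \<tau> + 2 / s * ((1 + 0 / \<tau> / r) ^ (n - 1) * shadow n \<xi> A)) (at_right 0)"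
    by (intro tendsto_intros lim) (use s A'(4) in auto)
  then have "((\<lambda>\<epsilon>. ?D A (1 / \<tau> * \<epsilon>) / \<tau> + 2 / s * ((1 + \<epsilon> / \<tau> / r) ^ (n - 1) * shadow n \<xi> A))
      \<longlongrightarrow> surface_area n A / \<tau> + 2 / s * shadow n \<xi> A) (at_right 0)" by simp
  moreover have "\<forall>\<^sub>F \<epsilon> in at_right 0. ?D (?T ` A) \<epsilon>
      \<le> ?D A (1 / \<tau> * \<epsilon>) / \<tau> + 2 / s * ((1 + \<epsilon> / \<tau> / r) ^ (n - 1) * shadow n \<xi> A)"
    unfolding eventually_at_right_field by (intro exI[of _ 1] conjI allI impI bound) auto
  ultimately show ?thesis
    by (intro tendsto_le[OF _ _ surface_area_tendsto[OF TA n]]) auto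
qed

text \<open>Averaging points of A with the segment from 0 to l * \<xi> stays in A. Hence over each
  point of the shadow shrunk by 1/2 the fibre has length at least l/2, and the shrunk shadow loses a
  factor 2^(n-1).\<close>

lemma vol_ge_shadow:
  assumes "0 \<le> l" "l *\<^sub>R \<xi> \<in> A"
  shows "l * shadow n \<xi> A \<le> 2 ^ n * vol (Rn n) A"
proof -
  let ?F = "Rn n \<inter> hyperplane_perp \<xi>"
  have F: "fdsub ?F" "dim ?F = n - 1"
    using fdsub_perp[OF fdsub_Rn] dim_perp[OF fdsub_Rn \<xi>] by (auto simp: dim_Rn)
  have PA: "proj ?F ` A \<in> sets borel" by (rule compact_borel[OF compact_proj[OF A'(1)]])
  let ?H = "(\<lambda>x. (1/2) *\<^sub>R x) ` proj ?F ` A"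
  have "compact ?H" by (rule compact_scaling[OF compact_proj[OF A'(1)]])
  then have H: "?H \<in> sets borel" by (rule compact_borel)
  have "ennreal (l / 2 * ((1/2) ^ (n - 1) * shadow n \<xi> A)) = ennreal (l / 2) * emeasure (leb ?F) ?H"
  proof -
    have "emeasure (leb ?F) ?H = ennreal ((1/2) ^ (n - 1)) * ennreal (shadow n \<xi> A)"
      using emeasure_leb_scale[OF F(1) _ PA, of "1/2"] F(2) emeasure_shadow[OF A'(1)] by simp
    also have "\<dots> = ennreal ((1/2) ^ (n - 1) * shadow n \<xi> A)"
      by (rule ennreal_mult[symmetric]) (simp_all add: shadow_nonneg)
    finally show ?thesis
      using assms(1) shadow_nonneg[of n \<xi> A] by (simp only:) (rule ennreal_mult; simp)
  qed
  also have "\<dots> = (\<integral>\<^sup>+y. ennreal (l / 2) * indicator ?H y \<partial>leb ?F)"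
    using H by (simp add: nn_integral_cmult)
  also have "\<dots> \<le> (\<integral>\<^sup>+y. emeasure lborel {u. u *\<^sub>R \<xi> + y \<in> A} \<partial>leb ?F)"
  proof (rule nn_integral_mono)
    fix y
    show "ennreal (l / 2) * indicator ?H y \<le> emeasure lborel {u. u *\<^sub>R \<xi> + y \<in> A}"
    proof (cases "y \<in> ?H")
      case True
      then obtain z where z: "z \<in> A" "y = (1/2) *\<^sub>R proj ?F z" by auto
      have y: "y = (1/2) *\<^sub>R (z - (z \<bullet> \<xi>) *\<^sub>R \<xi>)"
        using proj_perp[OF fdsub_Rn \<xi> subsetD[OF A'(3) z(1)]] z(2) by simp
      \<comment> \<open>The height of z / 2 along \<xi>; the fibre contains the interval of length
        l/2 starting there.\<close>
      let ?a = "(z \<bullet> \<xi>) / 2"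
      have sub: "{?a..?a + l / 2} \<subseteq> {u. u *\<^sub>R \<xi> + y \<in> A}"
      proof
        fix u assume u: "u \<in> {?a..?a + l / 2}"
        have "(2 * (u - ?a)) *\<^sub>R \<xi> \<in> A"
        proof (cases "l = 0")
          case True
          then have "2 * (u - ?a) = 0" "0 \<in> A" using u assms(2) by simp_all
          then show ?thesis by (simp only: scaleR_zero_left)
        next
          case False
          then have "0 < l" using assms(1) by simp
          then have "((2 * (u - ?a)) / l) *\<^sub>R (l *\<^sub>R \<xi>) \<in> A"
            by (intro cbody_scale[OF A assms(2)]) (use u in \<open>auto simp: field_simps\<close>)
          then show ?thesis using False by simp
        qed
        then have "(1/2) *\<^sub>R z + (1/2) *\<^sub>R ((2 * (u - ?a)) *\<^sub>R \<xi>) \<in> A"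
          using A'(2) z(1) by (intro convexD) auto
        moreover have "(1/2) *\<^sub>R z + (1/2) *\<^sub>R ((2 * (u - ?a)) *\<^sub>R \<xi>) = u *\<^sub>R \<xi> + y"
          by (simp add: y algebra_simps)
        ultimately show "u \<in> {u. u *\<^sub>R \<xi> + y \<in> A}" by simp
      qed
      have "?a \<in> {?a..?a + l / 2}" using assms(1) by simp
      then have "?a \<in> {u. u *\<^sub>R \<xi> + y \<in> A}" by (rule subsetD[OF sub])
      then have ne: "{u. u *\<^sub>R \<xi> + y \<in> A} \<noteq> {}" by (intro notI) (simp only: empty_iff)
      obtain a b where ab: "a \<le> b" "{u. u *\<^sub>R \<xi> + y \<in> A} = {a..b}"
        by (rule fiber_interval[OF A'(1,2) \<xi>(2) ne])
      have "ennreal (l / 2) = emeasure lborel {?a..?a + l / 2}" using assms(1) by simp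
      also have "\<dots> \<le> emeasure lborel {u. u *\<^sub>R \<xi> + y \<in> A}"
        by (rule emeasure_mono[OF sub]) (simp add: ab(2))
      finally show ?thesis using True by simp
    qed simp
  qed
  also have "\<dots> = emeasure (leb (Rn n)) A"
    by (rule emeasure_leb_fibers[OF fdsub_Rn \<xi> compact_borel[OF A'(1)], symmetric])
  also have "\<dots> = ennreal (vol (Rn n) A)" by (rule emeasure_vol[OF compact_imp_bounded[OF A'(1)]])
  finally have "l / 2 * ((1/2) ^ (n - 1) * shadow n \<xi> A) \<le> vol (Rn n) A"
    by (subst (asm) ennreal_le_iff) (auto simp: vol_nonneg)
  then have "l * shadow n \<xi> A / 2 ^ n \<le> vol (Rn n) A"
    using n by (cases n) (auto simp: power_one_over field_simps)
  then show ?thesis by (simp add: pos_divide_le_eq mult.commute)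
qed

text \<open>Every fibre parallel to \<xi> has length at most a + b, and the nonempty ones sit over
  the shadow.\<close>

lemma vol_le_shadow:
  assumes w: "\<And>x. x \<in> A \<Longrightarrow> -a \<le> x \<bullet> \<xi> \<and> x \<bullet> \<xi> \<le> b"
  shows "vol (Rn n) A \<le> (a + b) * shadow n \<xi> A"
proof -
  let ?F = "Rn n \<inter> hyperplane_perp \<xi>"
  have \<xi>\<xi>: "\<xi> \<bullet> \<xi> = 1" using \<xi>(2) by (simp add: norm_eq_1)
  have ab: "0 \<le> a + b" using w[OF cbody_zero[OF A]] by simp
  have PA: "proj ?F ` A \<in> sets borel" by (rule compact_borel[OF compact_proj[OF A'(1)]])
  have "ennreal (vol (Rn n) A) = emeasure (leb (Rn n)) A"
    by (rule emeasure_vol[OF compact_imp_bounded[OF A'(1)], symmetric])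
  also have "\<dots> = (\<integral>\<^sup>+y. emeasure lborel {u. u *\<^sub>R \<xi> + y \<in> A} \<partial>leb ?F)"
    by (rule emeasure_leb_fibers[OF fdsub_Rn \<xi> compact_borel[OF A'(1)]])
  also have "\<dots> \<le> (\<integral>\<^sup>+y. ennreal (a + b) * indicator (proj ?F ` A) y \<partial>leb ?F)"
  proof (rule nn_integral_mono_AE, use leb_AE[OF fdsub_perp[OF fdsub_Rn], of n \<xi>] in eventually_elim)
    case (elim y)
    then have y: "y \<bullet> \<xi> = 0" by (simp add: hyperplane_perp_def)
    show ?case
    proof (cases "{u. u *\<^sub>R \<xi> + y \<in> A} = {}")
      case False
      have "{u. u *\<^sub>R \<xi> + y \<in> A} \<subseteq> {-a..b}"
      proof
        fix u assume "u \<in> {u. u *\<^sub>R \<xi> + y \<in> A}"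
        then show "u \<in> {-a..b}" using w[of "u *\<^sub>R \<xi> + y"] by (simp add: inner_add_left y \<xi>\<xi>)
      qed
      then have "emeasure lborel {u. u *\<^sub>R \<xi> + y \<in> A} \<le> emeasure lborel {-a..b}"
        by (rule emeasure_mono) simp
      also have "\<dots> = ennreal (a + b)" using ab by (simp add: add.commute)
      finally show ?thesis
        using False mem_proj_iff_fiber[OF fdsub_Rn \<xi> A'(3) elim] by simp
    qed simp
  qed
  also have "\<dots> = ennreal (a + b) * ennreal (shadow n \<xi> A)"
    using PA emeasure_shadow[OF A'(1)] by (simp add: nn_integral_cmult)
  also have "\<dots> = ennreal ((a + b) * shadow n \<xi> A)"
    using ab by (intro ennreal_mult[symmetric]) (auto simp: shadow_nonneg)
  finally show ?thesis
    using ab by (subst (asm) ennreal_le_iff) (auto simp: shadow_nonneg)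
qed

end

text \<open>Squeezing K along the direction \<xi> of x and doubling it across halves the surface
  area up to a multiple of the shadow along \<xi>. By minimality this shadow controls the surface
  area and hence the shadow along \<eta>. Volume then links the two: it is at most the width along
  \<eta> times one shadow, and up to 2^n at least norm x times the other.\<close>

lemma (in centered_body) surface_area_bound:
  assumes sa: "min_surface_area_position n K" and x: "x \<in> K" and \<eta>: "\<eta> \<in> Rn n" "norm \<eta> = 1"
  shows "norm x \<le> 32 ^ n * h \<eta>"
proof (cases "x = 0")
  case True
  then show ?thesis using h_nonneg[OF \<eta>(1)] by simp
next
  case False
  obtain r R where c: "cbody n r R K" by (rule cbody_K)
  define \<xi> where "\<xi> = sgn x"
  have \<xi>: "\<xi> \<in> Rn n" "norm \<xi> = 1"
    using False x K(1) by (auto simp: \<xi>_def norm_sgn) (auto simp: sgn_div_norm intro: subspace_scale[OF subspace_Rn])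
  have x\<xi>: "norm x *\<^sub>R \<xi> \<in> K" using False x by (simp add: \<xi>_def sgn_div_norm)
  \<comment> \<open>Compensates the factor 2 in the n - 1 directions orthogonal to \<xi>.\<close>
  define s :: real where "s = (1/2) ^ (n - 1)"
  have s: "s > 0" "s * 2 ^ (n - 1) = 1" by (auto simp: s_def power_one_over)
  have "diag_map \<xi> s 2 \<in> SL n" by (rule diag_map_SL[OF \<xi> s(2)])
  then have "surface_area n K \<le> surface_area n (diag_map \<xi> s 2 ` K)"
    using sa by (simp add: min_surface_area_position_def)
  also have "\<dots> \<le> surface_area n K / 2 + 2 / s * shadow n \<xi> K"
    by (rule surface_area_diag_le[OF c n \<xi> s(1) _ s(2)]) simp
  finally have "surface_area n K \<le> 2 * (2 / s * shadow n \<xi> K)" by simp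
  also have "2 / s = 2 ^ n" using n by (cases n) (simp_all add: s_def power_one_over)
  finally have S: "surface_area n K \<le> 2 * (2 ^ n * shadow n \<xi> K)" .
  have "2 * shadow n \<eta> K \<le> surface_area n K" by (rule surface_area_ge_shadow[OF c n \<eta>])
  with S have sh: "shadow n \<eta> K \<le> 2 ^ n * shadow n \<xi> K" by simp
  define W where "W = h (-\<eta>) + h \<eta>"
  have W0: "0 \<le> W" using h_nonneg[OF \<eta>(1)] h_nonneg[of "-\<eta>"] \<eta>(1) subspace_neg[OF subspace_Rn] by (simp add: W_def)
  have "V \<le> W * shadow n \<eta> K"
    unfolding V_def W_def
  proof (rule vol_le_shadow[OF c n \<eta>])
    fix y assume "y \<in> K"
    then show "- h (-\<eta>) \<le> y \<bullet> \<eta> \<and> y \<bullet> \<eta> \<le> h \<eta>"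
      using h_ge[of y \<eta>] h_ge[of y "-\<eta>"] by simp
  qed
  also have "\<dots> \<le> W * (2 ^ n * shadow n \<xi> K)" by (rule mult_left_mono[OF sh W0])
  finally have V1: "V \<le> W * (2 ^ n * shadow n \<xi> K)" .
  \<comment> \<open>Positive volume excludes a vanishing shadow, so that it may be cancelled
    below.\<close>
  then have p: "shadow n \<xi> K > 0"
    using V(2) shadow_nonneg[of n \<xi> K] by (cases "shadow n \<xi> K = 0") auto
  have "norm x * shadow n \<xi> K \<le> 2 ^ n * V"
    unfolding V_def by (rule vol_ge_shadow[OF c n \<xi> _ x\<xi>]) simp
  also have "\<dots> \<le> 2 ^ n * (W * (2 ^ n * shadow n \<xi> K))" by (rule mult_left_mono[OF V1]) simp
  also have "\<dots> = (2 ^ (n + n) * W) * shadow n \<xi> K" by (simp add: power_add mult_ac)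
  finally have "norm x \<le> 2 ^ (n + n) * W" using p by simp
  also have "W \<le> 2 ^ (n + 1) * h \<eta> + 2 ^ (n + 1) * h \<eta>"
  proof -
    have "h (-\<eta>) \<le> 2 ^ (n + 1) * h \<eta>"
      using h_le_opposite[of "-\<eta>"] \<eta>(1) subspace_neg[OF subspace_Rn] by simp
    moreover have "h \<eta> \<le> 2 ^ (n + 1) * h \<eta>"
      using mult_right_mono[OF one_le_power[of "2::real" "n + 1"] h_nonneg[OF \<eta>(1)]] by simp
    ultimately show ?thesis unfolding W_def by (rule add_mono)
  qed
  also have "2 ^ (n + n) * (2 ^ (n + 1) * h \<eta> + 2 ^ (n + 1) * h \<eta>) = 2 ^ (n + n + (n + 2)) * h \<eta>"
    by (simp add: power_add)
  also have "\<dots> \<le> 32 ^ n * h \<eta>"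
    using n h_nonneg[OF \<eta>(1)] by (intro mult_right_mono pow2_le_32) auto
  finally show ?thesis by simp
qed

section \<open>The main inequality\<close>

lemma unit_ball_vol_log_concave:
  assumes "j \<ge> 1"
  shows "unit_ball_vol (real (j - 1)) * unit_ball_vol (real (j + 1)) \<le> (unit_ball_vol (real j))\<^sup>2"
proof -
  let ?x = "real (j - 1) / 2 + 1"
  have x: "?x > 0" by simp
  have j: "real j / 2 + 1 = ?x + 1/2" "real (j + 1) / 2 + 1 = ?x + 1" using assms by (auto simp: of_nat_diff field_simps)
  \<comment> \<open>Going from j - 1 to j + 1 shifts the argument of Gamma by 1, and j is the
    midpoint; log-convexity of Gamma there is log-concavity of the ball volumes, as the powers of pi
    agree.\<close>
  have "(ln \<circ> Gamma) ((1 - 1/2) *\<^sub>R ?x + (1/2) *\<^sub>R (?x + 1)) \<le> (1 - 1/2) * (ln \<circ> Gamma) ?x + (1/2) * (ln \<circ> Gamma) (?x + 1)"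
    by (rule convex_onD[OF log_convex_Gamma_real]) (use x in auto)
  also have "(1 - 1/2) *\<^sub>R ?x + (1/2) *\<^sub>R (?x + 1) = ?x + 1/2" by (simp add: field_simps)
  finally have "2 * ln (Gamma (?x + 1/2)) \<le> ln (Gamma ?x) + ln (Gamma (?x + 1))" by simp
  moreover have G: "Gamma ?x > 0" "Gamma (?x + 1/2) > 0" "Gamma (?x + 1) > 0"
    by (intro Gamma_real_pos; simp)+
  ultimately have "ln ((Gamma (?x + 1/2))\<^sup>2) \<le> ln (Gamma ?x * Gamma (?x + 1))"
    unfolding ln_mult_pos[OF G(1,3)] ln_realpow by simp
  then have "(Gamma (?x + 1/2))\<^sup>2 \<le> Gamma ?x * Gamma (?x + 1)" 
    by (rule ln_le_cancel_iff[OF zero_less_power[OF G(2)] mult_pos_pos[OF G(1,3)], THEN iffD1])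
  then have "1 / (Gamma ?x * Gamma (?x + 1)) \<le> 1 / (Gamma (?x + 1/2))\<^sup>2"
    by (rule divide_left_mono[OF _ zero_le_one mult_pos_pos[OF mult_pos_pos[OF G(1,3)] zero_less_power[OF G(2)]]])
  then have le: "pi powr j * (1 / (Gamma ?x * Gamma (?x + 1))) \<le> pi powr j * (1 / (Gamma (?x + 1/2))\<^sup>2)"
    by (rule mult_left_mono) simp
  have p: "pi powr (real (j - 1) / 2) * pi powr (real (j + 1) / 2) = pi powr j"
    "(pi powr (real j / 2))\<^sup>2 = pi powr j"
    using assms by (simp_all add: powr_add[symmetric] power2_eq_square of_nat_diff add_divide_distrib[symmetric])
  have "unit_ball_vol (real (j - 1)) * unit_ball_vol (real (j + 1)) = pi powr j * (1 / (Gamma ?x * Gamma (?x + 1)))"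
    unfolding unit_ball_vol_def j(2) p(1)[symmetric] by simp
  moreover have "(unit_ball_vol (real j))\<^sup>2 = pi powr j * (1 / (Gamma (?x + 1/2))\<^sup>2)"
    unfolding unit_ball_vol_def j(1) power_divide p(2) by simp
  ultimately show ?thesis using le by simp
qed

lemma unit_ball_vol_step2:
  assumes "j \<ge> 1"
  shows "unit_ball_vol (real (j + 1)) = 2 * pi / (j + 1) * unit_ball_vol (real (j - 1))"
proof -
  let ?x = "real (j - 1) / 2 + 1"
  have j: "real (j + 1) / 2 + 1 = ?x + 1" "real (j + 1) / 2 = real (j - 1) / 2 + 1" "?x = (real j + 1) / 2"
    using assms by (auto simp: of_nat_diff field_simps)
  have G: "Gamma ?x > 0" by (intro Gamma_real_pos) simp
  have "Gamma (?x + 1) = ?x * Gamma ?x"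
    by (rule Gamma_plus1) (use nonpos_Ints_nonpos[of ?x] in auto)
  moreover have "pi powr (real (j + 1) / 2) = pi powr (real (j - 1) / 2) * pi"
    unfolding j(2) powr_add by simp
  ultimately have "unit_ball_vol (real (j + 1)) = pi powr (real (j - 1) / 2) * pi / (?x * Gamma ?x)"
    unfolding unit_ball_vol_def j(1) by simp
  also have "\<dots> = pi / ?x * unit_ball_vol (real (j - 1))"
    unfolding unit_ball_vol_def by simp
  also have "pi / ?x = 2 * pi / (j + 1)" unfolding j(3) by (simp add: field_simps)
  finally show ?thesis .
qed

text \<open>One factor of the square is moved down two dimensions by the recursion; log-concavity
  then returns the square in dimension n, and the factors 2 * pi / (n + 1) accumulate to the
  factorial.\<close>

lemma unit_ball_vol_sq_le: "(unit_ball_vol (real n))\<^sup>2 \<le> (2 * pi) ^ n / fact n"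
proof (induction n)
  case (Suc n)
  show ?case
  proof (cases "n = 0")
    case True
    then show ?thesis using pi_ge_two by simp
  next
    case False
    then have n: "n \<ge> 1" by simp
    have "(unit_ball_vol (real (Suc n)))\<^sup>2 = unit_ball_vol (real (n + 1)) * (2 * pi / (n + 1) * unit_ball_vol (real (n - 1)))"
      using unit_ball_vol_step2[OF n] by (simp add: power2_eq_square)
    also have "\<dots> = 2 * pi / (n + 1) * (unit_ball_vol (real (n - 1)) * unit_ball_vol (real (n + 1)))" by simp
    also have "\<dots> \<le> 2 * pi / (n + 1) * (unit_ball_vol (real n))\<^sup>2"
      by (rule mult_left_mono[OF unit_ball_vol_log_concave[OF n]]) simp
    also have "\<dots> \<le> 2 * pi / (n + 1) * ((2 * pi) ^ n / fact n)"
      by (rule mult_left_mono[OF Suc.IH]) simp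
    also have "\<dots> = (2 * pi) ^ Suc n / fact (Suc n)" by simp
    finally show ?thesis .
  qed
qed simp

text \<open>The left-hand side is one term of the exponential series.\<close>

lemma power_div_fact_le_exp: "real n ^ n / fact n \<le> exp n"
proof -
  have "(\<Sum>k<Suc n. real n ^ k / fact k) \<le> suminf (\<lambda>k. real n ^ k / fact k)"
    by (rule sum_le_suminf) (use summable_exp[of "real n"] in \<open>auto simp: divide_inverse mult.commute\<close>)
  also have "\<dots> = exp (real n)" by (simp add: exp_def divide_inverse mult.commute)
  finally have "(\<Sum>k<Suc n. real n ^ k / fact k) \<le> exp (real n)" .
  moreover have "real n ^ n / fact n \<le> (\<Sum>k<Suc n. real n ^ k / fact k)"
    by (rule member_le_sum) auto
  ultimately show ?thesis by linarith
qed

text \<open>The square of q is at most 2 * pi * e / n, while the squared ratio of consecutive ball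
  volumes is at least 2 * pi / (j + 1), hence at least 2 * pi / n because j < n. The quotient of the
  two is at most e, which is below 4.\<close>

lemma unit_ball_vol_root_mult_le:
  assumes q: "q \<ge> 0" "q ^ n = unit_ball_vol (real n)" and j: "1 \<le> j" "j < n"
  shows "q * unit_ball_vol (real (j - 1)) \<le> 2 * unit_ball_vol (real j)"
proof -
  have n: "n > 0" using j by simp
  have "(q\<^sup>2) ^ n = (unit_ball_vol (real n))\<^sup>2"
    unfolding q(2)[symmetric] power_mult[symmetric] by (simp add: mult.commute)
  also have "\<dots> \<le> (2 * pi) ^ n / fact n" by (rule unit_ball_vol_sq_le)
  also have "\<dots> = (2 * pi / n) ^ n * (real n ^ n / fact n)" using n by (simp add: power_divide)
  also have "\<dots> \<le> (2 * pi / n) ^ n * exp n" by (rule mult_left_mono[OF power_div_fact_le_exp]) simp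
  also have "\<dots> = (2 * pi / n * exp 1) ^ n"
    by (simp only: power_mult_distrib exp_of_nat_mult[symmetric] mult_1_right)
  finally have q2: "q\<^sup>2 \<le> 2 * pi / n * exp 1"
    using n by (simp add: power_mono_iff)
  have "(unit_ball_vol (real (j - 1)))\<^sup>2 * (2 * pi / (j + 1)) = unit_ball_vol (real (j - 1)) * unit_ball_vol (real (j + 1))"
    using unit_ball_vol_step2[OF j(1)] by (simp add: power2_eq_square)
  also have "\<dots> \<le> (unit_ball_vol (real j))\<^sup>2" by (rule unit_ball_vol_log_concave[OF j(1)])
  finally have b: "(unit_ball_vol (real (j - 1)))\<^sup>2 * (2 * pi / (j + 1)) \<le> (unit_ball_vol (real j))\<^sup>2" .
  have "(q * unit_ball_vol (real (j - 1)))\<^sup>2 = q\<^sup>2 * (unit_ball_vol (real (j - 1)))\<^sup>2"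
    by (rule power_mult_distrib)
  also have "\<dots> \<le> (2 * pi / n * exp 1) * (unit_ball_vol (real (j - 1)))\<^sup>2"
    by (rule mult_right_mono[OF q2]) simp
  also have "\<dots> \<le> (2 * pi / (j + 1) * exp 1) * (unit_ball_vol (real (j - 1)))\<^sup>2"
    using j by (intro mult_right_mono divide_left_mono) auto
  also have "\<dots> = exp 1 * ((unit_ball_vol (real (j - 1)))\<^sup>2 * (2 * pi / (j + 1)))" by simp
  also have "\<dots> \<le> 4 * (unit_ball_vol (real j))\<^sup>2"
    by (rule mult_mono[OF _ b]) (use exp_le in auto)
  also have "\<dots> = (2 * unit_ball_vol (real j))\<^sup>2" by (simp add: power_mult_distrib)
  finally show ?thesis by (rule power2_le_imp_le) simp
qed

text \<open>Compares the ball constants of the two sides: q^k comes from |K|^(k/n), and each of its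
  k factors raises the dimension of the other ball by one at the price of 2.\<close>

lemma unit_ball_vol_iterate:
  assumes q: "q \<ge> 0" "q ^ n = unit_ball_vol (real n)" and k: "k < n"
  shows "q ^ k * unit_ball_vol (real (n - 1 - k)) \<le> 2 ^ k * unit_ball_vol (real (n - 1))"
  using k
proof (induction k)
  case (Suc k)
  have "q * unit_ball_vol (real (n - 1 - k - 1)) \<le> 2 * unit_ball_vol (real (n - 1 - k))"
    by (rule unit_ball_vol_root_mult_le[OF q]) (use Suc.prems in auto)
  then have "q ^ k * (q * unit_ball_vol (real (n - 1 - Suc k))) \<le> q ^ k * (2 * unit_ball_vol (real (n - 1 - k)))"
    using q(1) by (intro mult_left_mono) auto
  also have "\<dots> = 2 * (q ^ k * unit_ball_vol (real (n - 1 - k)))" by simp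
  also have "\<dots> \<le> 2 * (2 ^ k * unit_ball_vol (real (n - 1)))" using Suc by simp
  finally show ?case by (simp add: mult_ac)
qed simp

section \<open>From the positions to the inequality\<close>

lemma (in centered_body) classical_bound:
  assumes "classical_position n K" "x \<in> K" "\<eta> \<in> Rn n" "norm \<eta> = 1"
  shows "norm x \<le> 32 ^ n * h \<eta>"
  using assms isotropic_bound surface_area_bound mean_width_bound John_bound Loewner_bound
  unfolding classical_position_def by blast

text \<open>R is the norm of a longest vector of K. The bound in the given position says that the
  support function is at least R / 32^n in every direction, so a ball of that radius is
  inscribed.\<close>

lemma (in centered_body) classical_cbody:
  assumes "classical_position n K"
  obtains R where "R > 0" "cbody n (R / 32 ^ n) R K"
proof -
  have "continuous_on K norm" by (intro continuous_intros)
  from continuous_attains_sup[OF K(3) K_ne this]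
  obtain x where x: "x \<in> K" "\<And>y. y \<in> K \<Longrightarrow> norm y \<le> norm x" by blast
  obtain \<eta> where \<eta>: "\<eta> \<in> Rn n" "norm \<eta> = 1"
    by (rule fdsub_ex_unit[OF fdsub_Rn]) (use n in \<open>simp add: dim_Rn\<close>)
  obtain y where y: "y \<in> K" "y \<bullet> \<eta> = h \<eta>" by (rule h_attained)
  have "norm x > 0"
    using h_pos[OF \<eta>] y norm_cauchy_schwarz[of y \<eta>] \<eta>(2) x(2)[OF y(1)] by (auto simp del: zero_less_norm_iff)
  moreover have "ball_n n (norm x / 32 ^ n) \<subseteq> K"
    by (rule separation_ball[OF K(3,2,1) K_ne])
       (use classical_bound[OF assms x(1)] in \<open>simp add: pos_divide_le_eq mult.commute\<close>)
  ultimately have "cbody n (norm x / 32 ^ n) (norm x) K"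
    using K x(2) by (auto simp: cbody_def ball_n_def)
  then show thesis using that \<open>norm x > 0\<close> by blast
qed

text \<open>Writing |K|^(k/n) as (q * v)^k separates the problem: q concerns the unit balls only, v
  the moments of \<rho> only.\<close>

lemma cbody_average_section_le:
  assumes K: "cbody n (R / 32 ^ n) R K" and R: "R > 0" and k: "1 \<le> k" "k \<le> n - 1"
  shows "vol (Rn n) K powr (real k / real n) * (unit_ball_vol (real (n - k - 1)) * radial_moment n K (n - k - 1))
    \<le> 4096 ^ k * (unit_ball_vol (real (n - 1)) * radial_moment n K (n - 1))"
proof -
  have n: "n \<ge> 2" using k by simp
  have dn: "dim (Rn n) > 0" using n by (simp add: dim_Rn)
  let ?u = "usphere (Rn n)"
  interpret prob_space ?u by (rule prob_space_usphere[OF fdsub_Rn dn])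
  have P1: "prob UNIV = 1" using prob_space by simp
  define r where "r = R / 32 ^ n"
  have r: "r > 0" "R = 32 ^ n * r" using R by (auto simp: r_def)
  have AE: "AE x in ?u. r \<le> radial K x \<and> radial K x \<le> R"
    using AE_usphere_sphere[OF fdsub_Rn dn]
  proof eventually_elim
    case (elim x)
    then have "norm x = 1" "x \<in> Rn n" "x \<noteq> 0" by auto
    then show ?case using radial_ge[OF K, of x] radial_le[OF K, of x] by (simp add: r_def)
  qed
  note int = integrable_radial[OF K fdsub_Rn dn]
  note radial_moment = radial_moment_def[OF K]
  define M where "M = radial_moment n K (n - 1)"
  define q where "q = root n (unit_ball_vol (real n))"
  define v where "v = root n (radial_moment n K n)"
  have "radial_moment n K n \<ge> r ^ n"
  proof -
    have "(\<integral>x. r ^ n \<partial>?u) \<le> (\<integral>x. radial K x ^ n \<partial>?u)"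
      by (rule integral_mono_AE[OF _ int], simp, use AE in eventually_elim)
         (use r in \<open>auto intro: power_mono\<close>)
    then show ?thesis by (simp add: radial_moment P1)
  qed
  then have mn: "radial_moment n K n > 0" "v \<ge> r"
    using r n real_root_le_mono[of n "r ^ n" "radial_moment n K n"]
    by (auto simp: v_def real_root_power_cancel intro: less_le_trans[OF zero_less_power[OF r(1), of n]])
  have q: "q \<ge> 0" "q ^ n = unit_ball_vol (real n)" and v: "v > 0" "v ^ n = radial_moment n K n"
    using n mn r by (auto simp: q_def v_def)
  \<comment> \<open>Only one of the n factors of \<rho> is replaced by its maximum. Since R is at
    most 32^n * v, cancelling one v leaves a loss of 32^n for the power n - 1.\<close>
  have MR: "v ^ n \<le> R * M"
  proof -
    have "(\<integral>x. radial K x ^ n \<partial>?u) \<le> (\<integral>x. R * radial K x ^ (n - 1) \<partial>?u)"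
    proof (rule integral_mono_AE[OF int])
      show "integrable ?u (\<lambda>x. R * radial K x ^ (n - 1))" by (rule integrable_mult_right) (rule int)
      show "AE x in ?u. radial K x ^ n \<le> R * radial K x ^ (n - 1)"
        using AE
      proof eventually_elim
        case (elim x)
        have "radial K x ^ n = radial K x * radial K x ^ (n - 1)" using n by (cases n) auto
        also have "\<dots> \<le> R * radial K x ^ (n - 1)"
          using elim r by (intro mult_right_mono) auto
        finally show ?case .
      qed
    qed
    then show ?thesis by (simp add: v(2) radial_moment M_def)
  qed
  \<comment> \<open>1024 is 32^2: for n \<ge> 2 the loss 32^n is at most 1024^(n-1), so it turns
    into a constant factor per power of v.\<close>
  define l where "l = v / 1024"
  have l: "l > 0" using v by (simp add: l_def)
  have lM: "l ^ (n - 1) \<le> M"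
  proof -
    have "v * v ^ (n - 1) \<le> (32 ^ n * r) * M"
      using MR n r(2) by (cases n) auto
    also have "\<dots> \<le> v * (32 ^ n * M)"
    proof -
      have "0 \<le> M" unfolding M_def radial_moment by (rule integral_nonneg_AE) (simp add: radial_nonneg[OF K])
      then show ?thesis using mult_right_mono[OF mn(2), of "32 ^ n * M"] by (simp add: mult_ac)
    qed
    finally have vM: "v ^ (n - 1) \<le> 32 ^ n * M" using v by simp
    have "(32::real) ^ n \<le> 32 ^ (2 * (n - 1))" using n by (intro power_increasing) auto
    also have "\<dots> = 1024 ^ (n - 1)" by (simp add: power_mult)
    finally have c: "(32::real) ^ n \<le> 1024 ^ (n - 1)" .
    have "0 \<le> M" unfolding M_def radial_moment by (rule integral_nonneg_AE) (simp add: radial_nonneg[OF K])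
    then have "v ^ (n - 1) \<le> 1024 ^ (n - 1) * M"
      using vM mult_right_mono[OF c, of M] by linarith
    then show ?thesis by (simp add: l_def power_divide pos_divide_le_eq mult.commute)
  qed
  define m where "m = n - k - 1"
  have mk: "m + k = n - 1" using k by (simp add: m_def)
  have lm: "l ^ k * radial_moment n K m \<le> 2 * M"
  proof -
    have "(\<integral>x. l ^ k * radial K x ^ m \<partial>?u) \<le> (\<integral>x. l ^ (n - 1) + radial K x ^ (n - 1) \<partial>?u)"
    proof (rule integral_mono)
      show "integrable ?u (\<lambda>x. l ^ k * radial K x ^ m)" by (rule integrable_mult_right) (rule int)
      show "integrable ?u (\<lambda>x. l ^ (n - 1) + radial K x ^ (n - 1))" by (intro Bochner_Integration.integrable_add int) simp
      fix x
      let ?p = "radial K x"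
      have p: "0 \<le> ?p" by (rule radial_nonneg[OF K])
      show "l ^ k * ?p ^ m \<le> l ^ (n - 1) + ?p ^ (n - 1)"
      \<comment> \<open>The k factors \<open>l\<close> and m factors \<open>?p\<close> number n - 1
        in total, so the product is at most the (n-1)-th power of the larger one.\<close>
      proof (cases "?p \<le> l")
        case True
        have "l ^ k * ?p ^ m \<le> l ^ k * l ^ m" using True p l by (intro mult_left_mono power_mono) auto
        also have "\<dots> = l ^ (n - 1)" unfolding mk[symmetric] power_add by simp
        finally show ?thesis using p by (simp add: add_increasing2)
      next
        case False
        have "l ^ k * ?p ^ m \<le> ?p ^ k * ?p ^ m" using False p l by (intro mult_right_mono power_mono) auto
        also have "\<dots> = ?p ^ (n - 1)" unfolding mk[symmetric] power_add by simp
        finally show ?thesis using l by (simp add: add_increasing)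
      qed
    qed
    also have "(\<integral>x. l ^ (n - 1) + radial K x ^ (n - 1) \<partial>?u) = l ^ (n - 1) + M"
      using int by (simp add: M_def radial_moment P1)
    finally show ?thesis using lM by (simp add: radial_moment)
  qed
  have "vol (Rn n) K = (q * v) ^ n"
    using vol_cbody[OF K] n by (simp add: power_mult_distrib q v)
  then have "vol (Rn n) K powr (real k / real n) = (q * v) ^ k"
  proof -
    have qv: "q * v > 0" using q v n by (auto simp: q_def intro!: mult_pos_pos)
    have "vol (Rn n) K powr (real k / real n) = ((q * v) powr real n) powr (real k / real n)"
      using \<open>vol (Rn n) K = (q * v) ^ n\<close> qv by (simp add: powr_realpow)
    also have "\<dots> = (q * v) powr real k" using n by (simp add: powr_powr)
    finally show ?thesis using qv by (simp add: powr_realpow)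
  qed
  then have "vol (Rn n) K powr (real k / real n) * (unit_ball_vol (real m) * radial_moment n K m)
      = 1024 ^ k * ((l ^ k * radial_moment n K m) * (q ^ k * unit_ball_vol (real m)))"
    by (simp add: l_def power_mult_distrib power_divide)
  also have "\<dots> \<le> 1024 ^ k * ((2 * M) * (2 ^ k * unit_ball_vol (real (n - 1))))"
  proof (rule mult_left_mono[OF mult_mono[OF lm]])
    have "n - 1 - k = m" by (simp add: m_def)
    then show "q ^ k * unit_ball_vol (real m) \<le> 2 ^ k * unit_ball_vol (real (n - 1))"
      using unit_ball_vol_iterate[OF q, of k] k n by simp
    have "0 \<le> M" unfolding M_def radial_moment by (rule integral_nonneg_AE) (simp add: radial_nonneg[OF K])
    then show "0 \<le> 2 * M" by simp
  qed (use q in auto)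
  also have "\<dots> = (1024 ^ k * 2 ^ k * 2) * (unit_ball_vol (real (n - 1)) * M)" by simp
  also have "\<dots> \<le> 4096 ^ k * (unit_ball_vol (real (n - 1)) * M)"
  proof (rule mult_right_mono)
    \<comment> \<open>The factor 2 from the sum of the two powers is absorbed because k \<ge> 1;
      together with 2^k from the unit balls and 1024^k from the moments it gives 4096 = 1024 * 2 *
      2.\<close>
    have "(2::real) \<le> 2 ^ k" using k(1) power_increasing[of 1 k "2::real"] by simp
    then have "(1024::real) ^ k * 2 ^ k * 2 \<le> 1024 ^ k * 2 ^ k * 2 ^ k" by simp
    also have "\<dots> = 4096 ^ k" by (simp add: power_mult_distrib[symmetric])
    finally show "(1024::real) ^ k * 2 ^ k * 2 \<le> 4096 ^ k" .
    have "0 \<le> M" unfolding M_def radial_moment by (rule integral_nonneg_AE) (simp add: radial_nonneg[OF K])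
    then show "0 \<le> unit_ball_vol (real (n - 1)) * M" by simp
  qed
  finally show ?thesis by (simp add: m_def M_def)
qed

theorem theorem1p9:
  shows "\<exists>c\<^sub>6::real. c\<^sub>6 > 0 \<and>
    (\<forall>(n::nat) (K::pt set). convex_body n K \<longrightarrow> centered n K \<longrightarrow> classical_position n K \<longrightarrow>
      (\<forall>k::nat. 1 \<le> k \<and> k \<le> n - 1 \<longrightarrow>
        vol (Rn n) K powr (real k / real n) * (\<integral>E. avg_section E K \<partial>haar_Gr n (n - k))
          \<le> c\<^sub>6 ^ k * avg_section (Rn n) K))"
proof (intro exI[of _ 4096] conjI allI impI)
  fix n K k
  assume cb: "convex_body n K" "centered n K" "classical_position n K" and k: "1 \<le> k \<and> k \<le> n - 1"
  have n: "n > 0" using k by linarith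
  interpret centered_body n K
    using cb n by unfold_locales
  obtain R where R: "R > 0" "cbody n (R / 32 ^ n) R K"
    by (rule classical_cbody[OF cb(3)])
  have "(\<integral>E. avg_section E K \<partial>haar_Gr n (n - k)) = unit_ball_vol (real (n - k - 1)) * radial_moment n K (n - k - 1)"
    by (rule integral_haar_Gr_avg_section[OF R(2)]) (use k in auto)
  then show "vol (Rn n) K powr (real k / real n) * (\<integral>E. avg_section E K \<partial>haar_Gr n (n - k))
      \<le> 4096 ^ k * avg_section (Rn n) K"
    using cbody_average_section_le[OF R(2,1), of k] k avg_section_Rn[OF R(2) n] by simp
qed simp

end
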